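(* Let $f,g:\mathbb{R}^2\to\mathbb{R}$ be arbitrary $C^1$-functions and let $\Omega\subset\mathbb{R}^n$ be a bounded domain with a smooth boundary and such that $|\Omega|=1$. Fix arbitrary $u_0,v_0\in L^\infty(\Omega)$ and $T>0$. Assume that, for each $D>0$, the couple $(u^D,v^D)$ is a solution of the initial-boundary value problem \begin{align*} &u^D_t=f(u^D,v^D),&& v^D_t=D\Delta v^D+g(u^D,v^D)&&\text{in }\Omega,\\ &u^D(x,0)=u_0(x),&& v^D(x,0)=v_0(x)&&\text{in }\Omega,\\ &&&\partial_nv^D=0&&\text{on }\partial\Omega \end{align*} on the common time interval $[0,T]$. Suppose that $$\sup_{D>0}\Big(\sup_{0\le t\le T}\|u^D(t)\|_\infty+\sup_{0\le t\le T}\|v^D(t)\|_\infty\Big)<\infty .$$ Then $$\lim_{D\to\infty}\ \sup_{0\le t\le T}t^{n/2}\Big(\|u^D(t)-u(t)\|_\infty+\|v^D(t)-\xi(t)\|_\infty\Big)=0,$$ where $(u,\xi)$ is the solution of the nonlocal system $$u_t=f(u,\xi)\quad(x\in\Omega,\ t>0),\qquad \xi_t=\int_\Omega g\big(u(x,t),\xi(t)\big)\,dx\quad(t>0)$$ with $u(\cdot,0)=u_0$ and $\xi(0)=\xi_0=\int_\Omega v_0(x)\,dx$.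
   Context: $\|\cdot\|_\infty$ is the $L^\infty(\Omega)$ norm and $\partial_n$ is the normal derivative on $\partial\Omega$. Let $\{e^{tD\Delta}\}_{t\ge0}$ be the heat semigroup on $\Omega$ with Neumann boundary condition and diffusion coefficient $D$. Solutions of the initial-boundary value problem satisfy the integral equations $$u^D(t)=u_0+\int_0^tf(u^D(s),v^D(s))\,ds,\qquad v^D(t)=e^{tD\Delta}v_0+\int_0^te^{(t-s)D\Delta}g(u^D(s),v^D(s))\,ds,$$ and solutions of the nonlocal system satisfy $$u(x,t)=u_0(x)+\int_0^tf(u(x,s),\xi(s))\,ds,\qquad \xi(t)=\xi_0+\int_0^t\int_\Omega g(u(x,s),\xi(s))\,dx\,ds,$$ with $u$ continuous in time with values in $L^\infty(\Omega)$ and $\xi$ continuous. *)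

theory Defs
  imports "HOL-Analysis.Analysis" "HOL-Probability.Essential_Supremum"
begin

fun Ck_on :: "nat \<Rightarrow> ('a::euclidean_space \<Rightarrow> real) \<Rightarrow> 'a set \<Rightarrow> bool" where
  "Ck_on 0 f U \<longleftrightarrow> continuous_on U f"
| "Ck_on (Suc k) f U \<longleftrightarrow>
     (\<exists>G :: 'a \<Rightarrow> 'a. (\<forall>x\<in>U. (f has_derivative (\<lambda>h. G x \<bullet> h)) (at x)) \<and>
        (\<forall>i\<in>Basis. Ck_on k (\<lambda>x. G x \<bullet> i) U))"

definition smooth_on :: "('a::euclidean_space \<Rightarrow> real) \<Rightarrow> 'a set \<Rightarrow> bool" where
  "smooth_on f U \<longleftrightarrow> (\<forall>k. Ck_on k f U)"

text \<open>Smoothness of the boundary is expressed by local defining functions; the set lies locally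
  on one side of its boundary.\<close>

definition smooth_bounded_domain :: "'a::euclidean_space set \<Rightarrow> bool" where
  "smooth_bounded_domain \<Omega> \<longleftrightarrow>
     open \<Omega> \<and> connected \<Omega> \<and> \<Omega> \<noteq> {} \<and> bounded \<Omega> \<and>
     (\<forall>p\<in>frontier \<Omega>. \<exists>U \<psi>. open U \<and> p \<in> U \<and> smooth_on \<psi> U \<and>
        \<not> (\<psi> has_derivative (\<lambda>h. 0)) (at p) \<and>
        \<Omega> \<inter> U = {x \<in> U. \<psi> x < 0})"

text \<open>Elements of the Lebesgue spaces are represented by functions on the whole type; only their
  values on \<open>\<Omega>\<close>, up to null sets, matter.\<close>

definition Linf_norm :: "'a::euclidean_space set \<Rightarrow> ('a \<Rightarrow> real) \<Rightarrow> ereal" where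
  "Linf_norm \<Omega> w = esssup (lebesgue_on \<Omega>) (\<lambda>x. ereal \<bar>w x\<bar>)"

definition Linf :: "'a::euclidean_space set \<Rightarrow> ('a \<Rightarrow> real) set" where
  "Linf \<Omega> = {w. w \<in> borel_measurable (lebesgue_on \<Omega>) \<and> Linf_norm \<Omega> w < \<infinity>}"

definition L2 :: "'a::euclidean_space set \<Rightarrow> ('a \<Rightarrow> real) set" where
  "L2 \<Omega> = {w. w \<in> borel_measurable (lebesgue_on \<Omega>) \<and> integrable (lebesgue_on \<Omega>) (\<lambda>x. (w x)\<^sup>2)}"

definition L2_norm :: "'a::euclidean_space set \<Rightarrow> ('a \<Rightarrow> real) \<Rightarrow> real" where
  "L2_norm \<Omega> w = sqrt (LINT x|lebesgue_on \<Omega>. (w x)\<^sup>2)"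

definition test_function :: "'a::euclidean_space set \<Rightarrow> ('a \<Rightarrow> real) \<Rightarrow> bool" where
  "test_function \<Omega> \<phi> \<longleftrightarrow>
     smooth_on \<phi> UNIV \<and> (\<exists>K. compact K \<and> K \<subseteq> \<Omega> \<and> (\<forall>x. x \<notin> K \<longrightarrow> \<phi> x = 0))"

text \<open>\<open>w \<in> H\<^sup>1(\<Omega>)\<close> with weak gradient \<open>G\<close>.\<close>

definition H1_gradient :: "'a::euclidean_space set \<Rightarrow> ('a \<Rightarrow> real) \<Rightarrow> ('a \<Rightarrow> 'a) \<Rightarrow> bool" where
  "H1_gradient \<Omega> w G \<longleftrightarrow>
     w \<in> L2 \<Omega> \<and> (\<forall>i\<in>Basis. (\<lambda>x. G x \<bullet> i) \<in> L2 \<Omega>) \<and>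
     (\<forall>\<phi> i. test_function \<Omega> \<phi> \<and> i \<in> Basis \<longrightarrow>
        (LINT x|lebesgue_on \<Omega>. w x * frechet_derivative \<phi> (at x) i) =
        - (LINT x|lebesgue_on \<Omega>. (G x \<bullet> i) * \<phi> x))"

text \<open>The graph of the Neumann Laplacian on \<open>L\<^sup>2(\<Omega>)\<close>: \<open>w\<close> is in its domain and \<open>\<Delta>w = h\<close>.
  The condition \<open>\<partial>\<^sub>n w = 0\<close> is encoded by testing with all of \<open>H\<^sup>1(\<Omega>)\<close>, so that
  the boundary term in Green's formula must vanish.\<close>

definition neumann_laplacian :: "'a::euclidean_space set \<Rightarrow> ('a \<Rightarrow> real) \<Rightarrow> ('a \<Rightarrow> real) \<Rightarrow> bool" where
  "neumann_laplacian \<Omega> w h \<longleftrightarrow>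
     h \<in> L2 \<Omega> \<and>
     (\<exists>G. H1_gradient \<Omega> w G \<and>
        (\<forall>\<phi> \<Phi>. H1_gradient \<Omega> \<phi> \<Phi> \<longrightarrow>
           (LINT x|lebesgue_on \<Omega>. G x \<bullet> \<Phi> x) = - (LINT x|lebesgue_on \<Omega>. h x * \<phi> x)))"

definition L2_C0_semigroup ::
    "'a::euclidean_space set \<Rightarrow> (real \<Rightarrow> ('a \<Rightarrow> real) \<Rightarrow> ('a \<Rightarrow> real)) \<Rightarrow> bool" where
  "L2_C0_semigroup \<Omega> S \<longleftrightarrow>
     (\<forall>t\<ge>0. \<forall>w\<in>L2 \<Omega>. S t w \<in> L2 \<Omega>) \<and>
     (\<forall>t\<ge>0. \<forall>w\<in>L2 \<Omega>. \<forall>z\<in>L2 \<Omega>. \<forall>a b.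
        AE x in lebesgue_on \<Omega>. S t (\<lambda>y. a * w y + b * z y) x = a * S t w x + b * S t z x) \<and>
     (\<forall>t\<ge>0. \<exists>C. \<forall>w\<in>L2 \<Omega>. L2_norm \<Omega> (S t w) \<le> C * L2_norm \<Omega> w) \<and>
     (\<forall>w\<in>L2 \<Omega>. AE x in lebesgue_on \<Omega>. S 0 w x = w x) \<and>
     (\<forall>s\<ge>0. \<forall>t\<ge>0. \<forall>w\<in>L2 \<Omega>. AE x in lebesgue_on \<Omega>. S (s + t) w x = S s (S t w) x) \<and>
     (\<forall>w\<in>L2 \<Omega>. ((\<lambda>t. L2_norm \<Omega> (\<lambda>x. S t w x - w x)) \<longlongrightarrow> 0) (at_right 0))"

text \<open>The graph of the infinitesimal generator.\<close>

definition L2_generator ::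
    "'a::euclidean_space set \<Rightarrow> (real \<Rightarrow> ('a \<Rightarrow> real) \<Rightarrow> ('a \<Rightarrow> real)) \<Rightarrow> ('a \<Rightarrow> real) \<Rightarrow> ('a \<Rightarrow> real) \<Rightarrow> bool"
  where
  "L2_generator \<Omega> S w h \<longleftrightarrow>
     w \<in> L2 \<Omega> \<and> h \<in> L2 \<Omega> \<and>
     ((\<lambda>t. L2_norm \<Omega> (\<lambda>x. (S t w x - w x) / t - h x)) \<longlongrightarrow> 0) (at_right 0)"

text \<open>\<open>S t = e\<^bsup>t\<Delta>\<^esup>\<close>; the semigroup with diffusion coefficient \<open>D\<close> is then
  \<open>e\<^bsup>tD\<Delta>\<^esup> = S (t * D)\<close>.\<close>

definition neumann_heat_semigroup ::
    "'a::euclidean_space set \<Rightarrow> (real \<Rightarrow> ('a \<Rightarrow> real) \<Rightarrow> ('a \<Rightarrow> real)) \<Rightarrow> bool" where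
  "neumann_heat_semigroup \<Omega> S \<longleftrightarrow>
     L2_C0_semigroup \<Omega> S \<and>
     (\<forall>w h. L2_generator \<Omega> S w h \<longleftrightarrow> neumann_laplacian \<Omega> w h)"

text \<open>\<open>h\<close> is the integral of \<open>F\<close> over \<open>[0,t]\<close> in the Hilbert space \<open>L\<^sup>2(\<Omega>)\<close>. The integral is
  stated by pairing with the elements of \<open>L\<^sup>2(\<Omega>)\<close>, because the slices \<open>F s\<close> are only
  determined up to null sets depending on \<open>s\<close>.\<close>

definition has_L2_integral ::
    "'a::euclidean_space set \<Rightarrow> (real \<Rightarrow> 'a \<Rightarrow> real) \<Rightarrow> real \<Rightarrow> ('a \<Rightarrow> real) \<Rightarrow> bool" where
  "has_L2_integral \<Omega> F t h \<longleftrightarrow>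
     (\<forall>s\<in>{0..t}. F s \<in> L2 \<Omega>) \<and> h \<in> L2 \<Omega> \<and>
     (\<forall>\<phi>\<in>L2 \<Omega>.
        (\<lambda>s. LINT x|lebesgue_on \<Omega>. F s x * \<phi> x) absolutely_integrable_on {0..t} \<and>
        integral {0..t} (\<lambda>s. LINT x|lebesgue_on \<Omega>. F s x * \<phi> x) = (LINT x|lebesgue_on \<Omega>. h x * \<phi> x))"

definition L2_continuous :: "'a::euclidean_space set \<Rightarrow> real \<Rightarrow> (real \<Rightarrow> 'a \<Rightarrow> real) \<Rightarrow> bool" where
  "L2_continuous \<Omega> T w \<longleftrightarrow>
     (\<forall>t\<in>{0..T}. w t \<in> L2 \<Omega> \<and>
        ((\<lambda>s. L2_norm \<Omega> (\<lambda>x. w s x - w t x)) \<longlongrightarrow> 0) (at t within {0..T}))"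

definition Linf_continuous :: "'a::euclidean_space set \<Rightarrow> real \<Rightarrow> (real \<Rightarrow> 'a \<Rightarrow> real) \<Rightarrow> bool" where
  "Linf_continuous \<Omega> T w \<longleftrightarrow>
     (\<forall>t\<in>{0..T}. w t \<in> Linf \<Omega> \<and>
        ((\<lambda>s. Linf_norm \<Omega> (\<lambda>x. w s x - w t x)) \<longlongrightarrow> 0) (at t within {0..T}))"

text \<open>Solutions of the initial-boundary value problem on \<open>[0,T]\<close> in the mild sense, with \<open>S\<close> the
  Neumann heat semigroup. Continuity in time is required in \<open>L\<^sup>2(\<Omega>)\<close> only: for
  \<open>v\<^sub>0 \<in> L\<^sup>\<infinity>(\<Omega>)\<close>, the function \<open>v\<close> is in general not continuous at \<open>t = 0\<close> with values in
  \<open>L\<^sup>\<infinity>(\<Omega>)\<close>.\<close>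

definition mild_solution ::
    "'a::euclidean_space set \<Rightarrow> (real \<Rightarrow> ('a \<Rightarrow> real) \<Rightarrow> ('a \<Rightarrow> real)) \<Rightarrow>
     (real \<times> real \<Rightarrow> real) \<Rightarrow> (real \<times> real \<Rightarrow> real) \<Rightarrow> real \<Rightarrow> real \<Rightarrow>
     ('a \<Rightarrow> real) \<Rightarrow> ('a \<Rightarrow> real) \<Rightarrow> (real \<Rightarrow> 'a \<Rightarrow> real) \<Rightarrow> (real \<Rightarrow> 'a \<Rightarrow> real) \<Rightarrow> bool" where
  "mild_solution \<Omega> S f g D T u\<^sub>0 v\<^sub>0 u v \<longleftrightarrow>
     L2_continuous \<Omega> T u \<and> L2_continuous \<Omega> T v \<and>
     (\<forall>t\<in>{0..T}. u t \<in> Linf \<Omega> \<and> v t \<in> Linf \<Omega>) \<and>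
     (\<forall>t\<in>{0..T}. has_L2_integral \<Omega> (\<lambda>s x. f (u s x, v s x)) t (\<lambda>x. u t x - u\<^sub>0 x)) \<and>
     (\<forall>t\<in>{0..T}. has_L2_integral \<Omega> (\<lambda>s. S ((t - s) * D) (\<lambda>x. g (u s x, v s x))) t
                    (\<lambda>x. v t x - S (t * D) v\<^sub>0 x))"

text \<open>The exceptional null set of points \<open>x\<close> does not depend on \<open>t\<close>; every
  \<open>L\<^sup>\<infinity>(\<Omega>)\<close>-valued solution has such a representative.\<close>

definition nonlocal_solution ::
    "'a::euclidean_space set \<Rightarrow> (real \<times> real \<Rightarrow> real) \<Rightarrow> (real \<times> real \<Rightarrow> real) \<Rightarrow> real \<Rightarrow>
     ('a \<Rightarrow> real) \<Rightarrow> real \<Rightarrow> (real \<Rightarrow> 'a \<Rightarrow> real) \<Rightarrow> (real \<Rightarrow> real) \<Rightarrow> bool" where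
  "nonlocal_solution \<Omega> f g T u\<^sub>0 \<xi>\<^sub>0 u \<xi> \<longleftrightarrow>
     Linf_continuous \<Omega> T u \<and> continuous_on {0..T} \<xi> \<and>
     (AE x in lebesgue_on \<Omega>. \<forall>t\<in>{0..T}.
        ((\<lambda>s. f (u s x, \<xi> s)) has_integral (u t x - u\<^sub>0 x)) {0..t}) \<and>
     (\<forall>t\<in>{0..T}.
        ((\<lambda>s. LINT x|lebesgue_on \<Omega>. g (u s x, \<xi> s)) has_integral (\<xi> t - \<xi>\<^sub>0)) {0..t})"

end

theory Submission
  imports Defs "HOL-Computational_Algebra.Polynomial" "HOL-Real_Asymp.Real_Asymp"
begin

text \<open>
  For \<open>|w| \<le> B\<close> the heat semigroup satisfies \<open>|S \<tau> w - \<integral> w| \<le> B K / sqrt (1 + \<tau>)\<close>. The semigroup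
  contracts the supremum norm, as one sees by differentiating \<open>\<integral> \<beta> (S \<tau> w)\<close> for a convex penalty
  \<open>\<beta>\<close> of linear growth; smoothing from L2 to the supremum norm follows from Nash's inequality by duality, and decay in L2
  from Poincare's inequality. Both inequalities are obtained from star-shaped patches of the domain, the
  second by chaining overlapping patches.

  If \<open>f\<close> and \<open>g\<close> are bounded and Lipschitz, subtracting the two systems of integral equations and estimating
  in a norm with weight \<open>exp (-\<omega> t)\<close> bounds the error by a multiple of \<open>\<integral> 1 / sqrt (1 + t D) dt\<close>, hence of
  \<open>1 / sqrt D\<close>, up to the initial layer \<open>B K / sqrt (1 + t D)\<close>, which the factor \<open>t powr (n/2)\<close> absorbs.
  For general \<open>f\<close> and \<open>g\<close> both are truncated outside a large ball. Picard iteration solves the truncated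
  nonlocal system, and the solution inherits the uniform bound of \<open>(u\<^sup>D, v\<^sup>D)\<close> in the limit, so that it
  never leaves the region where truncation has no effect.
\<close>

section \<open>The space L2\<close>

text \<open>The hypotheses know \<open>S\<close> only through its generator on
  \<open>L2 \<Omega>\<close>, so neither a heat kernel nor an eigenfunction expansion is at hand.
  Their place is taken by the energy identity, the squared norm of \<open>S t w\<close> having
  derivative \<open>-2\<close> times the Dirichlet energy. It holds for data in the domain of the
  generator, which is dense because it contains the test functions; estimates are proved there and
  extended by density.

  The time integrals in the definition of a mild solution are weak, and the slices carry no joint
  measurability in time and space. Therefore supremum bounds are reached by pairing with bounded
  functions, the mean value theorem replaces the integration of differential inequalities, and an
  iteration of bounds replaces Gronwall's lemma.

  The rate \<open>1 / sqrt (1 + \<tau>)\<close> is much weaker than the true exponential decay. It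
  is what Poincare's inequality yields together with one application of the mean value theorem.
  Since it has no singularity at \<open>\<tau> = 0\<close>, the initial layer costs only the factor
  \<open>t powr (1/2)\<close>, and dimension at least 1 makes the weight in the theorem strong
  enough.\<close>

definition L2_inner :: "'a::euclidean_space set \<Rightarrow> ('a \<Rightarrow> real) \<Rightarrow> ('a \<Rightarrow> real) \<Rightarrow> real" where
  "L2_inner \<Omega> w z = (LINT x|lebesgue_on \<Omega>. w x * z x)"

lemma L2_measurable: "w \<in> L2 \<Omega> \<Longrightarrow> w \<in> borel_measurable (lebesgue_on \<Omega>)"
  by (simp add: L2_def)

lemma L2_square_integrable: "w \<in> L2 \<Omega> \<Longrightarrow> integrable (lebesgue_on \<Omega>) (\<lambda>x. (w x)\<^sup>2)"
  by (simp add: L2_def)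

lemma L2_mult_integrable:
  assumes "w \<in> L2 \<Omega>" "z \<in> L2 \<Omega>"
  shows "integrable (lebesgue_on \<Omega>) (\<lambda>x. w x * z x)"
proof (rule Bochner_Integration.integrable_bound)
  show "integrable (lebesgue_on \<Omega>) (\<lambda>x. (w x)\<^sup>2 + (z x)\<^sup>2)"
    using assms by (intro Bochner_Integration.integrable_add L2_square_integrable)
  show "(\<lambda>x. w x * z x) \<in> borel_measurable (lebesgue_on \<Omega>)"
    using assms[THEN L2_measurable] by measurable
  have "\<bar>a * b\<bar> \<le> a\<^sup>2 + b\<^sup>2" for a b :: real
  proof -
    have "\<bar>a * b\<bar> \<le> 2 * \<bar>a\<bar> * \<bar>b\<bar>" by (simp add: abs_mult)
    also have "\<dots> \<le> a\<^sup>2 + b\<^sup>2" using sum_squares_bound[of "\<bar>a\<bar>" "\<bar>b\<bar>"] by simp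
    finally show ?thesis .
  qed
  then show "AE x in lebesgue_on \<Omega>. norm (w x * z x) \<le> norm ((w x)\<^sup>2 + (z x)\<^sup>2)"
    by simp
qed

lemma L2_cmult: "w \<in> L2 \<Omega> \<Longrightarrow> (\<lambda>x. c * w x) \<in> L2 \<Omega>"
  by (auto simp: L2_def power_mult_distrib)

lemma L2_add:
  assumes "w \<in> L2 \<Omega>" "z \<in> L2 \<Omega>"
  shows "(\<lambda>x. w x + z x) \<in> L2 \<Omega>"
proof -
  have "integrable (lebesgue_on \<Omega>) (\<lambda>x. (w x)\<^sup>2 + (z x)\<^sup>2 + 2 * (w x * z x))"
    using assms L2_mult_integrable[OF assms]
    by (intro Bochner_Integration.integrable_add L2_square_integrable integrable_mult_right)
  then have "integrable (lebesgue_on \<Omega>) (\<lambda>x. (w x + z x)\<^sup>2)"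
    by (simp add: power2_sum algebra_simps)
  then show ?thesis
    using assms[THEN L2_measurable] by (auto simp: L2_def)
qed

lemma L2_uminus: "w \<in> L2 \<Omega> \<Longrightarrow> (\<lambda>x. - w x) \<in> L2 \<Omega>"
  using L2_cmult[of w \<Omega> "-1"] by simp

lemma L2_diff: "w \<in> L2 \<Omega> \<Longrightarrow> z \<in> L2 \<Omega> \<Longrightarrow> (\<lambda>x. w x - z x) \<in> L2 \<Omega>"
  using L2_add[of w \<Omega> "\<lambda>x. - z x"] L2_uminus[of z \<Omega>] by simp

lemma L2_divide: "w \<in> L2 \<Omega> \<Longrightarrow> (\<lambda>x. w x / c) \<in> L2 \<Omega>"
  using L2_cmult[of w \<Omega> "1/c"] by simp

lemma L2_sum: "(\<And>i. i \<in> I \<Longrightarrow> w i \<in> L2 \<Omega>) \<Longrightarrow> (\<lambda>x. \<Sum>i\<in>I. w i x) \<in> L2 \<Omega>"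
proof (induction I rule: infinite_finite_induct)
  case (insert i I)
  then show ?case using L2_add[of "w i" \<Omega> "\<lambda>x. \<Sum>i\<in>I. w i x"] by simp
qed (auto simp: L2_def)

lemma L2_abs: "w \<in> L2 \<Omega> \<Longrightarrow> (\<lambda>x. \<bar>w x\<bar>) \<in> L2 \<Omega>"
  by (auto simp: L2_def)

lemma L2_bounded_by:
  assumes "w \<in> L2 \<Omega>" "z \<in> borel_measurable (lebesgue_on \<Omega>)"
    and "AE x in lebesgue_on \<Omega>. \<bar>z x\<bar> \<le> \<bar>w x\<bar>"
  shows "z \<in> L2 \<Omega>"
proof -
  have "integrable (lebesgue_on \<Omega>) (\<lambda>x. (z x)\<^sup>2)"
  proof (rule Bochner_Integration.integrable_bound[OF L2_square_integrable[OF assms(1)]])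
    show "(\<lambda>x. (z x)\<^sup>2) \<in> borel_measurable (lebesgue_on \<Omega>)" using assms(2) by measurable
    show "AE x in lebesgue_on \<Omega>. norm ((z x)\<^sup>2) \<le> norm ((w x)\<^sup>2)"
      using assms(3) by eventually_elim (simp add: abs_le_square_iff)
  qed
  then show ?thesis using assms(2) by (simp add: L2_def)
qed

lemma L2_mult_bounded:
  assumes "w \<in> L2 \<Omega>" "b \<in> borel_measurable (lebesgue_on \<Omega>)"
    and "AE x in lebesgue_on \<Omega>. \<bar>b x\<bar> \<le> B"
  shows "(\<lambda>x. b x * w x) \<in> L2 \<Omega>"
proof (rule L2_bounded_by[OF L2_cmult[OF assms(1), of B]])
  show "(\<lambda>x. b x * w x) \<in> borel_measurable (lebesgue_on \<Omega>)"
    using assms(2) L2_measurable[OF assms(1)] by measurable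
  show "AE x in lebesgue_on \<Omega>. \<bar>b x * w x\<bar> \<le> \<bar>B * w x\<bar>"
    using assms(3) by eventually_elim (auto simp: abs_mult intro!: mult_right_mono)
qed

lemma L2_const: "\<Omega> \<in> lmeasurable \<Longrightarrow> (\<lambda>x. c) \<in> L2 \<Omega>"
  unfolding L2_def using finite_measure.integrable_const[OF finite_measure_lebesgue_on] by simp

lemma L2_bounded:
  assumes "\<Omega> \<in> lmeasurable" "w \<in> borel_measurable (lebesgue_on \<Omega>)"
    and "AE x in lebesgue_on \<Omega>. \<bar>w x\<bar> \<le> B"
  shows "w \<in> L2 \<Omega>"
  using L2_mult_bounded[OF L2_const[OF assms(1), of 1] assms(2,3)] by simp

lemma L2_integrable: "\<Omega> \<in> lmeasurable \<Longrightarrow> w \<in> L2 \<Omega> \<Longrightarrow> integrable (lebesgue_on \<Omega>) w"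
  using L2_mult_integrable[OF _ L2_const[of \<Omega> 1], of w] by simp

lemma L2_inner_commute: "L2_inner \<Omega> w z = L2_inner \<Omega> z w"
  by (simp add: L2_inner_def mult.commute)

lemma L2_inner_cmult: "L2_inner \<Omega> (\<lambda>x. c * w x) z = c * L2_inner \<Omega> w z"
  by (simp add: L2_inner_def mult.assoc)

lemma L2_inner_add:
  "w \<in> L2 \<Omega> \<Longrightarrow> w' \<in> L2 \<Omega> \<Longrightarrow> z \<in> L2 \<Omega> \<Longrightarrow>
    L2_inner \<Omega> (\<lambda>x. w x + w' x) z = L2_inner \<Omega> w z + L2_inner \<Omega> w' z"
  by (simp add: L2_inner_def distrib_right L2_mult_integrable)

lemma L2_inner_diff:
  "w \<in> L2 \<Omega> \<Longrightarrow> w' \<in> L2 \<Omega> \<Longrightarrow> z \<in> L2 \<Omega> \<Longrightarrow>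
    L2_inner \<Omega> (\<lambda>x. w x - w' x) z = L2_inner \<Omega> w z - L2_inner \<Omega> w' z"
  by (simp add: L2_inner_def left_diff_distrib L2_mult_integrable)

lemma L2_inner_diff_right:
  "w \<in> L2 \<Omega> \<Longrightarrow> w' \<in> L2 \<Omega> \<Longrightarrow> z \<in> L2 \<Omega> \<Longrightarrow>
    L2_inner \<Omega> z (\<lambda>x. w x - w' x) = L2_inner \<Omega> z w - L2_inner \<Omega> z w'"
  by (simp add: L2_inner_def right_diff_distrib L2_mult_integrable)

lemma L2_inner_add_right:
  "w \<in> L2 \<Omega> \<Longrightarrow> w' \<in> L2 \<Omega> \<Longrightarrow> z \<in> L2 \<Omega> \<Longrightarrow>
    L2_inner \<Omega> z (\<lambda>x. w x + w' x) = L2_inner \<Omega> z w + L2_inner \<Omega> z w'"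
  by (simp add: L2_inner_def distrib_left L2_mult_integrable)

lemma L2_inner_cmult_right: "L2_inner \<Omega> z (\<lambda>x. c * w x) = c * L2_inner \<Omega> z w"
  by (simp add: L2_inner_def mult.left_commute)

lemma L2_inner_cong_AE:
  assumes w: "w \<in> L2 \<Omega>" "w' \<in> L2 \<Omega>" "z \<in> L2 \<Omega>" and eq: "AE x in lebesgue_on \<Omega>. w x = w' x"
  shows "L2_inner \<Omega> w z = L2_inner \<Omega> w' z"
  unfolding L2_inner_def using w[THEN L2_measurable] eq
  by (intro integral_cong_AE) auto

lemma L2_norm_nonneg [simp]: "0 \<le> L2_norm \<Omega> w"
  by (simp add: L2_norm_def)

lemma L2_norm_square: "(L2_norm \<Omega> w)\<^sup>2 = L2_inner \<Omega> w w"
  by (simp add: L2_norm_def L2_inner_def power2_eq_square flip: real_sqrt_mult)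

lemma L2_norm_square_integral: "(L2_norm \<Omega> w)\<^sup>2 = (LINT x|lebesgue_on \<Omega>. (w x)\<^sup>2)"
  by (simp add: L2_norm_def)

lemma L2_norm_cong_AE:
  assumes "w \<in> borel_measurable (lebesgue_on \<Omega>)" "z \<in> borel_measurable (lebesgue_on \<Omega>)"
    and "AE x in lebesgue_on \<Omega>. w x = z x"
  shows "L2_norm \<Omega> w = L2_norm \<Omega> z"
  unfolding L2_norm_def using assms
  by (intro arg_cong[where f=sqrt] integral_cong_AE) auto

lemma L2_norm_cmult: "L2_norm \<Omega> (\<lambda>x. c * w x) = \<bar>c\<bar> * L2_norm \<Omega> w"
  by (simp add: L2_norm_def power_mult_distrib real_sqrt_mult)

lemma L2_norm_uminus: "L2_norm \<Omega> (\<lambda>x. - w x) = L2_norm \<Omega> w"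
  by (simp add: L2_norm_def)

lemma L2_norm_diff_commute: "L2_norm \<Omega> (\<lambda>x. w x - z x) = L2_norm \<Omega> (\<lambda>x. z x - w x)"
  by (simp add: L2_norm_def power2_commute)

lemma L2_norm_zero [simp]: "L2_norm \<Omega> (\<lambda>x. 0) = 0"
  by (simp add: L2_norm_def)

lemma L2_Cauchy_Schwarz:
  assumes w: "w \<in> L2 \<Omega>" and z: "z \<in> L2 \<Omega>"
  shows "\<bar>L2_inner \<Omega> w z\<bar> \<le> L2_norm \<Omega> w * L2_norm \<Omega> z"
proof -
  let ?a = "L2_inner \<Omega> w w" and ?b = "L2_inner \<Omega> w z" and ?c = "L2_inner \<Omega> z z"
  have q: "0 \<le> ?a - 2 * t * ?b + t\<^sup>2 * ?c" for t
  proof -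
    have "0 \<le> L2_inner \<Omega> (\<lambda>x. w x - t * z x) (\<lambda>x. w x - t * z x)"
      by (simp add: L2_inner_def)
    also have "\<dots> = ?a - 2 * t * ?b + t\<^sup>2 * ?c"
      using w z
      by (simp add: L2_inner_diff L2_inner_diff_right L2_cmult L2_diff L2_inner_cmult
          L2_inner_cmult_right L2_inner_commute[of \<Omega> z w] power2_eq_square algebra_simps)
    finally show ?thesis .
  qed
  have "?b\<^sup>2 \<le> ?a * ?c"
  proof (cases "?c = 0")
    case True
    have "?b = 0"
    proof (rule ccontr)
      assume "?b \<noteq> 0"
      \<comment> \<open>If \<open>?c = 0\<close> the quadratic is affine in \<open>t\<close>, and at
        this \<open>t\<close> its value is -1.\<close>
      with q[of "(?a + 1) / (2 * ?b)"] True show False by simp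
    qed
    with True show ?thesis by simp
  next
    case False
    then have "?c > 0" using L2_norm_square[of \<Omega> z] by (metis zero_le_power2 order_less_le)
    with q[of "?b / ?c"] show ?thesis
      by (simp add: power2_eq_square field_simps)
  qed
  then have "?b\<^sup>2 \<le> (L2_norm \<Omega> w * L2_norm \<Omega> z)\<^sup>2"
    by (simp add: power_mult_distrib L2_norm_square)
  then show ?thesis
    by (simp add: abs_le_square_iff[symmetric])
qed

lemma L2_norm_triangle:
  assumes w: "w \<in> L2 \<Omega>" and z: "z \<in> L2 \<Omega>"
  shows "L2_norm \<Omega> (\<lambda>x. w x + z x) \<le> L2_norm \<Omega> w + L2_norm \<Omega> z"
proof -
  have "(L2_norm \<Omega> (\<lambda>x. w x + z x))\<^sup>2 = L2_inner \<Omega> w w + 2 * L2_inner \<Omega> w z + L2_inner \<Omega> z z"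
    using w z
    by (simp add: L2_norm_square L2_inner_add L2_inner_add_right L2_add
        L2_inner_commute[of \<Omega> z w])
  also have "\<dots> \<le> (L2_norm \<Omega> w + L2_norm \<Omega> z)\<^sup>2"
    using L2_Cauchy_Schwarz[OF w z] by (simp add: power2_sum L2_norm_square abs_le_iff)
  finally show ?thesis
    by (rule power2_le_imp_le) simp
qed

lemma L2_norm_triangle_diff:
  "w \<in> L2 \<Omega> \<Longrightarrow> z \<in> L2 \<Omega> \<Longrightarrow> L2_norm \<Omega> (\<lambda>x. w x - z x) \<le> L2_norm \<Omega> w + L2_norm \<Omega> z"
  using L2_norm_triangle[of w \<Omega> "\<lambda>x. - z x"] L2_uminus[of z \<Omega>] by (simp add: L2_norm_uminus)

lemma L2_norm_triangle_le:
  "w \<in> L2 \<Omega> \<Longrightarrow> z \<in> L2 \<Omega> \<Longrightarrow> L2_norm \<Omega> w \<le> L2_norm \<Omega> z + L2_norm \<Omega> (\<lambda>x. w x - z x)"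
  using L2_norm_triangle[of z \<Omega> "\<lambda>x. w x - z x"] L2_diff[of w \<Omega> z] by simp

lemma L2_norm_triangle_mid:
  assumes "w \<in> L2 \<Omega>" "z \<in> L2 \<Omega>" "y \<in> L2 \<Omega>"
  shows "L2_norm \<Omega> (\<lambda>x. w x - y x) \<le> L2_norm \<Omega> (\<lambda>x. w x - z x) + L2_norm \<Omega> (\<lambda>x. z x - y x)"
  using L2_norm_triangle[OF L2_diff[OF assms(1,2)] L2_diff[OF assms(2,3)]] by simp

lemma L2_norm_sum_le:
  "(\<And>i. i \<in> I \<Longrightarrow> w i \<in> L2 \<Omega>) \<Longrightarrow>
    L2_norm \<Omega> (\<lambda>x. \<Sum>i\<in>I. w i x) \<le> (\<Sum>i\<in>I. L2_norm \<Omega> (w i))"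
proof (induction I rule: infinite_finite_induct)
  case (insert i I)
  have "L2_norm \<Omega> (\<lambda>x. w i x + (\<Sum>i\<in>I. w i x)) \<le> L2_norm \<Omega> (w i) + L2_norm \<Omega> (\<lambda>x. \<Sum>i\<in>I. w i x)"
    by (rule L2_norm_triangle) (use insert.prems in \<open>auto intro: L2_sum\<close>)
  also have "\<dots> \<le> L2_norm \<Omega> (w i) + (\<Sum>i\<in>I. L2_norm \<Omega> (w i))"
    using insert.IH insert.prems by simp
  finally show ?case using insert.hyps by simp
qed auto

lemma L2_norm_mono_AE:
  assumes "w \<in> L2 \<Omega>" "z \<in> borel_measurable (lebesgue_on \<Omega>)"
    and "AE x in lebesgue_on \<Omega>. \<bar>z x\<bar> \<le> \<bar>w x\<bar>"
  shows "L2_norm \<Omega> z \<le> L2_norm \<Omega> w"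
  unfolding L2_norm_def
proof (intro real_sqrt_le_mono integral_mono_AE L2_square_integrable)
  show "z \<in> L2 \<Omega>" using L2_bounded_by[OF assms] .
  show "w \<in> L2 \<Omega>" by fact
  show "AE x in lebesgue_on \<Omega>. (z x)\<^sup>2 \<le> (w x)\<^sup>2"
    using assms(3) by eventually_elim (simp add: abs_le_square_iff)
qed

lemma L1_le_L2_norm:
  assumes "\<Omega> \<in> lmeasurable" "w \<in> L2 \<Omega>"
  shows "(LINT x|lebesgue_on \<Omega>. \<bar>w x\<bar>) \<le> sqrt (measure lebesgue \<Omega>) * L2_norm \<Omega> w"
proof -
  have "L2_norm \<Omega> (\<lambda>x. 1) = sqrt (measure lebesgue \<Omega>)"
    using assms(1) by (simp add: L2_norm_def measure_restrict_space fmeasurableD)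
  then show ?thesis
    using L2_Cauchy_Schwarz[OF L2_abs[OF assms(2)] L2_const[OF assms(1), of 1]]
    by (simp add: L2_inner_def L2_norm_def mult.commute)
qed

section \<open>Completeness of L2, and supremum bounds by duality\<close>

lemma L2_normI:
  assumes [measurable]: "w \<in> borel_measurable (lebesgue_on \<Omega>)"
    and "(\<integral>\<^sup>+ x. ennreal ((w x)\<^sup>2) \<partial>lebesgue_on \<Omega>) \<le> ennreal (K\<^sup>2)" "K \<ge> 0"
  shows "w \<in> L2 \<Omega>" "L2_norm \<Omega> w \<le> K"
proof -
  have int: "integrable (lebesgue_on \<Omega>) (\<lambda>x. (w x)\<^sup>2)"
    using assms(2) by (intro integrableI_bounded) (auto simp: less_top[symmetric] top_unique)
  then show "w \<in> L2 \<Omega>" by (simp add: L2_def)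
  have "ennreal (LINT x|lebesgue_on \<Omega>. (w x)\<^sup>2) \<le> ennreal (K\<^sup>2)"
    using assms(2) int by (subst nn_integral_eq_integral[symmetric]) auto
  then have "(L2_norm \<Omega> w)\<^sup>2 \<le> K\<^sup>2" by (simp add: L2_norm_square_integral)
  then show "L2_norm \<Omega> w \<le> K" using assms(3) by (rule power2_le_imp_le)
qed

lemma nn_integral_L2_square:
  "w \<in> L2 \<Omega> \<Longrightarrow> (\<integral>\<^sup>+ x. ennreal ((w x)\<^sup>2) \<partial>lebesgue_on \<Omega>) = ennreal ((L2_norm \<Omega> w)\<^sup>2)"
  by (subst nn_integral_eq_integral) (auto simp: L2_square_integrable L2_norm_square_integral)

text \<open>Completeness with an explicit tail bound. Monotone convergence bounds the sum of the
  absolute values in L2, hence almost everywhere, so the series converges pointwise off a null set;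
  Fatou's lemma then bounds the tails. The tail bound is what the gliding hump argument for uniform
  boundedness consumes.\<close>

lemma L2_summable_series:
  fixes d :: "nat \<Rightarrow> 'a::euclidean_space \<Rightarrow> real"
  assumes d: "\<And>k. d k \<in> L2 \<Omega>" and c: "summable c" and dc: "\<And>k. L2_norm \<Omega> (d k) \<le> c k"
  obtains w where "w \<in> L2 \<Omega>" "\<And>n. L2_norm \<Omega> (\<lambda>x. w x - (\<Sum>k<n. d k x)) \<le> (\<Sum>k. c (k + n))"
proof -
  let ?M = "lebesgue_on \<Omega>"
  have [measurable]: "d k \<in> borel_measurable ?M" for k using d L2_measurable by blast
  have c0: "c k \<ge> 0" for k using dc[of k] L2_norm_nonneg order_trans by blast
  have partial: "L2_norm \<Omega> (\<lambda>x. \<Sum>k\<in>I. \<bar>d k x\<bar>) \<le> suminf c" if "finite I" for I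
  proof -
    have "L2_norm \<Omega> (\<lambda>x. \<Sum>k\<in>I. \<bar>d k x\<bar>) \<le> (\<Sum>k\<in>I. L2_norm \<Omega> (\<lambda>x. \<bar>d k x\<bar>))"
      by (rule L2_norm_sum_le) (simp add: L2_abs d)
    also have "\<dots> = (\<Sum>k\<in>I. L2_norm \<Omega> (d k))" by (simp add: L2_norm_def)
    also have "\<dots> \<le> (\<Sum>k\<in>I. c k)" by (intro sum_mono dc)
    also have "\<dots> \<le> suminf c" using c c0 that by (intro sum_le_suminf) auto
    finally show ?thesis .
  qed
  define S where "S n x = (\<Sum>k<n. \<bar>d k x\<bar>)" for n x
  have S0: "0 \<le> S n x" for n x by (simp add: S_def sum_nonneg)
  have Smono: "S n x \<le> S m x" if "n \<le> m" for n m x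
    unfolding S_def using that by (intro sum_mono2) auto
  have "(\<integral>\<^sup>+ x. (SUP n. ennreal ((S n x)\<^sup>2)) \<partial>?M) = (SUP n. \<integral>\<^sup>+ x. ennreal ((S n x)\<^sup>2) \<partial>?M)"
    by (rule nn_integral_monotone_convergence_SUP)
       (auto simp: incseq_def le_fun_def S_def[abs_def] intro!: ennreal_leI power_mono sum_mono2 sum_nonneg)
  also have "\<dots> \<le> ennreal ((suminf c)\<^sup>2)"
  proof (rule SUP_least)
    fix n
    have "S n \<in> L2 \<Omega>" unfolding S_def[abs_def] by (intro L2_sum L2_abs d)
    then have "(\<integral>\<^sup>+ x. ennreal ((S n x)\<^sup>2) \<partial>?M) = ennreal ((L2_norm \<Omega> (S n))\<^sup>2)"
      by (rule nn_integral_L2_square)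
    also have "\<dots> \<le> ennreal ((suminf c)\<^sup>2)"
      using partial[of "{..<n}"] by (intro ennreal_leI power_mono) (auto simp: S_def[abs_def])
    finally show "(\<integral>\<^sup>+ x. ennreal ((S n x)\<^sup>2) \<partial>?M) \<le> ennreal ((suminf c)\<^sup>2)" .
  qed
  finally have "(\<integral>\<^sup>+ x. (SUP n. ennreal ((S n x)\<^sup>2)) \<partial>?M) \<noteq> \<infinity>"
    by (auto simp: top_unique)
  then have "AE x in ?M. (SUP n. ennreal ((S n x)\<^sup>2)) \<noteq> \<infinity>"
    by (intro nn_integral_noteq_infinite) (auto simp: S_def[abs_def])
  then have summ: "AE x in ?M. summable (\<lambda>k. d k x)"
  proof eventually_elim
    case (elim x)
    then obtain K where K: "(SUP n. ennreal ((S n x)\<^sup>2)) = ennreal K" "K \<ge> 0"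
      by (cases "SUP n. ennreal ((S n x)\<^sup>2)") auto
    have "S n x \<le> sqrt K" for n
    proof -
      have "ennreal ((S n x)\<^sup>2) \<le> ennreal K" unfolding K(1)[symmetric] by (rule SUP_upper) simp
      then have "(S n x)\<^sup>2 \<le> K" using K(2) by simp
      then show ?thesis by (rule real_le_rsqrt)
    qed
    then have "summable (\<lambda>k. \<bar>d k x\<bar>)"
      by (intro bounded_imp_summable[where B="sqrt K"])
         (auto simp: S_def lessThan_Suc_atMost[symmetric] simp del: sum.lessThan_Suc)
    then show ?case by (rule summable_rabs_cancel)
  qed
  define w where "w x = (\<Sum>k. d k x)" for x
  have [measurable]: "w \<in> borel_measurable ?M" unfolding w_def[abs_def] by measurable
  have tail: "(\<integral>\<^sup>+ x. ennreal ((w x - (\<Sum>k<n. d k x))\<^sup>2) \<partial>?M) \<le> ennreal ((\<Sum>k. c (k + n))\<^sup>2)" for n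
  proof -
    have cn: "summable (\<lambda>k. c (k + n))" using c by (simp add: summable_iff_shift)
    have "(\<integral>\<^sup>+ x. ennreal ((w x - (\<Sum>k<n. d k x))\<^sup>2) \<partial>?M)
        = (\<integral>\<^sup>+ x. liminf (\<lambda>m. ennreal ((\<Sum>k<m. d (k + n) x)\<^sup>2)) \<partial>?M)"
    proof (rule nn_integral_cong_AE)
      show "AE x in ?M. ennreal ((w x - (\<Sum>k<n. d k x))\<^sup>2) = liminf (\<lambda>m. ennreal ((\<Sum>k<m. d (k + n) x)\<^sup>2))"
        using summ
      proof eventually_elim
        case (elim x)
        then have "(\<lambda>k. d (k + n) x) sums (w x - (\<Sum>k<n. d k x))"
          using sums_iff_shift[of "\<lambda>k. d k x" n "w x - (\<Sum>k<n. d k x)"]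
          by (simp add: w_def summable_sums)
        then have "(\<lambda>m. ennreal ((\<Sum>k<m. d (k + n) x)\<^sup>2)) \<longlonglongrightarrow> ennreal ((w x - (\<Sum>k<n. d k x))\<^sup>2)"
          unfolding sums_def by (intro tendsto_intros tendsto_ennrealI) auto
        then show ?case by (intro lim_imp_Liminf[symmetric]) auto
      qed
    qed
    also have "\<dots> \<le> liminf (\<lambda>m. \<integral>\<^sup>+ x. ennreal ((\<Sum>k<m. d (k + n) x)\<^sup>2) \<partial>?M)"
      by (rule nn_integral_liminf) measurable
    also have "\<dots> \<le> liminf (\<lambda>m::nat. ennreal ((\<Sum>k. c (k + n))\<^sup>2))"
    proof (intro Liminf_mono always_eventually allI)
      fix m
      have in2: "(\<lambda>x. \<Sum>k<m. d (k + n) x) \<in> L2 \<Omega>" by (intro L2_sum d)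
      have "L2_norm \<Omega> (\<lambda>x. \<Sum>k<m. d (k + n) x) \<le> (\<Sum>k<m. L2_norm \<Omega> (d (k + n)))"
        by (rule L2_norm_sum_le) (simp add: d)
      also have "\<dots> \<le> (\<Sum>k<m. c (k + n))" by (intro sum_mono dc)
      also have "\<dots> \<le> (\<Sum>k. c (k + n))" using cn c0 by (intro sum_le_suminf) auto
      finally show "(\<integral>\<^sup>+ x. ennreal ((\<Sum>k<m. d (k + n) x)\<^sup>2) \<partial>?M) \<le> ennreal ((\<Sum>k. c (k + n))\<^sup>2)"
        using nn_integral_L2_square[OF in2] by (auto intro!: ennreal_leI power_mono)
    qed
    also have "\<dots> = ennreal ((\<Sum>k. c (k + n))\<^sup>2)" by (simp add: Liminf_const)
    finally show ?thesis .
  qed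
  have s0: "0 \<le> (\<Sum>k. c (k + n))" for n
    using c c0 by (intro suminf_nonneg) (auto simp: summable_iff_shift)
  show thesis
  proof
    show "w \<in> L2 \<Omega>" using L2_normI(1)[OF _ tail[of 0] s0] by simp
    show "L2_norm \<Omega> (\<lambda>x. w x - (\<Sum>k<n. d k x)) \<le> (\<Sum>k. c (k + n))" for n
      by (rule L2_normI(2)[OF _ tail s0]) measurable
  qed
qed

text \<open>Testing with the sign of \<open>z\<close>, cut off to the set where
  \<open>\<bar>z x\<bar> > K\<close>, turns \<open>z x * \<phi> x - K * \<bar>\<phi> x\<bar>\<close>
  into the excess of \<open>\<bar>z x\<bar>\<close> over \<open>K\<close>. Its integral is then both
  nonnegative and nonpositive. Restricting to \<open>\<bar>\<phi> x\<bar> \<le> 1\<close> keeps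
  every pairing inside L2; this is the gate from weak identities to supremum norms.\<close>

lemma AE_abs_le_by_duality:
  assumes \<Omega>: "\<Omega> \<in> lmeasurable" and z: "z \<in> L2 \<Omega>" and K: "K \<ge> 0"
    and dual: "\<And>\<phi>. \<phi> \<in> borel_measurable (lebesgue_on \<Omega>) \<Longrightarrow> (\<And>x. \<bar>\<phi> x\<bar> \<le> 1) \<Longrightarrow>
      L2_inner \<Omega> z \<phi> \<le> K * (LINT x|lebesgue_on \<Omega>. \<bar>\<phi> x\<bar>)"
  shows "AE x in lebesgue_on \<Omega>. \<bar>z x\<bar> \<le> K"
proof -
  let ?M = "lebesgue_on \<Omega>"
  have [measurable]: "z \<in> borel_measurable ?M" using z L2_measurable by blast
  define \<phi> where "\<phi> x = (if \<bar>z x\<bar> > K then sgn (z x) else 0)" for x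
  have [measurable]: "\<phi> \<in> borel_measurable ?M" unfolding \<phi>_def[abs_def] sgn_if by measurable
  have b: "\<bar>\<phi> x\<bar> \<le> 1" for x by (auto simp: \<phi>_def sgn_if)
  have \<phi>2: "\<phi> \<in> L2 \<Omega>" by (rule L2_bounded[OF \<Omega>, where B=1]) (auto simp: b)
  have int: "integrable ?M (\<lambda>x. z x * \<phi> x)" "integrable ?M (\<lambda>x. K * \<bar>\<phi> x\<bar>)"
    using L2_mult_integrable[OF z \<phi>2] L2_integrable[OF \<Omega> \<phi>2] by auto
  have eq: "z x * \<phi> x - K * \<bar>\<phi> x\<bar> = (if \<bar>z x\<bar> > K then \<bar>z x\<bar> - K else 0)" for x
    using K by (auto simp: \<phi>_def sgn_if)
  have i2: "integrable ?M (\<lambda>x. z x * \<phi> x - K * \<bar>\<phi> x\<bar>)" using int by simp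
  have "(LINT x|?M. z x * \<phi> x - K * \<bar>\<phi> x\<bar>) \<le> 0"
    using dual[OF _ b] int by (simp add: L2_inner_def)
  moreover have "(LINT x|?M. z x * \<phi> x - K * \<bar>\<phi> x\<bar>) \<ge> 0"
    by (rule integral_nonneg_AE) (simp add: eq)
  ultimately have "AE x in ?M. z x * \<phi> x - K * \<bar>\<phi> x\<bar> = 0"
    by (subst integral_nonneg_eq_0_iff_AE[OF i2, symmetric]) (auto simp: eq intro!: antisym)
  then show ?thesis
    by eventually_elim (simp add: eq split: if_splits)
qed

section \<open>Smooth functions and test functions\<close>

lemma Ck_on_Suc_imp: "Ck_on (Suc k) f U \<Longrightarrow> Ck_on k f U"
proof (induction k arbitrary: f)
  case 0
  then obtain G where "\<forall>x\<in>U. (f has_derivative (\<lambda>h. G x \<bullet> h)) (at x)" by auto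
  then show ?case
    by (auto intro!: continuous_at_imp_continuous_on has_derivative_continuous)
next
  case (Suc k)
  then obtain G where G: "\<forall>x\<in>U. (f has_derivative (\<lambda>h. G x \<bullet> h)) (at x)"
    and "\<forall>i\<in>Basis. Ck_on (Suc k) (\<lambda>x. G x \<bullet> i) U" by (subst (asm) Ck_on.simps(2)) blast
  with Suc.IH have "\<forall>i\<in>Basis. Ck_on k (\<lambda>x. G x \<bullet> i) U" by blast
  with G show ?case by auto
qed

lemma Ck_on_const: "Ck_on k (\<lambda>x. c) U"
proof (induction k arbitrary: c)
  case (Suc k)
  then show ?case by (auto intro!: exI[of _ "\<lambda>x. 0"] derivative_eq_intros)
qed auto

lemma Ck_on_inner: "Ck_on k (\<lambda>x. x \<bullet> a) U"
proof (cases k)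
  case (Suc m)
  then show ?thesis
    by (auto intro!: exI[of _ "\<lambda>x. a"] derivative_eq_intros Ck_on_const simp: inner_commute)
qed (auto intro!: continuous_intros)

lemma Ck_on_add: "Ck_on k f U \<Longrightarrow> Ck_on k g U \<Longrightarrow> Ck_on k (\<lambda>x. f x + g x) U"
proof (induction k arbitrary: f g)
  case (Suc k)
  obtain F where F: "\<forall>x\<in>U. (f has_derivative (\<lambda>h. F x \<bullet> h)) (at x)" "\<forall>i\<in>Basis. Ck_on k (\<lambda>x. F x \<bullet> i) U"
    using Suc.prems(1) by auto
  obtain G where G: "\<forall>x\<in>U. (g has_derivative (\<lambda>h. G x \<bullet> h)) (at x)" "\<forall>i\<in>Basis. Ck_on k (\<lambda>x. G x \<bullet> i) U"
    using Suc.prems(2) by auto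
  have "((\<lambda>x. f x + g x) has_derivative (\<lambda>h. (F x + G x) \<bullet> h)) (at x)" if "x \<in> U" for x
    using has_derivative_add[OF F(1)[rule_format, OF that] G(1)[rule_format, OF that]]
    by (simp add: inner_add_left)
  moreover have "Ck_on k (\<lambda>x. (F x + G x) \<bullet> i) U" if "i \<in> Basis" for i
    using F(2) G(2) Suc.IH that by (simp add: inner_add_left)
  ultimately show ?case
    unfolding Ck_on.simps by (intro exI[of _ "\<lambda>x. F x + G x"]) blast
qed (auto intro: continuous_intros)

lemma Ck_on_mult: "Ck_on k f U \<Longrightarrow> Ck_on k g U \<Longrightarrow> Ck_on k (\<lambda>x. f x * g x) U"
proof (induction k arbitrary: f g)
  case (Suc k)
  obtain F where F: "\<forall>x\<in>U. (f has_derivative (\<lambda>h. F x \<bullet> h)) (at x)" "\<forall>i\<in>Basis. Ck_on k (\<lambda>x. F x \<bullet> i) U"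
    using Suc.prems(1) by auto
  obtain G where G: "\<forall>x\<in>U. (g has_derivative (\<lambda>h. G x \<bullet> h)) (at x)" "\<forall>i\<in>Basis. Ck_on k (\<lambda>x. G x \<bullet> i) U"
    using Suc.prems(2) by auto
  have "((\<lambda>x. f x * g x) has_derivative (\<lambda>h. (f x *\<^sub>R G x + g x *\<^sub>R F x) \<bullet> h)) (at x)" if "x \<in> U" for x
    using has_derivative_mult[OF F(1)[rule_format, OF that] G(1)[rule_format, OF that]]
    by (simp add: inner_add_left mult.commute)
  moreover have "Ck_on k (\<lambda>x. (f x *\<^sub>R G x + g x *\<^sub>R F x) \<bullet> i) U" if "i \<in> Basis" for i
    using F(2) G(2) Suc.IH Suc.prems[THEN Ck_on_Suc_imp] that
    by (auto simp: inner_add_left intro!: Ck_on_add)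
  ultimately show ?case
    unfolding Ck_on.simps by (intro exI[of _ "\<lambda>x. f x *\<^sub>R G x + g x *\<^sub>R F x"]) blast
qed (auto intro: continuous_intros)

lemma Ck_on_sum: "(\<And>i. i \<in> I \<Longrightarrow> Ck_on k (f i) U) \<Longrightarrow> Ck_on k (\<lambda>x. \<Sum>i\<in>I. f i x) U"
  by (induction I rule: infinite_finite_induct) (auto intro: Ck_on_const Ck_on_add)

lemma Ck_on_diff: "Ck_on k f U \<Longrightarrow> Ck_on k g U \<Longrightarrow> Ck_on k (\<lambda>x. f x - g x) U"
  using Ck_on_add[of k f U "\<lambda>x. (-1) * g x"] Ck_on_mult[OF Ck_on_const[of k "-1" U]] by simp

text \<open>The sequence \<open>h\<close> lists a function together with all its derivatives. The
  conclusion is stated for every index \<open>n\<close> because the gradient of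
  \<open>h n (q x)\<close> brings in \<open>h (Suc n) (q x)\<close>, to which the induction
  hypothesis must apply.\<close>

lemma Ck_on_compose:
  fixes h :: "nat \<Rightarrow> real \<Rightarrow> real"
  assumes h: "\<And>n s. (h n has_real_derivative h (Suc n) s) (at s)"
  shows "Ck_on k q U \<Longrightarrow> Ck_on k (\<lambda>x. h n (q x)) U"
proof (induction k arbitrary: n)
  case 0
  have "continuous_on UNIV (h n)"
    using h by (intro continuous_at_imp_continuous_on ballI DERIV_isCont) blast
  with 0 show ?case by (auto intro: continuous_on_compose2)
next
  case (Suc k)
  obtain G where G: "\<forall>x\<in>U. (q has_derivative (\<lambda>h. G x \<bullet> h)) (at x)" "\<forall>i\<in>Basis. Ck_on k (\<lambda>x. G x \<bullet> i) U"
    using Suc.prems(1) by auto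
  have "((\<lambda>x. h n (q x)) has_derivative (\<lambda>y. (h (Suc n) (q x) *\<^sub>R G x) \<bullet> y)) (at x)" if "x \<in> U" for x
    using has_derivative_compose[OF G(1)[rule_format, OF that] h[unfolded has_field_derivative_def]] by simp
  moreover have "Ck_on k (\<lambda>x. (h (Suc n) (q x) *\<^sub>R G x) \<bullet> i) U" if "i \<in> Basis" for i
    using G(2) that Suc.IH[OF Ck_on_Suc_imp[OF Suc.prems(1)]] by (auto intro!: Ck_on_mult)
  ultimately show ?case
    unfolding Ck_on.simps by (intro exI[of _ "\<lambda>x. h (Suc n) (q x) *\<^sub>R G x"]) blast
qed

lemma Ck_on_translate: "Ck_on k f UNIV \<Longrightarrow> Ck_on k (\<lambda>x. f (x + a)) UNIV"
proof (induction k arbitrary: f)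
  case 0
  then show ?case by (auto intro!: continuous_on_compose2[of UNIV f] continuous_intros)
next
  case (Suc k)
  then obtain F where F: "\<And>x. (f has_derivative (\<lambda>h. F x \<bullet> h)) (at x)" "\<forall>i\<in>Basis. Ck_on k (\<lambda>x. F x \<bullet> i) UNIV"
    by auto
  have "((\<lambda>x. f (x + a)) has_derivative (\<lambda>h. F (x + a) \<bullet> h)) (at x)" for x
    by (rule has_derivative_compose[OF _ F(1), where f="\<lambda>x. x + a" and f'="\<lambda>h. h"])
       (auto intro!: derivative_eq_intros)
  with F(2) Suc.IH show ?case
    unfolding Ck_on.simps by (intro exI[of _ "\<lambda>x. F (x + a)"]) auto
qed

section \<open>A flat function and smooth bumps\<close>

lemma poly_times_exp_minus_tendsto_0: "((\<lambda>y::real. poly p y * exp (- y)) \<longlongrightarrow> 0) at_top"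
proof -
  have "((\<lambda>y::real. \<Sum>i\<le>degree p. coeff p i * (y ^ i / exp y)) \<longlongrightarrow> (\<Sum>i\<le>degree p. coeff p i * 0)) at_top"
    by (intro tendsto_intros tendsto_power_div_exp_0)
  then show ?thesis
    by (simp add: poly_altdef sum_distrib_right exp_minus divide_inverse mult.assoc)
qed

text \<open>The derivatives of \<open>exp (-1/s)\<close> on \<open>s > 0\<close> are of the form \<open>p (1/s) * exp (-1/s)\<close>.\<close>

fun flat_poly :: "nat \<Rightarrow> real poly" where
  "flat_poly 0 = 1"
| "flat_poly (Suc n) = [:0, 0, 1:] * (flat_poly n - pderiv (flat_poly n))"

definition flat_exp :: "nat \<Rightarrow> real \<Rightarrow> real" where
  "flat_exp n s = (if s > 0 then poly (flat_poly n) (1 / s) * exp (- (1 / s)) else 0)"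

lemma flat_exp_has_derivative: "(flat_exp n has_real_derivative flat_exp (Suc n) s) (at s)"
proof -
  consider "s > 0" | "s < 0" | "s = 0" by linarith
  then show ?thesis
  proof cases
    case 1
    have "((\<lambda>s. poly (flat_poly n) (1 / s) * exp (- (1 / s))) has_real_derivative flat_exp (Suc n) s) (at s)"
      using 1
      by (auto intro!: derivative_eq_intros DERIV_chain2[OF poly_DERIV] simp: flat_exp_def field_simps power2_eq_square)
    then show ?thesis
      by (rule has_field_derivative_transform_within[where d=s]) (use 1 in \<open>auto simp: flat_exp_def dist_real_def\<close>)
  next
    case 2
    have "((\<lambda>s. 0) has_real_derivative flat_exp (Suc n) s) (at s)"
      using 2 by (auto simp: flat_exp_def)
    then show ?thesis
      by (rule has_field_derivative_transform_within[where d="-s"]) (use 2 in \<open>auto simp: flat_exp_def dist_real_def\<close>)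
  next
    case 3
    have "((\<lambda>h. flat_exp n h / h) \<longlongrightarrow> 0) (at_left 0)"
      by (rule tendsto_eventually) (auto simp: flat_exp_def eventually_at_filter)
    \<comment> \<open>With \<open>h = 1 / y\<close> the quotient is again a polynomial in
      \<open>y\<close> times \<open>exp (- y)\<close>; the division by \<open>h\<close> contributes
      the extra factor \<open>[:0, 1:]\<close>.\<close>
    moreover have "((\<lambda>h. flat_exp n h / h) \<longlongrightarrow> 0) (at_right 0)"
      unfolding filterlim_at_right_to_top
    proof (rule Lim_transform_eventually[OF poly_times_exp_minus_tendsto_0[of "[:0, 1:] * flat_poly n"]])
      show "\<forall>\<^sub>F x in at_top. poly ([:0, 1:] * flat_poly n) x * exp (- x) = flat_exp n (inverse x) / inverse x"
        using eventually_gt_at_top[of 0] by eventually_elim (auto simp: flat_exp_def field_simps)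
    qed
    ultimately have "((\<lambda>h. flat_exp n h / h) \<longlongrightarrow> 0) (at 0)"
      by (rule filterlim_split_at)
    then show ?thesis
      using 3 by (simp add: has_field_derivative_iff flat_exp_def)
  qed
qed

definition bump :: "'a::euclidean_space \<Rightarrow> real \<Rightarrow> 'a \<Rightarrow> real" where
  "bump c r x = flat_exp 0 (r\<^sup>2 - (norm (x - c))\<^sup>2)"

lemma smooth_on_bump: "smooth_on (bump c r) U"
  unfolding smooth_on_def
proof
  fix k
  have eq: "r\<^sup>2 - (norm (x - c))\<^sup>2 = r\<^sup>2 - (\<Sum>i\<in>Basis. (x \<bullet> i - c \<bullet> i) * (x \<bullet> i - c \<bullet> i))" for x
    unfolding power2_norm_eq_inner by (subst euclidean_inner) (simp add: inner_diff_left)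
  have "Ck_on k (\<lambda>x. r\<^sup>2 - (norm (x - c))\<^sup>2) U"
    unfolding eq by (intro Ck_on_diff Ck_on_const Ck_on_sum Ck_on_mult Ck_on_inner)
  then show "Ck_on k (bump c r) U"
    unfolding bump_def[abs_def]
    by (intro Ck_on_compose[where h=flat_exp] flat_exp_has_derivative)
qed

lemma bump_nonneg: "0 \<le> bump c r x"
  by (simp add: bump_def flat_exp_def)

lemma bump_pos: "x \<in> ball c r \<Longrightarrow> 0 < bump c r x"
  by (auto simp: bump_def flat_exp_def dist_norm norm_minus_commute intro!: power_strict_mono)

lemma bump_eq_0: "r > 0 \<Longrightarrow> x \<notin> ball c r \<Longrightarrow> bump c r x = 0"
  by (auto simp: bump_def flat_exp_def dist_norm norm_minus_commute not_less intro!: power_mono)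

lemma test_function_Ck: "test_function \<Omega> \<phi> \<Longrightarrow> Ck_on k \<phi> UNIV"
  by (simp add: test_function_def smooth_on_def)

lemma test_functionE:
  assumes "test_function \<Omega> \<phi>"
  obtains K where "compact K" "K \<subseteq> \<Omega>" "\<And>x. x \<notin> K \<Longrightarrow> \<phi> x = 0"
  using assms by (auto simp: test_function_def)

lemma test_function_mono: "test_function V \<phi> \<Longrightarrow> V \<subseteq> \<Omega> \<Longrightarrow> test_function \<Omega> \<phi>"
  unfolding test_function_def by blast

lemma test_function_zero_outside: "test_function V \<phi> \<Longrightarrow> x \<notin> V \<Longrightarrow> \<phi> x = 0"
  unfolding test_function_def by blast

lemma test_function_has_derivative:
  assumes "test_function \<Omega> \<phi>"
  shows "(\<phi> has_derivative frechet_derivative \<phi> (at x)) (at x)"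
  using test_function_Ck[OF assms, of 1] by (auto simp: frechet_derivative_works[symmetric] differentiable_def)

lemma test_function_add:
  assumes "test_function \<Omega> \<phi>" "test_function \<Omega> \<eta>"
  shows "test_function \<Omega> (\<lambda>x. \<phi> x + \<eta> x)"
proof -
  obtain K K' where "compact K" "K \<subseteq> \<Omega>" "\<And>x. x \<notin> K \<Longrightarrow> \<phi> x = 0"
    "compact K'" "K' \<subseteq> \<Omega>" "\<And>x. x \<notin> K' \<Longrightarrow> \<eta> x = 0"
    using test_functionE[OF assms(1)] test_functionE[OF assms(2)] by metis
  then have "compact (K \<union> K') \<and> K \<union> K' \<subseteq> \<Omega> \<and> (\<forall>x. x \<notin> K \<union> K' \<longrightarrow> \<phi> x + \<eta> x = 0)"
    by (auto intro: compact_Un)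
  then show ?thesis
    using assms by (auto simp: test_function_def smooth_on_def intro!: Ck_on_add)
qed

lemma test_function_mult:
  assumes "test_function \<Omega> \<phi>" "smooth_on \<eta> UNIV"
  shows "test_function \<Omega> (\<lambda>x. \<phi> x * \<eta> x)"
  using assms unfolding test_function_def smooth_on_def by (auto intro!: Ck_on_mult)

lemma test_function_cmult: "test_function \<Omega> \<phi> \<Longrightarrow> test_function \<Omega> (\<lambda>x. c * \<phi> x)"
  using test_function_mult[of \<Omega> \<phi> "\<lambda>x. c"] by (simp add: smooth_on_def Ck_on_const mult.commute)

lemma test_function_zero: "test_function \<Omega> (\<lambda>x. 0)"
  by (auto simp: test_function_def smooth_on_def Ck_on_const)

lemma test_function_translate:
  assumes "test_function V \<phi>" "\<And>x. x \<in> V \<Longrightarrow> x + y \<in> \<Omega>"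
  shows "test_function \<Omega> (\<lambda>x. \<phi> (x - y))"
proof -
  obtain K where K: "compact K" "K \<subseteq> V" "\<And>x. x \<notin> K \<Longrightarrow> \<phi> x = 0"
    using test_functionE[OF assms(1)] by metis
  have "compact ((+) y ` K)" using K(1) by (rule compact_translation)
  moreover have "(+) y ` K \<subseteq> \<Omega>" using K(2) assms(2) by (auto simp: add.commute)
  moreover have "\<phi> (x - y) = 0" if "x \<notin> (+) y ` K" for x
    using that K(3)[of "x - y"] by (metis add_diff_cancel_left' diff_add_cancel image_eqI add.commute)
  ultimately show ?thesis
    using Ck_on_translate[OF test_function_Ck[OF assms(1)], of _ "-y"]
    unfolding test_function_def smooth_on_def by auto
qed

lemma frechet_derivative_translate:
  assumes "test_function V \<phi>"
  shows "frechet_derivative (\<lambda>x. \<phi> (x - y)) (at x) = frechet_derivative \<phi> (at (x - y))"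
proof -
  have "((\<lambda>x. \<phi> (x - y)) has_derivative frechet_derivative \<phi> (at (x - y))) (at x)"
    by (rule has_derivative_compose[OF _ test_function_has_derivative[OF assms], where f="\<lambda>x. x - y" and f'="\<lambda>h. h"])
       (auto intro!: derivative_eq_intros)
  then show ?thesis by (rule frechet_derivative_at[symmetric])
qed

lemma test_function_partial:
  assumes "test_function \<Omega> \<phi>"
  shows "test_function \<Omega> (\<lambda>x. frechet_derivative \<phi> (at x) i)"
proof -
  obtain K where K: "compact K" "K \<subseteq> \<Omega>" "\<And>x. x \<notin> K \<Longrightarrow> \<phi> x = 0"
    using test_functionE[OF assms(1)] by metis
  have "frechet_derivative \<phi> (at x) i = 0" if "x \<notin> K" for x
  proof -
    have "((\<lambda>x. 0) has_derivative (\<lambda>h. 0)) (at x)" by simp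
    then have "(\<phi> has_derivative (\<lambda>h. 0)) (at x)"
      by (rule has_derivative_transform_within_open[where s="- K"])
         (use K that in \<open>auto simp: open_Compl compact_imp_closed\<close>)
    then have "frechet_derivative \<phi> (at x) = (\<lambda>h. 0)" by (rule frechet_derivative_at[symmetric])
    then show ?thesis by simp
  qed
  moreover have "Ck_on k (\<lambda>x. frechet_derivative \<phi> (at x) i) UNIV" for k
  proof -
    obtain G where G: "\<forall>x\<in>UNIV. (\<phi> has_derivative (\<lambda>h. G x \<bullet> h)) (at x)"
      "\<forall>i\<in>Basis. Ck_on k (\<lambda>x. G x \<bullet> i) UNIV"
      using test_function_Ck[OF assms, of "Suc k"] by auto
    have "frechet_derivative \<phi> (at x) i = (\<Sum>b\<in>Basis. (i \<bullet> b) * (G x \<bullet> b))" for x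
      using frechet_derivative_at[OF G(1)[rule_format, of x]] euclidean_inner[of "G x" i]
      by (simp add: fun_eq_iff mult.commute)
    then show ?thesis
      using G(2) by (simp del: Ck_on.simps) (intro Ck_on_sum Ck_on_mult Ck_on_const, auto)
  qed
  ultimately show ?thesis
    using K(1,2) unfolding test_function_def smooth_on_def by auto
qed

lemma test_function_continuous: "test_function \<Omega> \<phi> \<Longrightarrow> continuous_on A \<phi>"
  using test_function_Ck[of \<Omega> \<phi> 0] continuous_on_subset by auto

lemma test_function_bounded:
  assumes "test_function \<Omega> \<phi>"
  obtains B where "B > 0" "\<And>x. \<bar>\<phi> x\<bar> \<le> B"
proof -
  obtain K where K: "compact K" "\<And>x. x \<notin> K \<Longrightarrow> \<phi> x = 0"
    using test_functionE[OF assms(1)] by metis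
  have "bounded (\<phi> ` K)"
    by (intro compact_imp_bounded compact_continuous_image test_function_continuous[OF assms] K)
  then obtain B where "B > 0" "\<forall>y\<in>\<phi> ` K. norm y \<le> B" using bounded_pos by blast
  then show thesis using K(2) that[of B] by (metis abs_zero image_eqI less_imp_le real_norm_def)
qed

lemma test_function_measurable [measurable_dest]:
  "test_function V \<phi> \<Longrightarrow> \<phi> \<in> borel_measurable borel"
  by (rule borel_measurable_continuous_onI[OF test_function_continuous])

lemma test_function_measurable_lebesgue:
  "test_function V \<phi> \<Longrightarrow> \<phi> \<in> borel_measurable (lebesgue_on \<Omega>)"
  by (intro measurable_restrict_space1 measurable_completion) (simp add: test_function_measurable)

lemma test_function_L2:
  assumes "test_function V \<phi>" "\<Omega> \<in> lmeasurable"
  shows "\<phi> \<in> L2 \<Omega>"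
proof -
  obtain B where "B > 0" "\<And>x. \<bar>\<phi> x\<bar> \<le> B" using test_function_bounded[OF assms(1)] by metis
  then show ?thesis
    by (intro L2_bounded[OF assms(2) test_function_measurable_lebesgue[OF assms(1)], of B]) auto
qed

lemma compact_support_uniformly_continuous:
  fixes f :: "'a::euclidean_space \<Rightarrow> real"
  assumes f: "continuous_on UNIV f" and K: "compact K" "\<And>x. x \<notin> K \<Longrightarrow> f x = 0"
  shows "uniformly_continuous_on UNIV f"
  unfolding uniformly_continuous_on_def
proof (intro allI impI)
  fix e :: real assume e: "e > 0"
  \<comment> \<open>The support thickened by the unit ball: two points at distance less than 1 lie
    both in \<open>K'\<close> as soon as one of them is in \<open>K\<close>, and otherwise both
    values vanish.\<close>
  define K' where "K' = {x + y |x y. x \<in> K \<and> y \<in> cball 0 1}"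
  have "compact K'" unfolding K'_def using K(1) by (intro compact_sums) auto
  then have "uniformly_continuous_on K' f"
    using f continuous_on_subset by (intro compact_uniformly_continuous) auto
  then obtain d where d: "d > 0" "\<And>x y. x \<in> K' \<Longrightarrow> y \<in> K' \<Longrightarrow> dist y x < d \<Longrightarrow> dist (f y) (f x) < e"
    using e unfolding uniformly_continuous_on_def by metis
  have in': "x \<in> K'" if "y \<in> K" "dist y x \<le> 1" for x y
    unfolding K'_def using that by (intro CollectI exI[of _ y] exI[of _ "x - y"]) (auto simp: dist_norm norm_minus_commute)
  show "\<exists>d>0. \<forall>x\<in>(UNIV :: 'a set). \<forall>x'\<in>UNIV. dist x' x < d \<longrightarrow> dist (f x') (f x) < e"
  proof (intro exI[of _ "min d 1"] conjI ballI impI)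
    fix x x' :: 'a assume *: "dist x' x < min d 1"
    show "dist (f x') (f x) < e"
    proof (cases "x \<in> K \<or> x' \<in> K")
      case True
      then have "x \<in> K' \<and> x' \<in> K'"
        using in'[of x x] in'[of x x'] in'[of x' x] in'[of x' x'] * by (auto simp: dist_commute)
      then show ?thesis using d(2) * by simp
    next
      case False
      then show ?thesis using K(2) e by simp
    qed
  qed (use d in auto)
qed

text \<open>Directional derivatives of a test function are uniformly continuous, so by the mean
  value theorem the first order error is small uniformly in \<open>x\<close>. The uniformity allows
  differentiation under an integral against a merely integrable function.\<close>

lemma test_function_uniformly_differentiable:
  assumes \<phi>: "test_function \<Omega> \<phi>" and e: "e > 0"
  obtains d where "d > 0" "\<And>h x. \<bar>h\<bar> < d \<Longrightarrow>
    \<bar>\<phi> (x + h *\<^sub>R y) - \<phi> x - h * frechet_derivative \<phi> (at x) y\<bar> \<le> e * \<bar>h\<bar>"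
proof -
  let ?D = "\<lambda>x. frechet_derivative \<phi> (at x) y"
  have t: "test_function \<Omega> ?D" by (rule test_function_partial[OF \<phi>])
  obtain K where K: "compact K" "\<And>x. x \<notin> K \<Longrightarrow> ?D x = 0"
    using test_functionE[OF t] by metis
  have "uniformly_continuous_on UNIV ?D"
    by (rule compact_support_uniformly_continuous[OF test_function_continuous[OF t] K])
  then obtain d where d: "d > 0" "\<And>x x'. dist x' x < d \<Longrightarrow> dist (?D x') (?D x) < e"
    using e unfolding uniformly_continuous_on_def by (metis UNIV_I)
  have lin: "linear (frechet_derivative \<phi> (at x))" for x
    using test_function_has_derivative[OF \<phi>] has_derivative_linear by blast
  \<comment> \<open>Adding 1 to \<open>norm y\<close> keeps the radius meaningful for
    \<open>y = 0\<close>.\<close>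
  have main: "\<bar>\<phi> (x + h *\<^sub>R y) - \<phi> x - h * ?D x\<bar> \<le> e * \<bar>h\<bar>" if h: "\<bar>h\<bar> < d / (norm y + 1)" for h x
  proof -
    define q where "q s = \<phi> (x + s *\<^sub>R (h *\<^sub>R y)) - s * (h * ?D x)" for s
    have q': "(q has_real_derivative (h * ?D (x + s *\<^sub>R (h *\<^sub>R y)) - h * ?D x)) (at s)" for s
    proof -
      have "((\<lambda>s. x + s *\<^sub>R (h *\<^sub>R y)) has_derivative (\<lambda>t. t *\<^sub>R (h *\<^sub>R y))) (at s)"
        by (auto intro!: derivative_eq_intros)
      from has_derivative_compose[OF this test_function_has_derivative[OF \<phi>]]
      have "((\<lambda>s. \<phi> (x + s *\<^sub>R (h *\<^sub>R y))) has_real_derivative h * ?D (x + s *\<^sub>R (h *\<^sub>R y))) (at s)"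
        unfolding has_field_derivative_def by (rule has_derivative_eq_rhs) (simp add: linear_scale[OF lin] fun_eq_iff mult_ac)
      then show ?thesis unfolding q_def by (auto intro!: derivative_eq_intros)
    qed
    obtain s where s: "0 < s" "s < 1" "q 1 - q 0 = (1 - 0) * (h * ?D (x + s *\<^sub>R (h *\<^sub>R y)) - h * ?D x)"
      using MVT2[of 0 1 q "\<lambda>s. h * ?D (x + s *\<^sub>R (h *\<^sub>R y)) - h * ?D x"] q' by auto
    have "dist (x + s *\<^sub>R (h *\<^sub>R y)) x = s * (\<bar>h\<bar> * norm y)" using s by (simp add: dist_norm abs_mult)
    also have "\<dots> \<le> 1 * (\<bar>h\<bar> * norm y)" using s by (intro mult_right_mono) auto
    also have "\<dots> \<le> \<bar>h\<bar> * (norm y + 1)" by (simp add: algebra_simps)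
    also have "\<dots> < d" using h by (simp add: field_simps add_pos_nonneg pos_less_divide_eq)
    finally have "\<bar>?D (x + s *\<^sub>R (h *\<^sub>R y)) - ?D x\<bar> \<le> e" using d(2) by (force simp: dist_real_def)
    then have "\<bar>h\<bar> * \<bar>?D (x + s *\<^sub>R (h *\<^sub>R y)) - ?D x\<bar> \<le> \<bar>h\<bar> * e" by (intro mult_left_mono) auto
    then show ?thesis using s(3) by (simp add: q_def mult.commute flip: abs_mult right_diff_distrib)
  qed
  show thesis
    by (rule that[of "d / (norm y + 1)"]) (use d main in \<open>auto simp: add_nonneg_pos\<close>)
qed

section \<open>Translations\<close>

text \<open>A translation is the coordinatewise affine map all of whose scaling factors are
  1.\<close>

lemma lebesgue_distr_translation:
  fixes a :: "'a::euclidean_space"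
  shows "distr lebesgue lebesgue (\<lambda>x. x + a) = lebesgue" "(\<lambda>x. x + a) \<in> lebesgue \<rightarrow>\<^sub>M lebesgue"
proof -
  have *: "(\<lambda>x. a + (\<Sum>j\<in>Basis. (1 * (x \<bullet> j)) *\<^sub>R j)) = (\<lambda>x::'a. x + a)"
    by (simp add: euclidean_representation add.commute)
  show "(\<lambda>x. x + a) \<in> lebesgue \<rightarrow>\<^sub>M lebesgue"
    using lebesgue_affine_measurable[of "\<lambda>_. 1" a] unfolding * by simp
  show "distr lebesgue lebesgue (\<lambda>x. x + a) = lebesgue"
    using lebesgue_affine_euclidean[of "\<lambda>_. 1" a] unfolding * by (simp add: density_1)
qed

lemma lebesgue_integral_translate:
  fixes f :: "'a::euclidean_space \<Rightarrow> real"
  assumes "f \<in> borel_measurable lebesgue"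
  shows "(LINT x|lebesgue. f (x + a)) = (LINT x|lebesgue. f x)"
    and "integrable lebesgue (\<lambda>x. f (x + a)) \<longleftrightarrow> integrable lebesgue f"
  using integral_distr[OF lebesgue_distr_translation(2)[of a] assms]
    integrable_distr_eq[OF lebesgue_distr_translation(2)[of a] assms]
  by (simp_all add: lebesgue_distr_translation(1))

lemma lebesgue_on_integral_eq:
  fixes f :: "'a::euclidean_space \<Rightarrow> real"
  assumes "\<Omega> \<in> sets lebesgue" "\<And>x. x \<notin> \<Omega> \<Longrightarrow> f x = 0"
  shows "(LINT x|lebesgue_on \<Omega>. f x) = (LINT x|lebesgue. f x)"
    and "integrable (lebesgue_on \<Omega>) f \<longleftrightarrow> integrable lebesgue f"
    and "f \<in> borel_measurable (lebesgue_on \<Omega>) \<longleftrightarrow> f \<in> borel_measurable lebesgue"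
proof -
  have *: "(\<lambda>x. indicator \<Omega> x *\<^sub>R f x) = f"
    using assms(2) by (auto simp: indicator_def fun_eq_iff)
  show "(LINT x|lebesgue_on \<Omega>. f x) = (LINT x|lebesgue. f x)"
    using assms(1) by (simp add: integral_restrict_space * del: real_scaleR_def)
  show "integrable (lebesgue_on \<Omega>) f \<longleftrightarrow> integrable lebesgue f"
    using assms(1) by (simp add: integrable_restrict_space * del: real_scaleR_def)
  show "f \<in> borel_measurable (lebesgue_on \<Omega>) \<longleftrightarrow> f \<in> borel_measurable lebesgue"
    using assms(1) by (simp add: borel_measurable_restrict_space_iff * del: real_scaleR_def)
qed

section \<open>Density of test functions\<close>

text \<open>The L2 closure of the test functions. As it is stable under limits and linear
  combinations, density reduces to indicator functions, and for these to open sets.\<close>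

definition test_approximable :: "'a::euclidean_space set \<Rightarrow> ('a \<Rightarrow> real) \<Rightarrow> bool" where
  "test_approximable V z \<longleftrightarrow> z \<in> L2 V \<and> (\<forall>e>0. \<exists>\<phi>. test_function V \<phi> \<and> L2_norm V (\<lambda>x. z x - \<phi> x) < e)"

lemma test_approximable_limit:
  assumes V: "V \<in> lmeasurable" and z: "z \<in> L2 V"
    and ap: "\<And>e. e > 0 \<Longrightarrow> \<exists>w. test_approximable V w \<and> L2_norm V (\<lambda>x. z x - w x) < e"
  shows "test_approximable V z"
  unfolding test_approximable_def
proof (intro conjI allI impI z)
  fix e :: real assume "e > 0"
  then obtain w where w: "test_approximable V w" "L2_norm V (\<lambda>x. z x - w x) < e / 2" using ap[of "e/2"] by auto
  then obtain \<phi> where \<phi>: "test_function V \<phi>" "L2_norm V (\<lambda>x. w x - \<phi> x) < e / 2"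
    using \<open>e > 0\<close> unfolding test_approximable_def by (meson half_gt_zero)
  have "L2_norm V (\<lambda>x. z x - \<phi> x) \<le> L2_norm V (\<lambda>x. z x - w x) + L2_norm V (\<lambda>x. w x - \<phi> x)"
    using z w(1) test_function_L2[OF \<phi>(1) V] by (intro L2_norm_triangle_mid) (auto simp: test_approximable_def)
  then show "\<exists>\<phi>. test_function V \<phi> \<and> L2_norm V (\<lambda>x. z x - \<phi> x) < e"
    using \<phi> w(2) by (intro exI[of _ \<phi>]) auto
qed

lemma test_approximable_add:
  assumes V: "V \<in> lmeasurable" and z: "test_approximable V z" and w: "test_approximable V w"
  shows "test_approximable V (\<lambda>x. z x + w x)"
  unfolding test_approximable_def
proof (intro conjI allI impI)
  have z2: "z \<in> L2 V" and w2: "w \<in> L2 V" using z w by (auto simp: test_approximable_def)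
  then show "(\<lambda>x. z x + w x) \<in> L2 V" by (rule L2_add)
  fix e :: real assume "e > 0"
  then obtain \<phi> \<eta> where \<phi>: "test_function V \<phi>" "L2_norm V (\<lambda>x. z x - \<phi> x) < e / 2"
    and \<eta>: "test_function V \<eta>" "L2_norm V (\<lambda>x. w x - \<eta> x) < e / 2"
    using z w unfolding test_approximable_def by (meson half_gt_zero)
  have "L2_norm V (\<lambda>x. (z x - \<phi> x) + (w x - \<eta> x)) \<le> L2_norm V (\<lambda>x. z x - \<phi> x) + L2_norm V (\<lambda>x. w x - \<eta> x)"
    using z2 w2 test_function_L2[OF \<phi>(1) V] test_function_L2[OF \<eta>(1) V]
    by (intro L2_norm_triangle L2_diff)
  moreover have "(\<lambda>x. (z x - \<phi> x) + (w x - \<eta> x)) = (\<lambda>x. z x + w x - (\<phi> x + \<eta> x))" by auto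
  ultimately show "\<exists>\<phi>. test_function V \<phi> \<and> L2_norm V (\<lambda>x. z x + w x - \<phi> x) < e"
    using \<phi> \<eta> by (intro exI[of _ "\<lambda>x. \<phi> x + \<eta> x"]) (auto intro: test_function_add)
qed

lemma test_approximable_cmult:
  assumes z: "test_approximable V z"
  shows "test_approximable V (\<lambda>x. c * z x)"
  unfolding test_approximable_def
proof (intro conjI allI impI)
  show "(\<lambda>x. c * z x) \<in> L2 V" using z by (auto simp: test_approximable_def L2_cmult)
  fix e :: real assume "e > 0"
  then have "e / (\<bar>c\<bar> + 1) > 0" by (simp add: add_nonneg_pos)
  then obtain \<phi> where \<phi>: "test_function V \<phi>" "L2_norm V (\<lambda>x. z x - \<phi> x) < e / (\<bar>c\<bar> + 1)"
    using z unfolding test_approximable_def by metis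
  have "L2_norm V (\<lambda>x. c * z x - c * \<phi> x) = \<bar>c\<bar> * L2_norm V (\<lambda>x. z x - \<phi> x)"
    by (simp flip: right_diff_distrib add: L2_norm_cmult)
  also have "\<dots> \<le> (\<bar>c\<bar> + 1) * L2_norm V (\<lambda>x. z x - \<phi> x)" by (intro mult_right_mono) auto
  also have "\<dots> < e" using \<phi>(2) by (simp add: field_simps add_nonneg_pos pos_less_divide_eq)
  finally show "\<exists>\<phi>. test_function V \<phi> \<and> L2_norm V (\<lambda>x. c * z x - \<phi> x) < e"
    using \<phi>(1) test_function_cmult by blast
qed

lemma test_approximable_zero: "test_approximable V (\<lambda>x. 0)"
  unfolding test_approximable_def
  by (auto simp: L2_def intro!: exI[of _ "\<lambda>x. 0"] test_function_zero)

lemma test_approximable_sum: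
  "V \<in> lmeasurable \<Longrightarrow> (\<And>i. i \<in> I \<Longrightarrow> test_approximable V (f i)) \<Longrightarrow> test_approximable V (\<lambda>x. \<Sum>i\<in>I. f i x)"
  by (induction I rule: infinite_finite_induct) (auto intro: test_approximable_zero test_approximable_add)

lemma L2_dominated_convergence:
  assumes w: "w \<in> L2 V" and s: "\<And>i. s i \<in> borel_measurable (lebesgue_on V)"
    and z: "z \<in> borel_measurable (lebesgue_on V)"
    and lim: "AE x in lebesgue_on V. (\<lambda>i. s i x) \<longlonglongrightarrow> z x"
    and bound: "\<And>i. AE x in lebesgue_on V. \<bar>z x - s i x\<bar> \<le> \<bar>w x\<bar>"
  shows "(\<lambda>i. L2_norm V (\<lambda>x. z x - s i x)) \<longlonglongrightarrow> 0"
proof -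
  note [measurable] = s z
  have "(\<lambda>i. LINT x|lebesgue_on V. (z x - s i x)\<^sup>2) \<longlonglongrightarrow> (LINT x|lebesgue_on V. 0)"
  proof (rule integral_dominated_convergence[where w="\<lambda>x. (w x)\<^sup>2"])
    show "integrable (lebesgue_on V) (\<lambda>x. (w x)\<^sup>2)" by (rule L2_square_integrable[OF w])
    show "AE x in lebesgue_on V. (\<lambda>i. (z x - s i x)\<^sup>2) \<longlonglongrightarrow> 0"
      using lim
    proof eventually_elim
      case (elim x)
      then have "(\<lambda>i. (z x - s i x)\<^sup>2) \<longlonglongrightarrow> (z x - z x)\<^sup>2" by (intro tendsto_intros)
      then show ?case by simp
    qed
    show "AE x in lebesgue_on V. norm ((z x - s i x)\<^sup>2) \<le> (w x)\<^sup>2" for i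
      using bound[of i] by eventually_elim (simp add: abs_le_square_iff)
  qed measurable
  then have "(\<lambda>i. sqrt (LINT x|lebesgue_on V. (z x - s i x)\<^sup>2)) \<longlonglongrightarrow> sqrt 0"
    by (intro tendsto_intros) simp
  then show ?thesis by (simp add: L2_norm_def)
qed

text \<open>By Lindelof the open set is a countable union of balls whose closures it contains. Each
  ball carries a bump, and a smooth saturating function of growing multiples of finite sums of bumps
  tends pointwise to the indicator, with values in [0, 1]; dominated convergence finishes.\<close>

lemma test_approximable_indicator_open:
  assumes V: "V \<in> lmeasurable" and U: "open U" "U \<subseteq> V"
  shows "test_approximable V (indicator U)"
proof (cases "U = {}")
  case True
  then have "(indicator U :: 'a \<Rightarrow> real) = (\<lambda>x. 0)" by auto
  then show ?thesis by (simp add: test_approximable_zero)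
next
  case False
  define \<F> where "\<F> = {ball x r |x r. r > 0 \<and> cball x r \<subseteq> U}"
  have "\<Union>\<F> = U"
  proof
    show "\<Union>\<F> \<subseteq> U" using ball_subset_cball by (fastforce simp: \<F>_def)
    show "U \<subseteq> \<Union>\<F>"
    proof
      fix x assume "x \<in> U"
      then obtain r where "r > 0" "cball x r \<subseteq> U" using U(1) open_contains_cball by blast
      then show "x \<in> \<Union>\<F>" unfolding \<F>_def by (intro UnionI[of "ball x r"]) auto
    qed
  qed
  moreover obtain \<F>' where \<F>': "\<F>' \<subseteq> \<F>" "countable \<F>'" "\<Union>\<F>' = \<Union>\<F>"
    using Lindelof[of \<F>] by (auto simp: \<F>_def)
  ultimately have ne: "\<F>' \<noteq> {}" and un: "\<Union>\<F>' = U" using False by auto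
  have "\<forall>m. \<exists>c r. r > 0 \<and> cball c r \<subseteq> U \<and> from_nat_into \<F>' m = ball c r"
    using from_nat_into[OF ne] \<F>'(1) unfolding \<F>_def by blast
  then obtain c r where cr: "\<And>m. r m > 0" "\<And>m. cball (c m) (r m) \<subseteq> U" "\<And>m. from_nat_into \<F>' m = ball (c m) (r m)"
    by metis
  have cover: "\<exists>m. x \<in> ball (c m) (r m)" if "x \<in> U" for x
    using that un from_nat_into_surj[OF \<F>'(2)] cr(3) by (metis Union_iff)
  \<comment> \<open>The factor \<open>real N\<close> drives the exponent to minus infinity wherever
    at least one bump is positive, while the restriction to \<open>m < N\<close> keeps the support
    inside finitely many closed balls.\<close>
  define \<phi> where "\<phi> N x = 1 - exp (- (real N * (\<Sum>m<N. bump (c m) (r m) x)))" for N x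
  have t: "test_function V (\<phi> N)" for N
    unfolding test_function_def
  proof (intro conjI exI[of _ "\<Union>m<N. cball (c m) (r m)"] allI impI)
    show "smooth_on (\<phi> N) UNIV"
      unfolding smooth_on_def
    proof
      fix k
      have "Ck_on k (\<lambda>x. real N * (\<Sum>m<N. bump (c m) (r m) x)) UNIV"
        using smooth_on_bump unfolding smooth_on_def by (intro Ck_on_mult Ck_on_const Ck_on_sum) auto
      then have "Ck_on k (\<lambda>x. (\<lambda>n s. (-1) ^ n * exp (- s)) 0 (real N * (\<Sum>m<N. bump (c m) (r m) x))) UNIV"
        by (rule Ck_on_compose[where h="\<lambda>n s. (-1) ^ n * exp (- s)", rotated])
           (auto intro!: derivative_eq_intros)
      then show "Ck_on k (\<phi> N) UNIV"
        unfolding \<phi>_def[abs_def] by (intro Ck_on_diff Ck_on_const) simp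
    qed
    show "compact (\<Union>m<N. cball (c m) (r m))" by (intro compact_UN) auto
    show "(\<Union>m<N. cball (c m) (r m)) \<subseteq> V" using cr(2) U(2) by blast
    fix x assume x: "x \<notin> (\<Union>m<N. cball (c m) (r m))"
    have "bump (c m) (r m) x = 0" if "m < N" for m
    proof (rule bump_eq_0[OF cr(1)])
      show "x \<notin> ball (c m) (r m)" using x that ball_subset_cball by blast
    qed
    then show "\<phi> N x = 0" by (simp add: \<phi>_def)
  qed
  have lim: "(\<lambda>N. \<phi> N x) \<longlonglongrightarrow> indicator U x" for x
  proof (cases "x \<in> U")
    case True
    then obtain m where m: "x \<in> ball (c m) (r m)" using cover by blast
    let ?b = "bump (c m) (r m) x"
    have b: "?b > 0" by (rule bump_pos[OF m])
    have l0: "(\<lambda>N. exp (- (real N * ?b))) \<longlonglongrightarrow> 0"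
    proof (rule filterlim_compose[OF exp_at_bot])
      show "filterlim (\<lambda>N. - (real N * ?b)) at_bot sequentially"
        unfolding filterlim_uminus_at_bot minus_minus
        using b by (intro filterlim_at_top_mult_tendsto_pos[OF tendsto_const] filterlim_real_sequentially)
    qed
    have "(\<lambda>N. exp (- (real N * (\<Sum>m<N. bump (c m) (r m) x)))) \<longlonglongrightarrow> 0"
    proof (rule tendsto_sandwich[OF _ _ tendsto_const l0])
      show "\<forall>\<^sub>F N in sequentially. exp (- (real N * (\<Sum>m<N. bump (c m) (r m) x))) \<le> exp (- (real N * ?b))"
        using eventually_gt_at_top[of m]
      proof eventually_elim
        case (elim N)
        have "?b \<le> (\<Sum>m<N. bump (c m) (r m) x)"
          using elim by (intro member_le_sum) (auto simp: bump_nonneg)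
        then show ?case by (simp add: mult_left_mono)
      qed
    qed simp
    then have "(\<lambda>N. \<phi> N x) \<longlonglongrightarrow> 1 - 0" unfolding \<phi>_def by (intro tendsto_intros)
    then show ?thesis using True by simp
  next
    case False
    have "bump (c m) (r m) x = 0" for m
    proof (rule bump_eq_0[OF cr(1)])
      show "x \<notin> ball (c m) (r m)" using False cr(2)[of m] ball_subset_cball by blast
    qed
    then show ?thesis using False by (simp add: \<phi>_def)
  qed
  have b01: "0 \<le> \<phi> N x" "\<phi> N x \<le> 1" for N x
    by (auto simp: \<phi>_def intro!: mult_nonneg_nonneg sum_nonneg bump_nonneg)
  have meas: "(indicator U :: 'a \<Rightarrow> real) \<in> borel_measurable (lebesgue_on V)"
    using U by (intro borel_measurable_indicator) (auto simp: sets_restrict_space intro!: image_eqI[of _ _ U])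
  have "(\<lambda>N. L2_norm V (\<lambda>x. indicator U x - \<phi> N x)) \<longlonglongrightarrow> 0"
  proof (rule L2_dominated_convergence[OF L2_const[OF V, of 1]])
    show "AE x in lebesgue_on V. \<bar>indicator U x - \<phi> N x\<bar> \<le> \<bar>1\<bar>" for N
    proof (intro AE_I2)
      fix x show "\<bar>indicator U x - \<phi> N x\<bar> \<le> \<bar>1\<bar>"
        using b01[of N x] by (auto simp: indicator_def)
    qed
  qed (use lim meas test_function_measurable_lebesgue[OF t] in auto)
  then have lim0: "\<forall>\<^sub>F N in sequentially. L2_norm V (\<lambda>x. indicator U x - \<phi> N x) < e" if "e > 0" for e
    using that order_tendstoD(2) by blast
  show ?thesis
    unfolding test_approximable_def
  proof (intro conjI allI impI)
    show "indicator U \<in> L2 V" by (rule L2_bounded[OF V meas, of 1]) (auto simp: indicator_def)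
    fix e :: real assume "e > 0"
    then obtain N where "L2_norm V (\<lambda>x. indicator U x - \<phi> N x) < e"
      using eventually_happens'[OF sequentially_bot lim0] by blast
    with t show "\<exists>\<phi>. test_function V \<phi> \<and> L2_norm V (\<lambda>x. indicator U x - \<phi> x) < e" by blast
  qed
qed

lemma test_approximable_indicator:
  assumes V: "V \<in> lmeasurable" "open V" and A: "A \<in> sets lebesgue" "A \<subseteq> V"
  shows "test_approximable V (indicator A)"
proof (rule test_approximable_limit[OF V(1)])
  have ind: "(indicator B :: 'a \<Rightarrow> real) \<in> L2 V" if "B \<in> sets lebesgue" "B \<subseteq> V" for B
    using that
    by (intro L2_bounded[OF V(1), where B=1] borel_measurable_indicator)
       (auto simp: indicator_def sets_restrict_space intro!: image_eqI[of _ _ B])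
  then show "indicator A \<in> L2 V" using A by blast
  fix e :: real assume e: "e > 0"
  \<comment> \<open>Outer regularity with tolerance \<open>e\<^sup>2\<close>, since the L2 norm of
    an indicator is the square root of the measure.\<close>
  obtain U where U: "open U" "A \<subseteq> U" "(U - A) \<in> lmeasurable" "emeasure lebesgue (U - A) < ennreal (e\<^sup>2)"
    using sets_lebesgue_outer_open[OF A(1), of "e\<^sup>2"] e by auto
  have UV: "U \<inter> V - A \<in> lmeasurable" "measure lebesgue (U \<inter> V - A) \<le> measure lebesgue (U - A)"
  proof -
    have s: "U \<inter> V - A \<in> sets lebesgue" using U V A by auto
    then show "U \<inter> V - A \<in> lmeasurable" by (rule fmeasurableI2[OF U(3), rotated]) auto
    show "measure lebesgue (U \<inter> V - A) \<le> measure lebesgue (U - A)"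
      by (rule measure_mono_fmeasurable) (use s U(3) in auto)
  qed
  have "measure lebesgue (U - A) < e\<^sup>2"
    using U(3,4) e by (simp add: emeasure_eq_measure2 ennreal_less_iff)
  with UV have less: "measure lebesgue (U \<inter> V - A) < e\<^sup>2" by linarith
  have "L2_norm V (\<lambda>x. indicator A x - indicator (U \<inter> V) x) = sqrt (LINT x|lebesgue_on V. indicator (U \<inter> V - A) x)"
    unfolding L2_norm_def using U(2) A(2)
    by (intro arg_cong[where f=sqrt] Bochner_Integration.integral_cong) (auto simp: indicator_def)
  also have "(LINT x|lebesgue_on V. indicator (U \<inter> V - A) x) = (LINT x|lebesgue. indicator (U \<inter> V - A) x :: real)"
    using V by (intro lebesgue_on_integral_eq) auto
  also have "\<dots> = measure lebesgue (U \<inter> V - A)" by simp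
  also have "sqrt \<dots> < e" using less e real_sqrt_less_mono by fastforce
  finally show "\<exists>w. test_approximable V w \<and> L2_norm V (\<lambda>x. indicator A x - w x) < e"
    using test_approximable_indicator_open[OF V(1), of "U \<inter> V"] U(1) V(2) by (intro exI[of _ "indicator (U \<inter> V)"]) auto
qed

theorem test_functions_dense_L2:
  assumes V: "V \<in> lmeasurable" "open V" and z: "z \<in> L2 V" and e: "e > 0"
  obtains \<phi> where "test_function V \<phi>" "L2_norm V (\<lambda>x. z x - \<phi> x) < e"
proof -
  let ?M = "lebesgue_on V"
  have zm: "z \<in> borel_measurable ?M" by (rule L2_measurable[OF z])
  from borel_measurable_implies_sequence_metric[OF zm, of 0] obtain s where
    s: "\<And>i. simple_function ?M (s i)" "\<And>x. x \<in> space ?M \<Longrightarrow> (\<lambda>i. s i x) \<longlonglongrightarrow> z x"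
    "\<And>i x. x \<in> space ?M \<Longrightarrow> \<bar>s i x\<bar> \<le> 2 * \<bar>z x\<bar>"
    by (simp add: dist_real_def) metis
  have sp: "space ?M = V" by simp
  have "test_approximable V z"
  proof (rule test_approximable_limit[OF V(1) z])
    fix e :: real assume e: "e > 0"
    have "(\<lambda>i. L2_norm V (\<lambda>x. z x - s i x)) \<longlonglongrightarrow> 0"
    \<comment> \<open>The simple functions satisfy
      \<open>\<bar>s i x\<bar> \<le> 2 * \<bar>z x\<bar>\<close>, hence the constant 3.\<close>
    proof (rule L2_dominated_convergence[OF L2_cmult[OF z, of 3]])
      show "AE x in ?M. \<bar>z x - s i x\<bar> \<le> \<bar>3 * z x\<bar>" for i
        using s(3)[of _ i] by (intro AE_I2) (smt (verit))
    qed (use s zm in \<open>auto intro: borel_measurable_simple_function\<close>)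
    then obtain i where i: "L2_norm V (\<lambda>x. z x - s i x) < e"
      using eventually_happens'[OF sequentially_bot order_tendstoD(2)[OF _ e]] by blast
    let ?R = "s i ` V"
    have fin: "finite ?R" using simple_functionD(1)[OF s(1)] by (simp add: sp)
    have pre: "s i -` {y} \<inter> V \<in> sets lebesgue" for y
    proof -
      have "s i -` {y} \<inter> space ?M \<in> sets ?M" by (rule simple_functionD(2)[OF s(1)])
      then show ?thesis using V by (simp add: sets_restrict_space_iff)
    qed
    have "test_approximable V (\<lambda>x. \<Sum>y\<in>?R. y * indicator (s i -` {y} \<inter> V) x)"
      using pre by (intro test_approximable_sum test_approximable_cmult test_approximable_indicator V) auto
    moreover have "L2_norm V (\<lambda>x. z x - (\<Sum>y\<in>?R. y * indicator (s i -` {y} \<inter> V) x)) = L2_norm V (\<lambda>x. z x - s i x)"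
      unfolding L2_norm_def
    proof (intro arg_cong[where f=sqrt] Bochner_Integration.integral_cong refl)
      fix x assume x: "x \<in> space ?M"
      have "(\<Sum>y\<in>?R. y * indicator (s i -` {y} \<inter> V) x) = (\<Sum>y\<in>?R. if y = s i x then y else 0)"
        using x by (intro sum.cong) (auto simp: indicator_def)
      also have "\<dots> = s i x" using x fin by simp
      finally show "(z x - (\<Sum>y\<in>?R. y * indicator (s i -` {y} \<inter> V) x))\<^sup>2 = (z x - s i x)\<^sup>2" by simp
    qed
    ultimately show "\<exists>w. test_approximable V w \<and> L2_norm V (\<lambda>x. z x - w x) < e"
      using i by (intro exI conjI) (assumption, simp)
  qed
  then show thesis using e that unfolding test_approximable_def by blast
qed

section \<open>Weak gradients\<close>

text \<open>Replacing one factor of \<open>L2_inner V h h\<close> by a nearby test function gives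
  that the squared norm is at most \<open>c\<close> times the norm, up to an arbitrarily small
  error; then divide.\<close>

lemma L2_norm_le_by_test_functions:
  assumes V: "V \<in> lmeasurable" "open V" and h: "h \<in> L2 V" and c: "c \<ge> 0"
    and dual: "\<And>\<phi>. test_function V \<phi> \<Longrightarrow> L2_inner V h \<phi> \<le> c * L2_norm V \<phi>"
  shows "L2_norm V h \<le> c"
proof -
  have "(L2_norm V h)\<^sup>2 - c * L2_norm V h \<le> 0"
  proof (rule field_le_epsilon)
    fix e :: real assume e: "e > 0"
    let ?e = "e / (L2_norm V h + c + 1)"
    have pos: "L2_norm V h + c + 1 > 0" using c by (simp add: add_nonneg_pos)
    then obtain \<phi> where \<phi>: "test_function V \<phi>" "L2_norm V (\<lambda>x. h x - \<phi> x) < ?e"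
      using test_functions_dense_L2[OF V h, of ?e] e by auto
    have \<phi>2: "\<phi> \<in> L2 V" by (rule test_function_L2[OF \<phi>(1) V(1)])
    have "(L2_norm V h)\<^sup>2 = L2_inner V h (\<lambda>x. h x - \<phi> x) + L2_inner V h \<phi>"
      using h \<phi>2 by (simp add: L2_norm_square L2_inner_diff_right)
    also have "\<dots> \<le> L2_norm V h * L2_norm V (\<lambda>x. h x - \<phi> x) + c * L2_norm V \<phi>"
      using L2_Cauchy_Schwarz[OF h L2_diff[OF h \<phi>2]] dual[OF \<phi>(1)] by (auto simp: abs_le_iff)
    also have "\<dots> \<le> L2_norm V h * ?e + c * (L2_norm V h + ?e)"
    proof (intro add_mono mult_left_mono)
      show "L2_norm V \<phi> \<le> L2_norm V h + ?e"
        using L2_norm_triangle_le[OF \<phi>2 h] \<phi>(2) L2_norm_diff_commute[of V h \<phi>] by simp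
    qed (use \<phi>(2) c in auto)
    also have "\<dots> = c * L2_norm V h + (L2_norm V h + c) * ?e" by (simp only: distrib_left distrib_right add_ac)
    also have "\<dots> \<le> c * L2_norm V h + e"
    proof -
      have "(L2_norm V h + c) * ?e \<le> (L2_norm V h + c + 1) * ?e" using e pos by (intro mult_right_mono) auto
      also have "\<dots> = e" using pos by simp
      finally show ?thesis by simp
    qed
    finally show "(L2_norm V h)\<^sup>2 - c * L2_norm V h \<le> 0 + e" by simp
  qed
  then have *: "L2_norm V h * L2_norm V h \<le> c * L2_norm V h" by (simp add: power2_eq_square)
  show ?thesis
  proof (cases "L2_norm V h = 0")
    case False
    then have "L2_norm V h > 0" using L2_norm_nonneg[of V h] by linarith
    with * show ?thesis by (rule mult_right_le_imp_le)
  qed (simp add: c)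
qed

lemma has_real_derivativeI:
  fixes f :: "real \<Rightarrow> real"
  assumes "\<And>e. e > 0 \<Longrightarrow> \<exists>d>0. \<forall>h. \<bar>h\<bar> < d \<longrightarrow> \<bar>f (s + h) - f s - h * D\<bar> \<le> e * \<bar>h\<bar>"
  shows "(f has_real_derivative D) (at s)"
  unfolding has_field_derivative_def has_derivative_at_alt
proof (intro conjI allI impI)
  show "bounded_linear (\<lambda>x. D * x)" by (rule bounded_linear_mult_right)
  fix e :: real assume "e > 0"
  then obtain d where "d > 0" "\<And>h. \<bar>h\<bar> < d \<Longrightarrow> \<bar>f (s + h) - f s - h * D\<bar> \<le> e * \<bar>h\<bar>" using assms by metis
  then show "\<exists>d>0. \<forall>y. norm (y - s) < d \<longrightarrow> norm (f y - f s - D * (y - s)) \<le> e * norm (y - s)"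
    by (intro exI[of _ d]) (metis add.commute diff_add_cancel mult.commute real_norm_def)
qed

text \<open>The shift acts on the smooth factor alone, so integrability of \<open>w\<close>
  suffices: the error of the difference quotient is at most a small multiple of
  \<open>\<bar>h\<bar>\<close> times the L1 norm of \<open>w\<close>.\<close>

lemma integral_translate_test_function_derivative:
  fixes w :: "'a::euclidean_space \<Rightarrow> real"
  assumes w: "integrable (lebesgue_on \<Omega>) w" and \<phi>: "test_function V \<phi>"
  shows "((\<lambda>s. LINT x|lebesgue_on \<Omega>. w x * \<phi> (x - s *\<^sub>R y)) has_real_derivative
      - (LINT x|lebesgue_on \<Omega>. w x * frechet_derivative \<phi> (at (x - s *\<^sub>R y)) y)) (at s)"
proof (rule has_real_derivativeI)
  let ?M = "lebesgue_on \<Omega>" and ?D = "\<lambda>x. frechet_derivative \<phi> (at x) y"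
  have int: "integrable ?M (\<lambda>x. w x * \<eta> (x - z))" if \<eta>: "test_function V \<eta>" for \<eta> z
  proof -
    obtain B where B: "\<And>x. \<bar>\<eta> x\<bar> \<le> B" using test_function_bounded[OF \<eta>] by metis
    have t: "test_function UNIV (\<lambda>x. \<eta> (x - z))" by (rule test_function_translate[OF \<eta>]) auto
    have "integrable ?M (\<lambda>x. \<eta> (x - z) * w x)"
    proof (rule Bochner_Integration.integrable_bound[OF integrable_mult_right[OF w, of B]])
      show "(\<lambda>x. \<eta> (x - z) * w x) \<in> borel_measurable ?M"
        using borel_measurable_integrable[OF w] test_function_measurable_lebesgue[OF t] by measurable
      show "AE x in ?M. norm (\<eta> (x - z) * w x) \<le> norm (B * w x)"
      proof (intro AE_I2)
        fix x show "norm (\<eta> (x - z) * w x) \<le> norm (B * w x)"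
          using B[of "x - z"] by (auto simp: abs_mult intro!: mult_right_mono)
      qed
    qed
    then show ?thesis by (simp add: mult.commute)
  qed
  fix e :: real assume e: "e > 0"
  let ?I = "LINT x|?M. \<bar>w x\<bar>"
  have I0: "?I + 1 > 0" by (simp add: add_nonneg_pos)
  have e': "e / (?I + 1) > 0" using e by (simp add: add_nonneg_pos)
  obtain d where d: "d > 0" "\<And>h x. \<bar>h\<bar> < d \<Longrightarrow> \<bar>\<phi> (x + h *\<^sub>R y) - \<phi> x - h * ?D x\<bar> \<le> e / (?I + 1) * \<bar>h\<bar>"
    using test_function_uniformly_differentiable[OF \<phi> e', of y] by metis
  show "\<exists>d>0. \<forall>h. \<bar>h\<bar> < d \<longrightarrow> \<bar>(LINT x|?M. w x * \<phi> (x - (s + h) *\<^sub>R y)) - (LINT x|?M. w x * \<phi> (x - s *\<^sub>R y))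
      - h * - (LINT x|?M. w x * ?D (x - s *\<^sub>R y))\<bar> \<le> e * \<bar>h\<bar>"
  proof (intro exI[of _ d] conjI allI impI d(1))
    fix h :: real assume h: "\<bar>h\<bar> < d"
    note i = int[OF \<phi>] int[OF test_function_partial[OF \<phi>, of y]]
    let ?r = "\<lambda>x. \<phi> (x - (s + h) *\<^sub>R y) - \<phi> (x - s *\<^sub>R y) + h * ?D (x - s *\<^sub>R y)"
    have ii: "integrable ?M (\<lambda>x. h * (w x * ?D (x - s *\<^sub>R y)))" by (intro integrable_mult_right i)
    have iii: "integrable ?M (\<lambda>x. w x * ?r x)"
      using Bochner_Integration.integrable_add[OF Bochner_Integration.integrable_diff[OF i(1)[of "(s + h) *\<^sub>R y"] i(1)[of "s *\<^sub>R y"]] ii]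
      by (simp add: algebra_simps)
    have eq: "(LINT x|?M. w x * \<phi> (x - (s + h) *\<^sub>R y)) - (LINT x|?M. w x * \<phi> (x - s *\<^sub>R y))
        - h * - (LINT x|?M. w x * ?D (x - s *\<^sub>R y))
        = (LINT x|?M. w x * \<phi> (x - (s + h) *\<^sub>R y) - w x * \<phi> (x - s *\<^sub>R y) + h * (w x * ?D (x - s *\<^sub>R y)))"
      using i ii by simp
    have eq': "\<dots> = (LINT x|?M. w x * ?r x)"
      by (intro Bochner_Integration.integral_cong refl) (simp only: distrib_left right_diff_distrib mult.left_commute)
    have "\<bar>(LINT x|?M. w x * ?r x)\<bar> \<le> (LINT x|?M. \<bar>w x * ?r x\<bar>)" by (rule integral_abs_bound)
    also have "\<dots> \<le> (LINT x|?M. e / (?I + 1) * \<bar>h\<bar> * \<bar>w x\<bar>)"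
    proof (rule integral_mono)
      fix x
      have "\<bar>?r x\<bar> \<le> e / (?I + 1) * \<bar>h\<bar>"
      proof -
        have "x - s *\<^sub>R y - h *\<^sub>R y = x - (s + h) *\<^sub>R y" by (simp add: scaleR_left_distrib)
        then have "\<phi> (x - s *\<^sub>R y - h *\<^sub>R y) = \<phi> (x - (s + h) *\<^sub>R y)" by (rule arg_cong)
        then show ?thesis using d(2)[of "-h" "x - s *\<^sub>R y"] h by simp
      qed
      then show "\<bar>w x * ?r x\<bar> \<le> e / (?I + 1) * \<bar>h\<bar> * \<bar>w x\<bar>"
        using mult_right_mono[OF _ abs_ge_zero[of "w x"]] by (simp only: abs_mult mult.commute[of "\<bar>w x\<bar>"])
    qed (use iii w in auto)
    also have "\<dots> = e * \<bar>h\<bar> * (?I / (?I + 1))" by simp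
    also have "\<dots> \<le> e * \<bar>h\<bar> * 1" using e I0 by (intro mult_left_mono) (auto simp: divide_le_eq_1)
    finally show "\<bar>(LINT x|?M. w x * \<phi> (x - (s + h) *\<^sub>R y)) - (LINT x|?M. w x * \<phi> (x - s *\<^sub>R y))
      - h * - (LINT x|?M. w x * ?D (x - s *\<^sub>R y))\<bar> \<le> e * \<bar>h\<bar>" unfolding eq eq' by simp
  qed
qed

text \<open>The integral of a translate does not depend on the shift. Differentiating in the shift
  at 0 gives the claim.\<close>

lemma integral_test_function_partial:
  assumes \<phi>: "test_function \<Omega> \<phi>" and \<Omega>: "\<Omega> \<in> sets lebesgue"
  shows "(LINT x|lebesgue_on \<Omega>. frechet_derivative \<phi> (at x) y) = 0"
proof -
  obtain K where K: "compact K" "\<And>x. x \<notin> K \<Longrightarrow> \<phi> x = 0" using test_functionE[OF \<phi>] by metis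
  obtain B where B: "B > 0" "\<And>x. x \<in> K \<Longrightarrow> norm x \<le> B"
    using compact_imp_bounded[OF K(1)] bounded_pos by metis
  \<comment> \<open>The previous lemma is applied with the weight 1, which has to be integrable. It
    is therefore restricted to a ball that contains the supports of all translates with
    \<open>\<bar>s\<bar> \<le> 1\<close>.\<close>
  let ?W = "cball 0 (B + norm y) :: 'a set"
  let ?J = "\<lambda>s. LINT x|lebesgue_on ?W. 1 * \<phi> (x - s *\<^sub>R y)"
  have t: "test_function \<Omega> (\<lambda>x. frechet_derivative \<phi> (at x) y)" by (rule test_function_partial[OF \<phi>])
  have W: "?W \<in> sets lebesgue" by simp
  have big: "x \<in> ?W" if "x - s *\<^sub>R y \<in> K" "\<bar>s\<bar> \<le> 1" for x s
  proof -
    have "norm x \<le> norm (x - s *\<^sub>R y) + norm (s *\<^sub>R y)" by (metis diff_add_cancel norm_triangle_ineq)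
    also have "\<dots> \<le> B + norm y" using B(2)[OF that(1)] that(2) by (intro add_mono) (auto intro: mult_left_le_one_le)
    finally show ?thesis by simp
  qed
  have const: "?J s = (LINT x|lebesgue. \<phi> x)" if "\<bar>s\<bar> \<le> 1" for s
  proof -
    have "?J s = (LINT x|lebesgue. \<phi> (x - s *\<^sub>R y))"
      using K(2) big that by (subst lebesgue_on_integral_eq(1)[OF W]) (fastforce, simp)
    also have "\<dots> = (LINT x|lebesgue. \<phi> x)"
      using lebesgue_integral_translate(1)[of \<phi> "- s *\<^sub>R y"] test_function_measurable[OF \<phi>]
      by (simp add: measurable_completion)
    finally show ?thesis .
  qed
  have i1: "integrable (lebesgue_on ?W) (\<lambda>x. 1::real)"
    by (intro finite_measure.integrable_const finite_measure_lebesgue_on) auto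
  have "(?J has_real_derivative - (LINT x|lebesgue_on ?W. 1 * frechet_derivative \<phi> (at (x - 0 *\<^sub>R y)) y)) (at 0)"
    by (rule integral_translate_test_function_derivative[OF i1 \<phi>])
  moreover have "(?J has_real_derivative 0) (at 0)"
  proof -
    have "((\<lambda>s. LINT x|lebesgue. \<phi> x) has_real_derivative 0) (at (0::real))" by simp
    then show ?thesis
      by (rule has_field_derivative_transform_within[where d=1]) (use const in \<open>auto simp: dist_real_def\<close>)
  qed
  ultimately have "(LINT x|lebesgue_on ?W. frechet_derivative \<phi> (at x) y) = 0"
    using DERIV_unique by fastforce
  moreover have "(LINT x|lebesgue_on ?W. frechet_derivative \<phi> (at x) y) = (LINT x|lebesgue. frechet_derivative \<phi> (at x) y)"
  proof (rule lebesgue_on_integral_eq(1)[OF W])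
    fix x assume "x \<notin> ?W"
    then have "x \<notin> K" using big[of x 0] by auto
    have "((\<lambda>x. 0) has_derivative (\<lambda>h. 0)) (at x)" by simp
    then have "(\<phi> has_derivative (\<lambda>h. 0)) (at x)"
      by (rule has_derivative_transform_within_open[where s="- K"])
         (use K \<open>x \<notin> K\<close> in \<open>auto simp: open_Compl compact_imp_closed\<close>)
    then have "frechet_derivative \<phi> (at x) = (\<lambda>h. 0)" by (rule frechet_derivative_at[symmetric])
    then show "frechet_derivative \<phi> (at x) y = 0" by simp
  qed
  ultimately show ?thesis
    using lebesgue_on_integral_eq(1)[OF \<Omega>, of "\<lambda>x. frechet_derivative \<phi> (at x) y"]
      test_function_zero_outside[OF t] by simp
qed

lemma L2_translate:
  fixes w :: "'a::euclidean_space \<Rightarrow> real"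
  assumes w: "w \<in> L2 \<Omega>" and \<Omega>: "\<Omega> \<in> sets lebesgue" and V: "V \<in> sets lebesgue"
    and sub: "\<And>x. x \<in> V \<Longrightarrow> x + y \<in> \<Omega>"
  shows "(\<lambda>x. w (x + y)) \<in> L2 V" and "L2_norm V (\<lambda>x. w (x + y)) \<le> L2_norm \<Omega> w"
proof -
  define W where "W x = indicator \<Omega> x * w x" for x
  have Wm: "W \<in> borel_measurable lebesgue"
    using L2_measurable[OF w] \<Omega> by (simp add: borel_measurable_restrict_space_iff W_def[abs_def])
  have W2: "integrable lebesgue (\<lambda>x. (W x)\<^sup>2)"
  proof -
    have "integrable lebesgue (\<lambda>x. indicator \<Omega> x *\<^sub>R (w x)\<^sup>2)"
      using L2_square_integrable[OF w] \<Omega> by (simp add: integrable_restrict_space)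
    moreover have "(\<lambda>x. indicator \<Omega> x *\<^sub>R (w x)\<^sup>2) = (\<lambda>x. (W x)\<^sup>2)" by (auto simp: W_def indicator_def)
    ultimately show ?thesis by simp
  qed
  have W2m: "(\<lambda>x. (W x)\<^sup>2) \<in> borel_measurable lebesgue" using Wm by measurable
  have Wy: "integrable lebesgue (\<lambda>x. (W (x + y))\<^sup>2)"
    using lebesgue_integral_translate(2)[OF W2m] W2 by simp
  have eq: "w (x + y) = W (x + y)" if "x \<in> V" for x using sub[OF that] by (simp add: W_def)
  have m: "(\<lambda>x. W (x + y)) \<in> borel_measurable (lebesgue_on V)"
    using measurable_compose[OF lebesgue_distr_translation(2) Wm] by (rule measurable_restrict_space1)
  have m': "(\<lambda>x. w (x + y)) \<in> borel_measurable (lebesgue_on V)"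
    using m by (subst measurable_cong[where g="\<lambda>x. W (x + y)"]) (auto simp: eq)
  have iV: "integrable (lebesgue_on V) (\<lambda>x. (W (x + y))\<^sup>2)"
    using Wy V integrable_mult_indicator[OF V Wy] by (simp add: integrable_restrict_space)
  have "integrable (lebesgue_on V) (\<lambda>x. (w (x + y))\<^sup>2)"
    using iV by (subst Bochner_Integration.integrable_cong[OF refl, where g="\<lambda>x. (W (x + y))\<^sup>2"]) (auto simp: eq)
  with m' show "(\<lambda>x. w (x + y)) \<in> L2 V" by (simp add: L2_def)
  have "(LINT x|lebesgue_on V. (w (x + y))\<^sup>2) = (LINT x|lebesgue_on V. (W (x + y))\<^sup>2)"
    by (intro Bochner_Integration.integral_cong) (auto simp: eq)
  also have "\<dots> = (LINT x|lebesgue. indicator V x *\<^sub>R (W (x + y))\<^sup>2)"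
    using V by (simp add: integral_restrict_space)
  also have "\<dots> \<le> (LINT x|lebesgue. (W (x + y))\<^sup>2)"
    by (rule integral_mono[OF integrable_mult_indicator[OF V Wy] Wy]) (auto simp: indicator_def)
  also have "\<dots> = (LINT x|lebesgue. (W x)\<^sup>2)" by (rule lebesgue_integral_translate(1)[OF W2m])
  also have "\<dots> = (LINT x|lebesgue. indicator \<Omega> x *\<^sub>R (w x)\<^sup>2)"
    by (intro Bochner_Integration.integral_cong) (auto simp: W_def indicator_def)
  also have "\<dots> = (LINT x|lebesgue_on \<Omega>. (w x)\<^sup>2)" using \<Omega> by (simp add: integral_restrict_space)
  finally show "L2_norm V (\<lambda>x. w (x + y)) \<le> L2_norm \<Omega> w" by (simp add: L2_norm_def)
qed

lemmas L2_restrict = L2_translate[where y=0, simplified]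

lemma L2_inner_translate:
  fixes w \<phi> :: "'a::euclidean_space \<Rightarrow> real"
  assumes w: "w \<in> borel_measurable (lebesgue_on \<Omega>)" and \<Omega>: "\<Omega> \<in> sets lebesgue" and V: "V \<in> sets lebesgue"
    and sub: "\<And>x. x \<in> V \<Longrightarrow> x + y \<in> \<Omega>"
    and \<phi>: "\<phi> \<in> borel_measurable lebesgue" "\<And>x. x \<notin> V \<Longrightarrow> \<phi> x = 0"
  shows "L2_inner V (\<lambda>x. w (x + y)) \<phi> = L2_inner \<Omega> w (\<lambda>x. \<phi> (x - y))"
proof -
  define W where "W x = indicator \<Omega> x * w x" for x
  have Wm: "W \<in> borel_measurable lebesgue"
    using w \<Omega> by (simp add: borel_measurable_restrict_space_iff W_def[abs_def])
  have \<phi>y: "(\<lambda>x. \<phi> (x - y)) \<in> borel_measurable lebesgue"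
    using measurable_compose[OF lebesgue_distr_translation(2)[of "-y"] \<phi>(1)] by simp
  have "L2_inner V (\<lambda>x. w (x + y)) \<phi> = (LINT x|lebesgue_on V. W (x + y) * \<phi> x)"
    unfolding L2_inner_def by (intro Bochner_Integration.integral_cong) (auto simp: W_def sub)
  also have "\<dots> = (LINT x|lebesgue. W (x + y) * \<phi> ((x + y) - y))"
    using \<phi>(2) by (subst lebesgue_on_integral_eq(1)[OF V]) auto
  also have "\<dots> = (LINT x|lebesgue. W x * \<phi> (x - y))"
    using Wm \<phi>y by (intro lebesgue_integral_translate(1)[of "\<lambda>x. W x * \<phi> (x - y)"]) measurable
  also have "\<dots> = (LINT x|lebesgue_on \<Omega>. W x * \<phi> (x - y))"
    by (rule lebesgue_on_integral_eq(1)[OF \<Omega>, symmetric]) (simp add: W_def)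
  also have "\<dots> = L2_inner \<Omega> w (\<lambda>x. \<phi> (x - y))"
    unfolding L2_inner_def by (intro Bochner_Integration.integral_cong) (auto simp: W_def)
  finally show ?thesis .
qed

lemma H1_gradientD:
  assumes "H1_gradient \<Omega> w G"
  shows "w \<in> L2 \<Omega>" "i \<in> Basis \<Longrightarrow> (\<lambda>x. G x \<bullet> i) \<in> L2 \<Omega>"
    "test_function \<Omega> \<phi> \<Longrightarrow> i \<in> Basis \<Longrightarrow>
      L2_inner \<Omega> w (\<lambda>x. frechet_derivative \<phi> (at x) i) = - L2_inner \<Omega> (\<lambda>x. G x \<bullet> i) \<phi>"
  using assms unfolding H1_gradient_def L2_inner_def by auto

lemma H1_gradient_inner_L2:
  assumes "H1_gradient \<Omega> w G"
  shows "(\<lambda>x. G x \<bullet> y) \<in> L2 \<Omega>"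
proof -
  have "(\<lambda>x. \<Sum>i\<in>Basis. (y \<bullet> i) * (G x \<bullet> i)) \<in> L2 \<Omega>"
    using H1_gradientD(2)[OF assms] by (intro L2_sum L2_cmult)
  moreover have "(\<Sum>i\<in>Basis. (y \<bullet> i) * (G x \<bullet> i)) = G x \<bullet> y" for x
    by (subst euclidean_inner[of "G x" y]) (simp add: mult.commute)
  ultimately show ?thesis by simp
qed

lemma H1_gradient_measurable:
  assumes "H1_gradient \<Omega> w G"
  shows "G \<in> borel_measurable (lebesgue_on \<Omega>)"
  by (subst borel_measurable_euclidean_space) (use H1_gradientD(2)[OF assms] L2_measurable in blast)

lemma H1_gradient_norm_L2:
  assumes "H1_gradient \<Omega> w G"
  shows "(\<lambda>x. norm (G x)) \<in> L2 \<Omega>"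
proof -
  have "integrable (lebesgue_on \<Omega>) (\<lambda>x. \<Sum>i\<in>Basis. (G x \<bullet> i)\<^sup>2)"
    using H1_gradientD(2)[OF assms] by (intro Bochner_Integration.integrable_sum L2_square_integrable)
  moreover have "(\<Sum>i\<in>Basis. (G x \<bullet> i)\<^sup>2) = (norm (G x))\<^sup>2" for x
    unfolding power2_norm_eq_inner by (subst euclidean_inner[of "G x"]) (simp add: power2_eq_square)
  ultimately show ?thesis
    using H1_gradient_measurable[OF assms] unfolding L2_def by auto
qed

lemma H1_gradient_directional:
  assumes H: "H1_gradient \<Omega> w G" and \<phi>: "test_function \<Omega> \<phi>" and \<Omega>: "\<Omega> \<in> lmeasurable"
  shows "L2_inner \<Omega> w (\<lambda>x. frechet_derivative \<phi> (at x) y) = - L2_inner \<Omega> (\<lambda>x. G x \<bullet> y) \<phi>"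
proof -
  have lin: "linear (frechet_derivative \<phi> (at x))" for x
    using test_function_has_derivative[OF \<phi>] has_derivative_linear by blast
  have e1: "frechet_derivative \<phi> (at x) y = (\<Sum>i\<in>Basis. (y \<bullet> i) * frechet_derivative \<phi> (at x) i)" for x
    by (subst euclidean_representation[of y, symmetric]) (simp add: linear_sum[OF lin] linear_scale[OF lin])
  have e2: "G x \<bullet> y = (\<Sum>i\<in>Basis. (y \<bullet> i) * (G x \<bullet> i))" for x
    by (subst euclidean_inner[of "G x" y]) (simp add: mult.commute)
  have i1: "integrable (lebesgue_on \<Omega>) (\<lambda>x. w x * frechet_derivative \<phi> (at x) i)" for i
    by (intro L2_mult_integrable H1_gradientD(1)[OF H] test_function_L2[OF test_function_partial[OF \<phi>] \<Omega>])
  have i2: "integrable (lebesgue_on \<Omega>) (\<lambda>x. (G x \<bullet> i) * \<phi> x)" if "i \<in> Basis" for i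
    by (intro L2_mult_integrable H1_gradientD(2)[OF H that] test_function_L2[OF \<phi> \<Omega>])
  have "L2_inner \<Omega> w (\<lambda>x. frechet_derivative \<phi> (at x) y)
      = (LINT x|lebesgue_on \<Omega>. (\<Sum>i\<in>Basis. (y \<bullet> i) * (w x * frechet_derivative \<phi> (at x) i)))"
    unfolding L2_inner_def e1 by (simp add: sum_distrib_left mult.left_commute)
  also have "\<dots> = (\<Sum>i\<in>Basis. (y \<bullet> i) * L2_inner \<Omega> w (\<lambda>x. frechet_derivative \<phi> (at x) i))"
    using i1 by (simp add: L2_inner_def)
  also have "\<dots> = (\<Sum>i\<in>Basis. - ((y \<bullet> i) * L2_inner \<Omega> (\<lambda>x. G x \<bullet> i) \<phi>))"
    using H1_gradientD(3)[OF H \<phi>] by (intro sum.cong) auto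
  also have "\<dots> = - (LINT x|lebesgue_on \<Omega>. (\<Sum>i\<in>Basis. (y \<bullet> i) * ((G x \<bullet> i) * \<phi> x)))"
    using i2 by (simp add: L2_inner_def sum_negf)
  also have "\<dots> = - L2_inner \<Omega> (\<lambda>x. G x \<bullet> y) \<phi>"
    unfolding L2_inner_def e2 by (simp add: sum_distrib_right mult.assoc)
  finally show ?thesis .
qed

text \<open>By duality the shift is moved onto a test function \<open>\<phi>\<close> on
  \<open>V\<close>. The pairing of \<open>w\<close> with the translates of \<open>\<phi>\<close> is
  differentiable in the shift, with derivative given by the weak gradient. The segment condition
  keeps every intermediate translate a test function of \<Omega>, which is where the geometry
  enters.\<close>

lemma H1_translation_estimate:
  assumes H: "H1_gradient \<Omega> w G" and \<Omega>: "\<Omega> \<in> lmeasurable" and V: "V \<in> lmeasurable" "open V"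
    and sub: "\<And>x s. x \<in> V \<Longrightarrow> 0 \<le> s \<Longrightarrow> s \<le> 1 \<Longrightarrow> x + s *\<^sub>R y \<in> \<Omega>"
  shows "L2_norm V (\<lambda>x. w (x + y) - w x) \<le> norm y * L2_norm \<Omega> (\<lambda>x. norm (G x))"
proof (rule L2_norm_le_by_test_functions[OF V])
  have sets: "\<Omega> \<in> sets lebesgue" "V \<in> sets lebesgue" using \<Omega> V by auto
  have V\<Omega>: "x \<in> \<Omega>" if "x \<in> V" for x using sub[OF that, of 0] by simp
  have Vy: "x + y \<in> \<Omega>" if "x \<in> V" for x using sub[OF that, of 1] by simp
  have wL: "w \<in> L2 \<Omega>" by (rule H1_gradientD(1)[OF H])
  have wV: "w \<in> L2 V" and wy: "(\<lambda>x. w (x + y)) \<in> L2 V"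
    using L2_restrict[OF wL sets] L2_translate[OF wL sets, of y] V\<Omega> Vy by auto
  then show "(\<lambda>x. w (x + y) - w x) \<in> L2 V" by (intro L2_diff)
  fix \<phi> assume \<phi>: "test_function V \<phi>"
  let ?J = "\<lambda>s. LINT x|lebesgue_on \<Omega>. w x * \<phi> (x - s *\<^sub>R y)"
  let ?J' = "\<lambda>s. L2_inner \<Omega> (\<lambda>x. G x \<bullet> y) (\<lambda>x. \<phi> (x - s *\<^sub>R y))"
  have ts: "test_function \<Omega> (\<lambda>x. \<phi> (x - s *\<^sub>R y))" if "0 \<le> s" "s \<le> 1" for s
    using test_function_translate[OF \<phi>] sub that by blast
  have der: "(?J has_real_derivative ?J' s) (at s)" if "0 \<le> s" "s \<le> 1" for s
    using integral_translate_test_function_derivative[OF L2_integrable[OF \<Omega> wL] \<phi>, of y s]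
      H1_gradient_directional[OF H ts[OF that] \<Omega>, of y]
    by (simp add: frechet_derivative_translate[OF \<phi>] L2_inner_def)
  \<comment> \<open>A single intermediate shift is enough, because the bound for the derivative is
    the same at all shifts.\<close>
  obtain s where s: "0 < s" "s < 1" "?J 1 - ?J 0 = (1 - 0) * ?J' s"
    using MVT2[of 0 1 ?J ?J'] der by auto
  have \<phi>m: "\<phi> \<in> borel_measurable lebesgue"
    using test_function_measurable[OF \<phi>] by (simp add: measurable_completion)
  have \<phi>V: "\<phi> \<in> L2 V" by (rule test_function_L2[OF \<phi> V(1)])
  have "L2_inner V (\<lambda>x. w (x + y) - w x) \<phi> = L2_inner V (\<lambda>x. w (x + y)) \<phi> - L2_inner V (\<lambda>x. w (x + 0)) \<phi>"
    using wV wy \<phi>V by (simp add: L2_inner_diff)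
  also have "\<dots> = L2_inner \<Omega> w (\<lambda>x. \<phi> (x - y)) - L2_inner \<Omega> w (\<lambda>x. \<phi> (x - 0))"
    using V\<Omega> Vy test_function_zero_outside[OF \<phi>]
    by (intro arg_cong2[where f="(-)"] L2_inner_translate[OF L2_measurable[OF wL] sets _ \<phi>m]) auto
  also have "\<dots> = ?J' s" using s(3) by (simp add: L2_inner_def)
  also have "\<dots> \<le> L2_norm \<Omega> (\<lambda>x. G x \<bullet> y) * L2_norm \<Omega> (\<lambda>x. \<phi> (x - s *\<^sub>R y))"
    using L2_Cauchy_Schwarz[OF H1_gradient_inner_L2[OF H] test_function_L2[OF ts \<Omega>]] s(1,2)
    by (meson abs_le_iff less_imp_le)
  also have "\<dots> \<le> (norm y * L2_norm \<Omega> (\<lambda>x. norm (G x))) * L2_norm V \<phi>"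
  proof (intro mult_mono)
    have "L2_norm \<Omega> (\<lambda>x. G x \<bullet> y) \<le> L2_norm \<Omega> (\<lambda>x. norm y * norm (G x))"
    proof (rule L2_norm_mono_AE[OF L2_cmult[OF H1_gradient_norm_L2[OF H]]])
      show "(\<lambda>x. G x \<bullet> y) \<in> borel_measurable (lebesgue_on \<Omega>)"
        by (rule L2_measurable[OF H1_gradient_inner_L2[OF H]])
      show "AE x in lebesgue_on \<Omega>. \<bar>G x \<bullet> y\<bar> \<le> \<bar>norm y * norm (G x)\<bar>"
        using Cauchy_Schwarz_ineq2[of _ y] by (intro AE_I2) (simp add: mult.commute[of "norm y"])
    qed
    then show "L2_norm \<Omega> (\<lambda>x. G x \<bullet> y) \<le> norm y * L2_norm \<Omega> (\<lambda>x. norm (G x))" by (simp add: L2_norm_cmult)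
    have "(LINT x|lebesgue_on \<Omega>. (\<phi> (x - s *\<^sub>R y))\<^sup>2) = (LINT x|lebesgue. (\<phi> (x - s *\<^sub>R y))\<^sup>2)"
      using s ts[of s] test_function_zero_outside by (intro lebesgue_on_integral_eq(1)[OF sets(1)]) fastforce
    also have "\<dots> = (LINT x|lebesgue. (\<phi> x)\<^sup>2)"
      using lebesgue_integral_translate(1)[of "\<lambda>x. (\<phi> x)\<^sup>2" "- (s *\<^sub>R y)"] \<phi>m by simp
    also have "\<dots> = (LINT x|lebesgue_on V. (\<phi> x)\<^sup>2)"
      using test_function_zero_outside[OF \<phi>] by (intro lebesgue_on_integral_eq(1)[OF sets(2), symmetric]) auto
    finally show "L2_norm \<Omega> (\<lambda>x. \<phi> (x - s *\<^sub>R y)) \<le> L2_norm V \<phi>" by (simp add: L2_norm_def)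
  qed auto
  finally show "L2_inner V (\<lambda>x. w (x + y) - w x) \<phi> \<le> norm y * L2_norm \<Omega> (\<lambda>x. norm (G x)) * L2_norm V \<phi>" .
qed simp

text \<open>For a test function this is the derivative of a translated pairing. The translation
  estimate bounds the difference quotients uniformly in \<open>h\<close>, so density carries the
  limit over to every \<open>\<zeta>\<close> in L2. The chain rule needs this generality, since it
  pairs with \<open>\<psi>' (w x) * \<phi> x\<close>, which is not smooth.\<close>

lemma H1_difference_quotient_weak:
  assumes H: "H1_gradient \<Omega> w G" and \<Omega>: "\<Omega> \<in> lmeasurable" and V: "V \<in> lmeasurable" "open V"
    and e: "e > 0" and sub: "\<And>x s. x \<in> V \<Longrightarrow> 0 \<le> s \<Longrightarrow> s \<le> e \<Longrightarrow> x + s *\<^sub>R i \<in> \<Omega>"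
    and \<zeta>: "\<zeta> \<in> L2 V" and i: "i \<in> Basis"
  shows "((\<lambda>h. L2_inner V (\<lambda>x. w (x + h *\<^sub>R i) - w x) \<zeta> / h) \<longlongrightarrow> L2_inner V (\<lambda>x. G x \<bullet> i) \<zeta>) (at_right 0)"
proof -
  have sets: "\<Omega> \<in> sets lebesgue" "V \<in> sets lebesgue" using \<Omega> V by auto
  have V\<Omega>: "x \<in> \<Omega>" if "x \<in> V" for x using sub[OF that, of 0] e by simp
  have wL: "w \<in> L2 \<Omega>" by (rule H1_gradientD(1)[OF H])
  have wV: "w \<in> L2 V" using L2_restrict[OF wL sets] V\<Omega> by auto
  have wh: "(\<lambda>x. w (x + h *\<^sub>R i)) \<in> L2 V" if "0 < h" "h < e" for h
    using L2_translate[OF wL sets, of "h *\<^sub>R i"] sub that by auto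
  have GV: "(\<lambda>x. G x \<bullet> i) \<in> L2 V"
    using L2_restrict[OF H1_gradientD(2)[OF H i] sets] V\<Omega> by auto
  define N where "N = L2_norm \<Omega> (\<lambda>x. norm (G x))"
  have N0: "N \<ge> 0" by (simp add: N_def)
  have bound: "L2_norm V (\<lambda>x. w (x + h *\<^sub>R i) - w x) \<le> h * N" if "0 < h" "h < e" for h
  proof -
    have "L2_norm V (\<lambda>x. w (x + h *\<^sub>R i) - w x) \<le> norm (h *\<^sub>R i) * N"
      unfolding N_def
    proof (rule H1_translation_estimate[OF H \<Omega> V])
      fix x and s :: real assume "x \<in> V" "0 \<le> s" "s \<le> 1"
      moreover from this have "s * h \<le> e" using that mult_right_mono[of s 1 h] by linarith
      ultimately show "x + s *\<^sub>R h *\<^sub>R i \<in> \<Omega>" using sub[of x "s * h"] that by simp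
    qed
    then show ?thesis using that i by simp
  qed
  let ?Q = "\<lambda>\<zeta> h. L2_inner V (\<lambda>x. w (x + h *\<^sub>R i) - w x) \<zeta> / h"
  have test: "(?Q \<phi> \<longlongrightarrow> L2_inner V (\<lambda>x. G x \<bullet> i) \<phi>) (at_right 0)" if \<phi>: "test_function V \<phi>" for \<phi>
  proof -
    let ?J = "\<lambda>s. LINT x|lebesgue_on \<Omega>. w x * \<phi> (x - s *\<^sub>R i)"
    have \<phi>\<Omega>: "test_function \<Omega> \<phi>" using test_function_mono[OF \<phi>] V\<Omega> by auto
    have \<phi>m: "\<phi> \<in> borel_measurable lebesgue"
      using test_function_measurable[OF \<phi>] by (simp add: measurable_completion)
    have \<phi>V: "\<phi> \<in> L2 V" by (rule test_function_L2[OF \<phi> V(1)])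
    have eq: "L2_inner V (\<lambda>x. G x \<bullet> i) \<phi> = L2_inner \<Omega> (\<lambda>x. G x \<bullet> i) \<phi>"
      using L2_inner_translate[OF L2_measurable[OF H1_gradientD(2)[OF H i]] sets _ \<phi>m, of 0]
        V\<Omega> test_function_zero_outside[OF \<phi>] by simp
    have "(?J has_real_derivative L2_inner V (\<lambda>x. G x \<bullet> i) \<phi>) (at 0)"
      unfolding eq using integral_translate_test_function_derivative[OF L2_integrable[OF \<Omega> wL] \<phi>, of i 0]
        H1_gradientD(3)[OF H \<phi>\<Omega> i] by (simp add: L2_inner_def)
    then have "((\<lambda>h. (?J h - ?J 0) / h) \<longlongrightarrow> L2_inner V (\<lambda>x. G x \<bullet> i) \<phi>) (at 0)"
      by (simp add: has_field_derivative_iff)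
    then have "((\<lambda>h. (?J h - ?J 0) / h) \<longlongrightarrow> L2_inner V (\<lambda>x. G x \<bullet> i) \<phi>) (at_right 0)"
      by (rule filterlim_mono[OF _ order_refl at_le]) simp
    moreover have "\<forall>\<^sub>F h in at_right 0. (?J h - ?J 0) / h = ?Q \<phi> h"
      using eventually_at_right_less[of 0] eventually_at_right_real[OF e]
    proof eventually_elim
      case (elim h)
      have "L2_inner V (\<lambda>x. w (x + h *\<^sub>R i) - w x) \<phi> = L2_inner V (\<lambda>x. w (x + h *\<^sub>R i)) \<phi> - L2_inner V (\<lambda>x. w (x + 0)) \<phi>"
        using wV wh[of h] \<phi>V elim by (simp add: L2_inner_diff)
      also have "\<dots> = L2_inner \<Omega> w (\<lambda>x. \<phi> (x - h *\<^sub>R i)) - L2_inner \<Omega> w (\<lambda>x. \<phi> (x - 0))"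
        using V\<Omega> sub elim test_function_zero_outside[OF \<phi>]
        by (intro arg_cong2[where f="(-)"] L2_inner_translate[OF L2_measurable[OF wL] sets _ \<phi>m]) auto
      finally show ?case by (simp add: L2_inner_def)
    qed
    ultimately show ?thesis by (rule Lim_transform_eventually)
  qed
  show ?thesis
  proof (rule tendstoI)
    fix \<epsilon> :: real assume \<epsilon>: "\<epsilon> > 0"
    \<comment> \<open>\<open>N\<close> pays for replacing \<open>\<zeta>\<close> by
      \<open>\<phi>\<close> in the quotient, the norm of the derivative pays for the replacement in
      the limit, and 1 keeps the sum positive.\<close>
    let ?K = "N + L2_norm V (\<lambda>x. G x \<bullet> i) + 1"
    have K: "?K > 0" using N0 by (simp add: add_nonneg_pos)
    then obtain \<phi> where \<phi>: "test_function V \<phi>" "L2_norm V (\<lambda>x. \<zeta> x - \<phi> x) < \<epsilon> / 2 / ?K"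
      using test_functions_dense_L2[OF V \<zeta>, of "\<epsilon> / 2 / ?K"] \<epsilon> by auto
    have \<phi>2: "\<phi> \<in> L2 V" by (rule test_function_L2[OF \<phi>(1) V(1)])
    let ?d = "\<lambda>x. \<zeta> x - \<phi> x"
    have d2: "?d \<in> L2 V" by (rule L2_diff[OF \<zeta> \<phi>2])
    have "\<forall>\<^sub>F h in at_right 0. dist (?Q \<phi> h) (L2_inner V (\<lambda>x. G x \<bullet> i) \<phi>) < \<epsilon> / 2"
      using tendstoD[OF test[OF \<phi>(1)], of "\<epsilon> / 2"] \<epsilon> by simp
    then show "\<forall>\<^sub>F h in at_right 0. dist (?Q \<zeta> h) (L2_inner V (\<lambda>x. G x \<bullet> i) \<zeta>) < \<epsilon>"
      using eventually_at_right_less[of 0] eventually_at_right_real[OF e]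
    proof eventually_elim
      case (elim h)
      let ?w = "\<lambda>x. w (x + h *\<^sub>R i) - w x"
      have w2: "?w \<in> L2 V" using L2_diff[OF wh wV] elim by auto
      have "\<bar>?Q ?d h\<bar> \<le> L2_norm V ?w * L2_norm V ?d / h"
        using L2_Cauchy_Schwarz[OF w2 d2] elim by (simp add: divide_right_mono)
      also have "\<dots> \<le> h * N * L2_norm V ?d / h"
        using bound[of h] elim by (intro divide_right_mono mult_right_mono) auto
      also have "\<dots> = N * L2_norm V ?d" using elim by simp
      finally have 1: "\<bar>?Q ?d h\<bar> \<le> N * L2_norm V ?d" .
      have 2: "\<bar>L2_inner V (\<lambda>x. G x \<bullet> i) ?d\<bar> \<le> L2_norm V (\<lambda>x. G x \<bullet> i) * L2_norm V ?d"
        by (rule L2_Cauchy_Schwarz[OF GV d2])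
      have "(N + L2_norm V (\<lambda>x. G x \<bullet> i)) * L2_norm V ?d \<le> ?K * L2_norm V ?d" by (intro mult_right_mono) auto
      also have "\<dots> < \<epsilon> / 2" using \<phi>(2) K by (simp only: pos_less_divide_eq mult.commute[of ?K])
      finally have 3: "N * L2_norm V ?d + L2_norm V (\<lambda>x. G x \<bullet> i) * L2_norm V ?d < \<epsilon> / 2"
        by (simp add: distrib_right)
      have "?Q \<zeta> h = ?Q \<phi> h + ?Q ?d h"
        using L2_inner_diff_right[OF \<zeta> \<phi>2 w2] by (simp add: diff_divide_distrib)
      moreover have "L2_inner V (\<lambda>x. G x \<bullet> i) \<zeta> = L2_inner V (\<lambda>x. G x \<bullet> i) \<phi> + L2_inner V (\<lambda>x. G x \<bullet> i) ?d"
        using L2_inner_diff_right[OF \<zeta> \<phi>2 GV] by simp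
      ultimately show ?case
        using elim(1) 1 2 3 unfolding dist_real_def by linarith
    qed
  qed
qed

text \<open>Difference quotients of \<open>\<psi> (w x)\<close> are compared with
  \<open>\<psi>' (w x)\<close> times those of \<open>w\<close>. The Taylor remainder is quadratic in
  the increment of \<open>w\<close>, whose L2 norm is of order \<open>h\<close>, so its integral is
  of order \<open>h\<^sup>2\<close> and disappears after division by \<open>h\<close>. No
  regularization of \<open>w\<close> is involved; the price is the quadratic remainder bound for
  \<open>\<psi>\<close>.\<close>

lemma H1_chain_rule:
  assumes H: "H1_gradient \<Omega> w G" and \<Omega>: "\<Omega> \<in> lmeasurable" "open \<Omega>"
    and lip: "\<And>a b. \<bar>\<psi> b - \<psi> a\<bar> \<le> B * \<bar>b - a\<bar>"
    and taylor: "\<And>a b. \<bar>\<psi> b - \<psi> a - \<psi>' a * (b - a)\<bar> \<le> C * (b - a)\<^sup>2"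
    and bd: "\<And>a. \<bar>\<psi>' a\<bar> \<le> B" and meas: "\<psi> \<in> borel_measurable borel" "\<psi>' \<in> borel_measurable borel"
  shows "H1_gradient \<Omega> (\<lambda>x. \<psi> (w x)) (\<lambda>x. \<psi>' (w x) *\<^sub>R G x)"
proof -
  have sO: "\<Omega> \<in> sets lebesgue" using \<Omega> by auto
  have wL: "w \<in> L2 \<Omega>" by (rule H1_gradientD(1)[OF H])
  note [measurable] = L2_measurable[OF wL] meas
  have \<psi>w: "(\<lambda>x. \<psi> (w x)) \<in> L2 \<Omega>"
  proof (rule L2_bounded_by[OF L2_add[OF L2_const[OF \<Omega>(1), of "\<bar>\<psi> 0\<bar>"] L2_cmult[OF L2_abs[OF wL], of B]]])
    show "(\<lambda>x. \<psi> (w x)) \<in> borel_measurable (lebesgue_on \<Omega>)" by measurable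
    show "AE x in lebesgue_on \<Omega>. \<bar>\<psi> (w x)\<bar> \<le> \<bar>\<bar>\<psi> 0\<bar> + B * \<bar>w x\<bar>\<bar>"
    proof (intro AE_I2)
      fix x show "\<bar>\<psi> (w x)\<bar> \<le> \<bar>\<bar>\<psi> 0\<bar> + B * \<bar>w x\<bar>\<bar>" using lip[of "w x" 0] by simp
    qed
  qed
  have \<psi>'m: "(\<lambda>x. \<psi>' (w x)) \<in> borel_measurable (lebesgue_on \<Omega>)" by measurable
  have G\<psi>: "(\<lambda>x. \<psi>' (w x) * (G x \<bullet> i)) \<in> L2 \<Omega>" if "i \<in> Basis" for i
    by (rule L2_mult_bounded[OF H1_gradientD(2)[OF H that] \<psi>'m, of B]) (simp add: bd)
  have "L2_inner \<Omega> (\<lambda>x. \<psi> (w x)) (\<lambda>x. frechet_derivative \<phi> (at x) i) = - L2_inner \<Omega> (\<lambda>x. \<psi>' (w x) * (G x \<bullet> i)) \<phi>"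
    if \<phi>: "test_function \<Omega> \<phi>" and i: "i \<in> Basis" for \<phi> i
  proof -
    obtain K where K: "compact K" "K \<subseteq> \<Omega>" "\<And>x. x \<notin> K \<Longrightarrow> \<phi> x = 0" using test_functionE[OF \<phi>] by metis
    obtain e where e: "e > 0" "(\<Union>x\<in>K. ball x e) \<subseteq> \<Omega>"
      using compact_subset_open_imp_ball_epsilon_subset[OF K(1) \<Omega>(2) K(2)] by metis
    \<comment> \<open>Points of \<open>V\<close> are within \<open>e / 2\<close> of the support, so
      shifts up to \<open>e / 4\<close> stay within distance \<open>e\<close> of it and hence in
      \<Omega>.\<close>
    define V where "V = (\<Union>x\<in>K. ball x (e / 2))"
    have Vo: "open V" unfolding V_def by auto
    have V\<Omega>: "V \<subseteq> \<Omega>" 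
    proof -
      have "ball x (e / 2) \<subseteq> ball x e" for x :: 'a using e(1) by (intro subset_ball) simp
      then show ?thesis using e(2) unfolding V_def by blast
    qed
    have Vl: "V \<in> lmeasurable" by (rule fmeasurableI2[OF \<Omega>(1) V\<Omega>]) (use Vo in auto)
    have KV: "K \<subseteq> V" unfolding V_def using e(1) by (auto intro!: bexI)
    have sV: "V \<in> sets lebesgue" using Vl by auto
    have sub: "x + s *\<^sub>R i \<in> \<Omega>" if "x \<in> V" "0 \<le> s" "s \<le> e / 4" for x s
    proof -
      obtain k where k: "k \<in> K" "dist k x < e / 2" using \<open>x \<in> V\<close> by (auto simp: V_def)
      have "dist k (x + s *\<^sub>R i) \<le> dist k x + dist x (x + s *\<^sub>R i)" by (rule dist_triangle)
      also have "dist x (x + s *\<^sub>R i) = s" using that i by (simp add: dist_norm)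
      finally have "x + s *\<^sub>R i \<in> ball k e" using k that e(1) by simp
      then show ?thesis using e(2) k(1) by blast
    qed
    have \<phi>V: "\<phi> x = 0" if "x \<notin> V" for x using K(3) KV that by blast
    have \<phi>m: "\<phi> \<in> borel_measurable lebesgue"
      using test_function_measurable[OF \<phi>] by (simp add: measurable_completion)
    have \<phi>2: "\<phi> \<in> L2 V" by (rule test_function_L2[OF \<phi> Vl])
    obtain P where P: "P > 0" "\<And>x. \<bar>\<phi> x\<bar> \<le> P" using test_function_bounded[OF \<phi>] by metis
    have wV: "w \<in> L2 V" and \<psi>wV: "(\<lambda>x. \<psi> (w x)) \<in> L2 V"
      using L2_restrict[OF _ sO sV] wL \<psi>w V\<Omega> by auto
    have [measurable]: "w \<in> borel_measurable (lebesgue_on V)" by (rule L2_measurable[OF wV])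
    have \<zeta>: "(\<lambda>x. \<psi>' (w x) * \<phi> x) \<in> L2 V"
      by (rule L2_mult_bounded[OF \<phi>2, of _ B]) (auto simp: bd)
    \<comment> \<open>The difference quotient of \<open>?J\<close> at 0 is evaluated twice: with the
      shift on \<open>\<phi>\<close> it yields the derivative of \<open>\<phi>\<close>
      (\<open>lim1\<close>), with the shift on \<open>w\<close> the candidate gradient
      (\<open>lim2\<close> and \<open>lim3\<close>). Equality of the limits is the weak
      identity.\<close>
    let ?J = "\<lambda>s. LINT x|lebesgue_on \<Omega>. \<psi> (w x) * \<phi> (x - s *\<^sub>R i)"
    let ?w = "\<lambda>h x. w (x + h *\<^sub>R i) - w x"
    let ?r = "\<lambda>h x. \<psi> (w (x + h *\<^sub>R i)) - \<psi> (w x) - \<psi>' (w x) * ?w h x"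
    define N where "N = L2_norm \<Omega> (\<lambda>x. norm (G x))"
    have lim1: "((\<lambda>h. (?J h - ?J 0) / h) \<longlongrightarrow> - L2_inner \<Omega> (\<lambda>x. \<psi> (w x)) (\<lambda>x. frechet_derivative \<phi> (at x) i)) (at_right 0)"
    proof -
      have "((\<lambda>h. (?J h - ?J 0) / h) \<longlongrightarrow> - L2_inner \<Omega> (\<lambda>x. \<psi> (w x)) (\<lambda>x. frechet_derivative \<phi> (at x) i)) (at 0)"
        using integral_translate_test_function_derivative[OF L2_integrable[OF \<Omega>(1) \<psi>w] \<phi>, of i 0]
        by (simp add: has_field_derivative_iff L2_inner_def)
      then show ?thesis by (rule filterlim_mono[OF _ order_refl at_le]) simp
    qed
    have lim2: "((\<lambda>h. L2_inner V (?w h) (\<lambda>x. \<psi>' (w x) * \<phi> x) / h) \<longlongrightarrow> L2_inner V (\<lambda>x. G x \<bullet> i) (\<lambda>x. \<psi>' (w x) * \<phi> x)) (at_right 0)"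
      by (rule H1_difference_quotient_weak[where e="e / 4", OF H \<Omega>(1) Vl Vo _ sub \<zeta> i]) (use e in auto)
    have split: "(?J h - ?J 0) / h = L2_inner V (?w h) (\<lambda>x. \<psi>' (w x) * \<phi> x) / h + L2_inner V (?r h) \<phi> / h"
      and rbound: "\<bar>L2_inner V (?r h) \<phi> / h\<bar> \<le> C * P * N\<^sup>2 * h" if h: "0 < h" "h < e / 4" for h
    proof -
      have wh: "(\<lambda>x. w (x + h *\<^sub>R i)) \<in> L2 V"
        using L2_translate[OF wL sO sV, of "h *\<^sub>R i"] sub h by auto
      have \<psi>wh: "(\<lambda>x. \<psi> (w (x + h *\<^sub>R i))) \<in> L2 V"
        using L2_translate[OF \<psi>w sO sV, of "h *\<^sub>R i"] sub h by auto
      have w2: "?w h \<in> L2 V" by (rule L2_diff[OF wh wV])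
      have p2: "(\<lambda>x. \<psi>' (w x) * ?w h x) \<in> L2 V"
        by (rule L2_mult_bounded[OF w2, of _ B]) (auto simp: bd)
      have d2: "(\<lambda>x. \<psi> (w (x + h *\<^sub>R i)) - \<psi> (w x)) \<in> L2 V" by (rule L2_diff[OF \<psi>wh \<psi>wV])
      have r2: "?r h \<in> L2 V" by (rule L2_diff[OF d2 p2])
      have "?J h - ?J 0 = L2_inner \<Omega> (\<lambda>x. \<psi> (w x)) (\<lambda>x. \<phi> (x - h *\<^sub>R i)) - L2_inner \<Omega> (\<lambda>x. \<psi> (w x)) (\<lambda>x. \<phi> (x - 0))"
        by (simp add: L2_inner_def)
      also have "\<dots> = L2_inner V (\<lambda>x. \<psi> (w (x + h *\<^sub>R i))) \<phi> - L2_inner V (\<lambda>x. \<psi> (w (x + 0))) \<phi>"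
        using V\<Omega> sub h \<phi>V
        by (intro arg_cong2[where f="(-)"] L2_inner_translate[OF L2_measurable[OF \<psi>w] sO sV _ \<phi>m, symmetric]) auto
      also have "\<dots> = L2_inner V (\<lambda>x. \<psi> (w (x + h *\<^sub>R i)) - \<psi> (w x)) \<phi>"
        by (simp add: L2_inner_diff[OF \<psi>wh \<psi>wV \<phi>2])
      also have "\<dots> = L2_inner V (\<lambda>x. \<psi>' (w x) * ?w h x) \<phi> + L2_inner V (?r h) \<phi>"
        using L2_inner_diff[OF d2 p2 \<phi>2] by simp
      also have "L2_inner V (\<lambda>x. \<psi>' (w x) * ?w h x) \<phi> = L2_inner V (?w h) (\<lambda>x. \<psi>' (w x) * \<phi> x)"
        by (simp add: L2_inner_def mult_ac)
      finally show "(?J h - ?J 0) / h = L2_inner V (?w h) (\<lambda>x. \<psi>' (w x) * \<phi> x) / h + L2_inner V (?r h) \<phi> / h"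
        by (simp add: add_divide_distrib)
      have "\<bar>L2_inner V (?r h) \<phi>\<bar> \<le> (LINT x|lebesgue_on V. \<bar>?r h x * \<phi> x\<bar>)"
        unfolding L2_inner_def by (rule integral_abs_bound)
      also have "\<dots> \<le> (LINT x|lebesgue_on V. C * P * (?w h x)\<^sup>2)"
      proof (rule integral_mono)
        show "integrable (lebesgue_on V) (\<lambda>x. \<bar>?r h x * \<phi> x\<bar>)" using L2_mult_integrable[OF r2 \<phi>2] by auto
        show "integrable (lebesgue_on V) (\<lambda>x. C * P * (?w h x)\<^sup>2)" using L2_square_integrable[OF w2] by auto
        fix x
        have "\<bar>?r h x\<bar> * \<bar>\<phi> x\<bar> \<le> C * (?w h x)\<^sup>2 * P"
          using taylor[of "w (x + h *\<^sub>R i)" "w x"] P(2)[of x]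
            order_trans[OF abs_ge_zero taylor[of "w (x + h *\<^sub>R i)" "w x"]] by (intro mult_mono) simp_all
        then show "\<bar>?r h x * \<phi> x\<bar> \<le> C * P * (?w h x)\<^sup>2" by (simp add: abs_mult mult_ac)
      qed
      also have "\<dots> = C * P * (L2_norm V (?w h))\<^sup>2" by (simp add: L2_norm_square_integral)
      also have "\<dots> \<le> C * P * (h * N)\<^sup>2"
      proof (intro mult_left_mono power_mono)
        have "L2_norm V (?w h) \<le> norm (h *\<^sub>R i) * N"
          unfolding N_def
        proof (rule H1_translation_estimate[OF H \<Omega>(1) Vl Vo])
          fix x and s :: real assume "x \<in> V" "0 \<le> s" "s \<le> 1"
          moreover from this have "s * h \<le> e / 4" using h mult_right_mono[of s 1 h] by linarith
          ultimately show "x + s *\<^sub>R h *\<^sub>R i \<in> \<Omega>" using sub[of x "s * h"] h by simp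
        qed
        then show "L2_norm V (?w h) \<le> h * N" using h i by simp
        show "0 \<le> C * P" using taylor[of 1 0] P(1) by (intro mult_nonneg_nonneg) (auto intro: order_trans[OF abs_ge_zero])
      qed simp
      finally have "\<bar>L2_inner V (?r h) \<phi>\<bar> / h \<le> C * P * (h * N)\<^sup>2 / h" using h by (intro divide_right_mono) auto
      also have "\<dots> = C * P * N\<^sup>2 * h" using h by (simp add: power2_eq_square)
      finally show "\<bar>L2_inner V (?r h) \<phi> / h\<bar> \<le> C * P * N\<^sup>2 * h" using h by simp
    qed
    have ev: "\<forall>\<^sub>F h in at_right 0. 0 < h \<and> h < e / 4"
      using eventually_at_right_real[of 0 "e/4"] e(1) by simp
    have lim3: "((\<lambda>h. L2_inner V (?r h) \<phi> / h) \<longlongrightarrow> 0) (at_right 0)"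
    proof (rule Lim_null_comparison)
      show "\<forall>\<^sub>F h in at_right 0. norm (L2_inner V (?r h) \<phi> / h) \<le> C * P * N\<^sup>2 * h"
        using ev by eventually_elim (use rbound in auto)
      show "((\<lambda>h. C * P * N\<^sup>2 * h) \<longlongrightarrow> 0) (at_right 0)" by (auto intro!: tendsto_eq_intros)
    qed
    have "((\<lambda>h. (?J h - ?J 0) / h) \<longlongrightarrow> L2_inner V (\<lambda>x. G x \<bullet> i) (\<lambda>x. \<psi>' (w x) * \<phi> x)) (at_right 0)"
    proof (rule Lim_transform_eventually)
      show "((\<lambda>h. L2_inner V (?w h) (\<lambda>x. \<psi>' (w x) * \<phi> x) / h + L2_inner V (?r h) \<phi> / h)
          \<longlongrightarrow> L2_inner V (\<lambda>x. G x \<bullet> i) (\<lambda>x. \<psi>' (w x) * \<phi> x)) (at_right 0)"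
        using tendsto_add[OF lim2 lim3] by simp
      show "\<forall>\<^sub>F h in at_right 0. L2_inner V (?w h) (\<lambda>x. \<psi>' (w x) * \<phi> x) / h + L2_inner V (?r h) \<phi> / h = (?J h - ?J 0) / h"
        using ev by eventually_elim (use split in auto)
    qed
    then have "- L2_inner \<Omega> (\<lambda>x. \<psi> (w x)) (\<lambda>x. frechet_derivative \<phi> (at x) i) = L2_inner V (\<lambda>x. G x \<bullet> i) (\<lambda>x. \<psi>' (w x) * \<phi> x)"
      using lim1 by (intro tendsto_unique[OF _ lim1]) auto
    also have "\<dots> = L2_inner V (\<lambda>x. \<psi>' (w x) * (G x \<bullet> i)) \<phi>" by (simp add: L2_inner_def mult_ac)
    also have "\<dots> = L2_inner \<Omega> (\<lambda>x. \<psi>' (w x) * (G x \<bullet> i)) \<phi>"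
      using L2_inner_translate[OF L2_measurable[OF G\<psi>[OF i]] sO sV _ \<phi>m, of 0] V\<Omega> \<phi>V by auto
    finally show ?thesis by simp
  qed
  then show ?thesis
    using \<psi>w G\<psi> by (auto simp: H1_gradient_def L2_inner_def)
qed

section \<open>Gradients and Laplacians of elementary functions\<close>

lemma H1_gradient_const:
  assumes \<Omega>: "\<Omega> \<in> lmeasurable"
  shows "H1_gradient \<Omega> (\<lambda>x. c) (\<lambda>x. 0)"
  using integral_test_function_partial[of \<Omega>] \<Omega> L2_const[OF \<Omega>, of c] L2_const[OF \<Omega>, of 0]
  by (auto simp: H1_gradient_def)

lemma H1_gradient_diff:
  assumes H: "H1_gradient \<Omega> w G" "H1_gradient \<Omega> w' G'" and \<Omega>: "\<Omega> \<in> lmeasurable"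
  shows "H1_gradient \<Omega> (\<lambda>x. w x - w' x) (\<lambda>x. G x - G' x)"
proof -
  have "L2_inner \<Omega> (\<lambda>x. w x - w' x) (\<lambda>x. frechet_derivative \<phi> (at x) i) = - L2_inner \<Omega> (\<lambda>x. (G x - G' x) \<bullet> i) \<phi>"
    if \<phi>: "test_function \<Omega> \<phi>" and i: "i \<in> Basis" for \<phi> i
    using H1_gradientD(1,2)[OF H(1)] H1_gradientD(1,2)[OF H(2)] i
      test_function_L2[OF \<phi> \<Omega>] test_function_L2[OF test_function_partial[OF \<phi>] \<Omega>]
      H1_gradientD(3)[OF H(1) \<phi> i] H1_gradientD(3)[OF H(2) \<phi> i]
    by (simp add: inner_diff_left L2_inner_diff)
  then show ?thesis
    using H1_gradientD(1,2)[OF H(1)] H1_gradientD(1,2)[OF H(2)]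
    by (auto simp: H1_gradient_def L2_inner_def inner_diff_left intro!: L2_diff)
qed

lemma neumann_laplacian_const:
  assumes \<Omega>: "\<Omega> \<in> lmeasurable"
  shows "neumann_laplacian \<Omega> (\<lambda>x. c) (\<lambda>x. 0)"
  unfolding neumann_laplacian_def
  using H1_gradient_const[OF \<Omega>] L2_const[OF \<Omega>, of 0] by (intro conjI exI[of _ "\<lambda>x. 0"]) auto

text \<open>Integration of the product rule for \<open>\<phi> x * \<eta> x\<close>, whose partial
  derivatives have integral 0.\<close>

lemma H1_gradient_test_function:
  assumes \<phi>: "test_function \<Omega> \<phi>" and \<Omega>: "\<Omega> \<in> lmeasurable"
  shows "H1_gradient \<Omega> \<phi> (\<lambda>x. \<Sum>i\<in>Basis. frechet_derivative \<phi> (at x) i *\<^sub>R i)"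
proof -
  have comp: "(\<Sum>j\<in>Basis. frechet_derivative \<phi> (at x) j *\<^sub>R j) \<bullet> i = frechet_derivative \<phi> (at x) i"
    if "i \<in> Basis" for i x
    using that by (simp add: inner_sum_left_Basis)
  have "L2_inner \<Omega> \<phi> (\<lambda>x. frechet_derivative \<eta> (at x) i) = - L2_inner \<Omega> (\<lambda>x. frechet_derivative \<phi> (at x) i) \<eta>"
    if \<eta>: "test_function \<Omega> \<eta>" for \<eta> i
  proof -
    have t: "test_function \<Omega> (\<lambda>x. \<phi> x * \<eta> x)"
      using test_function_mult[OF \<phi>] \<eta> by (simp add: test_function_def)
    have der: "((\<lambda>x. \<phi> x * \<eta> x) has_derivative (\<lambda>h. \<phi> x * frechet_derivative \<eta> (at x) h + frechet_derivative \<phi> (at x) h * \<eta> x)) (at x)" for x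
      by (rule has_derivative_mult[OF test_function_has_derivative[OF \<phi>] test_function_has_derivative[OF \<eta>]])
    have "frechet_derivative (\<lambda>x. \<phi> x * \<eta> x) (at x) i = \<phi> x * frechet_derivative \<eta> (at x) i + frechet_derivative \<phi> (at x) i * \<eta> x" for x
      by (subst frechet_derivative_at[OF der, symmetric]) (rule refl)
    then have "(LINT x|lebesgue_on \<Omega>. \<phi> x * frechet_derivative \<eta> (at x) i + frechet_derivative \<phi> (at x) i * \<eta> x) = 0"
      using integral_test_function_partial[OF t, of i] \<Omega> by auto
    moreover have "integrable (lebesgue_on \<Omega>) (\<lambda>x. \<phi> x * frechet_derivative \<eta> (at x) i)"
      "integrable (lebesgue_on \<Omega>) (\<lambda>x. frechet_derivative \<phi> (at x) i * \<eta> x)"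
      using \<phi> \<eta> \<Omega> by (auto intro!: L2_mult_integrable test_function_L2 test_function_partial)
    ultimately show ?thesis by (simp add: L2_inner_def)
  qed
  then show ?thesis
    using comp test_function_L2[OF \<phi> \<Omega>] test_function_L2[OF test_function_partial[OF \<phi>] \<Omega>]
    by (auto simp: H1_gradient_def L2_inner_def)
qed

text \<open>The partial derivatives of \<open>\<phi>\<close> are test functions themselves, so the
  weak gradient of an arbitrary \<open>z\<close> in H1 may be tested with them. Hence Green's
  formula holds without a boundary term, and the domain of the generator contains a dense
  set.\<close>

lemma neumann_laplacian_test_function:
  assumes \<phi>: "test_function \<Omega> \<phi>" and \<Omega>: "\<Omega> \<in> lmeasurable"
  shows "\<exists>h. neumann_laplacian \<Omega> \<phi> h"
proof -
  let ?D = "\<lambda>i x. frechet_derivative \<phi> (at x) i"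
  let ?h = "\<lambda>x. \<Sum>i\<in>Basis. frechet_derivative (?D i) (at x) i"
  have tD: "test_function \<Omega> (?D i)" for i by (rule test_function_partial[OF \<phi>])
  have tDD: "test_function \<Omega> (\<lambda>x. frechet_derivative (?D i) (at x) i)" for i by (rule test_function_partial[OF tD])
  have "(LINT x|lebesgue_on \<Omega>. (\<Sum>i\<in>Basis. ?D i x *\<^sub>R i) \<bullet> \<Phi> x) = - (LINT x|lebesgue_on \<Omega>. ?h x * z x)"
    if H: "H1_gradient \<Omega> z \<Phi>" for z \<Phi>
  proof -
    have i1: "integrable (lebesgue_on \<Omega>) (\<lambda>x. (\<Phi> x \<bullet> i) * ?D i x)" if "i \<in> Basis" for i
      by (intro L2_mult_integrable H1_gradientD(2)[OF H that] test_function_L2[OF tD \<Omega>])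
    have i2: "integrable (lebesgue_on \<Omega>) (\<lambda>x. z x * frechet_derivative (?D i) (at x) i)" for i
      by (intro L2_mult_integrable H1_gradientD(1)[OF H] test_function_L2[OF tDD \<Omega>])
    have "(LINT x|lebesgue_on \<Omega>. (\<Sum>i\<in>Basis. ?D i x *\<^sub>R i) \<bullet> \<Phi> x) = (LINT x|lebesgue_on \<Omega>. (\<Sum>i\<in>Basis. (\<Phi> x \<bullet> i) * ?D i x))"
    proof (intro Bochner_Integration.integral_cong refl)
      fix x show "(\<Sum>i\<in>Basis. ?D i x *\<^sub>R i) \<bullet> \<Phi> x = (\<Sum>i\<in>Basis. (\<Phi> x \<bullet> i) * ?D i x)"
        by (simp add: inner_sum_right inner_commute[of _ "\<Phi> x"] mult.commute)
    qed
    also have "\<dots> = (\<Sum>i\<in>Basis. L2_inner \<Omega> (\<lambda>x. \<Phi> x \<bullet> i) (?D i))"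
      using i1 by (simp add: L2_inner_def)
    also have "\<dots> = (\<Sum>i\<in>Basis. - L2_inner \<Omega> z (\<lambda>x. frechet_derivative (?D i) (at x) i))"
      using H1_gradientD(3)[OF H tD] by (intro sum.cong) auto
    also have "\<dots> = - (LINT x|lebesgue_on \<Omega>. (\<Sum>i\<in>Basis. z x * frechet_derivative (?D i) (at x) i))"
      using i2 by (simp add: L2_inner_def sum_negf)
    also have "\<dots> = - (LINT x|lebesgue_on \<Omega>. ?h x * z x)"
      by (simp add: sum_distrib_left[symmetric] mult.commute)
    finally show ?thesis .
  qed
  moreover have "?h \<in> L2 \<Omega>" by (intro L2_sum test_function_L2[OF tDD \<Omega>])
  ultimately have "neumann_laplacian \<Omega> \<phi> ?h"
    unfolding neumann_laplacian_def using H1_gradient_test_function[OF \<phi> \<Omega>]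
    by (intro conjI exI[of _ "\<lambda>x. \<Sum>i\<in>Basis. ?D i x *\<^sub>R i"] allI impI)
  then show ?thesis by (intro exI)
qed

section \<open>Geometry of smooth domains\<close>

text \<open>A uniform cone condition in which the cone at \<open>x\<close> is spanned by the ball \<open>x + ball p \<rho>\<close>.\<close>

definition star_patch :: "'a::euclidean_space set \<Rightarrow> 'a set \<Rightarrow> 'a \<Rightarrow> 'a \<Rightarrow> real \<Rightarrow> bool" where
  "star_patch \<Omega> V c p \<rho> \<longleftrightarrow> open V \<and> V \<noteq> {} \<and> \<rho> > 0 \<and> V \<subseteq> ball c (\<rho> / 2) \<and>
     (\<forall>x\<in>V. \<forall>y\<in>ball p \<rho>. \<forall>s. 0 \<le> s \<and> s \<le> 1 \<longrightarrow> x + s *\<^sub>R y \<in> \<Omega>)"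

text \<open>In the interior no direction is distinguished: \<open>p = 0\<close> serves, and
  \<open>d / 4 + d / 2 < d\<close> keeps the segments in the ball around \<open>q\<close>.\<close>

lemma star_patch_interior:
  assumes "open \<Omega>" "q \<in> \<Omega>"
  shows "\<exists>p \<rho>. star_patch \<Omega> (ball q (\<rho> / 2) \<inter> \<Omega>) q p \<rho>"
proof -
  obtain d where d: "d > 0" "ball q d \<subseteq> \<Omega>" using assms open_contains_ball by blast
  have "x + s *\<^sub>R y \<in> \<Omega>" if x: "x \<in> ball q (d / 4)" and y: "y \<in> ball 0 (d / 2)" and s: "0 \<le> s" "s \<le> 1" for x y s
  proof -
    have "norm (s *\<^sub>R y) \<le> norm y" using s by (simp add: mult_left_le_one_le)
    moreover have "dist q (x + s *\<^sub>R y) \<le> dist q x + norm (s *\<^sub>R y)"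
      using dist_triangle[of q "x + s *\<^sub>R y" x] by (simp add: dist_norm)
    ultimately have "dist q (x + s *\<^sub>R y) < d" using x y d(1) by simp
    then show ?thesis using d(2) by auto
  qed
  moreover have "q \<in> ball q (d / 4) \<inter> \<Omega>" using d(1) assms(2) by simp
  then have "ball q (d / 4) \<inter> \<Omega> \<noteq> {}" by blast
  ultimately have "star_patch \<Omega> (ball q ((d / 2) / 2) \<inter> \<Omega>) q 0 (d / 2)"
    using d(1) assms unfolding star_patch_def by auto
  then show ?thesis by blast
qed

text \<open>The vector \<open>p\<close> points along the negative gradient of the defining function
  at \<open>q\<close>. By continuity of the gradient, \<open>\<psi>\<close> decreases near
  \<open>q\<close> along every direction in a ball around \<open>p\<close>, so segments that start
  where \<open>\<psi> < 0\<close> stay there.\<close>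

lemma star_patch_frontier:
  fixes \<psi> :: "'a::euclidean_space \<Rightarrow> real"
  assumes U: "open U" "q \<in> U" and \<psi>: "Ck_on 1 \<psi> U" "\<not> (\<psi> has_derivative (\<lambda>h. 0)) (at q)"
    and \<Omega>: "open \<Omega>" "q \<in> closure \<Omega>" "\<Omega> \<inter> U = {x \<in> U. \<psi> x < 0}"
  shows "\<exists>p \<rho>. star_patch \<Omega> (ball q (\<rho> / 2) \<inter> \<Omega>) q p \<rho>"
proof -
  obtain G where G: "\<And>x. x \<in> U \<Longrightarrow> (\<psi> has_derivative (\<lambda>h. G x \<bullet> h)) (at x)"
    and "\<forall>i\<in>Basis. continuous_on U (\<lambda>x. G x \<bullet> i)" using \<psi>(1) by (auto simp: One_nat_def)
  then have Gc: "continuous_on U G" by (subst continuous_on_componentwise) blast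
  have "G q \<noteq> 0" using G[OF U(2)] \<psi>(2) by (metis (no_types, lifting) ext inner_zero_left)
  define a where "a = norm (G q)"
  have a: "a > 0" using \<open>G q \<noteq> 0\<close> by (simp add: a_def)
  obtain d1 where d1: "d1 > 0" "ball q d1 \<subseteq> U" using U open_contains_ball by blast
  obtain d2 where d2: "d2 > 0" "\<And>x. x \<in> U \<Longrightarrow> dist x q < d2 \<Longrightarrow> dist (G x) (G q) < a / 4"
    using Gc U(2) a unfolding continuous_on_iff by (metis zero_less_divide_iff zero_less_numeral)
  define d where "d = min d1 d2 / 2"
  have d: "d > 0" using d1 d2 by (simp add: d_def)
  have nearU: "x \<in> U" and nearG: "norm (G x - G q) \<le> a / 4" if "dist q x < 2 * d" for x
  proof -
    show "x \<in> U" using that d1(2) by (auto simp: d_def)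
    then show "norm (G x - G q) \<le> a / 4"
      using d2(2)[of x] that by (simp add: d_def dist_commute dist_norm norm_minus_commute)
  qed
  \<comment> \<open>Start points lie within \<open>\<tau> / 8\<close> of \<open>q\<close> and
    directions have length at most \<open>5 * \<tau> / 4\<close>; with \<open>\<tau> = d / 2\<close>
    all segments remain within \<open>2 * d\<close> of \<open>q\<close>, where the gradient is
    controlled.\<close>
  define \<tau> where "\<tau> = d / 2"
  have \<tau>: "\<tau> > 0" using d by (simp add: \<tau>_def)
  define p where "p = - (\<tau> / a) *\<^sub>R G q"
  have np: "norm p = \<tau>" using a \<tau> by (simp add: p_def a_def)
  have Gp: "G q \<bullet> p = - (a * \<tau>)"
    using a by (simp add: p_def a_def power2_norm_eq_inner[symmetric] power2_eq_square)
  \<comment> \<open>The main term is \<open>- (a * \<tau>)\<close>. Varying the direction costs at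
    most \<open>a * \<tau> / 4\<close>, varying the gradient at most
    \<open>5 * a * \<tau> / 16\<close>, and the sum of the losses is less than
    \<open>a * \<tau>\<close>.\<close>
  have neg: "G x \<bullet> y < 0" if x: "dist q x < 2 * d" and y: "y \<in> ball p (\<tau> / 4)" for x y
  proof -
    have yp: "norm (y - p) < \<tau> / 4" using y by (simp add: dist_norm norm_minus_commute)
    have ny: "norm y \<le> 5 * \<tau> / 4" using norm_triangle_ineq[of p "y - p"] yp np by simp
    have "G x \<bullet> y = G q \<bullet> p + G q \<bullet> (y - p) + (G x - G q) \<bullet> y"
      by (simp add: inner_diff_left inner_diff_right)
    also have "\<dots> \<le> - (a * \<tau>) + a * (\<tau> / 4) + a / 4 * (5 * \<tau> / 4)"
    proof (intro add_mono)
      have "G q \<bullet> (y - p) \<le> a * norm (y - p)" unfolding a_def by (rule norm_cauchy_schwarz)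
      also have "\<dots> \<le> a * (\<tau> / 4)" using a yp by (intro mult_left_mono) auto
      finally show "G q \<bullet> (y - p) \<le> a * (\<tau> / 4)" .
      have "(G x - G q) \<bullet> y \<le> norm (G x - G q) * norm y" by (rule norm_cauchy_schwarz)
      also have "\<dots> \<le> a / 4 * (5 * \<tau> / 4)" using nearG[OF x] ny a by (intro mult_mono) auto
      finally show "(G x - G q) \<bullet> y \<le> a / 4 * (5 * \<tau> / 4)" .
    qed (simp add: Gp)
    also have "\<dots> = - (7 / 16) * (a * \<tau>)" by (simp add: field_simps)
    also have "\<dots> < 0" using a \<tau> by simp
    finally show ?thesis .
  qed
  have "x + s *\<^sub>R y \<in> \<Omega>" if x: "x \<in> ball q (\<tau> / 4 / 2)" "x \<in> \<Omega>" and y: "y \<in> ball p (\<tau> / 4)" and s: "0 \<le> s" "s \<le> 1" for x y s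
  proof (cases "s = 0")
    case True
    then show ?thesis using x by simp
  next
    case False
    have ny: "norm y \<le> 5 * \<tau> / 4"
      using norm_triangle_ineq[of p "y - p"] y np by (simp add: dist_norm norm_minus_commute)
    have near: "dist q (x + t *\<^sub>R y) < 2 * d" if t: "0 \<le> t" "t \<le> s" for t
    proof -
      have "norm (t *\<^sub>R y) \<le> norm y" using t s by (simp add: mult_left_le_one_le)
      moreover have "dist q (x + t *\<^sub>R y) \<le> dist q x + norm (t *\<^sub>R y)"
        using dist_triangle[of q "x + t *\<^sub>R y" x] by (simp add: dist_norm)
      ultimately show ?thesis using x(1) ny \<tau> d by (simp add: \<tau>_def)
    qed
    have der: "((\<lambda>t. \<psi> (x + t *\<^sub>R y)) has_real_derivative G (x + t *\<^sub>R y) \<bullet> y) (at t)" if t: "0 \<le> t" "t \<le> s" for t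
    proof -
      have "((\<lambda>t. x + t *\<^sub>R y) has_derivative (\<lambda>r. r *\<^sub>R y)) (at t)" by (auto intro!: derivative_eq_intros)
      from has_derivative_compose[OF this G[OF nearU[OF near[OF t]]]]
      show ?thesis unfolding has_field_derivative_def by (rule has_derivative_eq_rhs) (simp add: fun_eq_iff mult.commute)
    qed
    obtain t where t: "0 < t" "t < s" "\<psi> (x + s *\<^sub>R y) - \<psi> (x + 0 *\<^sub>R y) = (s - 0) * (G (x + t *\<^sub>R y) \<bullet> y)"
      using MVT2[of 0 s "\<lambda>t. \<psi> (x + t *\<^sub>R y)" "\<lambda>t. G (x + t *\<^sub>R y) \<bullet> y"] der s False by auto
    have "s * (G (x + t *\<^sub>R y) \<bullet> y) < 0"
      using neg[OF near y, of t] t s False by (simp add: mult_pos_neg)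
    moreover have "\<psi> x < 0" using x(2) nearU[OF near[of 0]] s \<Omega>(3) by auto
    ultimately have "\<psi> (x + s *\<^sub>R y) < 0" using t(3) by simp
    then show ?thesis using nearU[OF near[of s]] s \<Omega>(3) by blast
  qed
  moreover have "ball q (\<tau> / 4 / 2) \<inter> \<Omega> \<noteq> {}"
    using \<Omega>(2) \<tau> unfolding closure_iff_nhds_not_empty
    by (metis Int_commute centre_in_ball divide_pos_pos open_ball order_refl zero_less_numeral)
  ultimately have "star_patch \<Omega> (ball q (\<tau> / 4 / 2) \<inter> \<Omega>) q p (\<tau> / 4)"
    using \<tau> \<Omega>(1) unfolding star_patch_def by auto
  then show ?thesis by blast
qed

text \<open>Interior and boundary patches have the same form, a ball around \<open>q\<close> cut
  with \<Omega>, so compactness of the closure treats both at once.\<close>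

lemma smooth_bounded_domain_cover:
  assumes "smooth_bounded_domain \<Omega>"
  obtains \<F> where "finite \<F>" "\<Union>\<F> = \<Omega>" "\<And>V. V \<in> \<F> \<Longrightarrow> \<exists>c p \<rho>. star_patch \<Omega> V c p \<rho>"
proof -
  have \<Omega>: "open \<Omega>" "bounded \<Omega>" using assms by (auto simp: smooth_bounded_domain_def)
  have "\<exists>p \<rho>. star_patch \<Omega> (ball q (\<rho> / 2) \<inter> \<Omega>) q p \<rho>" if q: "q \<in> closure \<Omega>" for q
  proof (cases "q \<in> \<Omega>")
    case True
    then show ?thesis using star_patch_interior \<Omega>(1) by blast
  next
    case False
    then have "q \<in> frontier \<Omega>" using q \<Omega>(1) by (simp add: frontier_def interior_open)
    then obtain U \<psi> where "open U" "q \<in> U" "smooth_on \<psi> U" "\<not> (\<psi> has_derivative (\<lambda>h. 0)) (at q)"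
      "\<Omega> \<inter> U = {x \<in> U. \<psi> x < 0}" using assms unfolding smooth_bounded_domain_def by blast
    then show ?thesis using star_patch_frontier[of U q \<psi> \<Omega>] \<Omega>(1) q by (simp add: smooth_on_def)
  qed
  then obtain p \<rho> where pr: "\<And>q. q \<in> closure \<Omega> \<Longrightarrow> star_patch \<Omega> (ball q (\<rho> q / 2) \<inter> \<Omega>) q (p q) (\<rho> q)"
    by metis
  have comp: "compact (closure \<Omega>)" using \<Omega>(2) by simp
  have cov: "closure \<Omega> \<subseteq> (\<Union>q\<in>closure \<Omega>. ball q (\<rho> q / 2))"
  proof
    fix q assume "q \<in> closure \<Omega>"
    then show "q \<in> (\<Union>q\<in>closure \<Omega>. ball q (\<rho> q / 2))"
      using pr[of q] by (intro UN_I[of q]) (auto simp: star_patch_def)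
  qed
  obtain C where C: "C \<subseteq> closure \<Omega>" "finite C" "closure \<Omega> \<subseteq> (\<Union>q\<in>C. ball q (\<rho> q / 2))"
    using compactE_image[OF comp _ cov] by auto
  show thesis
  proof (rule that[of "(\<lambda>q. ball q (\<rho> q / 2) \<inter> \<Omega>) ` C"])
    show "finite ((\<lambda>q. ball q (\<rho> q / 2) \<inter> \<Omega>) ` C)" using C(2) by simp
    show "\<Union>((\<lambda>q. ball q (\<rho> q / 2) \<inter> \<Omega>) ` C) = \<Omega>" using C(3) closure_subset[of \<Omega>] by blast
    fix V assume "V \<in> (\<lambda>q. ball q (\<rho> q / 2) \<inter> \<Omega>) ` C"
    then show "\<exists>c p \<rho>. star_patch \<Omega> V c p \<rho>" using pr C(1) by blast
  qed
qed

lemma star_patch_subset: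
  assumes "star_patch \<Omega> V c p \<rho>"
  shows "V \<subseteq> \<Omega>"
proof
  fix x assume "x \<in> V"
  moreover have "p \<in> ball p \<rho>" using assms by (simp add: star_patch_def)
  ultimately have "x + 0 *\<^sub>R p \<in> \<Omega>" using assms unfolding star_patch_def by (meson order_refl zero_le_one)
  then show "x \<in> \<Omega>" by simp
qed

section \<open>Nash and Poincare inequalities\<close>

text \<open>The averaging arguments below exchange integrals over products of \<open>lborel\<close>,
  where Borel measurability of the integrand is required. Changing \<open>w\<close> on a null set
  leaves its weak gradient untouched.\<close>

lemma H1_borel_representative:
  assumes H: "H1_gradient \<Omega> w G" and \<Omega>: "\<Omega> \<in> lmeasurable"
  obtains W where "W \<in> borel_measurable borel" "AE x in lebesgue_on \<Omega>. w x = W x" "H1_gradient \<Omega> W G"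
proof -
  have sO: "\<Omega> \<in> sets lebesgue" using \<Omega> by auto
  have wL: "w \<in> L2 \<Omega>" by (rule H1_gradientD(1)[OF H])
  have "(\<lambda>x. indicator \<Omega> x *\<^sub>R w x) \<in> borel_measurable (completion lborel)"
    using L2_measurable[OF wL] sO by (subst borel_measurable_restrict_space_iff[symmetric]) auto
  from completion_ex_borel_measurable_real[OF this] obtain W where
    W: "W \<in> borel_measurable lborel" "AE x in lborel. indicator \<Omega> x *\<^sub>R w x = W x" by auto
  have AE1: "AE x in lebesgue. indicator \<Omega> x *\<^sub>R w x = W x" using W(2) by (rule AE_completion)
  have AE: "AE x in lebesgue_on \<Omega>. w x = W x"
    using AE1 sO by (subst AE_restrict_space_iff) (auto elim!: eventually_mono)
  have Wm: "W \<in> borel_measurable (lebesgue_on \<Omega>)"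
    using W(1) by (intro measurable_restrict_space1 measurable_completion)
  have WL: "W \<in> L2 \<Omega>" by (rule L2_bounded_by[OF wL Wm]) (use AE in \<open>auto elim!: eventually_mono\<close>)
  have "L2_inner \<Omega> W (\<lambda>x. frechet_derivative \<phi> (at x) i) = L2_inner \<Omega> w (\<lambda>x. frechet_derivative \<phi> (at x) i)"
    if "test_function \<Omega> \<phi>" for \<phi> i
    using AE by (intro L2_inner_cong_AE WL wL test_function_L2[OF test_function_partial[OF that] \<Omega>]) (auto elim!: eventually_mono)
  then have "H1_gradient \<Omega> W G" using H WL by (auto simp: H1_gradient_def L2_inner_def)
  with W(1) AE show thesis by (intro that) auto
qed

text \<open>Substitution \<open>z = x + y\<close> for fixed \<open>x\<close>, then exchange of the
  integrals: pairs of points become points and displacements, to which the translation estimate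
  applies.\<close>

lemma nn_integral_shear:
  fixes h :: "'a::euclidean_space \<times> 'a \<Rightarrow> ennreal"
  assumes [measurable]: "h \<in> borel_measurable (lborel \<Otimes>\<^sub>M lborel)"
  shows "(\<integral>\<^sup>+x. \<integral>\<^sup>+z. h (x, z) \<partial>lborel \<partial>lborel) = (\<integral>\<^sup>+y. \<integral>\<^sup>+x. h (x, x + y) \<partial>lborel \<partial>lborel)"
proof -
  have "(\<integral>\<^sup>+z. h (x, z) \<partial>lborel) = (\<integral>\<^sup>+y. h (x, x + y) \<partial>lborel)" for x
  proof -
    have "(\<integral>\<^sup>+z. h (x, z) \<partial>lborel) = (\<integral>\<^sup>+z. h (x, z) \<partial>distr lborel borel ((+) x))"
      by (simp add: lborel_distr_plus)
    also have "\<dots> = (\<integral>\<^sup>+y. h (x, x + y) \<partial>lborel)" by (rule nn_integral_distr) measurable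
    finally show ?thesis .
  qed
  then have "(\<integral>\<^sup>+x. \<integral>\<^sup>+z. h (x, z) \<partial>lborel \<partial>lborel) = (\<integral>\<^sup>+x. \<integral>\<^sup>+y. h (x, x + y) \<partial>lborel \<partial>lborel)" by simp
  also have "\<dots> = (\<integral>\<^sup>+y. \<integral>\<^sup>+x. h (x, x + y) \<partial>lborel \<partial>lborel)"
    by (rule lborel_pair.Fubini'[symmetric]) measurable
  finally show ?thesis .
qed

lemma nn_integral_lborel_indicator:
  fixes F :: "'a::euclidean_space \<Rightarrow> real"
  assumes F[measurable]: "F \<in> borel_measurable borel" and V: "V \<in> sets borel"
    and int: "integrable (lebesgue_on V) F" and nn: "\<And>x. 0 \<le> F x"
  shows "(\<integral>\<^sup>+x. indicator V x * ennreal (F x) \<partial>lborel) = ennreal (LINT x|lebesgue_on V. F x)"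
proof -
  have "(\<integral>\<^sup>+x. indicator V x * ennreal (F x) \<partial>lborel) = (\<integral>\<^sup>+x. ennreal (F x) * indicator V x \<partial>lebesgue)"
    using V by (subst nn_integral_completion) (simp_all add: mult.commute)
  also have "\<dots> = (\<integral>\<^sup>+x. ennreal (F x) \<partial>lebesgue_on V)"
    using V by (subst nn_integral_restrict_space) auto
  also have "\<dots> = ennreal (LINT x|lebesgue_on V. F x)"
    using int nn by (intro nn_integral_eq_integral) auto
  finally show ?thesis .
qed

lemma emeasure_lborel_eq:
  fixes B :: "'a::euclidean_space set"
  assumes "B \<in> sets borel" "B \<in> lmeasurable"
  shows "emeasure lborel B = ennreal (measure lebesgue B)"
  using emeasure_eq_measure2[OF assms(2)] assms(1) by simp

text \<open>The average over displacements \<open>y\<close> in the scaled ball of the integral of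
  \<open>\<bar>W x\<bar> * \<bar>W (x + y)\<bar>\<close> is at most the squared L1 norm divided by
  the volume of the ball, so some displacement does no worse. For it, replacing \<open>W x\<close>
  by \<open>W (x + y)\<close> in one factor of the squared norm costs at most \<open>norm y\<close>
  times the norm of the gradient, and \<open>norm y\<close> is of order \<open>r\<close>.\<close>

lemma Nash_inequality_patch:
  fixes W :: "'a::euclidean_space \<Rightarrow> real"
  assumes H: "H1_gradient \<Omega> W G" and W[measurable]: "W \<in> borel_measurable borel"
    and \<Omega>: "\<Omega> \<in> lmeasurable" "open \<Omega>" and patch: "star_patch \<Omega> V c p \<rho>" and r: "0 < r" "r \<le> 1"
  shows "(L2_norm V W)\<^sup>2 \<le> 2 / measure lebesgue (ball (r *\<^sub>R p) (r * \<rho>)) * (LINT x|lebesgue_on \<Omega>. \<bar>W x\<bar>)\<^sup>2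
     + r\<^sup>2 * (norm p + \<rho>)\<^sup>2 * (L2_norm \<Omega> (\<lambda>x. norm (G x)))\<^sup>2"
proof -
  define B where "B = ball (r *\<^sub>R p) (r * \<rho>)"
  define m where "m = measure lebesgue B"
  define I where "I = (LINT x|lebesgue_on \<Omega>. \<bar>W x\<bar>)"
  define N where "N = L2_norm \<Omega> (\<lambda>x. norm (G x))"
  have V: "open V" "\<rho> > 0" using patch by (auto simp: star_patch_def)
  have V\<Omega>: "V \<subseteq> \<Omega>" by (rule star_patch_subset[OF patch])
  have Vl: "V \<in> lmeasurable" by (rule fmeasurableI2[OF \<Omega>(1) V\<Omega>]) (use V in auto)
  have sets: "\<Omega> \<in> sets lebesgue" "V \<in> sets lebesgue" using \<Omega> Vl by auto
  have [measurable]: "V \<in> sets borel" "\<Omega> \<in> sets borel" "B \<in> sets borel" using V \<Omega> by (auto simp: B_def)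
  have eB: "emeasure lborel B = ennreal m"
    unfolding m_def by (rule emeasure_lborel_eq) (simp_all add: B_def)
  have m: "m > 0"
    using V(2) r content_ball_pos[of "r * \<rho>" "r *\<^sub>R p"] by (simp add: m_def B_def)
  have star: "x + s *\<^sub>R y \<in> \<Omega>" if "x \<in> V" "y \<in> B" "0 \<le> s" "s \<le> 1" for x y s
  proof -
    have "y /\<^sub>R r \<in> ball p \<rho>"
    proof -
      have "r *\<^sub>R p - y = r *\<^sub>R (p - y /\<^sub>R r)" using r(1) by (simp add: scaleR_diff_right)
      then have "norm (r *\<^sub>R p - y) = r * norm (p - y /\<^sub>R r)" using r(1) by simp
      then show ?thesis using \<open>y \<in> B\<close> r(1) by (simp add: B_def dist_norm)
    qed
    moreover have "0 \<le> s * r \<and> s * r \<le> 1" using that r by (simp add: mult_le_one)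
    ultimately have "x + (s * r) *\<^sub>R (y /\<^sub>R r) \<in> \<Omega>"
      using patch \<open>x \<in> V\<close> unfolding star_patch_def by blast
    moreover have "(s * r) *\<^sub>R (y /\<^sub>R r) = s *\<^sub>R y" using r by (simp add: field_simps)
    ultimately show ?thesis by (simp only:)
  qed
  have ny: "norm y \<le> r * (norm p + \<rho>)" if "y \<in> B" for y
  proof -
    have "norm y \<le> norm (r *\<^sub>R p) + norm (y - r *\<^sub>R p)" using norm_triangle_ineq[of "r *\<^sub>R p" "y - r *\<^sub>R p"] by simp
    also have "\<dots> \<le> r * norm p + r * \<rho>" using that r by (simp add: B_def dist_norm norm_minus_commute)
    finally show ?thesis by (simp add: distrib_left)
  qed
  have WL: "W \<in> L2 \<Omega>" by (rule H1_gradientD(1)[OF H])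
  have WV: "W \<in> L2 V" using L2_restrict[OF WL sets] V\<Omega> by auto
  have Wy: "(\<lambda>x. W (x + y)) \<in> L2 V" if "y \<in> B" for y
    using L2_translate[OF WL sets, of y] star[OF _ that, of _ 1] by auto
  have I0: "I \<ge> 0" by (simp add: I_def)
  have main: "(L2_norm V W)\<^sup>2 \<le> 2 / m * (I\<^sup>2 + \<delta>) + r\<^sup>2 * (norm p + \<rho>)\<^sup>2 * N\<^sup>2" if \<delta>: "\<delta> > 0" for \<delta>
  proof -
    \<comment> \<open>The positive \<open>\<delta>\<close> leaves room for the contradiction:
      integrating strict inequalities yields only \<open>K * m \<le> I * I\<close>, which
      \<open>K * m = I\<^sup>2 + \<delta>\<close> excludes.\<close>
    define K where "K = (I\<^sup>2 + \<delta>) / m"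
    have K0: "K > 0" using m \<delta> by (simp add: K_def add_nonneg_pos)
    have "\<exists>y\<in>B. (LINT x|lebesgue_on V. \<bar>W x\<bar> * \<bar>W (x + y)\<bar>) \<le> K"
    proof (rule ccontr)
      assume "\<not> ?thesis"
      then have big: "(LINT x|lebesgue_on V. \<bar>W x\<bar> * \<bar>W (x + y)\<bar>) > K" if "y \<in> B" for y using that by force
      let ?h = "\<lambda>(x, z). indicator V x * indicator \<Omega> z * (ennreal \<bar>W x\<bar> * ennreal \<bar>W z\<bar>) * indicator B (z - x)"
      have "ennreal (K * m) = (\<integral>\<^sup>+y. ennreal K * indicator B y \<partial>lborel)"
        using K0 m by (simp add: nn_integral_cmult_indicator eB ennreal_mult)
      also have "\<dots> \<le> (\<integral>\<^sup>+y. \<integral>\<^sup>+x. ?h (x, x + y) \<partial>lborel \<partial>lborel)"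
      proof (rule nn_integral_mono)
        fix y :: 'a
        show "ennreal K * indicator B y \<le> (\<integral>\<^sup>+x. ?h (x, x + y) \<partial>lborel)"
        proof (cases "y \<in> B")
          case True
          have "ennreal K \<le> ennreal (LINT x|lebesgue_on V. \<bar>W x\<bar> * \<bar>W (x + y)\<bar>)"
            using big[OF True] by (intro ennreal_leI) simp
          also have "\<dots> = (\<integral>\<^sup>+x. indicator V x * ennreal (\<bar>W x\<bar> * \<bar>W (x + y)\<bar>) \<partial>lborel)"
            by (rule nn_integral_lborel_indicator[symmetric])
               (auto intro!: L2_mult_integrable L2_abs WV Wy True)
          also have "\<dots> = (\<integral>\<^sup>+x. ?h (x, x + y) \<partial>lborel)"
            using True star[OF _ True, of _ 1]
            by (intro nn_integral_cong) (auto simp: indicator_def ennreal_mult)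
          finally show ?thesis using True by simp
        qed simp
      qed
      also have "\<dots> = (\<integral>\<^sup>+x. \<integral>\<^sup>+z. ?h (x, z) \<partial>lborel \<partial>lborel)"
        by (rule nn_integral_shear[symmetric]) measurable
      also have "\<dots> \<le> (\<integral>\<^sup>+x. (indicator \<Omega> x * ennreal \<bar>W x\<bar>) * (\<integral>\<^sup>+z. indicator \<Omega> z * ennreal \<bar>W z\<bar> \<partial>lborel) \<partial>lborel)"
      proof (rule nn_integral_mono)
        fix x
        have "(\<integral>\<^sup>+z. ?h (x, z) \<partial>lborel) \<le> (\<integral>\<^sup>+z. (indicator \<Omega> x * ennreal \<bar>W x\<bar>) * (indicator \<Omega> z * ennreal \<bar>W z\<bar>) \<partial>lborel)"
          using V\<Omega> by (intro nn_integral_mono) (auto simp: indicator_def)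
        then show "(\<integral>\<^sup>+z. ?h (x, z) \<partial>lborel) \<le> (indicator \<Omega> x * ennreal \<bar>W x\<bar>) * (\<integral>\<^sup>+z. indicator \<Omega> z * ennreal \<bar>W z\<bar> \<partial>lborel)"
          by (subst (asm) nn_integral_cmult) auto
      qed
      also have "\<dots> = (\<integral>\<^sup>+z. indicator \<Omega> z * ennreal \<bar>W z\<bar> \<partial>lborel) * (\<integral>\<^sup>+z. indicator \<Omega> z * ennreal \<bar>W z\<bar> \<partial>lborel)"
        by (rule nn_integral_multc) measurable
      also have "(\<integral>\<^sup>+z. indicator \<Omega> z * ennreal \<bar>W z\<bar> \<partial>lborel) = ennreal I"
        unfolding I_def using L2_integrable[OF \<Omega>(1) L2_abs[OF WL]]
        by (intro nn_integral_lborel_indicator) auto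
      finally have "ennreal (K * m) \<le> ennreal (I * I)" using I0 by (simp add: ennreal_mult)
      then have "K * m \<le> I * I" using I0 by (simp add: ennreal_le_iff)
      then show False using m \<delta> by (simp add: K_def power2_eq_square)
    qed
    then obtain y where y: "y \<in> B" "(LINT x|lebesgue_on V. \<bar>W x\<bar> * \<bar>W (x + y)\<bar>) \<le> K" by blast
    let ?n = "L2_norm V W" and ?t = "L2_norm V (\<lambda>x. W (x + y) - W x)"
    have "?t \<le> norm y * N" unfolding N_def
      by (rule H1_translation_estimate[OF H \<Omega>(1) Vl V(1)]) (use star[OF _ y(1)] in auto)
    also have "\<dots> \<le> r * (norm p + \<rho>) * N" using ny[OF y(1)] by (intro mult_right_mono) (auto simp: N_def)
    finally have t: "?t \<le> r * (norm p + \<rho>) * N" .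
    have "?n\<^sup>2 = L2_inner V W (\<lambda>x. W (x + y)) - L2_inner V W (\<lambda>x. W (x + y) - W x)"
      using L2_inner_diff_right[OF Wy[OF y(1)] WV WV] by (simp add: L2_norm_square)
    also have "\<dots> \<le> K + ?n * ?t"
    proof -
      have "L2_inner V W (\<lambda>x. W (x + y)) \<le> (LINT x|lebesgue_on V. \<bar>W x\<bar> * \<bar>W (x + y)\<bar>)"
        unfolding L2_inner_def
        by (rule integral_mono[OF L2_mult_integrable[OF WV Wy[OF y(1)]] L2_mult_integrable[OF L2_abs[OF WV] L2_abs[OF Wy[OF y(1)]]]])
           (simp flip: abs_mult)
      moreover have "\<bar>L2_inner V W (\<lambda>x. W (x + y) - W x)\<bar> \<le> ?n * ?t"
        by (rule L2_Cauchy_Schwarz[OF WV L2_diff[OF Wy[OF y(1)] WV]])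
      ultimately show ?thesis using y(2) by linarith
    qed
    \<comment> \<open>Half of the squared norm is absorbed into the left-hand side.\<close>
    also have "?n * ?t \<le> ?n\<^sup>2 / 2 + ?t\<^sup>2 / 2"
      using sum_squares_bound[of ?n ?t] by simp
    finally have "?n\<^sup>2 \<le> 2 * K + ?t\<^sup>2" by simp
    also have "?t\<^sup>2 \<le> (r * (norm p + \<rho>) * N)\<^sup>2" using t by (rule power_mono) simp
    finally show ?thesis by (simp add: K_def power_mult_distrib)
  qed
  have "(L2_norm V W)\<^sup>2 \<le> 2 / m * I\<^sup>2 + r\<^sup>2 * (norm p + \<rho>)\<^sup>2 * N\<^sup>2"
  proof (rule field_le_epsilon)
    fix e :: real assume "e > 0"
    then have "e * m / 2 > 0" using m by simp
    from main[OF this] show "(L2_norm V W)\<^sup>2 \<le> 2 / m * I\<^sup>2 + r\<^sup>2 * (norm p + \<rho>)\<^sup>2 * N\<^sup>2 + e"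
      using m by (simp add: distrib_left)
  qed
  then show ?thesis by (simp add: m_def B_def I_def N_def)
qed

lemma L2_norm_le_sum_cover:
  assumes \<F>: "finite \<F>" "\<Omega> \<subseteq> \<Union>\<F>" "\<And>V. V \<in> \<F> \<Longrightarrow> V \<in> sets lebesgue" "\<And>V. V \<in> \<F> \<Longrightarrow> w \<in> L2 V"
    and \<Omega>: "\<Omega> \<in> sets lebesgue" and w: "w \<in> L2 \<Omega>"
  shows "(L2_norm \<Omega> w)\<^sup>2 \<le> (\<Sum>V\<in>\<F>. (L2_norm V w)\<^sup>2)"
proof -
  have i: "integrable lebesgue (\<lambda>x. indicator V x *\<^sub>R (w x)\<^sup>2)" if "V \<in> \<F>" for V
    using L2_square_integrable[OF \<F>(4)[OF that]] \<F>(3)[OF that] by (simp add: integrable_restrict_space)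
  have "(L2_norm \<Omega> w)\<^sup>2 = (LINT x|lebesgue. indicator \<Omega> x *\<^sub>R (w x)\<^sup>2)"
    using \<Omega> by (simp add: L2_norm_square_integral integral_restrict_space)
  also have "\<dots> \<le> (LINT x|lebesgue. (\<Sum>V\<in>\<F>. indicator V x *\<^sub>R (w x)\<^sup>2))"
  proof (rule integral_mono)
    show "integrable lebesgue (\<lambda>x. indicator \<Omega> x *\<^sub>R (w x)\<^sup>2)"
      using L2_square_integrable[OF w] \<Omega> by (simp add: integrable_restrict_space)
    show "integrable lebesgue (\<lambda>x. \<Sum>V\<in>\<F>. indicator V x *\<^sub>R (w x)\<^sup>2)" using i by (intro Bochner_Integration.integrable_sum)
    fix x
    show "indicator \<Omega> x *\<^sub>R (w x)\<^sup>2 \<le> (\<Sum>V\<in>\<F>. indicator V x *\<^sub>R (w x)\<^sup>2)"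
    proof (cases "x \<in> \<Omega>")
      case True
      then obtain V where V: "V \<in> \<F>" "x \<in> V" using \<F>(2) by blast
      have "indicator V x *\<^sub>R (w x)\<^sup>2 \<le> (\<Sum>V\<in>\<F>. indicator V x *\<^sub>R (w x)\<^sup>2)"
        by (rule member_le_sum[OF V(1)]) (use \<F>(1) in auto)
      then show ?thesis using V True by simp
    qed (simp add: sum_nonneg)
  qed
  also have "\<dots> = (\<Sum>V\<in>\<F>. LINT x|lebesgue. indicator V x *\<^sub>R (w x)\<^sup>2)" using i by (intro Bochner_Integration.integral_sum)
  also have "\<dots> = (\<Sum>V\<in>\<F>. (L2_norm V w)\<^sup>2)"
    using \<F>(3) by (intro sum.cong) (auto simp: L2_norm_square_integral integral_restrict_space)
  finally show ?thesis .
qed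

text \<open>The radius \<open>r\<close> is kept free instead of being optimized, since the smoothing
  argument runs through a geometric sequence of radii. The power of \<open>r\<close> is the volume
  of the scaled balls in the patch estimate, summed over a finite cover.\<close>

theorem Nash_inequality:
  fixes \<Omega> :: "'a::euclidean_space set"
  assumes dom: "smooth_bounded_domain \<Omega>"
  obtains C where "C > 0" "\<And>w G r. H1_gradient \<Omega> w G \<Longrightarrow> 0 < r \<Longrightarrow> r \<le> 1 \<Longrightarrow>
    (L2_norm \<Omega> w)\<^sup>2 \<le> C * (r\<^sup>2 * (L2_norm \<Omega> (\<lambda>x. norm (G x)))\<^sup>2 + (LINT x|lebesgue_on \<Omega>. \<bar>w x\<bar>)\<^sup>2 / r ^ DIM('a))"
proof -
  have \<Omega>o: "open \<Omega>" "bounded \<Omega>" using dom by (auto simp: smooth_bounded_domain_def)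
  then have \<Omega>: "\<Omega> \<in> lmeasurable" by (simp add: lmeasurable_open)
  obtain \<F> where \<F>: "finite \<F>" "\<Union>\<F> = \<Omega>" "\<And>V. V \<in> \<F> \<Longrightarrow> \<exists>c p \<rho>. star_patch \<Omega> V c p \<rho>"
    using smooth_bounded_domain_cover[OF dom] by metis
  then obtain c p \<rho> where pt: "\<And>V. V \<in> \<F> \<Longrightarrow> star_patch \<Omega> V (c V) (p V) (\<rho> V)" by metis
  define a where "a V = 2 / measure lebesgue (ball (p V) (\<rho> V)) + (norm (p V) + \<rho> V)\<^sup>2" for V
  define C where "C = (\<Sum>V\<in>\<F>. a V) + 1"
  have a0: "a V \<ge> 0" for V by (simp add: a_def)
  show thesis
  proof (rule that[of C])
    show "C > 0" using a0 by (simp add: C_def add_nonneg_pos sum_nonneg)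
    fix w G and r :: real assume H: "H1_gradient \<Omega> w G" and r: "0 < r" "r \<le> 1"
    obtain W where W: "W \<in> borel_measurable borel" "AE x in lebesgue_on \<Omega>. w x = W x" "H1_gradient \<Omega> W G"
      using H1_borel_representative[OF H \<Omega>] by metis
    have wL: "w \<in> L2 \<Omega>" and WL: "W \<in> L2 \<Omega>" using H1_gradientD(1) H W(3) by auto
    define I where "I = (LINT x|lebesgue_on \<Omega>. \<bar>w x\<bar>)"
    define N where "N = L2_norm \<Omega> (\<lambda>x. norm (G x))"
    have I: "(LINT x|lebesgue_on \<Omega>. \<bar>W x\<bar>) = I"
      unfolding I_def using W(2) L2_measurable[OF wL] L2_measurable[OF WL]
      by (intro integral_cong_AE) (auto elim!: eventually_mono)
    let ?X = "r\<^sup>2 * N\<^sup>2 + I\<^sup>2 / r ^ DIM('a)"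
    have X0: "?X \<ge> 0" using r by simp
    have pV: "(L2_norm V W)\<^sup>2 \<le> a V * ?X" if V: "V \<in> \<F>" for V
    proof -
      have \<rho>: "\<rho> V > 0" using pt[OF V] by (simp add: star_patch_def)
      define m where "m = measure lebesgue (ball (p V) (\<rho> V))"
      have m: "m > 0" using \<rho> content_ball_pos by (simp add: m_def)
      have mr: "measure lebesgue (ball (r *\<^sub>R p V) (r * \<rho> V)) = r ^ DIM('a) * m"
        using \<rho> r by (simp add: m_def content_ball power_mult_distrib)
      have "(L2_norm V W)\<^sup>2 \<le> 2 / (r ^ DIM('a) * m) * I\<^sup>2 + r\<^sup>2 * (norm (p V) + \<rho> V)\<^sup>2 * N\<^sup>2"
        using Nash_inequality_patch[OF W(3,1) \<Omega> \<Omega>o(1) pt[OF V] r] unfolding mr I N_def .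
      also have "\<dots> = (2 / m) * (I\<^sup>2 / r ^ DIM('a)) + (norm (p V) + \<rho> V)\<^sup>2 * (r\<^sup>2 * N\<^sup>2)" by simp
      also have "\<dots> \<le> (2 / m) * ?X + (norm (p V) + \<rho> V)\<^sup>2 * ?X"
        using m r by (intro add_mono mult_left_mono) auto
      also have "\<dots> = a V * ?X" by (simp add: a_def m_def distrib_right)
      finally show ?thesis .
    qed
    have sV: "V \<in> sets lebesgue" "W \<in> L2 V" if V: "V \<in> \<F>" for V
    proof -
      show s: "V \<in> sets lebesgue" using pt[OF V] by (auto simp: star_patch_def)
      show "W \<in> L2 V" using L2_restrict(1)[OF WL _ s] \<Omega> star_patch_subset[OF pt[OF V]] by auto
    qed
    have "(L2_norm \<Omega> w)\<^sup>2 = (L2_norm \<Omega> W)\<^sup>2"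
      using L2_norm_cong_AE[OF L2_measurable[OF wL] L2_measurable[OF WL] W(2)] by simp
    also have "\<dots> \<le> (\<Sum>V\<in>\<F>. (L2_norm V W)\<^sup>2)"
      using \<F>(1,2) sV \<Omega> WL by (intro L2_norm_le_sum_cover) auto
    also have "\<dots> \<le> (\<Sum>V\<in>\<F>. a V * ?X)" by (intro sum_mono pV)
    also have "\<dots> = (\<Sum>V\<in>\<F>. a V) * ?X" by (simp add: sum_distrib_right)
    also have "\<dots> \<le> C * ?X" using X0 by (intro mult_right_mono) (auto simp: C_def)
    finally show "(L2_norm \<Omega> w)\<^sup>2 \<le> C * (r\<^sup>2 * (L2_norm \<Omega> (\<lambda>x. norm (G x)))\<^sup>2 + (LINT x|lebesgue_on \<Omega>. \<bar>w x\<bar>)\<^sup>2 / r ^ DIM('a))"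
      by (simp add: N_def I_def)
  qed
qed

text \<open>The constant \<open>k\<close> subtracted on \<open>V\<close> may depend on
  \<open>w\<close>, whereas \<open>C\<close> may not. Asking for an \<open>E\<close> strictly above
  the energy gives slack: \<open>k\<close> will be a value of \<open>w\<close> found by an averaging
  argument, which needs a strict inequality to contradict. The gradient is measured on all of
  \<Omega>, because the segments of a patch leave \<open>V\<close>.\<close>

definition poincare_on :: "'a::euclidean_space set \<Rightarrow> 'a set \<Rightarrow> bool" where
  "poincare_on \<Omega> V \<longleftrightarrow> open V \<and> V \<noteq> {} \<and> V \<subseteq> \<Omega> \<and>
     (\<exists>C\<ge>0. \<forall>w G E. H1_gradient \<Omega> w G \<longrightarrow> (L2_norm \<Omega> (\<lambda>x. norm (G x)))\<^sup>2 < E \<longrightarrow>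
        (\<exists>k. (L2_norm V (\<lambda>x. w x - k))\<^sup>2 \<le> C * E))"

text \<open>The constant is a value of the function at a suitable point \<open>z\<close> of the ball
  \<open>B'\<close> around \<open>c + p\<close>. If \<open>x\<close> is in \<open>V\<close> and
  \<open>z\<close> in \<open>B'\<close>, two distances below \<open>\<rho> / 2\<close> add up and
  \<open>z - x\<close> lies in \<open>B\<close>. Hence the average over \<open>z\<close> of the
  squared norm of \<open>W x - W z\<close> is dominated by the translation estimates for
  displacements in \<open>B\<close>.\<close>

lemma poincare_on_patch:
  fixes \<Omega> :: "'a::euclidean_space set"
  assumes \<Omega>: "\<Omega> \<in> lmeasurable" "open \<Omega>" and patch: "star_patch \<Omega> V c p \<rho>"
  shows "poincare_on \<Omega> V"
proof -
  have V: "open V" "V \<noteq> {}" "\<rho> > 0" "V \<subseteq> ball c (\<rho> / 2)" using patch by (auto simp: star_patch_def)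
  have V\<Omega>: "V \<subseteq> \<Omega>" by (rule star_patch_subset[OF patch])
  have Vl: "V \<in> lmeasurable" by (rule fmeasurableI2[OF \<Omega>(1) V\<Omega>]) (use V in auto)
  have sets: "\<Omega> \<in> sets lebesgue" "V \<in> sets lebesgue" using \<Omega> Vl by auto
  define B where "B = ball p \<rho>"
  define B' where "B' = ball (c + p) (\<rho> / 2)"
  define R where "R = norm p + \<rho>"
  define m where "m = measure lebesgue B"
  define m' where "m' = measure lebesgue B'"
  have [measurable]: "V \<in> sets borel" "B \<in> sets borel" "B' \<in> sets borel" using V by (auto simp: B_def B'_def)
  have eB: "emeasure lborel B = ennreal m" "emeasure lborel B' = ennreal m'"
    unfolding m_def m'_def by (rule emeasure_lborel_eq; simp add: B_def B'_def)+
  have m: "m > 0" "m' > 0" "R > 0"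
    using V(3) content_ball_pos by (auto simp: m_def m'_def B_def B'_def R_def add_nonneg_pos)
  have star: "x + s *\<^sub>R y \<in> \<Omega>" if "x \<in> V" "y \<in> B" "0 \<le> s" "s \<le> 1" for x y s
    using patch that unfolding star_patch_def B_def by blast
  \<comment> \<open>Each displacement contributes at most \<open>R\<^sup>2\<close> times the energy;
    there are \<open>m\<close> of them in volume, averaged over the volume \<open>m'\<close> of the
    points \<open>z\<close>.\<close>
  define C where "C = R\<^sup>2 * m / m'"
  have "\<exists>k. (L2_norm V (\<lambda>x. w x - k))\<^sup>2 \<le> C * E"
    if H: "H1_gradient \<Omega> w G" and E: "(L2_norm \<Omega> (\<lambda>x. norm (G x)))\<^sup>2 < E" for w G E
  proof -
    obtain W where W: "W \<in> borel_measurable borel" "AE x in lebesgue_on \<Omega>. w x = W x" "H1_gradient \<Omega> W G"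
      using H1_borel_representative[OF H \<Omega>(1)] by metis
    note [measurable] = W(1)
    define N where "N = L2_norm \<Omega> (\<lambda>x. norm (G x))"
    have wL: "w \<in> L2 \<Omega>" and WL: "W \<in> L2 \<Omega>" using H1_gradientD(1) H W(3) by auto
    have WV: "W \<in> L2 V" and wV: "w \<in> L2 V" using L2_restrict[OF _ sets] wL WL V\<Omega> by auto
    have Wk: "(\<lambda>x. W x - k) \<in> L2 V" for k by (intro L2_diff WV L2_const Vl)
    have Wy: "(\<lambda>x. W (x + y)) \<in> L2 V" if "y \<in> B" for y
      using L2_translate[OF WL sets, of y] star[OF _ that, of _ 1] by auto
    have "\<exists>z\<in>B'. (L2_norm V (\<lambda>x. W x - W z))\<^sup>2 \<le> C * E"
    proof (rule ccontr)
      assume "\<not> ?thesis"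
      then have big: "(L2_norm V (\<lambda>x. W x - W z))\<^sup>2 > C * E" if "z \<in> B'" for z using that by force
      let ?h = "\<lambda>(x, z). indicator B' z * (indicator V x * ennreal ((W x - W z)\<^sup>2))"
      have "E \<ge> 0" using E zero_le_power2[of "L2_norm \<Omega> (\<lambda>x. norm (G x))"] by linarith
      then have CE: "C * E \<ge> 0" using m by (simp add: C_def)
      have "ennreal (C * E * m') = (\<integral>\<^sup>+z. ennreal (C * E) * indicator B' z \<partial>lborel)"
        using CE m by (simp add: nn_integral_cmult_indicator eB ennreal_mult)
      also have "\<dots> \<le> (\<integral>\<^sup>+z. \<integral>\<^sup>+x. ?h (x, z) \<partial>lborel \<partial>lborel)"
      proof (rule nn_integral_mono)
        fix z :: 'a
        show "ennreal (C * E) * indicator B' z \<le> (\<integral>\<^sup>+x. ?h (x, z) \<partial>lborel)"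
        proof (cases "z \<in> B'")
          case True
          have "ennreal (C * E) \<le> ennreal (LINT x|lebesgue_on V. (W x - W z)\<^sup>2)"
            using big[OF True] by (intro ennreal_leI) (simp add: L2_norm_square_integral)
          also have "\<dots> = (\<integral>\<^sup>+x. indicator V x * ennreal ((W x - W z)\<^sup>2) \<partial>lborel)"
            by (rule nn_integral_lborel_indicator[symmetric]) (auto intro!: L2_square_integrable Wk)
          finally show ?thesis using True by simp
        qed simp
      qed
      also have "\<dots> = (\<integral>\<^sup>+x. \<integral>\<^sup>+z. ?h (x, z) \<partial>lborel \<partial>lborel)"
        by (rule lborel_pair.Fubini') measurable
      also have "\<dots> = (\<integral>\<^sup>+y. \<integral>\<^sup>+x. ?h (x, x + y) \<partial>lborel \<partial>lborel)"
        by (rule nn_integral_shear) measurable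
      also have "\<dots> \<le> (\<integral>\<^sup>+y. ennreal (R\<^sup>2 * N\<^sup>2) * indicator B y \<partial>lborel)"
      proof (rule nn_integral_mono)
        fix y :: 'a
        show "(\<integral>\<^sup>+x. ?h (x, x + y) \<partial>lborel) \<le> ennreal (R\<^sup>2 * N\<^sup>2) * indicator B y"
        proof (cases "y \<in> B")
          case True
          have d2: "(\<lambda>x. W (x + y) - W x) \<in> L2 V" by (intro L2_diff Wy WV True)
          have "L2_norm V (\<lambda>x. W (x + y) - W x) \<le> norm y * N" unfolding N_def
            by (rule H1_translation_estimate[OF W(3) \<Omega>(1) Vl V(1)]) (use star[OF _ True] in auto)
          also have "\<dots> \<le> R * N"
          proof (intro mult_right_mono)
            show "norm y \<le> R" using True norm_triangle_ineq[of p "y - p"]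
              by (simp add: B_def R_def dist_norm norm_minus_commute)
          qed (simp add: N_def)
          finally have "(L2_norm V (\<lambda>x. W (x + y) - W x))\<^sup>2 \<le> (R * N)\<^sup>2" by (rule power_mono) simp
          then have le: "(L2_norm V (\<lambda>x. W (x + y) - W x))\<^sup>2 \<le> R\<^sup>2 * N\<^sup>2" by (simp add: power_mult_distrib)
          have "(\<integral>\<^sup>+x. ?h (x, x + y) \<partial>lborel) \<le> (\<integral>\<^sup>+x. indicator V x * ennreal ((W (x + y) - W x)\<^sup>2) \<partial>lborel)"
            by (intro nn_integral_mono) (auto simp: indicator_def power2_commute)
          also have "\<dots> = ennreal (LINT x|lebesgue_on V. (W (x + y) - W x)\<^sup>2)"
            by (rule nn_integral_lborel_indicator) (auto intro!: L2_square_integrable d2)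
          also have "\<dots> \<le> ennreal (R\<^sup>2 * N\<^sup>2)" using le by (intro ennreal_leI) (simp add: L2_norm_square_integral)
          finally show ?thesis using True by simp
        next
          case False
          have "x + y \<notin> B'" if "x \<in> V" for x
          proof
            assume "x + y \<in> B'"
            moreover have "dist c x < \<rho> / 2" using that V(4) by auto
            moreover have "dist p y \<le> dist (c + p) (x + y) + dist c x"
            proof -
              have "p - y = (c + p - (x + y)) - (c - x)" by simp
              then show ?thesis unfolding dist_norm by (metis norm_triangle_ineq4)
            qed
            ultimately have "y \<in> B" by (simp add: B_def B'_def)
            with False show False by blast
          qed
          then have "(\<integral>\<^sup>+x. ?h (x, x + y) \<partial>lborel) = (\<integral>\<^sup>+x. 0 \<partial>(lborel :: 'a measure))"
            by (intro nn_integral_cong) (auto simp: indicator_def)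
          then show ?thesis by simp
        qed
      qed
      also have "\<dots> = ennreal (R\<^sup>2 * N\<^sup>2 * m)"
        using m by (simp add: nn_integral_cmult_indicator eB ennreal_mult)
      finally have "C * E * m' \<le> R\<^sup>2 * N\<^sup>2 * m" using m by (simp add: ennreal_le_iff)
      moreover have "C * E * m' = R\<^sup>2 * m * E" using m by (simp add: C_def)
      moreover have "R\<^sup>2 * m * N\<^sup>2 < R\<^sup>2 * m * E" using m E by (simp add: N_def)
      moreover have "R\<^sup>2 * N\<^sup>2 * m = R\<^sup>2 * m * N\<^sup>2" by (simp only: mult_ac)
      ultimately show False by linarith
    qed
    then obtain z where z: "(L2_norm V (\<lambda>x. W x - W z))\<^sup>2 \<le> C * E" by blast
    have "AE x in lebesgue_on V. w x = W x"
    proof -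
      have "AE x in lebesgue. x \<in> \<Omega> \<longrightarrow> w x = W x" using W(2) sets by (simp add: AE_restrict_space_iff)
      then show ?thesis using sets V\<Omega> by (subst AE_restrict_space_iff) (auto elim!: eventually_mono)
    qed
    then have "L2_norm V (\<lambda>x. w x - W z) = L2_norm V (\<lambda>x. W x - W z)"
      using L2_measurable[OF wV] L2_measurable[OF WV] by (intro L2_norm_cong_AE) (auto elim!: eventually_mono)
    with z show ?thesis by metis
  qed
  moreover have "C \<ge> 0" using m by (simp add: C_def)
  ultimately show ?thesis unfolding poincare_on_def using V V\<Omega> by blast
qed

lemma L2_norm_const: "\<Omega> \<in> lmeasurable \<Longrightarrow> (L2_norm \<Omega> (\<lambda>x. k))\<^sup>2 = k\<^sup>2 * measure lebesgue \<Omega>"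
  by (simp add: L2_norm_square_integral measure_restrict_space fmeasurableD)

text \<open>On the overlap, which is open and so has positive measure, both constants approximate
  the same function. They are therefore close to each other, and the constant of \<open>V1\<close>
  may be used on \<open>V2\<close> as well.\<close>

lemma poincare_on_Un:
  fixes \<Omega> :: "'a::euclidean_space set"
  assumes \<Omega>: "\<Omega> \<in> lmeasurable" and P1: "poincare_on \<Omega> V1" and P2: "poincare_on \<Omega> V2"
    and meet: "V1 \<inter> V2 \<noteq> {}"
  shows "poincare_on \<Omega> (V1 \<union> V2)"
proof -
  have V: "open V1" "open V2" "V1 \<subseteq> \<Omega>" "V2 \<subseteq> \<Omega>" "V1 \<noteq> {}" using P1 P2 by (auto simp: poincare_on_def)
  have l: "A \<in> lmeasurable" if "open A" "A \<subseteq> \<Omega>" for A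
    by (rule fmeasurableI2[OF \<Omega> that(2)]) (use that in auto)
  have Vl: "V1 \<in> lmeasurable" "V2 \<in> lmeasurable" "V1 \<inter> V2 \<in> lmeasurable" "V1 \<union> V2 \<in> lmeasurable" using V by (auto intro!: l)
  have sO: "\<Omega> \<in> sets lebesgue" using \<Omega> by auto
  obtain C1 where C1: "C1 \<ge> 0" "\<And>w G E. H1_gradient \<Omega> w G \<Longrightarrow> (L2_norm \<Omega> (\<lambda>x. norm (G x)))\<^sup>2 < E \<Longrightarrow>
    \<exists>k. (L2_norm V1 (\<lambda>x. w x - k))\<^sup>2 \<le> C1 * E" using P1 unfolding poincare_on_def by blast
  obtain C2 where C2: "C2 \<ge> 0" "\<And>w G E. H1_gradient \<Omega> w G \<Longrightarrow> (L2_norm \<Omega> (\<lambda>x. norm (G x)))\<^sup>2 < E \<Longrightarrow>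
    \<exists>k. (L2_norm V2 (\<lambda>x. w x - k))\<^sup>2 \<le> C2 * E" using P2 unfolding poincare_on_def by blast
  define m where "m = measure lebesgue (V1 \<inter> V2)"
  define \<mu> where "\<mu> = measure lebesgue V2"
  have m: "m > 0"
  proof -
    obtain x where "x \<in> V1 \<inter> V2" using meet by blast
    then obtain e where e: "e > 0" "ball x e \<subseteq> V1 \<inter> V2" using V(1,2) open_contains_ball by (metis open_Int)
    have "measure lebesgue (ball x e) \<le> m" unfolding m_def
      by (rule measure_mono_fmeasurable[OF e(2) _ Vl(3)]) auto
    moreover have "measure lebesgue (ball x e) > 0" using content_ball_pos[OF e(1), of x] by simp
    ultimately show ?thesis by linarith
  qed
  have \<mu>: "\<mu> \<ge> 0" by (simp add: \<mu>_def)
  \<comment> \<open>\<open>D * E\<close> bounds the squared difference of the two constants. In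
    \<open>C\<close>, the summand \<open>C1\<close> belongs to \<open>V1\<close>, and the other two
    to \<open>V2\<close> after the change of constant, with the factor 2 from
    \<open>(a + b)\<^sup>2 \<le> 2 * a\<^sup>2 + 2 * b\<^sup>2\<close>.\<close>
  define D where "D = 2 * (C1 + C2) / m"
  define C where "C = C1 + 2 * C2 + 2 * \<mu> * D"
  have sq: "(a + b)\<^sup>2 \<le> 2 * a\<^sup>2 + 2 * b\<^sup>2" for a b :: real
    using sum_squares_bound[of a b] by (simp add: power2_sum)
  have "\<exists>k. (L2_norm (V1 \<union> V2) (\<lambda>x. w x - k))\<^sup>2 \<le> C * E"
    if H: "H1_gradient \<Omega> w G" and E: "(L2_norm \<Omega> (\<lambda>x. norm (G x)))\<^sup>2 < E" for w G E
  proof -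
    have wL: "w \<in> L2 \<Omega>" by (rule H1_gradientD(1)[OF H])
    have wV: "(\<lambda>x. w x - k) \<in> L2 A" if "A \<in> lmeasurable" "A \<subseteq> \<Omega>" for A k
      using L2_restrict(1)[OF wL sO, of A] that by (intro L2_diff L2_const) auto
    obtain k1 where k1: "(L2_norm V1 (\<lambda>x. w x - k1))\<^sup>2 \<le> C1 * E" using C1(2)[OF H E] by blast
    obtain k2 where k2: "(L2_norm V2 (\<lambda>x. w x - k2))\<^sup>2 \<le> C2 * E" using C2(2)[OF H E] by blast
    have "(k1 - k2)\<^sup>2 * m \<le> 2 * (C1 + C2) * E"
    proof -
      let ?A = "V1 \<inter> V2"
      have A: "?A \<in> lmeasurable" "?A \<subseteq> \<Omega>" using Vl V by auto
      have "L2_norm ?A (\<lambda>x. w x - k2 - (w x - k1)) \<le> L2_norm ?A (\<lambda>x. w x - k2) + L2_norm ?A (\<lambda>x. w x - k1)"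
        by (rule L2_norm_triangle_diff) (auto intro!: wV A)
      also have "\<dots> \<le> L2_norm V2 (\<lambda>x. w x - k2) + L2_norm V1 (\<lambda>x. w x - k1)"
      proof (rule add_mono)
        show "L2_norm ?A (\<lambda>x. w x - k2) \<le> L2_norm V2 (\<lambda>x. w x - k2)"
          by (rule L2_restrict(2)[OF wV[OF Vl(2) V(4)]]) (use Vl in auto)
        show "L2_norm ?A (\<lambda>x. w x - k1) \<le> L2_norm V1 (\<lambda>x. w x - k1)"
          by (rule L2_restrict(2)[OF wV[OF Vl(1) V(3)]]) (use Vl in auto)
      qed
      finally have "(L2_norm ?A (\<lambda>x. w x - k2 - (w x - k1)))\<^sup>2 \<le> (L2_norm V2 (\<lambda>x. w x - k2) + L2_norm V1 (\<lambda>x. w x - k1))\<^sup>2"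
        by (rule power_mono) simp
      also have "\<dots> \<le> 2 * (L2_norm V2 (\<lambda>x. w x - k2))\<^sup>2 + 2 * (L2_norm V1 (\<lambda>x. w x - k1))\<^sup>2" by (rule sq)
      also have "\<dots> \<le> 2 * (C1 + C2) * E" using k1 k2 by (simp add: algebra_simps)
      finally show ?thesis using L2_norm_const[OF A(1), of "k1 - k2"] by (simp add: m_def)
    qed
    then have kk: "(k1 - k2)\<^sup>2 \<le> D * E" using m by (simp add: D_def pos_le_divide_eq)
    have "L2_norm V2 (\<lambda>x. w x - k2 - (k1 - k2)) \<le> L2_norm V2 (\<lambda>x. w x - k2) + L2_norm V2 (\<lambda>x. k1 - k2)"
      by (rule L2_norm_triangle_diff) (auto intro!: wV Vl V L2_const)
    then have "(L2_norm V2 (\<lambda>x. w x - k2 - (k1 - k2)))\<^sup>2 \<le> (L2_norm V2 (\<lambda>x. w x - k2) + L2_norm V2 (\<lambda>x. k1 - k2))\<^sup>2"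
      by (rule power_mono) simp
    also have "\<dots> \<le> 2 * (L2_norm V2 (\<lambda>x. w x - k2))\<^sup>2 + 2 * (L2_norm V2 (\<lambda>x. k1 - k2))\<^sup>2" by (rule sq)
    also have "(L2_norm V2 (\<lambda>x. k1 - k2))\<^sup>2 = (k1 - k2)\<^sup>2 * \<mu>" by (simp add: L2_norm_const[OF Vl(2)] \<mu>_def)
    also have "2 * (L2_norm V2 (\<lambda>x. w x - k2))\<^sup>2 + 2 * ((k1 - k2)\<^sup>2 * \<mu>) \<le> 2 * (C2 * E) + 2 * (D * E * \<mu>)"
      using k2 kk \<mu> by (intro add_mono mult_left_mono mult_right_mono) auto
    finally have b2: "(L2_norm V2 (\<lambda>x. w x - k1))\<^sup>2 \<le> 2 * (C2 * E) + 2 * (D * E * \<mu>)" by simp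
    have "(L2_norm (V1 \<union> V2) (\<lambda>x. w x - k1))\<^sup>2 \<le> (\<Sum>A\<in>{V1, V2}. (L2_norm A (\<lambda>x. w x - k1))\<^sup>2)"
      using Vl V by (intro L2_norm_le_sum_cover) (auto intro!: wV)
    also have "\<dots> \<le> (L2_norm V1 (\<lambda>x. w x - k1))\<^sup>2 + (L2_norm V2 (\<lambda>x. w x - k1))\<^sup>2"
      by (cases "V1 = V2") auto
    also have "\<dots> \<le> C1 * E + (2 * (C2 * E) + 2 * (D * E * \<mu>))" using k1 b2 by simp
    also have "\<dots> = C * E" by (simp add: C_def algebra_simps)
    finally show ?thesis by blast
  qed
  moreover have "C \<ge> 0" using C1 C2 m \<mu> by (simp add: C_def D_def)
  ultimately show ?thesis unfolding poincare_on_def using V by blast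
qed

text \<open>Chaining over overlapping patches is phrased through maximality: a maximal family of
  patches with a good union is disjoint from all other patches, and connectedness leaves no others.
  Zero mean makes the choice of the constant harmless.\<close>

theorem Poincare_inequality:
  fixes \<Omega> :: "'a::euclidean_space set"
  assumes dom: "smooth_bounded_domain \<Omega>"
  obtains C where "C > 0" "\<And>w G. H1_gradient \<Omega> w G \<Longrightarrow> (LINT x|lebesgue_on \<Omega>. w x) = 0 \<Longrightarrow>
    (L2_norm \<Omega> w)\<^sup>2 \<le> C * (L2_norm \<Omega> (\<lambda>x. norm (G x)))\<^sup>2"
proof -
  have \<Omega>o: "open \<Omega>" "bounded \<Omega>" "connected \<Omega>" "\<Omega> \<noteq> {}" using dom by (auto simp: smooth_bounded_domain_def)
  then have \<Omega>: "\<Omega> \<in> lmeasurable" by (simp add: lmeasurable_open)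
  obtain \<F> where \<F>: "finite \<F>" "\<Union>\<F> = \<Omega>" "\<And>V. V \<in> \<F> \<Longrightarrow> \<exists>c p \<rho>. star_patch \<Omega> V c p \<rho>"
    using smooth_bounded_domain_cover[OF dom] by metis
  then have P: "poincare_on \<Omega> V" if "V \<in> \<F>" for V using poincare_on_patch[OF \<Omega> \<Omega>o(1)] that by blast
  \<comment> \<open>Working with finite subfamilies of the cover avoids ordering the patches into a
    chain.\<close>
  define \<A> where "\<A> = {\<G>. \<G> \<subseteq> \<F> \<and> poincare_on \<Omega> (\<Union>\<G>)}"
  have "finite \<A>" unfolding \<A>_def by (rule finite_subset[of _ "Pow \<F>"]) (use \<F>(1) in auto)
  moreover obtain V0 where "V0 \<in> \<F>" using \<F>(2) \<Omega>o(4) by blast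
  then have "{V0} \<in> \<A>" using P by (simp add: \<A>_def)
  ultimately obtain \<G> where \<G>: "\<G> \<in> \<A>" "\<And>\<H>. \<H> \<in> \<A> \<Longrightarrow> \<G> \<subseteq> \<H> \<Longrightarrow> \<G> = \<H>"
    using finite_has_maximal[of \<A>] by blast
  have PG: "poincare_on \<Omega> (\<Union>\<G>)" and G\<F>: "\<G> \<subseteq> \<F>" using \<G>(1) by (auto simp: \<A>_def)
  have disj: "V \<inter> \<Union>\<G> = {}" if V: "V \<in> \<F> - \<G>" for V
  proof (rule ccontr)
    assume "V \<inter> \<Union>\<G> \<noteq> {}"
    then have "poincare_on \<Omega> (\<Union>\<G> \<union> V)"
      using poincare_on_Un[OF \<Omega> PG P] V by blast
    then have "insert V \<G> \<in> \<A>" using V G\<F> by (simp add: \<A>_def Un_commute)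
    then show False using \<G>(2)[of "insert V \<G>"] V by blast
  qed
  have "\<Union>\<G> = \<Omega>"
  proof (rule ccontr)
    assume ne: "\<Union>\<G> \<noteq> \<Omega>"
    have o: "open (\<Union>\<G>)" "open (\<Union>(\<F> - \<G>))" using P G\<F> by (auto simp: poincare_on_def intro!: open_Union)
    have "\<Union>\<G> \<inter> \<Union>(\<F> - \<G>) \<inter> \<Omega> = {}" using disj by blast
    moreover have "\<Omega> \<subseteq> \<Union>\<G> \<union> \<Union>(\<F> - \<G>)" using \<F>(2) by blast
    moreover have "\<Union>\<G> \<inter> \<Omega> \<noteq> {}" using PG unfolding poincare_on_def by blast
    moreover have "\<Union>(\<F> - \<G>) \<inter> \<Omega> \<noteq> {}" using ne \<F>(2) G\<F> by blast
    ultimately show False using connectedD[OF \<Omega>o(3) o] by blast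
  qed
  with PG obtain C where C: "C \<ge> 0" "\<And>w G E. H1_gradient \<Omega> w G \<Longrightarrow> (L2_norm \<Omega> (\<lambda>x. norm (G x)))\<^sup>2 < E \<Longrightarrow>
    \<exists>k. (L2_norm \<Omega> (\<lambda>x. w x - k))\<^sup>2 \<le> C * E" unfolding poincare_on_def by blast
  show thesis
  proof (rule that[of "C + 1"])
    show "C + 1 > 0" using C(1) by simp
    fix w G assume H: "H1_gradient \<Omega> w G" and mean: "(LINT x|lebesgue_on \<Omega>. w x) = 0"
    define N where "N = (L2_norm \<Omega> (\<lambda>x. norm (G x)))\<^sup>2"
    have wL: "w \<in> L2 \<Omega>" by (rule H1_gradientD(1)[OF H])
    have "(L2_norm \<Omega> w)\<^sup>2 \<le> (C + 1) * N"
    proof (rule field_le_epsilon)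
      fix e :: real assume e: "e > 0"
      define d where "d = e / (C + 1)"
      have d: "d > 0" using e C(1) by (simp add: d_def)
      obtain k where k: "(L2_norm \<Omega> (\<lambda>x. w x - k))\<^sup>2 \<le> C * (N + d)"
        using C(2)[OF H, of "N + d"] d by (auto simp: N_def)
      \<comment> \<open>A function of zero mean is orthogonal to constants, so subtracting any
        constant can only enlarge its norm.\<close>
      have "L2_inner \<Omega> w (\<lambda>x. k) = 0" using mean by (simp add: L2_inner_def)
      then have "(L2_norm \<Omega> (\<lambda>x. w x - k))\<^sup>2 = (L2_norm \<Omega> w)\<^sup>2 + (L2_norm \<Omega> (\<lambda>x. k))\<^sup>2"
        using wL L2_const[OF \<Omega>, of k] L2_inner_commute[of \<Omega> w "\<lambda>x. k"]
        by (simp add: L2_norm_square L2_inner_diff L2_inner_diff_right L2_diff)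
      then have "(L2_norm \<Omega> w)\<^sup>2 \<le> C * (N + d)" using k by (smt (verit) zero_le_power2)
      also have "\<dots> \<le> (C + 1) * (N + d)" using d by (intro mult_right_mono) (auto simp: N_def)
      also have "\<dots> = (C + 1) * N + e" using C(1) by (simp add: d_def distrib_left)
      finally show "(L2_norm \<Omega> w)\<^sup>2 \<le> (C + 1) * N + e" .
    qed
    then show "(L2_norm \<Omega> w)\<^sup>2 \<le> (C + 1) * (L2_norm \<Omega> (\<lambda>x. norm (G x)))\<^sup>2" by (simp add: N_def)
  qed
qed

section \<open>Uniform boundedness in L2\<close>

text \<open>A gliding hump argument in place of Baire's theorem: increments of geometrically
  decreasing norm are added up, each with a sign chosen so that one seminorm becomes large, and the
  later increments are too small to undo this. The statement concerns seminorms rather than linear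
  operators, because \<open>S t\<close> is linear only up to null sets.\<close>

lemma L2_uniform_boundedness:
  fixes p :: "nat \<Rightarrow> ('a::euclidean_space \<Rightarrow> real) \<Rightarrow> real"
  assumes sub: "\<And>k w z. w \<in> L2 \<Omega> \<Longrightarrow> z \<in> L2 \<Omega> \<Longrightarrow> p k (\<lambda>x. w x + z x) \<le> p k w + p k z"
    and hom: "\<And>k w c. w \<in> L2 \<Omega> \<Longrightarrow> p k (\<lambda>x. c * w x) = \<bar>c\<bar> * p k w"
    and bd: "\<And>k. \<exists>C. \<forall>w\<in>L2 \<Omega>. p k w \<le> C * L2_norm \<Omega> w"
    and pt: "\<And>w. w \<in> L2 \<Omega> \<Longrightarrow> \<exists>B. \<forall>k. p k w \<le> B"
  shows "\<exists>C. \<forall>k. \<forall>w\<in>L2 \<Omega>. p k w \<le> C * L2_norm \<Omega> w"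
proof (rule ccontr)
  assume "\<not> ?thesis"
  \<comment> \<open>The growth \<open>4 ^ n\<close> has to beat the decay \<open>(1 / 3) ^ n\<close>
    of the increments, leaving \<open>(4 / 3) ^ n\<close>.\<close>
  then have "\<forall>n::nat. \<exists>k w. w \<in> L2 \<Omega> \<and> p k w > 4 ^ n * L2_norm \<Omega> w" by (meson not_le)
  then obtain k v where kv: "\<And>n. v n \<in> L2 \<Omega>" "\<And>n. p (k n) (v n) > 4 ^ n * L2_norm \<Omega> (v n)" by metis
  have "\<forall>n. \<exists>C. \<forall>w\<in>L2 \<Omega>. p (k n) w \<le> C * L2_norm \<Omega> w" using bd by blast
  from choice[OF this] obtain C where C: "\<And>n w. w \<in> L2 \<Omega> \<Longrightarrow> p (k n) w \<le> C n * L2_norm \<Omega> w" by blast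
  define X where "X n = {p (k n) w |w. w \<in> L2 \<Omega> \<and> L2_norm \<Omega> w \<le> 1}" for n
  define M where "M n = Sup (X n)" for n
  have bdd: "bdd_above (X n)" for n
  proof (rule bdd_aboveI[of _ "\<bar>C n\<bar>"])
    fix y assume "y \<in> X n"
    then obtain w where w: "w \<in> L2 \<Omega>" "L2_norm \<Omega> w \<le> 1" "y = p (k n) w" by (auto simp: X_def)
    have "y \<le> C n * L2_norm \<Omega> w" using C w by simp
    also have "\<dots> \<le> \<bar>C n\<bar> * 1" using w(2) by (intro mult_mono) auto
    finally show "y \<le> \<bar>C n\<bar>" by simp
  qed
  have scaled: "p (k n) w / L2_norm \<Omega> w \<in> X n" if w: "w \<in> L2 \<Omega>" "L2_norm \<Omega> w > 0" for n w
  proof -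
    have "p (k n) w / L2_norm \<Omega> w = p (k n) (\<lambda>x. (1 / L2_norm \<Omega> w) * w x)" using w by (subst hom) auto
    moreover have "L2_norm \<Omega> (\<lambda>x. (1 / L2_norm \<Omega> w) * w x) = 1" using w by (subst L2_norm_cmult) auto
    ultimately show ?thesis
      unfolding X_def using L2_cmult[OF w(1), of "1 / L2_norm \<Omega> w"]
      by (intro CollectI exI[of _ "\<lambda>x. (1 / L2_norm \<Omega> w) * w x"]) simp
  qed
  have pM: "p (k n) w \<le> M n * L2_norm \<Omega> w" if w: "w \<in> L2 \<Omega>" for n w
  proof (cases "L2_norm \<Omega> w = 0")
    case True
    then show ?thesis using C[OF w, of n] by simp
  next
    case False
    then have pos: "L2_norm \<Omega> w > 0" using L2_norm_nonneg[of \<Omega> w] by linarith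
    then have "p (k n) w / L2_norm \<Omega> w \<le> M n" unfolding M_def by (intro cSup_upper scaled w bdd)
    then show ?thesis using pos by (simp add: pos_divide_le_eq)
  qed
  have M4: "M n > 4 ^ n" for n
  proof -
    have "L2_norm \<Omega> (v n) \<noteq> 0" using kv(2)[of n] C[OF kv(1), of n n] by auto
    then have pos: "L2_norm \<Omega> (v n) > 0" using L2_norm_nonneg[of \<Omega> "v n"] by linarith
    have "4 ^ n * L2_norm \<Omega> (v n) < M n * L2_norm \<Omega> (v n)" using kv(2)[of n] pM[OF kv(1), of n n] by linarith
    then show ?thesis using pos by (simp add: mult_less_cancel_right)
  qed
  have M0: "M n > 0" for n using M4[of n] by (meson less_trans zero_less_numeral zero_less_power)
  \<comment> \<open>A near-maximizer of the seminorm on the unit ball. Any factor strictly between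
    1/2 and 1 would do, because the later increments can take away at most one half.\<close>
  have "\<exists>w. w \<in> L2 \<Omega> \<and> L2_norm \<Omega> w \<le> 1 \<and> p (k n) w > 2 / 3 * M n" for n
  proof -
    have "(\<lambda>x. 0) \<in> L2 \<Omega>" by (simp add: L2_def)
    then have "X n \<noteq> {}" unfolding X_def using L2_norm_zero[of \<Omega>] by force
    moreover have "2 / 3 * M n < Sup (X n)" using M0[of n] by (simp add: M_def)
    ultimately obtain y where "y \<in> X n" "2 / 3 * M n < y" using less_cSup_iff[OF _ bdd] by blast
    then show ?thesis unfolding X_def by blast
  qed
  then obtain w where w: "\<And>n. w n \<in> L2 \<Omega>" "\<And>n. L2_norm \<Omega> (w n) \<le> 1" "\<And>n. p (k n) (w n) > 2 / 3 * M n" by metis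
  define h where "h n x = (1 / 3) ^ n * w n x" for n x
  have h2: "h n \<in> L2 \<Omega>" for n unfolding h_def[abs_def] by (intro L2_cmult w)
  have hN: "L2_norm \<Omega> (h n) \<le> (1 / 3) ^ n" for n
    unfolding h_def[abs_def] L2_norm_cmult using w(2)[of n] by (simp add: mult_left_le)
  have hp: "p (k n) (h n) > 2 / 3 * M n * (1 / 3) ^ n" for n
    unfolding h_def[abs_def] hom[OF w(1)] using w(3)[of n] by (simp add: mult_ac)
  \<comment> \<open>Since \<open>2 * h\<close> is the difference of \<open>u + h\<close> and
    \<open>u - h\<close>, one of the two has seminorm at least that of \<open>h\<close>; that one is
    taken.\<close>
  define X where "X = rec_nat (\<lambda>x. 0) (\<lambda>n u. if p (k n) (\<lambda>x. u x + h n x) \<ge> p (k n) (\<lambda>x. u x - h n x)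
      then (\<lambda>x. u x + h n x) else (\<lambda>x. u x - h n x))"
  define d where "d n x = X (Suc n) x - X n x" for n x
  have XS: "X (Suc n) = (if p (k n) (\<lambda>x. X n x + h n x) \<ge> p (k n) (\<lambda>x. X n x - h n x)
      then (\<lambda>x. X n x + h n x) else (\<lambda>x. X n x - h n x))" for n by (simp add: X_def)
  have X2: "X n \<in> L2 \<Omega>" for n
  proof (induction n)
    case 0
    show ?case by (simp add: X_def L2_def)
  next
    case (Suc n)
    then show ?case using h2[of n] by (simp add: XS L2_add L2_diff)
  qed
  have dh: "d n = h n \<or> d n = (\<lambda>x. - h n x)" for n by (auto simp: d_def[abs_def] XS)
  have d2: "d n \<in> L2 \<Omega>" for n using dh[of n] h2[of n] L2_uminus[OF h2, of n] by auto
  have dN: "L2_norm \<Omega> (d n) \<le> (1 / 3) ^ n" for n using dh[of n] hN[of n] L2_norm_uminus[of \<Omega> "h n"] by auto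
  have Xsum: "(\<Sum>j<n. d j x) = X n x" for n x
    by (induction n) (auto simp: d_def X_def)
  have Xp: "p (k n) (X (Suc n)) \<ge> p (k n) (h n)" for n
  proof -
    let ?a = "\<lambda>x. X n x + h n x" and ?b = "\<lambda>x. X n x - h n x"
    have a2: "?a \<in> L2 \<Omega>" and b2: "?b \<in> L2 \<Omega>" using X2 h2 by (auto intro!: L2_add L2_diff)
    have "2 * p (k n) (h n) = p (k n) (\<lambda>x. 2 * h n x)" using hom[OF h2, of "k n" 2 n] by simp
    also have "(\<lambda>x. 2 * h n x) = (\<lambda>x. ?a x + (-1) * ?b x)" by auto
    also have "p (k n) \<dots> \<le> p (k n) ?a + p (k n) (\<lambda>x. (-1) * ?b x)" by (rule sub[OF a2 L2_cmult[OF b2]])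
    also have "p (k n) (\<lambda>x. (-1) * ?b x) = p (k n) ?b" using hom[OF b2, of "k n" "-1"] by simp
    finally show ?thesis by (auto simp: XS)
  qed
  have summ: "summable (\<lambda>n. (1 / 3 :: real) ^ n)" by (intro summable_geometric) simp
  obtain u where u: "u \<in> L2 \<Omega>" "\<And>n. L2_norm \<Omega> (\<lambda>x. u x - (\<Sum>j<n. d j x)) \<le> (\<Sum>j. (1 / 3) ^ (j + n))"
    using L2_summable_series[OF d2 summ dN] by blast
  \<comment> \<open>The increments from index \<open>Suc n\<close> on have total norm at most half
    of the scale \<open>(1 / 3) ^ n\<close> of the hump. This leaves
    \<open>2 / 3 - 1 / 2 = 1 / 6\<close> of the hump in \<open>low\<close>.\<close>
  have tail: "(\<Sum>j. (1 / 3 :: real) ^ (j + Suc n)) = (1 / 3) ^ n / 2" for n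
  proof -
    have "(\<Sum>j. (1 / 3 :: real) ^ (j + Suc n)) = (\<Sum>j. (1 / 3) ^ Suc n * (1 / 3) ^ j)" by (simp add: power_add mult_ac)
    also have "\<dots> = (1 / 3) ^ Suc n * (\<Sum>j. (1 / 3) ^ j)" using summ by (rule suminf_mult)
    also have "(\<Sum>j. (1 / 3 :: real) ^ j) = 3 / 2" by (subst suminf_geometric) auto
    finally show ?thesis by simp
  qed
  have low: "p (k n) u \<ge> (4 / 3) ^ n / 6" for n
  proof -
    let ?r = "\<lambda>x. X (Suc n) x - u x"
    have r2: "?r \<in> L2 \<Omega>" using X2 u(1) by (intro L2_diff)
    have "L2_norm \<Omega> ?r \<le> (1 / 3) ^ n / 2"
      using u(2)[of "Suc n"] tail[of n] L2_norm_diff_commute[of \<Omega> u "X (Suc n)"] unfolding Xsum by simp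
    then have "M n * L2_norm \<Omega> ?r \<le> M n * ((1 / 3) ^ n / 2)" using M0[of n] by (intro mult_left_mono) auto
    then have pr: "p (k n) ?r \<le> M n * ((1 / 3) ^ n / 2)" using pM[OF r2, of n] by linarith
    have "p (k n) (X (Suc n)) = p (k n) (\<lambda>x. u x + ?r x)" by simp
    also have "\<dots> \<le> p (k n) u + p (k n) ?r" by (rule sub[OF u(1) r2])
    finally have "p (k n) u \<ge> 2 / 3 * M n * (1 / 3) ^ n - M n * ((1 / 3) ^ n / 2)"
      using pr Xp[of n] hp[of n] by linarith
    also have "2 / 3 * M n * (1 / 3) ^ n - M n * ((1 / 3) ^ n / 2) = M n * (1 / 3) ^ n / 6" by simp
    finally have "p (k n) u \<ge> M n * (1 / 3) ^ n / 6" .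
    moreover have "4 ^ n * (1 / 3) ^ n \<le> M n * (1 / 3) ^ n" using M4[of n] by (intro mult_right_mono) auto
    moreover have "(4 / 3 :: real) ^ n = 4 ^ n * (1 / 3) ^ n" by (simp add: power_divide)
    ultimately show ?thesis by linarith
  qed
  obtain B where B: "\<And>n. p n u \<le> B" using pt[OF u(1)] by blast
  obtain n where "(4 / 3 :: real) ^ n > 6 * B" using real_arch_pow[of "4/3"] by auto
  then show False using low[of n] B[of "k n"] by simp
qed

section \<open>Differentiation of L2-valued functions\<close>

text \<open>Differentiation is relative to a set of times: orbits live on \<open>{0..}\<close>, with
  a one-sided derivative at 0, and reversing time maps \<open>{0..\<tau>}\<close> to itself.\<close>

definition L2_has_derivative ::
    "'a::euclidean_space set \<Rightarrow> (real \<Rightarrow> 'a \<Rightarrow> real) \<Rightarrow> ('a \<Rightarrow> real) \<Rightarrow> real \<Rightarrow> real set \<Rightarrow> bool" where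
  "L2_has_derivative \<Omega> W h t A \<longleftrightarrow> (\<forall>s\<in>A. W s \<in> L2 \<Omega>) \<and> h \<in> L2 \<Omega> \<and> t \<in> A \<and>
     ((\<lambda>s. L2_norm \<Omega> (\<lambda>x. (W s x - W t x) / (s - t) - h x)) \<longlongrightarrow> 0) (at t within A)"

lemma L2_inner_tendsto:
  assumes a: "\<forall>\<^sub>F s in F. a s \<in> L2 \<Omega>" "a' \<in> L2 \<Omega>" "((\<lambda>s. L2_norm \<Omega> (\<lambda>x. a s x - a' x)) \<longlongrightarrow> 0) F"
    and b: "\<forall>\<^sub>F s in F. b s \<in> L2 \<Omega>" "b' \<in> L2 \<Omega>" "((\<lambda>s. L2_norm \<Omega> (\<lambda>x. b s x - b' x)) \<longlongrightarrow> 0) F"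
  shows "((\<lambda>s. L2_inner \<Omega> (a s) (b s)) \<longlongrightarrow> L2_inner \<Omega> a' b') F"
proof -
  let ?A = "\<lambda>s. L2_norm \<Omega> (\<lambda>x. a s x - a' x)" and ?B = "\<lambda>s. L2_norm \<Omega> (\<lambda>x. b s x - b' x)"
  have "((\<lambda>s. L2_inner \<Omega> (a s) (b s) - L2_inner \<Omega> a' b') \<longlongrightarrow> 0) F"
  proof (rule Lim_null_comparison)
    show "\<forall>\<^sub>F s in F. norm (L2_inner \<Omega> (a s) (b s) - L2_inner \<Omega> a' b') \<le> ?A s * (?B s + L2_norm \<Omega> b') + L2_norm \<Omega> a' * ?B s"
      using a(1) b(1)
    proof eventually_elim
      case (elim s)
      have "L2_inner \<Omega> (a s) (b s) - L2_inner \<Omega> a' b' = L2_inner \<Omega> (\<lambda>x. a s x - a' x) (b s) + L2_inner \<Omega> a' (\<lambda>x. b s x - b' x)"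
        using elim a(2) b(2) by (simp add: L2_inner_diff L2_inner_diff_right)
      moreover have "\<bar>L2_inner \<Omega> (\<lambda>x. a s x - a' x) (b s)\<bar> \<le> ?A s * L2_norm \<Omega> (b s)"
        using elim a(2) by (intro L2_Cauchy_Schwarz L2_diff)
      moreover have "?A s * L2_norm \<Omega> (b s) \<le> ?A s * (?B s + L2_norm \<Omega> b')"
        using L2_norm_triangle_le[OF elim(2) b(2)] by (intro mult_left_mono) auto
      moreover have "\<bar>L2_inner \<Omega> a' (\<lambda>x. b s x - b' x)\<bar> \<le> L2_norm \<Omega> a' * ?B s"
        using elim a(2) b(2) by (intro L2_Cauchy_Schwarz L2_diff)
      ultimately show ?case by simp
    qed
    show "((\<lambda>s. ?A s * (?B s + L2_norm \<Omega> b') + L2_norm \<Omega> a' * ?B s) \<longlongrightarrow> 0) F"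
      using a(3) b(3) by (auto intro!: tendsto_eq_intros)
  qed
  then show ?thesis by (simp add: LIM_zero_iff)
qed

lemma L2_has_derivative_quotient_L2:
  assumes "L2_has_derivative \<Omega> W h t A" "s \<in> A"
  shows "(\<lambda>x. (W s x - W t x) / (s - t)) \<in> L2 \<Omega>"
  using assms by (auto simp: L2_has_derivative_def intro!: L2_divide L2_diff)

lemma L2_has_derivative_quotient_bounded:
  assumes W: "L2_has_derivative \<Omega> W h t A"
  shows "\<forall>\<^sub>F s in at t within A. L2_norm \<Omega> (\<lambda>x. (W s x - W t x) / (s - t)) \<le> L2_norm \<Omega> h + 1"
proof -
  have lim: "((\<lambda>s. L2_norm \<Omega> (\<lambda>x. (W s x - W t x) / (s - t) - h x)) \<longlongrightarrow> 0) (at t within A)" and h: "h \<in> L2 \<Omega>"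
    using W by (auto simp: L2_has_derivative_def)
  have "\<forall>\<^sub>F s in at t within A. L2_norm \<Omega> (\<lambda>x. (W s x - W t x) / (s - t) - h x) < 1"
    by (rule order_tendstoD(2)[OF lim]) simp
  moreover have "\<forall>\<^sub>F s in at t within A. s \<in> A" by (simp add: eventually_at_filter)
  ultimately show ?thesis
  proof eventually_elim
    case (elim s)
    then show ?case using L2_norm_triangle_le[OF L2_has_derivative_quotient_L2[OF W elim(2)] h] by simp
  qed
qed

lemma L2_norm_increment:
  assumes "s \<noteq> t"
  shows "L2_norm \<Omega> (\<lambda>x. W s x - W t x) = \<bar>s - t\<bar> * L2_norm \<Omega> (\<lambda>x. (W s x - W t x) / (s - t))"
proof -
  have "(\<lambda>x. W s x - W t x) = (\<lambda>x. (s - t) * ((W s x - W t x) / (s - t)))" using assms by auto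
  then show ?thesis using L2_norm_cmult[of \<Omega> "s - t" "\<lambda>x. (W s x - W t x) / (s - t)"] by simp
qed

lemma L2_has_derivative_continuous:
  assumes W: "L2_has_derivative \<Omega> W h t A"
  shows "((\<lambda>s. L2_norm \<Omega> (\<lambda>x. W s x - W t x)) \<longlongrightarrow> 0) (at t within A)"
proof (rule Lim_null_comparison)
  have "\<forall>\<^sub>F s in at t within A. s \<noteq> t" by (simp add: eventually_at_filter)
  with L2_has_derivative_quotient_bounded[OF W]
  show "\<forall>\<^sub>F s in at t within A. norm (L2_norm \<Omega> (\<lambda>x. W s x - W t x)) \<le> \<bar>s - t\<bar> * (L2_norm \<Omega> h + 1)"
    by eventually_elim (simp add: L2_norm_increment mult_left_mono)
  show "((\<lambda>s. \<bar>s - t\<bar> * (L2_norm \<Omega> h + 1)) \<longlongrightarrow> 0) (at t within A)"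
    by (auto intro!: tendsto_eq_intros)
qed

lemma L2_inner_has_derivative:
  assumes W: "L2_has_derivative \<Omega> W h t A" and Z: "L2_has_derivative \<Omega> Z k t A"
  shows "((\<lambda>s. L2_inner \<Omega> (W s) (Z s)) has_real_derivative (L2_inner \<Omega> h (Z t) + L2_inner \<Omega> (W t) k)) (at t within A)"
proof -
  have mem: "\<forall>\<^sub>F s in at t within A. s \<in> A \<and> s \<noteq> t" by (simp add: eventually_at_filter)
  have W2: "\<And>s. s \<in> A \<Longrightarrow> W s \<in> L2 \<Omega>" "h \<in> L2 \<Omega>" "t \<in> A" using W by (auto simp: L2_has_derivative_def)
  have Z2: "\<And>s. s \<in> A \<Longrightarrow> Z s \<in> L2 \<Omega>" "k \<in> L2 \<Omega>" using Z by (auto simp: L2_has_derivative_def)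
  let ?DW = "\<lambda>s x. (W s x - W t x) / (s - t)" and ?DZ = "\<lambda>s x. (Z s x - Z t x) / (s - t)"
  have "((\<lambda>s. L2_inner \<Omega> (?DW s) (Z s)) \<longlongrightarrow> L2_inner \<Omega> h (Z t)) (at t within A)"
    using W Z mem L2_has_derivative_quotient_L2[OF W] Z2 W2 L2_has_derivative_continuous[OF Z]
    by (intro L2_inner_tendsto) (auto simp: L2_has_derivative_def elim!: eventually_mono)
  moreover have "((\<lambda>s. L2_inner \<Omega> (W t) (?DZ s)) \<longlongrightarrow> L2_inner \<Omega> (W t) k) (at t within A)"
    using W Z mem L2_has_derivative_quotient_L2[OF Z] Z2 W2
    by (intro L2_inner_tendsto) (auto simp: L2_has_derivative_def elim!: eventually_mono)
  ultimately have "((\<lambda>s. L2_inner \<Omega> (?DW s) (Z s) + L2_inner \<Omega> (W t) (?DZ s)) \<longlongrightarrow> L2_inner \<Omega> h (Z t) + L2_inner \<Omega> (W t) k) (at t within A)"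
    by (rule tendsto_add)
  moreover have "\<forall>\<^sub>F s in at t within A. L2_inner \<Omega> (?DW s) (Z s) + L2_inner \<Omega> (W t) (?DZ s) = (L2_inner \<Omega> (W s) (Z s) - L2_inner \<Omega> (W t) (Z t)) / (s - t)"
    using mem
  proof eventually_elim
    case (elim s)
    have 1: "L2_inner \<Omega> (?DW s) (Z s) = (L2_inner \<Omega> (W s) (Z s) - L2_inner \<Omega> (W t) (Z s)) / (s - t)"
      using L2_inner_cmult[of \<Omega> "1 / (s - t)" "\<lambda>x. W s x - W t x" "Z s"] elim W2 Z2 by (simp add: L2_inner_diff)
    have 2: "L2_inner \<Omega> (W t) (?DZ s) = (L2_inner \<Omega> (W t) (Z s) - L2_inner \<Omega> (W t) (Z t)) / (s - t)"
      using L2_inner_cmult_right[of \<Omega> "W t" "1 / (s - t)" "\<lambda>x. Z s x - Z t x"] elim W2 Z2 by (simp add: L2_inner_diff_right)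
    show ?case unfolding 1 2 by (simp flip: add_divide_distrib)
  qed
  ultimately show ?thesis
    unfolding has_field_derivative_iff by (rule Lim_transform_eventually)
qed

text \<open>A differentiable curve in L2 moves by at most a multiple of
  \<open>\<bar>s - t\<bar>\<close>, so the quadratic remainder of \<open>\<Psi>\<close> contributes
  a term of second order to the integral. Thus pointwise Taylor expansion suffices and no pointwise
  derivative in time is required.\<close>

lemma L2_integral_has_derivative:
  assumes W: "L2_has_derivative \<Omega> W h t A"
    and taylor: "\<And>a b. \<bar>\<Psi> b - \<Psi> a - \<psi> a * (b - a)\<bar> \<le> C * (b - a)\<^sup>2"
    and \<psi>W: "(\<lambda>x. \<psi> (W t x)) \<in> L2 \<Omega>" and \<Psi>W: "\<And>s. s \<in> A \<Longrightarrow> integrable (lebesgue_on \<Omega>) (\<lambda>x. \<Psi> (W s x))"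
  shows "((\<lambda>s. LINT x|lebesgue_on \<Omega>. \<Psi> (W s x)) has_real_derivative L2_inner \<Omega> (\<lambda>x. \<psi> (W t x)) h) (at t within A)"
proof -
  let ?M = "lebesgue_on \<Omega>"
  have mem: "\<forall>\<^sub>F s in at t within A. s \<in> A \<and> s \<noteq> t" by (simp add: eventually_at_filter)
  have W2: "\<And>s. s \<in> A \<Longrightarrow> W s \<in> L2 \<Omega>" "h \<in> L2 \<Omega>" "t \<in> A" using W by (auto simp: L2_has_derivative_def)
  let ?DW = "\<lambda>s x. (W s x - W t x) / (s - t)"
  let ?R = "\<lambda>s x. \<Psi> (W s x) - \<Psi> (W t x) - \<psi> (W t x) * (W s x - W t x)"
  have C0: "C \<ge> 0" using taylor[of 1 0] by (auto intro: order_trans[OF abs_ge_zero])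
  have lim1: "((\<lambda>s. L2_inner \<Omega> (\<lambda>x. \<psi> (W t x)) (?DW s)) \<longlongrightarrow> L2_inner \<Omega> (\<lambda>x. \<psi> (W t x)) h) (at t within A)"
    using W mem L2_has_derivative_quotient_L2[OF W] W2 \<psi>W
    by (intro L2_inner_tendsto) (auto simp: L2_has_derivative_def elim!: eventually_mono)
  have dI: "integrable ?M (\<lambda>x. \<psi> (W t x) * (W s x - W t x))" if "s \<in> A" for s
    using that W2 \<psi>W by (intro L2_mult_integrable L2_diff) auto
  have RI: "integrable ?M (?R s)" if "s \<in> A" for s
    using that \<Psi>W W2(3) dI by (intro Bochner_Integration.integrable_diff) auto
  have lim2: "((\<lambda>s. (LINT x|?M. ?R s x) / (s - t)) \<longlongrightarrow> 0) (at t within A)"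
  proof (rule Lim_null_comparison)
    show "\<forall>\<^sub>F s in at t within A. norm ((LINT x|?M. ?R s x) / (s - t)) \<le> C * (L2_norm \<Omega> h + 1)\<^sup>2 * \<bar>s - t\<bar>"
      using mem L2_has_derivative_quotient_bounded[OF W]
    proof eventually_elim
      case (elim s)
      have d2: "(\<lambda>x. W s x - W t x) \<in> L2 \<Omega>" using elim W2 by (intro L2_diff) auto
      have "\<bar>LINT x|?M. ?R s x\<bar> \<le> (LINT x|?M. \<bar>?R s x\<bar>)" by (rule integral_abs_bound)
      also have "\<dots> \<le> (LINT x|?M. C * (W s x - W t x)\<^sup>2)"
        using RI elim L2_square_integrable[OF d2] taylor by (intro integral_mono) auto
      also have "\<dots> = C * (L2_norm \<Omega> (\<lambda>x. W s x - W t x))\<^sup>2" by (simp add: L2_norm_square_integral)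
      also have "\<dots> \<le> C * (\<bar>s - t\<bar> * (L2_norm \<Omega> h + 1))\<^sup>2"
        using elim C0 L2_norm_increment[of s t \<Omega> W]
        by (intro mult_left_mono power_mono) (auto intro: mult_left_mono)
      finally have "\<bar>LINT x|?M. ?R s x\<bar> / \<bar>s - t\<bar> \<le> C * (\<bar>s - t\<bar> * (L2_norm \<Omega> h + 1))\<^sup>2 / \<bar>s - t\<bar>"
        by (rule divide_right_mono) simp
      also have "\<dots> = C * (L2_norm \<Omega> h + 1)\<^sup>2 * \<bar>s - t\<bar>" using elim by (simp add: power_mult_distrib power2_eq_square)
      finally show ?case by (simp add: abs_divide)
    qed
    show "((\<lambda>s. C * (L2_norm \<Omega> h + 1)\<^sup>2 * \<bar>s - t\<bar>) \<longlongrightarrow> 0) (at t within A)"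
      by (auto intro!: tendsto_eq_intros)
  qed
  have "((\<lambda>s. L2_inner \<Omega> (\<lambda>x. \<psi> (W t x)) (?DW s) + (LINT x|?M. ?R s x) / (s - t)) \<longlongrightarrow> L2_inner \<Omega> (\<lambda>x. \<psi> (W t x)) h) (at t within A)"
    using tendsto_add[OF lim1 lim2] by simp
  moreover have "\<forall>\<^sub>F s in at t within A. L2_inner \<Omega> (\<lambda>x. \<psi> (W t x)) (?DW s) + (LINT x|?M. ?R s x) / (s - t)
      = ((LINT x|?M. \<Psi> (W s x)) - (LINT x|?M. \<Psi> (W t x))) / (s - t)"
    using mem
  proof eventually_elim
    case (elim s)
    have "(LINT x|?M. ?R s x) = (LINT x|?M. \<Psi> (W s x)) - (LINT x|?M. \<Psi> (W t x)) - L2_inner \<Omega> (\<lambda>x. \<psi> (W t x)) (\<lambda>x. W s x - W t x)"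
      using elim \<Psi>W W2(3) dI by (simp add: L2_inner_def)
    moreover have "L2_inner \<Omega> (\<lambda>x. \<psi> (W t x)) (?DW s) = L2_inner \<Omega> (\<lambda>x. \<psi> (W t x)) (\<lambda>x. W s x - W t x) / (s - t)"
      using L2_inner_cmult_right[of \<Omega> "\<lambda>x. \<psi> (W t x)" "1 / (s - t)" "\<lambda>x. W s x - W t x"] by simp
    ultimately show ?case by (simp flip: add_divide_distrib)
  qed
  ultimately show ?thesis
    unfolding has_field_derivative_iff by (rule Lim_transform_eventually)
qed

text \<open>Prepares the factor \<open>S (\<tau> - s) z\<close> in the proof of
  self-adjointness.\<close>

lemma L2_has_derivative_reverse:
  assumes W: "L2_has_derivative \<Omega> W h (\<tau> - t) {0..\<tau>}"
  shows "L2_has_derivative \<Omega> (\<lambda>s. W (\<tau> - s)) (\<lambda>x. - h x) t {0..\<tau>}"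
proof -
  have fl: "filterlim (\<lambda>s. \<tau> - s) (at (\<tau> - t) within {0..\<tau>}) (at t within {0..\<tau>})"
    unfolding filterlim_at
  proof
    show "((\<lambda>s. \<tau> - s) \<longlongrightarrow> \<tau> - t) (at t within {0..\<tau>})" by (intro tendsto_intros)
    show "\<forall>\<^sub>F s in at t within {0..\<tau>}. \<tau> - s \<in> {0..\<tau>} \<and> \<tau> - s \<noteq> \<tau> - t" by (auto simp: eventually_at_filter)
  qed
  have lim: "((\<lambda>s. L2_norm \<Omega> (\<lambda>x. (W s x - W (\<tau> - t) x) / (s - (\<tau> - t)) - h x)) \<longlongrightarrow> 0) (at (\<tau> - t) within {0..\<tau>})"
    using W by (simp add: L2_has_derivative_def)
  have "L2_norm \<Omega> (\<lambda>x. (W (\<tau> - s) x - W (\<tau> - t) x) / (\<tau> - s - (\<tau> - t)) - h x)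
      = L2_norm \<Omega> (\<lambda>x. (W (\<tau> - s) x - W (\<tau> - t) x) / (s - t) - - h x)" for s
  proof -
    have "(W (\<tau> - s) x - W (\<tau> - t) x) / (\<tau> - s - (\<tau> - t)) - h x = - ((W (\<tau> - s) x - W (\<tau> - t) x) / (s - t) - - h x)" for x
      using minus_divide_right[of "W (\<tau> - s) x - W (\<tau> - t) x" "s - t"] by simp
    then show ?thesis by (simp only: L2_norm_uminus)
  qed
  with filterlim_compose[OF lim fl] W show ?thesis
    unfolding L2_has_derivative_def by (auto intro: L2_uminus)
qed

lemma mean_value_within:
  assumes "0 \<le> a" "a < b" and der: "\<And>s. a \<le> s \<Longrightarrow> s \<le> b \<Longrightarrow> (f has_real_derivative f' s) (at s within A)"
    and "{a..b} \<subseteq> A"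
  obtains s where "a < s" "s < b" "f b - f a = (b - a) * f' s"
proof -
  have "\<exists>s\<in>{a<..<b}. f b - f a = f' s * (b - a)"
    using has_field_derivative_subset[OF der assms(4)]
    by (intro mvt_simple[OF assms(2)]) (auto simp: has_field_derivative_def)
  then show thesis using that by (auto simp: mult.commute)
qed

section \<open>The Neumann heat semigroup\<close>

locale neumann_semigroup =
  fixes \<Omega> :: "'a::euclidean_space set" and S :: "real \<Rightarrow> ('a \<Rightarrow> real) \<Rightarrow> ('a \<Rightarrow> real)"
  assumes dom: "smooth_bounded_domain \<Omega>" and unit_measure: "measure lebesgue \<Omega> = 1"
    and heat: "neumann_heat_semigroup \<Omega> S"
begin

abbreviation "nrm \<equiv> L2_norm \<Omega>"
abbreviation "ip \<equiv> L2_inner \<Omega>"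
abbreviation "M \<equiv> lebesgue_on \<Omega>"

section \<open>First consequences of the semigroup axioms\<close>

lemma domain: "open \<Omega>" "\<Omega> \<in> lmeasurable" "\<Omega> \<in> sets lebesgue"
  using dom by (auto simp: smooth_bounded_domain_def lmeasurable_open)

lemma C0: "L2_C0_semigroup \<Omega> S"
  using heat by (simp add: neumann_heat_semigroup_def)

lemma generator_iff: "L2_generator \<Omega> S w h \<longleftrightarrow> neumann_laplacian \<Omega> w h"
  using heat by (simp add: neumann_heat_semigroup_def)

lemma S_L2: "t \<ge> 0 \<Longrightarrow> w \<in> L2 \<Omega> \<Longrightarrow> S t w \<in> L2 \<Omega>"
  using C0 by (simp add: L2_C0_semigroup_def)

lemma S_lincomb: "t \<ge> 0 \<Longrightarrow> w \<in> L2 \<Omega> \<Longrightarrow> z \<in> L2 \<Omega> \<Longrightarrow>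
    AE x in M. S t (\<lambda>y. a * w y + b * z y) x = a * S t w x + b * S t z x"
  using C0 unfolding L2_C0_semigroup_def by blast

lemma S_0: "w \<in> L2 \<Omega> \<Longrightarrow> AE x in M. S 0 w x = w x"
  using C0 unfolding L2_C0_semigroup_def by blast

lemma S_add_time: "s \<ge> 0 \<Longrightarrow> t \<ge> 0 \<Longrightarrow> w \<in> L2 \<Omega> \<Longrightarrow> AE x in M. S (s + t) w x = S s (S t w) x"
  using C0 unfolding L2_C0_semigroup_def by blast

lemma S_continuous_0: "w \<in> L2 \<Omega> \<Longrightarrow> ((\<lambda>t. nrm (\<lambda>x. S t w x - w x)) \<longlongrightarrow> 0) (at_right 0)"
  using C0 unfolding L2_C0_semigroup_def by blast

lemma S_bounded: "t \<ge> 0 \<Longrightarrow> \<exists>C. \<forall>w\<in>L2 \<Omega>. nrm (S t w) \<le> C * nrm w"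
  using C0 unfolding L2_C0_semigroup_def by blast

lemma nrm_cong: "w \<in> L2 \<Omega> \<Longrightarrow> z \<in> L2 \<Omega> \<Longrightarrow> AE x in M. w x = z x \<Longrightarrow> nrm w = nrm z"
  by (intro L2_norm_cong_AE L2_measurable)

lemma S_diff: "t \<ge> 0 \<Longrightarrow> w \<in> L2 \<Omega> \<Longrightarrow> z \<in> L2 \<Omega> \<Longrightarrow>
    AE x in M. S t (\<lambda>y. w y - z y) x = S t w x - S t z x"
  using S_lincomb[of t w z 1 "-1"] by simp

lemma S_cmult: "t \<ge> 0 \<Longrightarrow> w \<in> L2 \<Omega> \<Longrightarrow> AE x in M. S t (\<lambda>y. c * w y) x = c * S t w x"
  using S_lincomb[of t w w c 0] by simp

lemma S_add: "t \<ge> 0 \<Longrightarrow> w \<in> L2 \<Omega> \<Longrightarrow> z \<in> L2 \<Omega> \<Longrightarrow>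
    AE x in M. S t (\<lambda>y. w y + z y) x = S t w x + S t z x"
  using S_lincomb[of t w z 1 1] by simp

lemma nrm_S_diff: "t \<ge> 0 \<Longrightarrow> w \<in> L2 \<Omega> \<Longrightarrow> z \<in> L2 \<Omega> \<Longrightarrow>
    nrm (\<lambda>x. S t w x - S t z x) = nrm (S t (\<lambda>x. w x - z x))"
  using S_diff[of t w z] by (intro nrm_cong L2_diff S_L2) auto

text \<open>The axioms bound each \<open>S t\<close> separately, with no uniformity in
  \<open>t\<close>. If uniformity failed near 0, the norms would be unbounded along some times
  tending to 0; but strong continuity at 0 makes every single orbit bounded along these times, which
  contradicts the uniform boundedness principle.\<close>

lemma S_locally_bounded: "\<exists>\<delta>>0. \<exists>C\<ge>1. \<forall>t. 0 \<le> t \<and> t \<le> \<delta> \<longrightarrow> (\<forall>w\<in>L2 \<Omega>. nrm (S t w) \<le> C * nrm w)"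
proof (rule ccontr)
  assume neg: "\<not> ?thesis"
  have "\<exists>t w. 0 \<le> t \<and> t \<le> 1 / real (Suc n) \<and> w \<in> L2 \<Omega> \<and> nrm (S t w) > real (Suc n) * nrm w" for n
  proof (rule ccontr)
    assume a: "\<not> ?thesis"
    have "\<forall>t. 0 \<le> t \<and> t \<le> 1 / real (Suc n) \<longrightarrow> (\<forall>w\<in>L2 \<Omega>. nrm (S t w) \<le> real (Suc n) * nrm w)"
      using a not_less by blast
    moreover have "1 / real (Suc n) > 0" "real (Suc n) \<ge> 1" by simp_all
    ultimately show False using neg by blast
  qed
  then obtain t v where tv: "\<And>n. 0 \<le> t n" "\<And>n. t n \<le> 1 / real (Suc n)" "\<And>n. v n \<in> L2 \<Omega>"
    "\<And>n. nrm (S (t n) (v n)) > real (Suc n) * nrm (v n)" by metis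
  have t0: "t \<longlonglongrightarrow> 0"
    by (rule tendsto_sandwich[OF _ _ tendsto_const LIMSEQ_Suc[OF lim_1_over_n, unfolded o_def]])
       (use tv(1,2) in \<open>auto intro!: always_eventually\<close>)
  have "\<exists>C. \<forall>k. \<forall>w\<in>L2 \<Omega>. nrm (S (t k) w) \<le> C * nrm w"
  proof (rule L2_uniform_boundedness)
    fix k w z assume w: "w \<in> L2 \<Omega>" and z: "z \<in> L2 \<Omega>"
    have "nrm (S (t k) (\<lambda>x. w x + z x)) = nrm (\<lambda>x. S (t k) w x + S (t k) z x)"
      using w z tv(1) S_add[of "t k" w z] by (intro nrm_cong L2_add S_L2) auto
    also have "\<dots> \<le> nrm (S (t k) w) + nrm (S (t k) z)" using w z tv(1) by (intro L2_norm_triangle S_L2)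
    finally show "nrm (S (t k) (\<lambda>x. w x + z x)) \<le> nrm (S (t k) w) + nrm (S (t k) z)" .
  next
    fix k w and c :: real assume w: "w \<in> L2 \<Omega>"
    have "nrm (S (t k) (\<lambda>x. c * w x)) = nrm (\<lambda>x. c * S (t k) w x)"
      using w tv(1) S_cmult[of "t k" w c] by (intro nrm_cong L2_cmult S_L2) auto
    then show "nrm (S (t k) (\<lambda>x. c * w x)) = \<bar>c\<bar> * nrm (S (t k) w)" by (simp add: L2_norm_cmult)
  next
    fix k show "\<exists>C. \<forall>w\<in>L2 \<Omega>. nrm (S (t k) w) \<le> C * nrm w" using S_bounded[OF tv(1)] .
  next
    fix w assume w: "w \<in> L2 \<Omega>"
    have "\<forall>\<^sub>F s in at_right 0. nrm (\<lambda>x. S s w x - w x) < 1"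
      using order_tendstoD(2)[OF S_continuous_0[OF w], of 1] by simp
    then obtain d where d: "d > 0" "\<And>s. 0 < s \<Longrightarrow> s < d \<Longrightarrow> nrm (\<lambda>x. S s w x - w x) < 1"
      by (auto simp: eventually_at_right[of 0 1])
    have small: "nrm (S s w) \<le> nrm w + 1" if "0 \<le> s" "s < d" for s
    proof (cases "s = 0")
      case True
      then show ?thesis using nrm_cong[OF S_L2[OF _ w] w S_0[OF w]] by simp
    next
      case False
      then show ?thesis using d(2)[of s] that L2_norm_triangle_le[OF S_L2[OF that(1) w] w] by simp
    qed
    have "\<forall>\<^sub>F n in sequentially. t n < d" using order_tendstoD(2)[OF t0 d(1)] .
    then obtain n0 where n0: "\<And>n. n \<ge> n0 \<Longrightarrow> t n < d" by (auto simp: eventually_sequentially)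
    \<comment> \<open>The sum takes care of the finitely many times that are not yet close to
      0.\<close>
    define B where "B = nrm w + 1 + (\<Sum>n<n0. nrm (S (t n) w))"
    have "nrm (S (t n) w) \<le> B" for n
    proof (cases "n \<ge> n0")
      case True
      then show ?thesis using small[OF tv(1) n0[OF True]] sum_nonneg[of "{..<n0}" "\<lambda>n. nrm (S (t n) w)"] by (simp add: B_def)
    next
      case False
      then have "nrm (S (t n) w) \<le> (\<Sum>n<n0. nrm (S (t n) w))" by (intro member_le_sum) auto
      then show ?thesis unfolding B_def using L2_norm_nonneg[of \<Omega> w] by linarith
    qed
    then show "\<exists>B. \<forall>k. nrm (S (t k) w) \<le> B" by blast
  qed
  then obtain C where C: "\<And>k w. w \<in> L2 \<Omega> \<Longrightarrow> nrm (S (t k) w) \<le> C * nrm w" by blast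
  obtain n where n: "real n \<ge> C" using real_arch_simple by blast
  have "C * nrm (v n) \<le> real (Suc n) * nrm (v n)" using n by (intro mult_right_mono) auto
  then show False using C[OF tv(3), of n n] tv(4)[of n] by linarith
qed

text \<open>Steps of length \<open>\<delta>\<close> multiply the bound by \<open>C\<close> each. The
  resulting exponential bound is crude; it is replaced by a contraction once the energy is
  available.\<close>

lemma S_bounded_on: "\<exists>C\<ge>1. \<forall>t. 0 \<le> t \<and> t \<le> \<tau> \<longrightarrow> (\<forall>w\<in>L2 \<Omega>. nrm (S t w) \<le> C * nrm w)"
proof -
  obtain \<delta> C where \<delta>: "\<delta> > 0" "C \<ge> 1" "\<And>t w. 0 \<le> t \<Longrightarrow> t \<le> \<delta> \<Longrightarrow> w \<in> L2 \<Omega> \<Longrightarrow> nrm (S t w) \<le> C * nrm w"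
    using S_locally_bounded by blast
  have step: "nrm (S t w) \<le> C ^ n * nrm w" if "0 \<le> t" "t \<le> real n * \<delta>" "w \<in> L2 \<Omega>" for n t w
    using that
  proof (induction n arbitrary: t)
    case 0
    then show ?case using nrm_cong[OF S_L2[OF _ 0(3)] 0(3) S_0[OF 0(3)]] by simp
  next
    case (Suc n)
    show ?case
    proof (cases "t \<le> \<delta>")
      case True
      have "nrm (S t w) \<le> C * nrm w" using \<delta>(3) Suc.prems True by blast
      also have "\<dots> \<le> C ^ Suc n * nrm w" using \<delta>(2) by (intro mult_right_mono) (auto simp: power_increasing[of 1 "Suc n" C, simplified])
      finally show ?thesis .
    next
      case False
      define r where "r = t - \<delta>"
      have r: "0 \<le> r" "r \<le> real n * \<delta>" "t = \<delta> + r" using False Suc.prems by (auto simp: r_def algebra_simps)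
      have Sr: "S r w \<in> L2 \<Omega>" by (rule S_L2[OF r(1) Suc.prems(3)])
      have "nrm (S t w) = nrm (S \<delta> (S r w))"
        unfolding r(3) using S_add_time[of \<delta> r w] \<delta>(1) r Suc.prems by (intro nrm_cong S_L2) auto
      also have "\<dots> \<le> C * nrm (S r w)" using \<delta> Sr by simp
      also have "\<dots> \<le> C * (C ^ n * nrm w)" using Suc.IH[OF r(1,2) Suc.prems(3)] \<delta>(2) by (intro mult_left_mono) auto
      finally show ?thesis by simp
    qed
  qed
  obtain n :: nat where n: "\<tau> < real n * \<delta>" using ex_less_of_nat_mult[OF \<delta>(1)] by blast
  show ?thesis
    by (intro exI[of _ "C ^ n"] conjI allI impI ballI step) (use n \<delta>(2) in auto)
qed

lemma generatorD: "L2_generator \<Omega> S w h \<Longrightarrow> w \<in> L2 \<Omega>" "L2_generator \<Omega> S w h \<Longrightarrow> h \<in> L2 \<Omega>"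
  by (auto simp: L2_generator_def)

lemma S_quotient:
  assumes t: "t \<ge> 0" and k: "k > 0" and w: "w \<in> L2 \<Omega>" and h: "h \<in> L2 \<Omega>"
  shows "AE x in M. S t (\<lambda>x. (S k w x - w x) / k - h x) x = (S (t + k) w x - S t w x) / k - S t h x"
proof -
  have k2: "S k w \<in> L2 \<Omega>" using k w by (intro S_L2) auto
  have q2: "(\<lambda>x. 1 / k * S k w x + (- 1 / k) * w x) \<in> L2 \<Omega>" using k2 w by (intro L2_add L2_cmult)
  have eq: "(\<lambda>x. (S k w x - w x) / k - h x) = (\<lambda>x. 1 * (1 / k * S k w x + (- 1 / k) * w x) + (- 1) * h x)"
    by (simp add: diff_divide_distrib)
  have "AE x in M. S t (\<lambda>x. 1 / k * S k w x + (- 1 / k) * w x) x = 1 / k * S t (S k w) x + (- 1 / k) * S t w x"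
    by (rule S_lincomb[OF t k2 w])
  moreover have "AE x in M. S (t + k) w x = S t (S k w) x" using t k w by (intro S_add_time) auto
  ultimately show ?thesis
    using S_lincomb[OF t q2 h, of 1 "-1"] unfolding eq[symmetric]
    by eventually_elim (simp add: diff_divide_distrib)
qed

text \<open>\<open>S t\<close> commutes with the difference quotients at 0 and is bounded, so it
  maps the domain into itself. The energy identity thereby becomes available at every time, not just
  at 0.\<close>

lemma generator_S:
  assumes g: "L2_generator \<Omega> S w h" and t: "t \<ge> 0"
  shows "L2_generator \<Omega> S (S t w) (S t h)"
proof -
  have w: "w \<in> L2 \<Omega>" and h: "h \<in> L2 \<Omega>" using generatorD[OF g] by auto
  obtain C where C: "\<And>w. w \<in> L2 \<Omega> \<Longrightarrow> nrm (S t w) \<le> C * nrm w" using S_bounded[OF t] by blast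
  let ?Q = "\<lambda>k x. (S k w x - w x) / k - h x"
  have Q: "((\<lambda>k. nrm (?Q k)) \<longlongrightarrow> 0) (at_right 0)" using g by (simp add: L2_generator_def)
  have "((\<lambda>k. nrm (\<lambda>x. (S k (S t w) x - S t w x) / k - S t h x)) \<longlongrightarrow> 0) (at_right 0)"
  proof (rule Lim_null_comparison)
    show "\<forall>\<^sub>F k in at_right 0. norm (nrm (\<lambda>x. (S k (S t w) x - S t w x) / k - S t h x)) \<le> C * nrm (?Q k)"
      using eventually_at_right_less[of 0]
    proof eventually_elim
      case (elim k)
      have Q2: "?Q k \<in> L2 \<Omega>" using elim w h by (intro L2_diff L2_divide S_L2) auto
      have "AE x in M. S (k + t) w x = S k (S t w) x" using t elim w by (intro S_add_time) auto
      with S_quotient[OF t elim w h]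
      have "AE x in M. (S k (S t w) x - S t w x) / k - S t h x = S t (?Q k) x"
        by eventually_elim (simp add: add.commute)
      then have "nrm (\<lambda>x. (S k (S t w) x - S t w x) / k - S t h x) = nrm (S t (?Q k))"
        using elim w h t Q2 by (intro nrm_cong L2_diff L2_divide S_L2) auto
      then show ?case using C[OF Q2] by simp
    qed
    show "((\<lambda>k. C * nrm (?Q k)) \<longlongrightarrow> 0) (at_right 0)" using Q by (auto intro!: tendsto_eq_intros)
  qed
  then show ?thesis using S_L2[OF t w] S_L2[OF t h] by (simp add: L2_generator_def)
qed

text \<open>The generator provides only the right derivative at 0. To the right of \<open>t\<close>
  one factors out \<open>S t\<close>. To the left one factors out \<open>S s\<close>, whose argument
  moves, so local uniform boundedness is needed, and a second error \<open>S s (S k h - h)\<close>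
  appears that strong continuity controls.\<close>

lemma S_has_derivative:
  assumes g: "L2_generator \<Omega> S w h" and t: "t \<ge> 0"
  shows "L2_has_derivative \<Omega> (\<lambda>s. S s w) (S t h) t {0..}"
proof -
  have w: "w \<in> L2 \<Omega>" and h: "h \<in> L2 \<Omega>" using generatorD[OF g] by auto
  obtain C where C: "C \<ge> 1" "\<And>s w. 0 \<le> s \<Longrightarrow> s \<le> t \<Longrightarrow> w \<in> L2 \<Omega> \<Longrightarrow> nrm (S s w) \<le> C * nrm w"
    using S_bounded_on[of t] by blast
  let ?Q = "\<lambda>k x. (S k w x - w x) / k - h x" and ?H = "\<lambda>k x. S k h x - h x"
  have Q: "((\<lambda>k. nrm (?Q k)) \<longlongrightarrow> 0) (at_right 0)" using g by (simp add: L2_generator_def)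
  have H: "((\<lambda>k. nrm (?H k)) \<longlongrightarrow> 0) (at_right 0)" by (rule S_continuous_0[OF h])
  have fl: "filterlim (\<lambda>s. \<bar>s - t\<bar>) (at_right 0) (at t within {0..})"
    unfolding filterlim_at
  proof
    have "((\<lambda>s. \<bar>s - t\<bar>) \<longlongrightarrow> \<bar>t - t\<bar>) (at t within {0..})" by (intro tendsto_intros)
    then show "((\<lambda>s. \<bar>s - t\<bar>) \<longlongrightarrow> 0) (at t within {0..})" by simp
    show "\<forall>\<^sub>F s in at t within {0..}. \<bar>s - t\<bar> \<in> {0<..} \<and> \<bar>s - t\<bar> \<noteq> 0" by (auto simp: eventually_at_filter)
  qed
  have lim: "((\<lambda>s. C * nrm (?Q \<bar>s - t\<bar>) + C * nrm (?H \<bar>s - t\<bar>)) \<longlongrightarrow> 0) (at t within {0..})"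
    using filterlim_compose[OF Q fl] filterlim_compose[OF H fl] by (auto intro!: tendsto_eq_intros)
  have mem: "\<forall>\<^sub>F s in at t within {0..}. 0 \<le> s \<and> s \<noteq> t" by (auto simp: eventually_at_filter)
  have "((\<lambda>s. nrm (\<lambda>x. (S s w x - S t w x) / (s - t) - S t h x)) \<longlongrightarrow> 0) (at t within {0..})"
  proof (rule Lim_null_comparison[OF _ lim])
    show "\<forall>\<^sub>F s in at t within {0..}. norm (nrm (\<lambda>x. (S s w x - S t w x) / (s - t) - S t h x)) \<le> C * nrm (?Q \<bar>s - t\<bar>) + C * nrm (?H \<bar>s - t\<bar>)"
      using mem
    proof eventually_elim
      case (elim s)
      define k where "k = \<bar>s - t\<bar>"
      have k: "k > 0" using elim by (simp add: k_def)
      have Q2: "?Q k \<in> L2 \<Omega>" using k w h by (intro L2_diff L2_divide S_L2) auto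
      have H2: "?H k \<in> L2 \<Omega>" using k h by (intro L2_diff S_L2) auto
      have L2a: "(\<lambda>x. (S s w x - S t w x) / (s - t) - S t h x) \<in> L2 \<Omega>"
        using elim t w h by (intro L2_diff L2_divide S_L2) auto
      have Cn: "0 \<le> C * nrm (?H k)" using C(1) by simp
      show ?case
      proof (cases "s > t")
        case True
        then have s: "s = t + k" by (simp add: k_def)
        have "nrm (\<lambda>x. (S s w x - S t w x) / (s - t) - S t h x) = nrm (S t (?Q k))"
          using S_quotient[OF t k w h] L2a Q2 t unfolding s by (intro nrm_cong S_L2) auto
        also have "\<dots> \<le> C * nrm (?Q k)" using C(2) t Q2 by blast
        finally show ?thesis using Cn by (simp add: k_def)
      next
        case False
        then have st: "t = s + k" "0 \<le> s" "s \<le> t" using elim by (auto simp: k_def)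
        have "AE x in M. S (s + k) h x = S s (S k h) x" using k st h by (intro S_add_time) auto
        moreover have "AE x in M. S s (?H k) x = S s (S k h) x - S s h x"
          using k st h by (intro S_diff S_L2) auto
        ultimately have "AE x in M. (S s w x - S t w x) / (s - t) - S t h x = S s (?Q k) x - S s (?H k) x"
          using S_quotient[OF st(2) k w h] unfolding st(1)
        proof eventually_elim
          case (elim x)
          have "(S s w x - S (s + k) w x) / (s - (s + k)) = (S (s + k) w x - S s w x) / k"
            using k by (simp add: field_simps)
          then show ?case using elim by simp
        qed
        then have "nrm (\<lambda>x. (S s w x - S t w x) / (s - t) - S t h x) = nrm (\<lambda>x. S s (?Q k) x - S s (?H k) x)"
          by (intro nrm_cong[OF L2a] L2_diff[OF S_L2[OF st(2) Q2] S_L2[OF st(2) H2]])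
        also have "\<dots> \<le> nrm (S s (?Q k)) + nrm (S s (?H k))" using Q2 H2 st by (intro L2_norm_triangle_diff S_L2)
        also have "\<dots> \<le> C * nrm (?Q k) + C * nrm (?H k)" using C(2) st Q2 H2 by (intro add_mono) auto
        finally show ?thesis by (simp add: k_def)
      qed
    qed
  qed
  then show ?thesis unfolding L2_has_derivative_def using S_L2 w h t by auto
qed

section \<open>Energy, contraction and self-adjointness\<close>

lemma generator_energy:
  assumes "L2_generator \<Omega> S w h"
  obtains G where "H1_gradient \<Omega> w G"
    "\<And>\<phi> \<Phi>. H1_gradient \<Omega> \<phi> \<Phi> \<Longrightarrow> ip h \<phi> = - (LINT x|M. G x \<bullet> \<Phi> x)"
    "ip h w = - (nrm (\<lambda>x. norm (G x)))\<^sup>2"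
proof -
  obtain G where G: "H1_gradient \<Omega> w G"
    "\<And>\<phi> \<Phi>. H1_gradient \<Omega> \<phi> \<Phi> \<Longrightarrow> (LINT x|M. G x \<bullet> \<Phi> x) = - ip h \<phi>"
    using assms unfolding generator_iff neumann_laplacian_def L2_inner_def by blast
  have "ip h w = - (nrm (\<lambda>x. norm (G x)))\<^sup>2"
    using G(2)[OF G(1)] by (simp add: L2_norm_square_integral power2_norm_eq_inner)
  with G show thesis by (intro that[of G]) auto
qed

lemma generator_symmetric:
  assumes g: "L2_generator \<Omega> S w h" and g': "L2_generator \<Omega> S z k"
  shows "ip h z = ip w k"
proof -
  obtain G where G: "H1_gradient \<Omega> w G" "\<And>\<phi> \<Phi>. H1_gradient \<Omega> \<phi> \<Phi> \<Longrightarrow> ip h \<phi> = - (LINT x|M. G x \<bullet> \<Phi> x)"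
    using generator_energy[OF g] by metis
  obtain G' where G': "H1_gradient \<Omega> z G'" "\<And>\<phi> \<Phi>. H1_gradient \<Omega> \<phi> \<Phi> \<Longrightarrow> ip k \<phi> = - (LINT x|M. G' x \<bullet> \<Phi> x)"
    using generator_energy[OF g'] by metis
  show ?thesis using G(2)[OF G'(1)] G'(2)[OF G(1)] by (simp add: L2_inner_commute[of \<Omega> w k] inner_commute)
qed

lemma generator_test_function: "test_function \<Omega> \<phi> \<Longrightarrow> \<exists>h. L2_generator \<Omega> S \<phi> h"
  using neumann_laplacian_test_function domain by (simp add: generator_iff)

lemma generator_const: "L2_generator \<Omega> S (\<lambda>x. c) (\<lambda>x. 0)"
  using neumann_laplacian_const domain by (simp add: generator_iff)

lemma generator_dense:
  assumes "w \<in> L2 \<Omega>" "e > 0"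
  obtains \<phi> h where "L2_generator \<Omega> S \<phi> h" "\<phi> \<in> L2 \<Omega>" "nrm (\<lambda>x. w x - \<phi> x) < e"
  using test_functions_dense_L2[OF domain(2,1) assms] generator_test_function generatorD by metis

lemma energy_derivative:
  assumes g: "L2_generator \<Omega> S w h" and t: "t \<ge> 0"
  obtains G where "H1_gradient \<Omega> (S t w) G"
    "((\<lambda>s. (nrm (S s w))\<^sup>2) has_real_derivative - 2 * (nrm (\<lambda>x. norm (G x)))\<^sup>2) (at t within {0..})"
proof -
  obtain G where G: "H1_gradient \<Omega> (S t w) G" "ip (S t h) (S t w) = - (nrm (\<lambda>x. norm (G x)))\<^sup>2"
    using generator_energy[OF generator_S[OF g t]] by metis
  have "((\<lambda>s. ip (S s w) (S s w)) has_real_derivative (ip (S t h) (S t w) + ip (S t w) (S t h))) (at t within {0..})"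
    by (intro L2_inner_has_derivative S_has_derivative g t)
  then have "((\<lambda>s. (nrm (S s w))\<^sup>2) has_real_derivative - 2 * (nrm (\<lambda>x. norm (G x)))\<^sup>2) (at t within {0..})"
    unfolding L2_norm_square[of \<Omega> "S _ w"] by (simp add: G(2) L2_inner_commute[of \<Omega> "S t w"])
  with G(1) show thesis by (rule that)
qed

text \<open>Produces a time \<open>s\<close> between \<open>a\<close> and \<open>b\<close> at which
  the Dirichlet energy equals its average, as measured by the drop of the squared norm. Contraction,
  smoothing and decay all use this one intermediate time, and the energy never has to be integrated
  over time.\<close>

lemma energy_mean_value:
  assumes g: "L2_generator \<Omega> S w h" and ab: "0 \<le> a" "a < b"
  obtains s G where "a < s" "s < b" "H1_gradient \<Omega> (S s w) G"
    "(nrm (S b w))\<^sup>2 - (nrm (S a w))\<^sup>2 = - 2 * (b - a) * (nrm (\<lambda>x. norm (G x)))\<^sup>2"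
proof -
  have "\<forall>t\<in>{0..}. \<exists>G. H1_gradient \<Omega> (S t w) G \<and>
    ((\<lambda>s. (nrm (S s w))\<^sup>2) has_real_derivative - 2 * (nrm (\<lambda>x. norm (G x)))\<^sup>2) (at t within {0..})"
    using energy_derivative[OF g] by (metis atLeast_iff)
  from bchoice[OF this] obtain G where G: "\<And>t. t \<ge> 0 \<Longrightarrow> H1_gradient \<Omega> (S t w) (G t)"
    "\<And>t. t \<ge> 0 \<Longrightarrow> ((\<lambda>s. (nrm (S s w))\<^sup>2) has_real_derivative - 2 * (nrm (\<lambda>x. norm (G t x)))\<^sup>2) (at t within {0..})"
    by auto
  have der: "\<And>s. a \<le> s \<Longrightarrow> s \<le> b \<Longrightarrow> ((\<lambda>s. (nrm (S s w))\<^sup>2) has_real_derivative - 2 * (nrm (\<lambda>x. norm (G s x)))\<^sup>2) (at s within {0..})"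
    using G(2) ab by auto
  obtain s where s: "a < s" "s < b" "(nrm (S b w))\<^sup>2 - (nrm (S a w))\<^sup>2 = (b - a) * (- 2 * (nrm (\<lambda>x. norm (G s x)))\<^sup>2)"
    by (rule mean_value_within[OF ab der]) (use ab in auto)
  have "s \<ge> 0" using s(1) ab(1) by simp
  moreover have "(nrm (S b w))\<^sup>2 - (nrm (S a w))\<^sup>2 = - 2 * (b - a) * (nrm (\<lambda>x. norm (G s x)))\<^sup>2"
    using s(3) by (simp add: algebra_simps)
  ultimately show thesis by (intro that[OF s(1,2) G(1)])
qed

text \<open>For data in the domain the squared norm has a nonpositive derivative.\<close>

lemma S_contraction:
  assumes w: "w \<in> L2 \<Omega>" and t: "t \<ge> 0"
  shows "nrm (S t w) \<le> nrm w"
proof -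
  have core: "nrm (S t \<phi>) \<le> nrm \<phi>" if g: "L2_generator \<Omega> S \<phi> h" for \<phi> h
  proof -
    have \<phi>: "\<phi> \<in> L2 \<Omega>" using generatorD[OF g] by auto
    have S0: "nrm (S 0 \<phi>) = nrm \<phi>" using nrm_cong[OF S_L2 \<phi> S_0[OF \<phi>]] \<phi> by simp
    show ?thesis
    proof (cases "t = 0")
      case False
      then have "0 < t" using t by simp
      obtain s G where "0 < s" "s < t" "H1_gradient \<Omega> (S s \<phi>) G"
        and eq: "(nrm (S t \<phi>))\<^sup>2 - (nrm (S 0 \<phi>))\<^sup>2 = - 2 * (t - 0) * (nrm (\<lambda>x. norm (G x)))\<^sup>2"
        by (rule energy_mean_value[OF g order_refl \<open>0 < t\<close>])
      have "- 2 * (t - 0) * (nrm (\<lambda>x. norm (G x)))\<^sup>2 \<le> 0" using t by (intro mult_nonpos_nonneg) auto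
      then have "(nrm (S t \<phi>))\<^sup>2 \<le> (nrm (S 0 \<phi>))\<^sup>2" using eq by linarith
      then have "(nrm (S t \<phi>))\<^sup>2 \<le> (nrm \<phi>)\<^sup>2" by (simp only: S0)
      then show ?thesis by (rule power2_le_imp_le) simp
    qed (simp add: S0)
  qed
  \<comment> \<open>Passing to general data needs some bound for \<open>S t\<close> applied to the
    approximation error; the contraction being proved is not yet available there.\<close>
  obtain C where C: "C \<ge> 1" "\<And>w. w \<in> L2 \<Omega> \<Longrightarrow> nrm (S t w) \<le> C * nrm w"
    using S_bounded_on[of t] t by blast
  show ?thesis
  proof (rule field_le_epsilon)
    fix e :: real assume e: "e > 0"
    then have e': "e / (C + 1) > 0" using C(1) by simp
    obtain \<phi> h where \<phi>: "L2_generator \<Omega> S \<phi> h" "\<phi> \<in> L2 \<Omega>" "nrm (\<lambda>x. w x - \<phi> x) < e / (C + 1)"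
      using generator_dense[OF w e'] by metis
    have "nrm (S t w) \<le> nrm (S t \<phi>) + nrm (\<lambda>x. S t w x - S t \<phi> x)"
      by (rule L2_norm_triangle_le[OF S_L2[OF t w] S_L2[OF t \<phi>(2)]])
    also have "nrm (\<lambda>x. S t w x - S t \<phi> x) = nrm (S t (\<lambda>x. w x - \<phi> x))" by (rule nrm_S_diff[OF t w \<phi>(2)])
    also have "\<dots> \<le> C * nrm (\<lambda>x. w x - \<phi> x)" by (rule C(2)[OF L2_diff[OF w \<phi>(2)]])
    also have "nrm (S t \<phi>) \<le> nrm \<phi>" by (rule core[OF \<phi>(1)])
    also have "nrm \<phi> \<le> nrm w + nrm (\<lambda>x. w x - \<phi> x)"
      using L2_norm_triangle_le[OF \<phi>(2) w] L2_norm_diff_commute[of \<Omega> w \<phi>] by simp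
    finally have "nrm (S t w) \<le> nrm w + (C + 1) * nrm (\<lambda>x. w x - \<phi> x)" by (simp add: algebra_simps)
    also have "(C + 1) * nrm (\<lambda>x. w x - \<phi> x) \<le> (C + 1) * (e / (C + 1))" using \<phi>(3) C(1) by (intro mult_left_mono) auto
    also have "\<dots> = e" using C(1) by simp
    finally show "nrm (S t w) \<le> nrm w + e" by simp
  qed
qed

lemma S_diff_contraction:
  "t \<ge> 0 \<Longrightarrow> w \<in> L2 \<Omega> \<Longrightarrow> z \<in> L2 \<Omega> \<Longrightarrow> nrm (\<lambda>x. S t w x - S t z x) \<le> nrm (\<lambda>x. w x - z x)"
  using nrm_S_diff S_contraction[OF L2_diff] by simp

text \<open>The pairing of \<open>S s w\<close> with \<open>S (\<tau> - s) z\<close> has derivative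
  0 in \<open>s\<close>, because the Neumann Laplacian is symmetric. Comparing its values at
  \<open>s = 0\<close> and \<open>s = \<tau>\<close> gives the identity.\<close>

lemma S_self_adjoint_generator:
  assumes g: "L2_generator \<Omega> S w h" and g': "L2_generator \<Omega> S z k" and \<tau>: "\<tau> \<ge> 0"
  shows "ip (S \<tau> w) z = ip w (S \<tau> z)"
proof (cases "\<tau> = 0")
  case True
  have "w \<in> L2 \<Omega>" "z \<in> L2 \<Omega>" using generatorD g g' by auto
  then show ?thesis
    using True S_0[of w] S_0[of z] L2_inner_cong_AE[of "S 0 w" \<Omega> w z] L2_inner_cong_AE[of "S 0 z" \<Omega> z w] S_L2[of 0]
    by (simp add: L2_inner_commute[of \<Omega> w])
next
  case False
  have wz: "w \<in> L2 \<Omega>" "z \<in> L2 \<Omega>" using generatorD g g' by auto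
  have der: "((\<lambda>s. ip (S s w) (S (\<tau> - s) z)) has_real_derivative 0) (at t within {0..\<tau>})" if t: "0 \<le> t" "t \<le> \<tau>" for t
  proof -
    have sub: "L2_has_derivative \<Omega> (\<lambda>s. S s y) d r {0..\<tau>}" if "L2_has_derivative \<Omega> (\<lambda>s. S s y) d r {0..}" "0 \<le> r" "r \<le> \<tau>" for y d r
      using that unfolding L2_has_derivative_def
      by (auto intro: tendsto_within_subset)
    have 1: "L2_has_derivative \<Omega> (\<lambda>s. S s w) (S t h) t {0..\<tau>}"
      by (rule sub[OF S_has_derivative[OF g]]) (use t in auto)
    have 2: "L2_has_derivative \<Omega> (\<lambda>s. S (\<tau> - s) z) (\<lambda>x. - S (\<tau> - t) k x) t {0..\<tau>}"
      by (rule L2_has_derivative_reverse[OF sub[OF S_has_derivative[OF g']]]) (use t in auto)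
    have "ip (S t h) (S (\<tau> - t) z) = ip (S t w) (S (\<tau> - t) k)"
      using t by (intro generator_symmetric generator_S g g') auto
    moreover have "ip (S t w) (\<lambda>x. - S (\<tau> - t) k x) = - ip (S t w) (S (\<tau> - t) k)" by (simp add: L2_inner_def)
    ultimately show ?thesis using L2_inner_has_derivative[OF 1 2] by simp
  qed
  obtain s where "ip (S \<tau> w) (S (\<tau> - \<tau>) z) - ip (S 0 w) (S (\<tau> - 0) z) = (\<tau> - 0) * (0::real)"
    by (rule mean_value_within[OF order_refl _ der order_refl]) (use False \<tau> in auto)
  then have "ip (S \<tau> w) (S 0 z) = ip (S 0 w) (S \<tau> z)" by simp
  moreover have "ip (S 0 z) (S \<tau> w) = ip z (S \<tau> w)" "ip (S 0 w) (S \<tau> z) = ip w (S \<tau> z)"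
    using wz \<tau> S_0 by (auto intro!: L2_inner_cong_AE S_L2)
  ultimately show ?thesis by (simp add: L2_inner_commute[of \<Omega> "S \<tau> w"])
qed

lemma S_self_adjoint:
  assumes w: "w \<in> L2 \<Omega>" and z: "z \<in> L2 \<Omega>" and t: "t \<ge> 0"
  shows "ip (S t w) z = ip w (S t z)"
proof -
  \<comment> \<open>Extension in the first argument for fixed second argument. It is used twice with
    the roles exchanged: first with the second argument in the domain, then without
    restriction.\<close>
  have ext: "ip (S t w) z = ip w (S t z)" if w: "w \<in> L2 \<Omega>" and z: "z \<in> L2 \<Omega>"
    and core: "\<And>\<phi> h. L2_generator \<Omega> S \<phi> h \<Longrightarrow> ip (S t \<phi>) z = ip \<phi> (S t z)" for w z
  proof -
    have "\<bar>ip (S t w) z - ip w (S t z)\<bar> \<le> 0 + e" if e: "e > 0" for e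
    proof -
      have e': "e / (2 * nrm z + 1) > 0" using e by (simp add: add_nonneg_pos)
      obtain \<phi> h where \<phi>: "L2_generator \<Omega> S \<phi> h" "\<phi> \<in> L2 \<Omega>" "nrm (\<lambda>x. w x - \<phi> x) < e / (2 * nrm z + 1)"
        using generator_dense[OF w e'] by metis
      let ?d = "\<lambda>x. w x - \<phi> x"
      have "ip (S t w) z - ip w (S t z) = ip (\<lambda>x. S t w x - S t \<phi> x) z - ip ?d (S t z)"
        using core[OF \<phi>(1)] w z \<phi>(2) t by (simp add: L2_inner_diff S_L2)
      moreover have "\<bar>ip (\<lambda>x. S t w x - S t \<phi> x) z\<bar> \<le> nrm (\<lambda>x. S t w x - S t \<phi> x) * nrm z"
        using w z \<phi>(2) t by (intro L2_Cauchy_Schwarz L2_diff S_L2)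
      moreover have "nrm (\<lambda>x. S t w x - S t \<phi> x) * nrm z \<le> nrm ?d * nrm z"
        using S_diff_contraction[OF t w \<phi>(2)] by (intro mult_right_mono) auto
      moreover have "\<bar>ip ?d (S t z)\<bar> \<le> nrm ?d * nrm (S t z)" using w z \<phi>(2) t by (intro L2_Cauchy_Schwarz L2_diff S_L2)
      moreover have "nrm ?d * nrm (S t z) \<le> nrm ?d * nrm z" using S_contraction[OF z t] by (intro mult_left_mono) auto
      moreover have "nrm ?d * (2 * nrm z) \<le> nrm ?d * (2 * nrm z + 1)" by (intro mult_left_mono) auto
      moreover have "nrm ?d * (2 * nrm z + 1) < e"
        using \<phi>(3) by (simp add: pos_less_divide_eq add_nonneg_pos)
      ultimately show ?thesis by linarith
    qed
    then have "\<bar>ip (S t w) z - ip w (S t z)\<bar> \<le> 0" by (rule field_le_epsilon)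
    then show ?thesis by simp
  qed
  have half: "ip (S t w) \<phi> = ip w (S t \<phi>)" if g: "L2_generator \<Omega> S \<phi> h" for \<phi> h
    using ext[OF w generatorD(1)[OF g]] S_self_adjoint_generator[OF _ g t] by blast
  have "ip (S t z) w = ip z (S t w)"
    by (rule ext[OF z w]) (use half in \<open>simp add: L2_inner_commute\<close>)
  then show ?thesis by (simp add: L2_inner_commute)
qed

lemma nrm_eq_0_AE:
  assumes "w \<in> L2 \<Omega>" "nrm w = 0"
  shows "AE x in M. w x = 0"
proof -
  have "(LINT x|M. (w x)\<^sup>2) = 0" using assms(2) L2_norm_square_integral[of \<Omega> w] by simp
  then have "AE x in M. (w x)\<^sup>2 = 0"
    by (subst (asm) integral_nonneg_eq_0_iff_AE[OF L2_square_integrable[OF assms(1)]]) auto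
  then show ?thesis by simp
qed

text \<open>Paired with any \<open>z\<close>, the orbit of a constant has derivative equal to the
  pairing of \<open>S r (\<lambda>x. 0)\<close> with \<open>z\<close>. This vanishes by contraction,
  as the axioms determine \<open>S r (\<lambda>x. 0)\<close> only up to null sets.\<close>

lemma S_const: 
  assumes t: "t \<ge> 0"
  shows "AE x in M. S t (\<lambda>x. c) x = c"
proof -
  have c2: "(\<lambda>x. c) \<in> L2 \<Omega>" and z2: "(\<lambda>x. 0) \<in> L2 \<Omega>" by (intro L2_const domain)+
  have const: "ip (S t (\<lambda>x. c)) z = ip (\<lambda>x. c) z" if z: "z \<in> L2 \<Omega>" for z
  proof (cases "t = 0")
    case True
    then show ?thesis using S_0[OF c2] c2 z by (intro L2_inner_cong_AE S_L2) auto
  next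
    case False
    have der: "((\<lambda>s. ip (S s (\<lambda>x. c)) z) has_real_derivative 0) (at r within {0..})" if r: "r \<ge> 0" for r
    proof -
      have Z: "L2_has_derivative \<Omega> (\<lambda>s. z) (\<lambda>x. 0) r {0..}"
        using z z2 r by (auto simp: L2_has_derivative_def)
      have "nrm (S r (\<lambda>x. 0)) \<le> 0" using S_contraction[OF z2 r] by simp
      then have "\<bar>ip (S r (\<lambda>x. 0)) z\<bar> \<le> 0"
        using L2_Cauchy_Schwarz[OF S_L2[OF r z2] z] L2_norm_nonneg[of \<Omega> "S r (\<lambda>x. 0)"] by simp
      then show ?thesis
        using L2_inner_has_derivative[OF S_has_derivative[OF generator_const r] Z] by (simp add: L2_inner_def)
    qed
    obtain s where "ip (S t (\<lambda>x. c)) z - ip (S 0 (\<lambda>x. c)) z = (t - 0) * (0::real)"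
      by (rule mean_value_within[of 0 t "\<lambda>s. ip (S s (\<lambda>x. c)) z" "\<lambda>_. 0" "{0..}"]) (use der False t in auto)
    moreover have "ip (S 0 (\<lambda>x. c)) z = ip (\<lambda>x. c) z" using S_0[OF c2] c2 z by (intro L2_inner_cong_AE S_L2) auto
    ultimately show ?thesis by simp
  qed
  let ?d = "\<lambda>x. S t (\<lambda>x. c) x - c"
  have d2: "?d \<in> L2 \<Omega>" using c2 t by (intro L2_diff S_L2)
  have "(nrm ?d)\<^sup>2 = ip (S t (\<lambda>x. c)) ?d - ip (\<lambda>x. c) ?d"
    using c2 t d2 by (simp add: L2_norm_square L2_inner_diff S_L2)
  then have "nrm ?d = 0" using const[OF d2] by simp
  then show ?thesis using nrm_eq_0_AE[OF d2] by simp
qed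

text \<open>Self-adjointness moves \<open>S t\<close> onto the constant 1, which it fixes.\<close>

lemma S_mass:
  assumes w: "w \<in> L2 \<Omega>" and t: "t \<ge> 0"
  shows "(LINT x|M. S t w x) = (LINT x|M. w x)"
proof -
  have c2: "(\<lambda>x. 1) \<in> L2 \<Omega>" by (intro L2_const domain)
  have "(LINT x|M. S t w x) = ip (S t w) (\<lambda>x. 1)" by (simp add: L2_inner_def)
  also have "\<dots> = ip w (S t (\<lambda>x. 1))" by (rule S_self_adjoint[OF w c2 t])
  also have "\<dots> = ip (S t (\<lambda>x. 1)) w" by (rule L2_inner_commute)
  also have "\<dots> = ip (\<lambda>x. 1) w" using S_const[OF t, of 1] by (intro L2_inner_cong_AE S_L2 t c2 w)
  finally show ?thesis by (simp add: L2_inner_def)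
qed

end

section \<open>Contraction in the supremum norm\<close>

lemma lipschitz_from_derivative:
  fixes \<psi> :: "real \<Rightarrow> real"
  assumes "\<And>s. (\<psi> has_real_derivative \<psi>' s) (at s)" "\<And>s. \<bar>\<psi>' s\<bar> \<le> B"
  shows "\<bar>\<psi> b - \<psi> a\<bar> \<le> B * \<bar>b - a\<bar>"
proof -
  have less: "\<bar>\<psi> b - \<psi> a\<bar> \<le> B * \<bar>b - a\<bar>" if ab: "a < b" for a b
  proof -
    obtain z where "\<psi> b - \<psi> a = (b - a) * \<psi>' z" using MVT2[OF ab, of \<psi> \<psi>'] assms(1) by blast
    then have "\<bar>\<psi> b - \<psi> a\<bar> = \<bar>\<psi>' z\<bar> * \<bar>b - a\<bar>" by (simp add: abs_mult)
    also have "\<dots> \<le> B * \<bar>b - a\<bar>" using assms(2) by (intro mult_right_mono) auto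
    finally show ?thesis .
  qed
  consider "a < b" | "b < a" | "a = b" by linarith
  then show ?thesis using less[of a b] less[of b a] by cases (simp_all add: abs_minus_commute)
qed

lemma taylor_from_lipschitz:
  fixes \<psi> :: "real \<Rightarrow> real"
  assumes "\<And>s. (\<psi> has_real_derivative \<psi>' s) (at s)" "\<And>a b. \<bar>\<psi>' b - \<psi>' a\<bar> \<le> C * \<bar>b - a\<bar>"
  shows "\<bar>\<psi> b - \<psi> a - \<psi>' a * (b - a)\<bar> \<le> C * (b - a)\<^sup>2"
proof -
  have C: "C \<ge> 0" using assms(2)[of 0 1] by (auto intro: order_trans[OF abs_ge_zero])
  have "\<exists>z. \<bar>z - a\<bar> \<le> \<bar>b - a\<bar> \<and> \<psi> b - \<psi> a = (b - a) * \<psi>' z"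
  proof -
    consider "a < b" | "b < a" | "a = b" by linarith
    then show ?thesis
    proof cases
      case 1
      then obtain z where "a < z" "z < b" "\<psi> b - \<psi> a = (b - a) * \<psi>' z" using MVT2[OF 1, of \<psi> \<psi>'] assms(1) by blast
      then show ?thesis by (intro exI[of _ z]) auto
    next
      case 2
      then obtain z where "b < z" "z < a" "\<psi> a - \<psi> b = (a - b) * \<psi>' z" using MVT2[OF 2, of \<psi> \<psi>'] assms(1) by blast
      then show ?thesis by (intro exI[of _ z]) (auto simp: algebra_simps)
    qed auto
  qed
  then obtain z where z: "\<bar>z - a\<bar> \<le> \<bar>b - a\<bar>" "\<psi> b - \<psi> a = (b - a) * \<psi>' z" by blast
  have "\<bar>\<psi> b - \<psi> a - \<psi>' a * (b - a)\<bar> = \<bar>\<psi>' z - \<psi>' a\<bar> * \<bar>b - a\<bar>"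
    unfolding z(2) by (simp flip: abs_mult add: algebra_simps)
  also have "\<dots> \<le> (C * \<bar>z - a\<bar>) * \<bar>b - a\<bar>" using assms(2) by (intro mult_right_mono) auto
  also have "\<dots> \<le> (C * \<bar>b - a\<bar>) * \<bar>b - a\<bar>" using z(1) C by (intro mult_right_mono mult_left_mono) auto
  also have "\<dots> = C * (b - a)\<^sup>2" by (simp add: power2_eq_square flip: abs_mult)
  finally show ?thesis .
qed

text \<open>The inner function has a corner at \<open>s = 1\<close>, but \<open>F' 0 = 0\<close>
  makes the composition flat there.\<close>

lemma truncation_has_derivative:
  fixes F :: "real \<Rightarrow> real"
  assumes F: "\<And>p. (F has_real_derivative F' p) (at p)" and F0: "F' 0 = 0"
  shows "((\<lambda>s. F (max 0 (s - 1))) has_real_derivative F' (max 0 (s - 1))) (at s)"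
proof -
  consider "s < 1" | "s > 1" | "s = 1" by linarith
  then show ?thesis
  proof cases
    case 1
    have "((\<lambda>s. F 0) has_real_derivative F' (max 0 (s - 1))) (at s)" using 1 F0 by simp
    then show ?thesis
      by (rule has_field_derivative_transform_within[where d="1 - s"]) (use 1 in \<open>auto simp: dist_real_def\<close>)
  next
    case 2
    have "((\<lambda>s. F (s - 1)) has_real_derivative F' (s - 1) * 1) (at s)"
      by (rule DERIV_chain2[OF F]) (auto intro!: derivative_eq_intros)
    then have "((\<lambda>s. F (s - 1)) has_real_derivative F' (max 0 (s - 1))) (at s)" using 2 by simp
    then show ?thesis
      by (rule has_field_derivative_transform_within[where d="s - 1"]) (use 2 in \<open>auto simp: dist_real_def\<close>)
  next
    case 3
    show ?thesis
    proof (rule has_real_derivativeI)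
      fix e :: real assume e: "e > 0"
      obtain d where d: "d > 0" "\<And>h. \<bar>h\<bar> < d \<Longrightarrow> \<bar>F h - F 0\<bar> \<le> e * \<bar>h\<bar>"
        using F[of 0] e unfolding has_field_derivative_def has_derivative_at_alt F0 by fastforce
      have "\<bar>F (max 0 h) - F 0\<bar> \<le> e * \<bar>h\<bar>" if "\<bar>h\<bar> < d" for h
        using d(2)[of h] that e by (cases "h \<ge> 0") (auto simp: max_def)
      then show "\<exists>d>0. \<forall>h. \<bar>h\<bar> < d \<longrightarrow> \<bar>F (max 0 (s + h - 1)) - F (max 0 (s - 1)) - h * F' (max 0 (s - 1))\<bar> \<le> e * \<bar>h\<bar>"
        using 3 F0 d(1) by (intro exI[of _ d]) simp
    qed
  qed
qed

text \<open>A convex penalty of linear growth that vanishes exactly on \<open>s \<le> 1\<close> and has two derivatives, so that it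
  may be differentiated along the flow and its derivative obeys the chain rule in \<open>H\<^sup>1\<close>.\<close>

definition penalty :: "real \<Rightarrow> real" where
  "penalty s = max 0 (s - 1) - arctan (max 0 (s - 1))"

definition penalty' :: "real \<Rightarrow> real" where
  "penalty' s = (max 0 (s - 1))\<^sup>2 / (1 + (max 0 (s - 1))\<^sup>2)"

definition penalty'' :: "real \<Rightarrow> real" where
  "penalty'' s = 2 * max 0 (s - 1) / (1 + (max 0 (s - 1))\<^sup>2)\<^sup>2"

lemma penalty_has_derivative: "(penalty has_real_derivative penalty' s) (at s)"
  unfolding penalty_def[abs_def] penalty'_def
proof (rule truncation_has_derivative[where F="\<lambda>p. p - arctan p" and F'="\<lambda>p. p\<^sup>2 / (1 + p\<^sup>2)"])
  fix p :: real
  have "1 + p\<^sup>2 > 0" by (simp add: add_pos_nonneg)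
  then show "((\<lambda>p. p - arctan p) has_real_derivative p\<^sup>2 / (1 + p\<^sup>2)) (at p)"
    by (auto intro!: derivative_eq_intros simp: field_simps)
qed simp

lemma penalty'_has_derivative: "(penalty' has_real_derivative penalty'' s) (at s)"
  unfolding penalty'_def[abs_def] penalty''_def
proof (rule truncation_has_derivative[where F="\<lambda>p. p\<^sup>2 / (1 + p\<^sup>2)" and F'="\<lambda>p. 2 * p / (1 + p\<^sup>2)\<^sup>2"])
  fix p :: real
  have "1 + p\<^sup>2 \<noteq> 0" by (metis add_pos_nonneg less_irrefl zero_le_power2 zero_less_one)
  then show "((\<lambda>p. p\<^sup>2 / (1 + p\<^sup>2)) has_real_derivative 2 * p / (1 + p\<^sup>2)\<^sup>2) (at p)"
    by (auto intro!: derivative_eq_intros simp: field_simps power2_eq_square)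
qed simp

lemma penalty'_bounded: "\<bar>penalty' s\<bar> \<le> 1"
  by (auto simp: penalty'_def divide_le_eq_1 add_pos_nonneg)

lemma penalty''_bounded: "0 \<le> penalty'' s" "\<bar>penalty'' s\<bar> \<le> 1"
proof -
  define p where "p = max 0 (s - 1)"
  have p: "p \<ge> 0" by (simp add: p_def)
  have q: "1 + p\<^sup>2 \<ge> 1" by simp
  have "2 * p \<le> 1 + p\<^sup>2" using sum_squares_bound[of 1 p] by (simp add: power2_eq_square)
  also have "\<dots> \<le> (1 + p\<^sup>2)\<^sup>2" using self_le_power[OF q, of 2] by simp
  finally have le: "2 * p \<le> (1 + p\<^sup>2)\<^sup>2" .
  show "0 \<le> penalty'' s" using p by (simp add: penalty''_def p_def[symmetric])
  have "(1 + p\<^sup>2)\<^sup>2 > 0" using q by (intro zero_less_power) linarith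
  then have "penalty'' s \<le> 1" using le by (simp add: penalty''_def p_def[symmetric] divide_le_eq_1)
  with \<open>0 \<le> penalty'' s\<close> show "\<bar>penalty'' s\<bar> \<le> 1" by simp
qed

text \<open>\<open>penalty''\<close> has a corner at \<open>s = 1\<close>, so the mean value theorem
  is applied to the rational function behind it, and the truncation, being 1-Lipschitz, is composed
  afterwards. This Lipschitz bound feeds the quadratic Taylor remainder in the chain rule.\<close>

lemma penalty''_lipschitz: "\<bar>penalty'' b - penalty'' a\<bar> \<le> 6 * \<bar>b - a\<bar>"
proof -
  define k where "k p = 2 * p / (1 + p\<^sup>2)\<^sup>2" for p :: real
  have der: "(k has_real_derivative (2 - 6 * p\<^sup>2) / (1 + p\<^sup>2) ^ 3) (at p)" for p
  proof -
    have ne: "1 + p\<^sup>2 \<noteq> 0" by (metis add_pos_nonneg less_irrefl zero_le_power2 zero_less_one)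
    have "(k has_real_derivative (2 * (1 + p\<^sup>2)\<^sup>2 - 2 * p * (2 * (1 + p\<^sup>2) * (2 * p))) / ((1 + p\<^sup>2)\<^sup>2 * (1 + p\<^sup>2)\<^sup>2)) (at p)"
      unfolding k_def[abs_def] using ne by (auto intro!: derivative_eq_intros)
    moreover have "(2 * (1 + p\<^sup>2)\<^sup>2 - 2 * p * (2 * (1 + p\<^sup>2) * (2 * p))) / ((1 + p\<^sup>2)\<^sup>2 * (1 + p\<^sup>2)\<^sup>2) = (2 - 6 * p\<^sup>2) / (1 + p\<^sup>2) ^ 3"
    proof -
      have "2 * (1 + p\<^sup>2)\<^sup>2 - 2 * p * (2 * (1 + p\<^sup>2) * (2 * p)) = (1 + p\<^sup>2) * (2 - 6 * p\<^sup>2)"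
        by (simp add: power2_eq_square algebra_simps)
      moreover have "(1 + p\<^sup>2)\<^sup>2 * (1 + p\<^sup>2)\<^sup>2 = (1 + p\<^sup>2) * (1 + p\<^sup>2) ^ 3" by (simp add: power2_eq_square power3_eq_cube)
      ultimately show ?thesis using ne by simp
    qed
    ultimately show ?thesis by simp
  qed
  have bd: "\<bar>(2 - 6 * p\<^sup>2) / (1 + p\<^sup>2) ^ 3\<bar> \<le> 6" for p :: real
  proof -
    have q: "1 + p\<^sup>2 \<ge> 1" by simp
    have "\<bar>2 - 6 * p\<^sup>2\<bar> \<le> 6 * (1 + p\<^sup>2)" by (simp add: abs_le_iff)
    also have "\<dots> \<le> 6 * (1 + p\<^sup>2) ^ 3" using self_le_power[OF q, of 3] by simp
    finally have le: "\<bar>2 - 6 * p\<^sup>2\<bar> \<le> 6 * (1 + p\<^sup>2) ^ 3" .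
    have "(1 + p\<^sup>2) ^ 3 > 0" using q by (intro zero_less_power) linarith
    then show ?thesis using le by (simp add: pos_divide_le_eq)
  qed
  have "\<bar>k (max 0 (b - 1)) - k (max 0 (a - 1))\<bar> \<le> 6 * \<bar>max 0 (b - 1) - max 0 (a - 1)\<bar>"
    by (rule lipschitz_from_derivative[OF der bd])
  also have "\<dots> \<le> 6 * \<bar>b - a\<bar>" by (intro mult_left_mono) (auto simp: max_def)
  finally show ?thesis by (simp add: k_def penalty''_def)
qed

lemma penalty_lipschitz: "\<bar>penalty b - penalty a\<bar> \<le> \<bar>b - a\<bar>"
  using lipschitz_from_derivative[OF penalty_has_derivative penalty'_bounded] by simp

lemma penalty'_lipschitz: "\<bar>penalty' b - penalty' a\<bar> \<le> 1 * \<bar>b - a\<bar>"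
  by (rule lipschitz_from_derivative[OF penalty'_has_derivative penalty''_bounded(2)])

lemma penalty_pos: "s > 1 \<Longrightarrow> penalty s > 0"
proof -
  assume s: "s > 1"
  then obtain z where z: "1 < z" "penalty s - penalty 1 = (s - 1) * penalty' z"
    using MVT2[OF s, of penalty penalty'] penalty_has_derivative by blast
  have "penalty' z > 0" using z(1) by (simp add: penalty'_def add_pos_nonneg)
  then show ?thesis using z(2) s by (simp add: penalty_def)
qed

lemma penalty_eq_0: "s \<le> 1 \<Longrightarrow> penalty s = 0"
  by (simp add: penalty_def max_def)

lemma penalty_nonneg: "penalty s \<ge> 0"
  using penalty_pos[of s] penalty_eq_0[of s] by (cases "s > 1") auto

lemma penalty_measurable [measurable]:
  "penalty \<in> borel_measurable borel" "penalty' \<in> borel_measurable borel" "penalty'' \<in> borel_measurable borel"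
  unfolding penalty_def[abs_def] penalty'_def[abs_def] penalty''_def[abs_def] by measurable

section \<open>The penalized integral along the flow\<close>

context neumann_semigroup
begin

lemma L1_le_nrm: "w \<in> L2 \<Omega> \<Longrightarrow> (LINT x|M. \<bar>w x\<bar>) \<le> nrm w"
  using L1_le_L2_norm[OF domain(2), of w] unit_measure by simp

lemma integrable_penalty:
  assumes "w \<in> L2 \<Omega>"
  shows "integrable M (\<lambda>x. penalty (w x))"
proof (rule Bochner_Integration.integrable_bound[OF L2_integrable[OF domain(2) assms]])
  have [measurable]: "w \<in> borel_measurable M" by (rule L2_measurable[OF assms])
  show "(\<lambda>x. penalty (w x)) \<in> borel_measurable M" by measurable
  show "AE x in M. norm (penalty (w x)) \<le> norm (w x)"
    using penalty_lipschitz[of _ 0] by (intro AE_I2) (simp add: penalty_eq_0)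
qed

lemma penalty_integral_diff:
  assumes a: "a \<in> L2 \<Omega>" and b: "b \<in> L2 \<Omega>"
  shows "\<bar>(LINT x|M. penalty (a x)) - (LINT x|M. penalty (b x))\<bar> \<le> nrm (\<lambda>x. a x - b x)"
proof -
  have "(LINT x|M. penalty (a x)) - (LINT x|M. penalty (b x)) = (LINT x|M. penalty (a x) - penalty (b x))"
    using a b by (simp add: integrable_penalty)
  also have "\<bar>\<dots>\<bar> \<le> (LINT x|M. \<bar>penalty (a x) - penalty (b x)\<bar>)" by (rule integral_abs_bound)
  also have "\<dots> \<le> (LINT x|M. \<bar>a x - b x\<bar>)"
    using a b penalty_lipschitz L2_integrable[OF domain(2) L2_diff[OF a b]]
    by (intro integral_mono) (auto intro!: integrable_penalty)
  also have "\<dots> \<le> nrm (\<lambda>x. a x - b x)" by (rule L1_le_nrm[OF L2_diff[OF a b]])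
  finally show ?thesis .
qed

text \<open>Green's formula with the test function \<open>penalty' (S r w x)\<close> turns the time
  derivative into minus the integral of \<open>penalty'' (S r w x) * (G x \<bullet> G x)\<close>,
  and convexity makes this nonpositive. The Neumann condition is used in that a function of
  \<open>S r w\<close> that need not vanish at the boundary may be tested with.\<close>

lemma penalty_integral_nonincreasing_generator:
  assumes g: "L2_generator \<Omega> S w h" and t: "t \<ge> 0"
  shows "(LINT x|M. penalty (S t w x)) \<le> (LINT x|M. penalty (w x))"
proof -
  have w: "w \<in> L2 \<Omega>" using generatorD[OF g] by auto
  let ?y = "\<lambda>s. LINT x|M. penalty (S s w x)"
  have "?y 0 - (LINT x|M. penalty (w x)) = 0"
    using penalty_integral_diff[OF S_L2[OF order_refl w] w]
      nrm_cong[OF L2_diff[OF S_L2[OF order_refl w] w] L2_const[OF domain(2), of 0]] S_0[OF w] by simp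
  moreover have "?y t \<le> ?y 0"
  proof (cases "t = 0")
    case False
    have "\<forall>r\<in>{0..}. \<exists>D. D \<le> 0 \<and> (?y has_real_derivative D) (at r within {0..})"
    proof
      fix r :: real assume "r \<in> {0..}"
      then have r: "r \<ge> 0" by simp
      have Sr: "S r w \<in> L2 \<Omega>" by (rule S_L2[OF r w])
      note [measurable] = L2_measurable[OF Sr]
      obtain G where G: "H1_gradient \<Omega> (S r w) G" "\<And>\<phi> \<Phi>. H1_gradient \<Omega> \<phi> \<Phi> \<Longrightarrow> ip (S r h) \<phi> = - (LINT x|M. G x \<bullet> \<Phi> x)"
        using generator_energy[OF generator_S[OF g r]] by metis
      have H: "H1_gradient \<Omega> (\<lambda>x. penalty' (S r w x)) (\<lambda>x. penalty'' (S r w x) *\<^sub>R G x)"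
        by (rule H1_chain_rule[OF G(1) domain(2,1) penalty'_lipschitz
              taylor_from_lipschitz[OF penalty'_has_derivative penalty''_lipschitz] penalty''_bounded(2)]) measurable
      have "ip (\<lambda>x. penalty' (S r w x)) (S r h) = - (LINT x|M. penalty'' (S r w x) * (G x \<bullet> G x))"
        using G(2)[OF H] by (simp add: L2_inner_commute[of \<Omega> "\<lambda>x. penalty' (S r w x)"])
      also have "\<dots> \<le> 0" using penalty''_bounded(1) by (simp add: integral_nonneg_AE)
      finally have D: "ip (\<lambda>x. penalty' (S r w x)) (S r h) \<le> 0" .
      have "(?y has_real_derivative ip (\<lambda>x. penalty' (S r w x)) (S r h)) (at r within {0..})"
        by (rule L2_integral_has_derivative[OF S_has_derivative[OF g r]
              taylor_from_lipschitz[OF penalty_has_derivative penalty'_lipschitz] H1_gradientD(1)[OF H]])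
           (use w in \<open>auto intro!: integrable_penalty S_L2\<close>)
      with D show "\<exists>D. D \<le> 0 \<and> (?y has_real_derivative D) (at r within {0..})" by blast
    qed
    from bchoice[OF this] obtain D where D: "\<And>r. r \<ge> 0 \<Longrightarrow> D r \<le> 0" "\<And>r. r \<ge> 0 \<Longrightarrow> (?y has_real_derivative D r) (at r within {0..})"
      by auto
    obtain s where s: "0 < s" "s < t" "?y t - ?y 0 = (t - 0) * D s"
      by (rule mean_value_within[of 0 t ?y D "{0..}"]) (use D(2) False t in auto)
    have "(t - 0) * D s \<le> 0" using D(1)[of s] s(1) t by (intro mult_nonneg_nonpos) auto
    then show ?thesis using s(3) by linarith
  qed simp
  ultimately show ?thesis by linarith
qed

text \<open>The penalized integral starts at 0 and cannot increase, so it stays 0, and the penalty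
  is positive above 1. Density works because the penalty is 1-Lipschitz, which makes its integral
  continuous in L2.\<close>

lemma S_le_1:
  assumes w: "w \<in> L2 \<Omega>" and t: "t \<ge> 0" and le: "AE x in M. w x \<le> 1"
  shows "AE x in M. S t w x \<le> 1"
proof -
  have St: "S t w \<in> L2 \<Omega>" by (rule S_L2[OF t w])
  have "(LINT x|M. penalty (S t w x)) \<le> (LINT x|M. penalty (w x))"
  proof (rule field_le_epsilon)
    fix e :: real assume "e > 0"
    then have e: "e / 2 > 0" by simp
    obtain \<phi> h where \<phi>: "L2_generator \<Omega> S \<phi> h" "\<phi> \<in> L2 \<Omega>" "nrm (\<lambda>x. w x - \<phi> x) < e / 2"
      using generator_dense[OF w e] by metis
    have "nrm (\<lambda>x. S t w x - S t \<phi> x) < e / 2" using S_diff_contraction[OF t w \<phi>(2)] \<phi>(3) by linarith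
    then show "(LINT x|M. penalty (S t w x)) \<le> (LINT x|M. penalty (w x)) + e"
      using penalty_integral_diff[OF St S_L2[OF t \<phi>(2)]] penalty_integral_diff[OF w \<phi>(2)] \<phi>(3)
        penalty_integral_nonincreasing_generator[OF \<phi>(1) t] by linarith
  qed
  also have "(LINT x|M. penalty (w x)) = (LINT x|M. 0)"
    using le L2_measurable[OF w] by (intro integral_cong_AE) (auto elim!: eventually_mono simp: penalty_eq_0)
  finally have "(LINT x|M. penalty (S t w x)) = 0"
    by (intro antisym) (auto intro!: integral_nonneg_AE simp: penalty_nonneg)
  then have "AE x in M. penalty (S t w x) = 0"
    by (subst (asm) integral_nonneg_eq_0_iff_AE[OF integrable_penalty[OF St]]) (auto simp: penalty_nonneg)
  then show ?thesis
  proof eventually_elim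
    case (elim x)
    then show ?case using penalty_pos[of "S t w x"] by (cases "S t w x > 1") auto
  qed
qed

lemma S_sup_contraction:
  assumes w: "w \<in> borel_measurable M" and t: "t \<ge> 0" and B: "B \<ge> 0" and le: "AE x in M. \<bar>w x\<bar> \<le> B"
  shows "AE x in M. \<bar>S t w x\<bar> \<le> B"
proof -
  have w2: "w \<in> L2 \<Omega>" by (rule L2_bounded[OF domain(2) w le])
  have main: "AE x in M. \<bar>S t w x\<bar> \<le> c" if c: "c > 0" "AE x in M. \<bar>w x\<bar> \<le> c" for c
  proof -
    have one: "AE x in M. S t (\<lambda>x. a * w x) x \<le> 1" if a: "\<bar>a\<bar> = 1 / c" for a
    proof (rule S_le_1[OF L2_cmult[OF w2] t])
      show "AE x in M. a * w x \<le> 1"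
        using c(2)
      proof eventually_elim
        case (elim x)
        have "a * w x \<le> \<bar>a\<bar> * \<bar>w x\<bar>" by (simp flip: abs_mult)
        also have "\<dots> \<le> 1 / c * c" unfolding a using elim c(1) by (intro mult_left_mono) auto
        finally show ?case using c(1) by simp
      qed
    qed
    have "AE x in M. S t (\<lambda>x. 1 / c * w x) x \<le> 1" "AE x in M. S t (\<lambda>x. - (1 / c) * w x) x \<le> 1"
      using one[of "1 / c"] one[of "- (1 / c)"] c(1) by auto
    with S_cmult[OF t w2, of "1 / c"] S_cmult[OF t w2, of "- (1 / c)"]
    show ?thesis
    proof eventually_elim
      case (elim x)
      then have "1 / c * S t w x \<le> 1" "- (1 / c) * S t w x \<le> 1" by simp_all
      then show ?case using c(1) by (auto simp: abs_le_iff field_simps)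
    qed
  qed
  \<comment> \<open>Rescaling to the threshold 1 requires a positive bound, whereas \<open>B\<close>
    may be 0; hence the approximation from above.\<close>
  have "AE x in M. \<forall>n::nat. \<bar>S t w x\<bar> \<le> B + 1 / real (Suc n)"
    unfolding AE_all_countable
  proof
    fix n :: nat
    show "AE x in M. \<bar>S t w x\<bar> \<le> B + 1 / real (Suc n)"
    proof (rule main)
      show "B + 1 / real (Suc n) > 0" using B by (intro add_nonneg_pos) auto
      show "AE x in M. \<bar>w x\<bar> \<le> B + 1 / real (Suc n)"
        using le by eventually_elim (smt (verit) divide_nonneg_nonneg of_nat_0_le_iff)
    qed
  qed
  then show ?thesis
  proof eventually_elim
    case (elim x)
    have "(\<lambda>n. B + 1 / real (Suc n)) \<longlonglongrightarrow> B + 0"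
      by (intro tendsto_intros LIMSEQ_Suc[OF lim_1_over_n, unfolded o_def])
    then show ?case using elim by (intro LIMSEQ_le_const[of _ B]) auto
  qed
qed

section \<open>Smoothing and decay of the heat semigroup\<close>

text \<open>Dual to the contraction in the supremum norm: pair \<open>S t w\<close> with its own
  sign and move the semigroup onto the sign.\<close>

lemma S_L1_contraction:
  assumes w: "w \<in> L2 \<Omega>" and t: "t \<ge> 0"
  shows "(LINT x|M. \<bar>S t w x\<bar>) \<le> (LINT x|M. \<bar>w x\<bar>)"
proof -
  have St: "S t w \<in> L2 \<Omega>" by (rule S_L2[OF t w])
  note [measurable] = L2_measurable[OF St]
  define \<phi> where "\<phi> x = sgn (S t w x)" for x
  have [measurable]: "\<phi> \<in> borel_measurable M" unfolding \<phi>_def[abs_def] sgn_if by measurable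
  have \<phi>1: "AE x in M. \<bar>\<phi> x\<bar> \<le> 1" by (intro AE_I2) (simp add: \<phi>_def sgn_if)
  have \<phi>: "\<phi> \<in> L2 \<Omega>" by (rule L2_bounded[OF domain(2) _ \<phi>1]) measurable
  have "(LINT x|M. \<bar>S t w x\<bar>) = ip (S t w) \<phi>"
    unfolding L2_inner_def by (intro Bochner_Integration.integral_cong) (auto simp: \<phi>_def abs_sgn)
  also have "\<dots> = ip w (S t \<phi>)" by (rule S_self_adjoint[OF w \<phi> t])
  also have "\<dots> \<le> (LINT x|M. \<bar>w x\<bar>)"
    unfolding L2_inner_def
  proof (rule integral_mono_AE[OF L2_mult_integrable[OF w S_L2[OF t \<phi>]] L2_integrable[OF domain(2) L2_abs[OF w]]])
    have "AE x in M. \<bar>S t \<phi> x\<bar> \<le> 1" by (rule S_sup_contraction[OF _ t _ \<phi>1]) auto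
    then show "AE x in M. w x * S t \<phi> x \<le> \<bar>w x\<bar>"
    proof eventually_elim
      case (elim x)
      have "w x * S t \<phi> x \<le> \<bar>w x\<bar> * \<bar>S t \<phi> x\<bar>" by (simp flip: abs_mult)
      also have "\<dots> \<le> \<bar>w x\<bar> * 1" using elim by (intro mult_left_mono) auto
      finally show ?case by simp
    qed
  qed
  finally show ?thesis .
qed

lemma nrm_S_antimono:
  assumes w: "w \<in> L2 \<Omega>" and st: "0 \<le> s" "s \<le> t"
  shows "nrm (S t w) \<le> nrm (S s w)"
proof -
  have "nrm (S t w) = nrm (S (t - s) (S s w))"
    using S_add_time[of "t - s" s w] st w by (intro nrm_cong S_L2) auto
  also have "\<dots> \<le> nrm (S s w)" using st w by (intro S_contraction S_L2) auto
  finally show ?thesis .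
qed

text \<open>Nash's argument along the times \<open>4\<^bsup>-k\<^esup>\<close> with the radii \<open>\<delta> 2\<^bsup>-k\<^esup>\<close>: the choice of \<open>\<delta>\<close> makes
  the resulting recursion for the squared norms contract faster than the constants grow.\<close>

lemma S_L1_L2_smoothing: "\<exists>K>0. \<forall>w\<in>L2 \<Omega>. nrm (S 1 w) \<le> K * (LINT x|M. \<bar>w x\<bar>)"
proof -
  obtain C where C: "C > 0" "\<And>w G r. H1_gradient \<Omega> w G \<Longrightarrow> 0 < r \<Longrightarrow> r \<le> 1 \<Longrightarrow>
    (nrm w)\<^sup>2 \<le> C * (r\<^sup>2 * (nrm (\<lambda>x. norm (G x)))\<^sup>2 + (LINT x|M. \<bar>w x\<bar>)\<^sup>2 / r ^ DIM('a))"
    using Nash_inequality[OF dom] by metis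
  define n where "n = DIM('a)"
  \<comment> \<open>This makes \<open>a * 2 ^ n\<close> equal to \<open>C / (2 * (C + 1))\<close>,
    hence below 1/2, while \<open>\<delta> \<le> 1\<close> keeps the radii admissible in Nash's
    inequality.\<close>
  define \<delta> where "\<delta> = sqrt (1 / (2 ^ (n + 1) * (C + 1)))"
  have den: "2 ^ (n + 1) * (C + 1) \<ge> 1"
    using C(1) one_le_power[of "2::real" "n + 1"] mult_mono[of 1 "2 ^ (n + 1) :: real" 1 "C + 1"] by simp
  have \<delta>2: "\<delta>\<^sup>2 = 1 / (2 ^ (n + 1) * (C + 1))" using C(1) by (simp add: \<delta>_def)
  have \<delta>: "\<delta> > 0" "\<delta> \<le> 1" using C(1) den by (auto simp: \<delta>_def intro!: divide_pos_pos)
  define a where "a = C * \<delta>\<^sup>2"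
  have a: "a \<ge> 0" "a * 2 ^ n \<le> 1 / 2"
  proof -
    show "a \<ge> 0" using C(1) by (simp add: a_def)
    have p: "2 ^ (n + 1) * (C + 1) = 2 ^ n * (2 * (C + 1))" by simp
    have "a * 2 ^ n = C / (2 * (C + 1))" unfolding a_def \<delta>2 p by simp
    also have "\<dots> \<le> 1 / 2" using C(1) by (simp add: field_simps)
    finally show "a * 2 ^ n \<le> 1 / 2" .
  qed
  have a_half: "a \<le> 1 / 2"
  proof -
    have "a * 1 \<le> a * 2 ^ n" using a(1) by (intro mult_left_mono) auto
    then show ?thesis using a(2) by linarith
  qed
  define K where "K = sqrt (2 * C / \<delta> ^ n)"
  have K: "K > 0" using C(1) \<delta>(1) by (simp add: K_def)
  have core: "nrm (S 1 w) \<le> K * (LINT x|M. \<bar>w x\<bar>)" if g: "L2_generator \<Omega> S w h" for w h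
  proof -
    have w: "w \<in> L2 \<Omega>" using generatorD[OF g] by auto
    define L where "L = (LINT x|M. \<bar>w x\<bar>)"
    have L0: "L \<ge> 0" by (simp add: L_def)
    define y where "y k = (nrm (S ((1 / 4) ^ k) w))\<^sup>2" for k
    have y0: "y k \<ge> 0" for k by (simp add: y_def)
    define b where "b = C * L\<^sup>2 / \<delta> ^ n"
    have b0: "b \<ge> 0" using C(1) \<delta>(1) by (simp add: b_def)
    have step: "y k \<le> a * y (Suc k) + b * (2 ^ n) ^ k" for k
    proof -
      let ?q = "(1 / 4 :: real) ^ k"
      have q: "?q > 0" by simp
      have lt: "(1 / 4 :: real) ^ Suc k < ?q" by simp
      obtain s G where sG: "(1 / 4) ^ Suc k < s" "s < ?q" "H1_gradient \<Omega> (S s w) G"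
        "(nrm (S ?q w))\<^sup>2 - (nrm (S ((1 / 4) ^ Suc k) w))\<^sup>2 = - 2 * (?q - (1 / 4) ^ Suc k) * (nrm (\<lambda>x. norm (G x)))\<^sup>2"
        by (rule energy_mean_value[OF g _ lt]) auto
      define E where "E = (nrm (\<lambda>x. norm (G x)))\<^sup>2"
      have E0: "E \<ge> 0" by (simp add: E_def)
      have s0: "s \<ge> 0" using sG(1) by (meson less_imp_le less_trans zero_less_power zero_less_divide_1_iff zero_less_numeral)
      \<comment> \<open>The time interval has length \<open>3 / 4 * ?q\<close>. Since
        \<open>y k\<close> is nonnegative, the norm at the earlier time
        \<open>(1 / 4) ^ Suc k\<close> pays for the energy: each step of the recursion goes back
        towards time 0.\<close>
      have "y k - y (Suc k) = - (3 / 2) * (?q * E)" using sG(4) unfolding y_def E_def by (simp add: algebra_simps)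
      then have qE: "?q * E \<le> y (Suc k)" using y0[of k] q E0 mult_nonneg_nonneg[of ?q E] by linarith
      define r where "r = \<delta> * (1 / 2) ^ k"
      have r: "0 < r" "r \<le> 1" using \<delta> by (auto simp: r_def power_le_one intro!: mult_le_one)
      have r2: "r\<^sup>2 = \<delta>\<^sup>2 * ?q"
      proof -
        have "((1 / 2 :: real) ^ k)\<^sup>2 = ?q" by (simp add: power2_eq_square flip: power_mult_distrib)
        then show ?thesis by (simp add: r_def power_mult_distrib)
      qed
      have rn: "1 / r ^ n = (2 ^ n) ^ k / \<delta> ^ n"
      proof -
        have "r ^ n = \<delta> ^ n * ((1 / 2) ^ n) ^ k" by (simp add: r_def power_mult_distrib power_mult[symmetric] mult.commute)
        then show ?thesis by (simp add: power_one_over)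
      qed
      have "y k \<le> (nrm (S s w))\<^sup>2"
        unfolding y_def by (intro power_mono nrm_S_antimono w) (use sG s0 in auto)
      also have "\<dots> \<le> C * (r\<^sup>2 * E + (LINT x|M. \<bar>S s w x\<bar>)\<^sup>2 / r ^ n)"
        unfolding E_def n_def by (rule C(2)[OF sG(3) r])
      also have "\<dots> \<le> C * (r\<^sup>2 * E + L\<^sup>2 / r ^ n)"
        using C(1) r(1) S_L1_contraction[OF w s0]
        by (intro mult_left_mono add_mono divide_right_mono power_mono) (auto simp: L_def)
      also have "\<dots> = C * \<delta>\<^sup>2 * (?q * E) + C * L\<^sup>2 * (1 / r ^ n)" unfolding r2 by (simp add: algebra_simps)
      also have "\<dots> \<le> a * y (Suc k) + C * L\<^sup>2 * (1 / r ^ n)"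
        unfolding a_def using qE C(1) by (intro add_mono mult_left_mono) auto
      also have "C * L\<^sup>2 * (1 / r ^ n) = b * (2 ^ n) ^ k" unfolding rn b_def by simp
      finally show ?thesis .
    qed
    have iter: "y 0 \<le> a ^ k * y k + b * (\<Sum>j<k. (a * 2 ^ n) ^ j)" for k
    proof (induction k)
      case (Suc k)
      have "a ^ k * y k \<le> a ^ k * (a * y (Suc k) + b * (2 ^ n) ^ k)" using step a(1) by (intro mult_left_mono) auto
      also have "\<dots> = a ^ Suc k * y (Suc k) + b * (a * 2 ^ n) ^ k" by (simp add: power_mult_distrib algebra_simps)
      finally show ?case using Suc.IH by (simp add: distrib_left)
    qed simp
    have geo: "(\<Sum>j<k. (a * 2 ^ n) ^ j) \<le> 2" for k
    proof -
      have "(\<Sum>j<k. (a * 2 ^ n) ^ j) \<le> (\<Sum>j<k. (1 / 2) ^ j)"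
        using a by (intro sum_mono power_mono) auto
      also have "\<dots> = 2 * (1 - (1 / 2) ^ k)" by (induction k) auto
      also have "\<dots> \<le> 2" by simp
      finally show ?thesis .
    qed
    have yk: "y k \<le> (nrm w)\<^sup>2" for k
      unfolding y_def by (intro power_mono S_contraction w) auto
    \<comment> \<open>The remainder \<open>a ^ k * y k\<close> vanishes in the limit because the
      norms along the orbit are bounded by \<open>nrm w\<close>; finiteness in L2 is thus used
      qualitatively, and the final constant contains the L1 norm alone.\<close>
    have bound: "y 0 \<le> (1 / 2) ^ k * (nrm w)\<^sup>2 + 2 * b" for k
    proof -
      have "a ^ k * y k \<le> (1 / 2) ^ k * (nrm w)\<^sup>2" using a(1) a_half yk y0 by (intro mult_mono power_mono) auto
      moreover have "b * (\<Sum>j<k. (a * 2 ^ n) ^ j) \<le> b * 2" using geo b0 by (intro mult_left_mono) auto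
      ultimately show ?thesis using iter[of k] by linarith
    qed
    have "(\<lambda>k. (1 / 2) ^ k * (nrm w)\<^sup>2 + 2 * b) \<longlonglongrightarrow> 0 * (nrm w)\<^sup>2 + 2 * b"
      by (intro tendsto_intros LIMSEQ_realpow_zero) auto
    then have "y 0 \<le> 2 * b" using bound by (intro LIMSEQ_le_const[of _ "2 * b"]) auto
    then have "(nrm (S 1 w))\<^sup>2 \<le> (K * L)\<^sup>2"
      using C(1) \<delta>(1) by (simp add: y_def b_def K_def power_mult_distrib)
    then have "nrm (S 1 w) \<le> K * L" by (rule power2_le_imp_le) (use K L0 in simp)
    then show ?thesis by (simp only: L_def)
  qed
  have "nrm (S 1 w) \<le> K * (LINT x|M. \<bar>w x\<bar>)" if w: "w \<in> L2 \<Omega>" for w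
  proof (rule field_le_epsilon)
    fix e :: real assume e: "e > 0"
    then have e': "e / (K + 1) > 0" using K by simp
    obtain \<phi> h where \<phi>: "L2_generator \<Omega> S \<phi> h" "\<phi> \<in> L2 \<Omega>" "nrm (\<lambda>x. w x - \<phi> x) < e / (K + 1)"
      using generator_dense[OF w e'] by metis
    have d2: "(\<lambda>x. w x - \<phi> x) \<in> L2 \<Omega>" by (rule L2_diff[OF w \<phi>(2)])
    have "(LINT x|M. \<bar>\<phi> x\<bar>) \<le> (LINT x|M. \<bar>w x\<bar> + \<bar>w x - \<phi> x\<bar>)"
      using L2_integrable[OF domain(2)] \<phi>(2) w d2 by (intro integral_mono) auto
    also have "\<dots> = (LINT x|M. \<bar>w x\<bar>) + (LINT x|M. \<bar>w x - \<phi> x\<bar>)"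
      using L2_integrable[OF domain(2)] w d2 by simp
    finally have l1: "(LINT x|M. \<bar>\<phi> x\<bar>) \<le> (LINT x|M. \<bar>w x\<bar>) + nrm (\<lambda>x. w x - \<phi> x)" using L1_le_nrm[OF d2] by linarith
    have "nrm (S 1 w) \<le> nrm (S 1 \<phi>) + nrm (\<lambda>x. S 1 w x - S 1 \<phi> x)"
      using w \<phi>(2) by (intro L2_norm_triangle_le S_L2) auto
    also have "\<dots> \<le> K * (LINT x|M. \<bar>\<phi> x\<bar>) + nrm (\<lambda>x. w x - \<phi> x)"
      using core[OF \<phi>(1)] S_diff_contraction[of 1 w \<phi>] w \<phi>(2) by (intro add_mono) auto
    also have "\<dots> \<le> K * ((LINT x|M. \<bar>w x\<bar>) + nrm (\<lambda>x. w x - \<phi> x)) + nrm (\<lambda>x. w x - \<phi> x)"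
      using l1 K by (intro add_mono mult_left_mono) auto
    also have "\<dots> = K * (LINT x|M. \<bar>w x\<bar>) + (K + 1) * nrm (\<lambda>x. w x - \<phi> x)" by (simp add: algebra_simps)
    also have "(K + 1) * nrm (\<lambda>x. w x - \<phi> x) \<le> (K + 1) * (e / (K + 1))" using \<phi>(3) K by (intro mult_left_mono) auto
    also have "\<dots> = e" using K by simp
    finally show "nrm (S 1 w) \<le> K * (LINT x|M. \<bar>w x\<bar>) + e" by simp
  qed
  with K show ?thesis by blast
qed

text \<open>The adjoint statement of smoothing from L1 to L2, as \<open>S 1\<close> is its own
  adjoint.\<close>

lemma S_L2_sup_smoothing: "\<exists>K>0. \<forall>w\<in>L2 \<Omega>. AE x in M. \<bar>S 1 w x\<bar> \<le> K * nrm w"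
proof -
  obtain K where K: "K > 0" "\<And>w. w \<in> L2 \<Omega> \<Longrightarrow> nrm (S 1 w) \<le> K * (LINT x|M. \<bar>w x\<bar>)" using S_L1_L2_smoothing by blast
  have "AE x in M. \<bar>S 1 w x\<bar> \<le> K * nrm w" if w: "w \<in> L2 \<Omega>" for w
  proof (rule AE_abs_le_by_duality[OF domain(2)])
    show "S 1 w \<in> L2 \<Omega>" using w by (intro S_L2) auto
    show "0 \<le> K * nrm w" using K(1) by simp
    fix \<phi> :: "'a \<Rightarrow> real" assume \<phi>: "\<phi> \<in> borel_measurable M" "\<And>x. \<bar>\<phi> x\<bar> \<le> 1"
    have \<phi>2: "\<phi> \<in> L2 \<Omega>" by (rule L2_bounded[OF domain(2) \<phi>(1), of 1]) (simp add: \<phi>(2))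
    have "ip (S 1 w) \<phi> = ip w (S 1 \<phi>)" using S_self_adjoint[OF w \<phi>2, of 1] by simp
    also have "\<dots> \<le> nrm w * nrm (S 1 \<phi>)" using L2_Cauchy_Schwarz[OF w S_L2[of 1 \<phi>]] \<phi>2 by (auto simp: abs_le_iff)
    also have "\<dots> \<le> nrm w * (K * (LINT x|M. \<bar>\<phi> x\<bar>))" using K(2)[OF \<phi>2] by (intro mult_left_mono) auto
    finally show "ip (S 1 w) \<phi> \<le> K * nrm w * (LINT x|M. \<bar>\<phi> x\<bar>)" by (simp add: mult_ac)
  qed
  with K(1) show ?thesis by blast
qed

lemma mean_abs_le: "w \<in> L2 \<Omega> \<Longrightarrow> \<bar>LINT x|M. w x\<bar> \<le> nrm w"
  using integral_abs_bound[of M w] L1_le_nrm[of w] by linarith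

lemma integral_const: "(LINT x|M. c) = (c::real)"
  using unit_measure domain(3) by (simp add: measure_restrict_space)

lemma nrm_const: "nrm (\<lambda>x. c) = \<bar>c\<bar>"
  by (simp only: L2_norm_def integral_const real_sqrt_abs)

lemma generator_diff_const:
  assumes "L2_generator \<Omega> S w h"
  shows "L2_generator \<Omega> S (\<lambda>x. w x - c) h"
proof -
  obtain G where G: "H1_gradient \<Omega> w G"
    "\<And>\<phi> \<Phi>. H1_gradient \<Omega> \<phi> \<Phi> \<Longrightarrow> (LINT x|M. G x \<bullet> \<Phi> x) = - (LINT x|M. h x * \<phi> x)" and h: "h \<in> L2 \<Omega>"
    using assms unfolding generator_iff neumann_laplacian_def by blast
  have "H1_gradient \<Omega> (\<lambda>x. w x - c) G"
    using H1_gradient_diff[OF G(1) H1_gradient_const[OF domain(2)] domain(2)] by simp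
  then show ?thesis unfolding generator_iff neumann_laplacian_def using G(2) h by blast
qed

text \<open>At the intermediate time the energy is bounded below through Poincare's inequality by
  the norm at the final time, and bounded above by the drop of the squared norm. Solving the
  resulting inequality for the final norm gives an algebraic rate, which is all that the comparison
  needs. Conservation of mass keeps the mean at 0.\<close>

lemma S_L2_decay:
  obtains C where "C > 0" "\<And>w t. w \<in> L2 \<Omega> \<Longrightarrow> (LINT x|M. w x) = 0 \<Longrightarrow> t \<ge> 0 \<Longrightarrow>
    nrm (S t w) \<le> sqrt (C / (C + 2 * t)) * nrm w"
proof -
  obtain C where C: "C > 0" "\<And>w G. H1_gradient \<Omega> w G \<Longrightarrow> (LINT x|M. w x) = 0 \<Longrightarrow>
    (nrm w)\<^sup>2 \<le> C * (nrm (\<lambda>x. norm (G x)))\<^sup>2" using Poincare_inequality[OF dom] by metis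
  have core: "nrm (S t w) \<le> sqrt (C / (C + 2 * t)) * nrm w"
    if g: "L2_generator \<Omega> S w h" and mean: "(LINT x|M. w x) = 0" and t: "t \<ge> 0" for w h t
  proof (cases "t = 0")
    case True
    have w: "w \<in> L2 \<Omega>" using generatorD[OF g] by auto
    show ?thesis using True C(1) S_contraction[OF w t] by simp
  next
    case False
    have w: "w \<in> L2 \<Omega>" using generatorD[OF g] by auto
    have t0: "0 < t" using t False by simp
    obtain s G where s: "0 < s" "s < t" "H1_gradient \<Omega> (S s w) G"
      and eq: "(nrm (S t w))\<^sup>2 - (nrm (S 0 w))\<^sup>2 = - 2 * (t - 0) * (nrm (\<lambda>x. norm (G x)))\<^sup>2"
      by (rule energy_mean_value[OF g order_refl t0])
    define E where "E = (nrm (\<lambda>x. norm (G x)))\<^sup>2"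
    have "(nrm (S t w))\<^sup>2 \<le> (nrm (S s w))\<^sup>2" using s by (intro power_mono nrm_S_antimono w) auto
    also have "\<dots> \<le> C * E" unfolding E_def using C(2)[OF s(3)] S_mass[OF w, of s] mean s(1) by simp
    finally have 1: "(nrm (S t w))\<^sup>2 \<le> C * E" .
    have "(nrm (S 0 w))\<^sup>2 \<le> (nrm w)\<^sup>2" by (intro power_mono S_contraction w) auto
    moreover have "(nrm (S t w))\<^sup>2 - (nrm (S 0 w))\<^sup>2 = - (2 * t * E)" using eq by (simp add: E_def)
    ultimately have 2: "2 * t * E \<le> (nrm w)\<^sup>2 - (nrm (S t w))\<^sup>2" by linarith
    have "2 * t * (nrm (S t w))\<^sup>2 \<le> 2 * t * (C * E)" using 1 t0 by (intro mult_left_mono) auto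
    also have "\<dots> = C * (2 * t * E)" by simp
    also have "\<dots> \<le> C * ((nrm w)\<^sup>2 - (nrm (S t w))\<^sup>2)" using 2 C(1) by (intro mult_left_mono) auto
    finally have "(C + 2 * t) * (nrm (S t w))\<^sup>2 \<le> C * (nrm w)\<^sup>2" by (simp add: algebra_simps)
    then have "(nrm (S t w))\<^sup>2 \<le> C / (C + 2 * t) * (nrm w)\<^sup>2" using C(1) t0 by (simp add: field_simps)
    then have "(nrm (S t w))\<^sup>2 \<le> (sqrt (C / (C + 2 * t)) * nrm w)\<^sup>2" using C(1) t0 by (simp add: power_mult_distrib)
    then show ?thesis by (rule power2_le_imp_le) (use C(1) t0 in auto)
  qed
  have "nrm (S t w) \<le> sqrt (C / (C + 2 * t)) * nrm w"
    if w: "w \<in> L2 \<Omega>" and mean: "(LINT x|M. w x) = 0" and t: "t \<ge> 0" for w t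
  proof (rule field_le_epsilon)
    fix e :: real assume e: "e > 0"
    define q where "q = sqrt (C / (C + 2 * t))"
    have q: "0 \<le> q" "q \<le> 1" using C(1) t by (auto simp: q_def)
    from e have e': "e / 4 > 0" by simp
    obtain \<phi> h where \<phi>: "L2_generator \<Omega> S \<phi> h" "\<phi> \<in> L2 \<Omega>" "nrm (\<lambda>x. w x - \<phi> x) < e / 4"
      using generator_dense[OF w e'] by metis
    \<comment> \<open>The approximant need not have mean 0, so its mean is subtracted. As
      \<open>w\<close> has mean 0, this mean is at most the approximation error, and the total error
      at most doubles to \<open>e / 2\<close>.\<close>
    define m where "m = (LINT x|M. \<phi> x)"
    define z where "z x = \<phi> x - m" for x
    have z2: "z \<in> L2 \<Omega>" unfolding z_def[abs_def] by (intro L2_diff \<phi> L2_const domain)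
    have gz: "L2_generator \<Omega> S z h" unfolding z_def[abs_def] by (rule generator_diff_const[OF \<phi>(1)])
    have mz: "(LINT x|M. z x) = 0"
      using L2_integrable[OF domain(2) \<phi>(2)] L2_integrable[OF domain(2) L2_const[OF domain(2), of m]] integral_const[of m]
      by (simp add: z_def m_def)
    have "(LINT x|M. w x - \<phi> x) = - m"
      using L2_integrable[OF domain(2) \<phi>(2)] L2_integrable[OF domain(2) w] mean by (simp add: m_def)
    then have m: "\<bar>m\<bar> < e / 4" using mean_abs_le[OF L2_diff[OF w \<phi>(2)]] \<phi>(3) by simp
    have "nrm (\<lambda>x. w x - z x) \<le> nrm (\<lambda>x. w x - \<phi> x) + nrm (\<lambda>x. m)"
      using L2_norm_triangle[OF L2_diff[OF w \<phi>(2)] L2_const[OF domain(2), of m]] by (simp add: z_def algebra_simps)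
    then have d: "nrm (\<lambda>x. w x - z x) < e / 2" using \<phi>(3) m by (simp add: nrm_const)
    have "nrm (S t w) \<le> nrm (S t z) + nrm (\<lambda>x. S t w x - S t z x)"
      using w z2 t by (intro L2_norm_triangle_le S_L2) auto
    also have "\<dots> \<le> q * nrm z + nrm (\<lambda>x. w x - z x)"
      using core[OF gz mz t] S_diff_contraction[OF t w z2] by (intro add_mono) (auto simp: q_def)
    also have "\<dots> \<le> q * (nrm w + nrm (\<lambda>x. w x - z x)) + nrm (\<lambda>x. w x - z x)"
      using L2_norm_triangle_le[OF z2 w] L2_norm_diff_commute[of \<Omega> w z] q by (intro add_mono mult_left_mono) auto
    also have "\<dots> = q * nrm w + (q * nrm (\<lambda>x. w x - z x) + nrm (\<lambda>x. w x - z x))" by (simp add: algebra_simps)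
    also have "q * nrm (\<lambda>x. w x - z x) \<le> 1 * nrm (\<lambda>x. w x - z x)" using q by (intro mult_right_mono) auto
    finally show "nrm (S t w) \<le> sqrt (C / (C + 2 * t)) * nrm w + e" using d by (simp add: q_def)
  qed
  with C(1) show thesis by (rule that)
qed

text \<open>For times beyond 1, a last unit of time converts the L2 decay of the mean-free part into
  a supremum bound. Up to time 1 the supremum contraction is used instead of smoothing, so the
  estimate stays bounded at \<open>\<tau> = 0\<close>.\<close>

theorem heat_semigroup_decay:
  obtains K where "K > 0" "\<And>\<tau> w B. \<tau> \<ge> 0 \<Longrightarrow> B \<ge> 0 \<Longrightarrow> w \<in> borel_measurable M \<Longrightarrow> AE x in M. \<bar>w x\<bar> \<le> B \<Longrightarrow>
    AE x in M. \<bar>S \<tau> w x - (LINT x|M. w x)\<bar> \<le> B * K / sqrt (1 + \<tau>)"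
proof -
  obtain K1 where K1: "K1 > 0" "\<And>w. w \<in> L2 \<Omega> \<Longrightarrow> AE x in M. \<bar>S 1 w x\<bar> \<le> K1 * nrm w" using S_L2_sup_smoothing by blast
  obtain C where C: "C > 0" "\<And>w t. w \<in> L2 \<Omega> \<Longrightarrow> (LINT x|M. w x) = 0 \<Longrightarrow> t \<ge> 0 \<Longrightarrow>
    nrm (S t w) \<le> sqrt (C / (C + 2 * t)) * nrm w" using S_L2_decay by metis
  \<comment> \<open>Chosen so that \<open>m * (1 + \<tau>) \<le> C + 2 * (\<tau> - 1)\<close> for
    \<open>\<tau> \<ge> 1\<close>: write \<open>1 + \<tau>\<close> as
    \<open>(\<tau> - 1) + 2\<close> and use \<open>m \<le> 1\<close> and
    \<open>2 * m \<le> C\<close>.\<close>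
  define m where "m = min (C / 2) 1"
  have m: "m > 0" "m \<le> C / 2" "m \<le> 1" using C(1) by (auto simp: m_def)
  \<comment> \<open>The value 4 serves \<open>\<tau> \<le> 1\<close>, where the error is at most
    \<open>2 * B\<close> and \<open>sqrt (1 + \<tau>) \<le> 2\<close>; the other value serves later
    times.\<close>
  define K where "K = max 4 (2 * K1 * sqrt (C / m))"
  show thesis
  proof (rule that[of K])
    show "K > 0" by (simp add: K_def)
    fix \<tau> B :: real and w assume \<tau>: "\<tau> \<ge> 0" and B: "B \<ge> 0" and w: "w \<in> borel_measurable M" and wB: "AE x in M. \<bar>w x\<bar> \<le> B"
    have w2: "w \<in> L2 \<Omega>" by (rule L2_bounded[OF domain(2) w wB])
    define \<mu> where "\<mu> = (LINT x|M. w x)"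
    have nw: "nrm w \<le> B"
      using L2_norm_mono_AE[OF L2_const[OF domain(2), of B] w] wB B by (simp add: nrm_const)
    then have \<mu>B: "\<bar>\<mu>\<bar> \<le> B" using mean_abs_le[OF w2] by (simp add: \<mu>_def)
    have "AE x in M. \<bar>S \<tau> w x - \<mu>\<bar> \<le> B * K / sqrt (1 + \<tau>)"
    proof (cases "\<tau> \<le> 1")
      case True
      have "sqrt (1 + \<tau>) \<le> sqrt 4" using True by (intro real_sqrt_le_mono) simp
      then have s2: "sqrt (1 + \<tau>) \<le> 2" by simp
      have s0: "sqrt (1 + \<tau>) > 0" using \<tau> by simp
      have "2 * B * sqrt (1 + \<tau>) \<le> 2 * B * 2" using s2 B by (intro mult_left_mono) auto
      also have "\<dots> = B * 4" by simp
      also have "\<dots> \<le> B * K" using B by (intro mult_left_mono) (simp_all add: K_def)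
      finally have le: "2 * B \<le> B * K / sqrt (1 + \<tau>)" using s0 by (simp add: pos_le_divide_eq)
      show ?thesis
        using S_sup_contraction[OF w \<tau> B wB]
      proof eventually_elim
        case (elim x)
        then show ?case using \<mu>B le by linarith
      qed
    next
      case False
      define z where "z x = w x - \<mu>" for x
      have c2: "(\<lambda>x. \<mu>) \<in> L2 \<Omega>" by (intro L2_const domain)
      have z2: "z \<in> L2 \<Omega>" unfolding z_def[abs_def] by (intro L2_diff w2 c2)
      have mz: "(LINT x|M. z x) = 0"
        using L2_integrable[OF domain(2) w2] L2_integrable[OF domain(2) c2] integral_const[of \<mu>]
        by (simp add: z_def \<mu>_def)
      have nz: "nrm z \<le> 2 * B"
        using L2_norm_triangle_diff[OF w2 c2] nw \<mu>B by (simp add: z_def[abs_def] nrm_const)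
      have t1: "\<tau> - 1 \<ge> 0" using False by simp
      have Sz: "S (\<tau> - 1) z \<in> L2 \<Omega>" by (rule S_L2[OF t1 z2])
      have den: "C + 2 * (\<tau> - 1) \<ge> m * (1 + \<tau>)"
      proof -
        have "m * (\<tau> - 1) \<le> 1 * (\<tau> - 1)" using m t1 by (intro mult_right_mono) auto
        then show ?thesis using m t1 by (simp add: algebra_simps)
      qed
      have "C / (C + 2 * (\<tau> - 1)) \<le> C / (m * (1 + \<tau>))" using den m C(1) \<tau> t1 by (intro divide_left_mono mult_pos_pos add_pos_nonneg) auto
      then have "sqrt (C / (C + 2 * (\<tau> - 1))) \<le> sqrt (C / m / (1 + \<tau>))" by (intro real_sqrt_le_mono) simp
      then have sq: "sqrt (C / (C + 2 * (\<tau> - 1))) \<le> sqrt (C / m) / sqrt (1 + \<tau>)" by (simp add: real_sqrt_divide real_sqrt_mult)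
      have "nrm (S (\<tau> - 1) z) \<le> sqrt (C / (C + 2 * (\<tau> - 1))) * nrm z" by (rule C(2)[OF z2 mz t1])
      also have "\<dots> \<le> sqrt (C / m) / sqrt (1 + \<tau>) * (2 * B)"
        using sq nz \<tau> m C(1) by (intro mult_mono) auto
      finally have "K1 * nrm (S (\<tau> - 1) z) \<le> K1 * (sqrt (C / m) / sqrt (1 + \<tau>) * (2 * B))" using K1(1) by (intro mult_left_mono) auto
      also have "\<dots> = B * (2 * K1 * sqrt (C / m)) / sqrt (1 + \<tau>)" by simp
      also have "\<dots> \<le> B * K / sqrt (1 + \<tau>)" using B \<tau> by (intro divide_right_mono mult_left_mono) (auto simp: K_def)
      finally have le: "K1 * nrm (S (\<tau> - 1) z) \<le> B * K / sqrt (1 + \<tau>)" .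
      have "AE x in M. S \<tau> z x = S 1 (S (\<tau> - 1) z) x" using S_add_time[of 1 "\<tau> - 1" z] t1 z2 by simp
      with S_diff[OF \<tau> w2 c2] S_const[OF \<tau>, of \<mu>] K1(2)[OF Sz] show ?thesis
        unfolding z_def[abs_def, symmetric]
      proof eventually_elim
        case (elim x)
        then show ?case using le by simp
      qed
    qed
    then show "AE x in M. \<bar>S \<tau> w x - (LINT x|M. w x)\<bar> \<le> B * K / sqrt (1 + \<tau>)" by (simp add: \<mu>_def)
  qed
qed

end

section \<open>Comparison of the two systems\<close>

definition lip2 :: "real \<Rightarrow> (real \<times> real \<Rightarrow> real) \<Rightarrow> bool" where
  "lip2 L F \<longleftrightarrow> (\<forall>a b a' b'. \<bar>F (a, b) - F (a', b')\<bar> \<le> L * (\<bar>a - a'\<bar> + \<bar>b - b'\<bar>))"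

lemma lip2D: "lip2 L F \<Longrightarrow> \<bar>F (a, b) - F (a', b')\<bar> \<le> L * (\<bar>a - a'\<bar> + \<bar>b - b'\<bar>)"
  by (simp add: lip2_def)

lemma lip2_nonneg: "lip2 L F \<Longrightarrow> L \<ge> 0"
  using lip2D[of L F 1 0 0 0] by (auto intro: order_trans[OF abs_ge_zero])

lemma lip2_continuous:
  assumes "lip2 L F"
  shows "continuous_on UNIV F"
proof -
  have "(2 * L)-lipschitz_on UNIV F"
  proof (rule lipschitz_onI)
    show "0 \<le> 2 * L" using lip2_nonneg[OF assms] by simp
    fix p q :: "real \<times> real"
    have "dist (F p) (F q) \<le> L * (\<bar>fst p - fst q\<bar> + \<bar>snd p - snd q\<bar>)"
      using lip2D[OF assms, of "fst p" "snd p" "fst q" "snd q"] by (simp add: dist_real_def)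
    also have "\<dots> \<le> L * (dist p q + dist p q)"
      using dist_fst_le[of p q] dist_snd_le[of p q] lip2_nonneg[OF assms]
      by (intro mult_left_mono add_mono) (auto simp: dist_real_def)
    finally show "dist (F p) (F q) \<le> 2 * L * dist p q" by simp
  qed
  then show ?thesis by (rule lipschitz_on_continuous_on)
qed

lemma lip2_measurable:
  assumes F: "lip2 L F" and [measurable]: "a \<in> borel_measurable N" "b \<in> borel_measurable N"
  shows "(\<lambda>x. F (a x, b x)) \<in> borel_measurable N"
proof -
  have [measurable]: "F \<in> borel_measurable borel"
    by (rule borel_measurable_continuous_onI[OF lip2_continuous[OF F]])
  have "(\<lambda>x. (a x, b x)) \<in> N \<rightarrow>\<^sub>M borel" unfolding borel_prod[symmetric] by measurable
  from measurable_compose[OF this] show ?thesis by measurable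
qed

lemma nonlocal_solutionD:
  assumes "nonlocal_solution \<Omega> F G T u\<^sub>0 \<xi>\<^sub>0 u \<xi>"
  shows "\<And>t. 0 \<le> t \<Longrightarrow> t \<le> T \<Longrightarrow> u t \<in> Linf \<Omega>" "continuous_on {0..T} \<xi>"
    "AE x in lebesgue_on \<Omega>. \<forall>t\<in>{0..T}. ((\<lambda>s. F (u s x, \<xi> s)) has_integral (u t x - u\<^sub>0 x)) {0..t}"
    "\<And>t. 0 \<le> t \<Longrightarrow> t \<le> T \<Longrightarrow> ((\<lambda>s. LINT x|lebesgue_on \<Omega>. G (u s x, \<xi> s)) has_integral (\<xi> t - \<xi>\<^sub>0)) {0..t}"
  using assms unfolding nonlocal_solution_def Linf_continuous_def by auto

lemma Linf_measurable: "w \<in> Linf \<Omega> \<Longrightarrow> w \<in> borel_measurable (lebesgue_on \<Omega>)"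
  by (simp add: Linf_def)

lemma Linf_norm_le_iff:
  assumes "w \<in> borel_measurable (lebesgue_on \<Omega>)"
  shows "Linf_norm \<Omega> w \<le> ereal c \<longleftrightarrow> (AE x in lebesgue_on \<Omega>. \<bar>w x\<bar> \<le> c)"
proof
  have m: "(\<lambda>x. ereal \<bar>w x\<bar>) \<in> borel_measurable (lebesgue_on \<Omega>)" using assms by measurable
  assume le: "Linf_norm \<Omega> w \<le> ereal c"
  have "AE x in lebesgue_on \<Omega>. ereal \<bar>w x\<bar> \<le> Linf_norm \<Omega> w" unfolding Linf_norm_def by (rule esssup_AE)
  then show "AE x in lebesgue_on \<Omega>. \<bar>w x\<bar> \<le> c"
  proof eventually_elim
    case (elim x)
    then have "ereal \<bar>w x\<bar> \<le> ereal c" using le by (rule order_trans)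
    then show ?case by simp
  qed
next
  have m: "(\<lambda>x. ereal \<bar>w x\<bar>) \<in> borel_measurable (lebesgue_on \<Omega>)" using assms by measurable
  assume "AE x in lebesgue_on \<Omega>. \<bar>w x\<bar> \<le> c"
  then show "Linf_norm \<Omega> w \<le> ereal c"
    unfolding Linf_norm_def by (intro esssup_I[OF m]) simp
qed

lemma L2_inner_bounded:
  assumes \<Omega>: "\<Omega> \<in> lmeasurable" and w: "w \<in> borel_measurable (lebesgue_on \<Omega>)" "AE x in lebesgue_on \<Omega>. \<bar>w x\<bar> \<le> c"
    and \<phi>: "\<phi> \<in> L2 \<Omega>"
  shows "\<bar>L2_inner \<Omega> w \<phi>\<bar> \<le> c * (LINT x|lebesgue_on \<Omega>. \<bar>\<phi> x\<bar>)"
proof -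
  have w2: "w \<in> L2 \<Omega>" by (rule L2_bounded[OF \<Omega> w])
  have "\<bar>L2_inner \<Omega> w \<phi>\<bar> \<le> (LINT x|lebesgue_on \<Omega>. \<bar>w x * \<phi> x\<bar>)"
    unfolding L2_inner_def by (rule integral_abs_bound)
  also have "\<dots> \<le> (LINT x|lebesgue_on \<Omega>. c * \<bar>\<phi> x\<bar>)"
  proof (rule integral_mono_AE)
    show "integrable (lebesgue_on \<Omega>) (\<lambda>x. \<bar>w x * \<phi> x\<bar>)" using L2_mult_integrable[OF w2 \<phi>] by auto
    show "integrable (lebesgue_on \<Omega>) (\<lambda>x. c * \<bar>\<phi> x\<bar>)" using L2_integrable[OF \<Omega> \<phi>] by auto
    show "AE x in lebesgue_on \<Omega>. \<bar>w x * \<phi> x\<bar> \<le> c * \<bar>\<phi> x\<bar>"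
      using w(2) by eventually_elim (simp add: abs_mult mult_right_mono)
  qed
  finally show ?thesis by simp
qed

text \<open>The pairing \<open>\<langle>u t, \<phi>\<rangle>\<close> is differentiable, because \<open>u\<close> is Lipschitz in time uniformly in \<open>x\<close>;
  this replaces an application of Fubini's theorem.\<close>

lemma nonlocal_solution_weak:
  assumes \<Omega>: "\<Omega> \<in> lmeasurable" and nl: "nonlocal_solution \<Omega> F G T u\<^sub>0 \<xi>\<^sub>0 u \<xi>"
    and F: "lip2 L F" "\<And>p. \<bar>F p\<bar> \<le> B" and u0: "u\<^sub>0 \<in> L2 \<Omega>" and \<phi>: "\<phi> \<in> L2 \<Omega>" and t: "0 \<le> t" "t \<le> T"
    and u2: "\<And>t. 0 \<le> t \<Longrightarrow> t \<le> T \<Longrightarrow> u t \<in> L2 \<Omega>"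
  shows "((\<lambda>s. L2_inner \<Omega> (\<lambda>x. F (u s x, \<xi> s)) \<phi>) has_integral L2_inner \<Omega> (\<lambda>x. u t x - u\<^sub>0 x) \<phi>) {0..t}"
proof -
  let ?M = "lebesgue_on \<Omega>"
  note nlD = nonlocal_solutionD[OF nl]
  have B0: "B \<ge> 0" using F(2)[of 0] by (auto intro: order_trans[OF abs_ge_zero])
  have L0: "L \<ge> 0" by (rule lip2_nonneg[OF F(1)])
  have Fm: "(\<lambda>x. F (u s x, \<xi> s)) \<in> borel_measurable ?M" if "0 \<le> s" "s \<le> T" for s
    by (intro lip2_measurable[OF F(1)] L2_measurable[OF u2[OF that]]) simp
  have F2: "(\<lambda>x. F (u s x, \<xi> s)) \<in> L2 \<Omega>" if "0 \<le> s" "s \<le> T" for s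
    by (rule L2_bounded[OF \<Omega> Fm[OF that], of B]) (simp add: F(2))
  have inc: "AE x in ?M. \<forall>a\<in>{0..T}. \<forall>b\<in>{0..T}. a \<le> b \<longrightarrow> ((\<lambda>s. F (u s x, \<xi> s)) has_integral (u b x - u a x)) {a..b}"
    using nlD(3)
  proof eventually_elim
    case (elim x)
    show ?case
    proof (intro ballI impI)
      fix a b assume ab: "a \<in> {0..T}" "b \<in> {0..T}" "a \<le> b"
      let ?f = "\<lambda>s. F (u s x, \<xi> s)"
      have 0: "(?f has_integral (u a x - u\<^sub>0 x)) {0..a}" "(?f has_integral (u b x - u\<^sub>0 x)) {0..b}" using elim ab by auto
      have int: "?f integrable_on {a..b}"
        using integrable_on_subinterval[OF has_integral_integrable[OF 0(2)], of a b] ab by auto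
      have "integral {0..a} ?f + integral {a..b} ?f = integral {0..b} ?f"
        using ab by (intro Henstock_Kurzweil_Integration.integral_combine has_integral_integrable[OF 0(2)]) auto
      then have "integral {a..b} ?f = u b x - u a x" using integral_unique[OF 0(1)] integral_unique[OF 0(2)] by simp
      then show "(?f has_integral (u b x - u a x)) {a..b}" using int by (simp add: has_integral_iff)
    qed
  qed
  have lipu: "AE x in ?M. \<forall>a\<in>{0..T}. \<forall>b\<in>{0..T}. \<bar>u b x - u a x\<bar> \<le> B * \<bar>b - a\<bar>"
    using inc
  proof eventually_elim
    case (elim x)
    have le: "\<bar>u b x - u a x\<bar> \<le> B * \<bar>b - a\<bar>" if "a \<in> {0..T}" "b \<in> {0..T}" "a \<le> b" for a b
      using has_integral_bound[OF B0, of "\<lambda>s. F (u s x, \<xi> s)" "u b x - u a x" a b] elim that F(2) by auto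
    show ?case
    proof (intro ballI)
      fix a b assume "a \<in> {0..T}" "b \<in> {0..T}"
      then show "\<bar>u b x - u a x\<bar> \<le> B * \<bar>b - a\<bar>"
        using le[of a b] le[of b a] by (cases "a \<le> b") (auto simp: abs_minus_commute)
    qed
  qed
  let ?y = "\<lambda>s. L2_inner \<Omega> (u s) \<phi>" and ?y' = "\<lambda>s. L2_inner \<Omega> (\<lambda>x. F (u s x, \<xi> s)) \<phi>"
  define I where "I = (LINT x|?M. \<bar>\<phi> x\<bar>)"
  have I0: "I \<ge> 0" by (simp add: I_def)
  have der: "(?y has_real_derivative ?y' r) (at r within {0..T})" if r: "r \<in> {0..T}" for r
    unfolding has_field_derivative_def has_derivative_within_alt
  proof (intro conjI allI impI)
    show "bounded_linear (\<lambda>x. ?y' r * x)" by (rule bounded_linear_mult_right)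
    fix e :: real assume e: "e > 0"
    \<comment> \<open>\<open>e1\<close> is the pointwise error allowed before pairing with
      \<open>\<phi>\<close>, with \<open>I + 1\<close> guarding against \<open>I = 0\<close>. Below,
      \<open>e2\<close> is allotted to each argument of \<open>F\<close>, so that the two together
      cost at most \<open>e1\<close> after multiplication by \<open>L\<close>.\<close>
    define e1 where "e1 = e / (I + 1)"
    have e1: "e1 > 0" using e I0 by (simp add: e1_def)
    define e2 where "e2 = e1 / (2 * (L + 1))"
    have e2: "e2 > 0" using e1 L0 by (simp add: e2_def)
    obtain d where d: "d > 0" "\<And>s. s \<in> {0..T} \<Longrightarrow> \<bar>s - r\<bar> < d \<Longrightarrow> \<bar>\<xi> s - \<xi> r\<bar> < e2"
      using nlD(2) r e2 unfolding continuous_on_iff dist_real_def by metis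
    define d' where "d' = min d (e2 / (B + 1))"
    have d': "d' > 0" using d(1) e2 B0 by (simp add: d'_def)
    show "\<exists>d>0. \<forall>s\<in>{0..T}. norm (s - r) < d \<longrightarrow> norm (?y s - ?y r - ?y' r * (s - r)) \<le> e * norm (s - r)"
    proof (intro exI[of _ d'] conjI ballI impI d')
      fix s assume s: "s \<in> {0..T}" "norm (s - r) < d'"
      have AEb: "AE x in ?M. \<bar>u s x - u r x - (s - r) * F (u r x, \<xi> r)\<bar> \<le> e1 * \<bar>s - r\<bar>"
        using inc lipu
      proof eventually_elim
        case (elim x)
        let ?f = "\<lambda>q. F (u q x, \<xi> q)"
        have near: "\<bar>?f q - ?f r\<bar> \<le> e1" if q: "q \<in> {0..T}" "\<bar>q - r\<bar> \<le> \<bar>s - r\<bar>" for q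
        proof -
          have "\<bar>\<xi> q - \<xi> r\<bar> \<le> e2" using d(2)[OF q(1)] q(2) s(2) by (force simp: d'_def)
          moreover have "\<bar>u q x - u r x\<bar> \<le> e2"
          proof -
            have "\<bar>u q x - u r x\<bar> \<le> B * \<bar>q - r\<bar>" using elim(2) q(1) r by blast
            also have "\<dots> \<le> (B + 1) * (e2 / (B + 1))" using B0 q(2) s(2) by (intro mult_mono) (auto simp: d'_def)
            also have "\<dots> = e2" using B0 by simp
            finally show ?thesis .
          qed
          ultimately have "L * (\<bar>u q x - u r x\<bar> + \<bar>\<xi> q - \<xi> r\<bar>) \<le> (L + 1) * (e2 + e2)"
            using L0 e2 by (intro mult_mono) auto
          also have "\<dots> = e2 * (2 * (L + 1))" by (simp add: algebra_simps)
          also have "\<dots> = e1" using L0 by (simp add: e2_def)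
          finally show ?thesis using lip2D[OF F(1), of "u q x" "\<xi> q" "u r x" "\<xi> r"] by linarith
        qed
        have main: "\<bar>u b x - u a x - (b - a) * ?f r\<bar> \<le> e1 * (b - a)"
          if ab: "a \<in> {0..T}" "b \<in> {0..T}" "a \<le> b" "\<And>q. a \<le> q \<Longrightarrow> q \<le> b \<Longrightarrow> \<bar>q - r\<bar> \<le> \<bar>s - r\<bar>" for a b
        proof -
          have h: "((\<lambda>q. ?f q - ?f r) has_integral ((u b x - u a x) - (b - a) * ?f r)) {a..b}"
            using has_integral_diff[of ?f "u b x - u a x" "{a..b}" "\<lambda>q. ?f r" "(b - a) * ?f r"] elim(1) ab
              has_integral_const_real[of "?f r" a b] by auto
          have "norm ((u b x - u a x) - (b - a) * ?f r) \<le> e1 * measure lborel {a..b}"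
            using e1 ab near by (intro has_integral_bound_real[OF _ finite.emptyI h]) auto
          then show ?thesis using ab(3) by simp
        qed
        show ?case
        proof (cases "r \<le> s")
          case True
          then show ?thesis using main[of r s] r s by auto
        next
          case False
          then have "\<bar>u r x - u s x - (r - s) * ?f r\<bar> \<le> e1 * (r - s)" using main[of s r] r s by auto
          moreover have "u s x - u r x - (s - r) * ?f r = - (u r x - u s x - (r - s) * ?f r)" by (simp add: algebra_simps)
          ultimately show ?thesis using False by (simp only: abs_minus_cancel) (simp add: abs_if)
        qed
      qed
      have sT: "0 \<le> s" "s \<le> T" "0 \<le> r" "r \<le> T" using s r by auto
      have m: "(\<lambda>x. u s x - u r x - (s - r) * F (u r x, \<xi> r)) \<in> borel_measurable ?M"
        by (intro L2_measurable L2_diff L2_cmult u2 F2 sT)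
      have "?y s - ?y r - ?y' r * (s - r) = L2_inner \<Omega> (\<lambda>x. u s x - u r x - (s - r) * F (u r x, \<xi> r)) \<phi>"
        using u2[OF sT(1,2)] u2[OF sT(3,4)] F2[OF sT(3,4)] \<phi>
        by (simp add: L2_inner_diff L2_diff L2_cmult L2_inner_cmult mult.commute)
      then have "norm (?y s - ?y r - ?y' r * (s - r)) \<le> e1 * \<bar>s - r\<bar> * I"
        using L2_inner_bounded[OF \<Omega> m AEb \<phi>] by (simp add: I_def)
      also have "\<dots> = e * \<bar>s - r\<bar> * (I / (I + 1))" by (simp add: e1_def)
      also have "\<dots> \<le> e * \<bar>s - r\<bar> * 1" using e I0 by (intro mult_left_mono) auto
      finally show "norm (?y s - ?y r - ?y' r * (s - r)) \<le> e * norm (s - r)" by simp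
    qed
  qed
  have "(?y' has_integral (?y t - ?y 0)) {0..t}"
  proof (rule fundamental_theorem_of_calculus[OF t(1)])
    fix r assume "r \<in> {0..t}"
    then have "(?y has_real_derivative ?y' r) (at r within {0..t})"
      using has_field_derivative_subset[OF der, of r "{0..t}"] t by auto
    then show "(?y has_vector_derivative ?y' r) (at r within {0..t})"
      by (simp add: has_real_derivative_iff_has_vector_derivative)
  qed
  moreover have "?y 0 = L2_inner \<Omega> u\<^sub>0 \<phi>"
  proof (rule L2_inner_cong_AE[OF _ u0 \<phi>])
    show "u 0 \<in> L2 \<Omega>" using u2 t by auto
    show "AE x in ?M. u 0 x = u\<^sub>0 x"
      using nlD(3)
    proof eventually_elim
      case (elim x)
      have "0 \<in> {0..T}" using t by simp
      with elim have "((\<lambda>s. F (u s x, \<xi> s)) has_integral (u 0 x - u\<^sub>0 x)) {0..0}" by blast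
      from integral_unique[OF this] show ?case by simp
    qed
  qed
  ultimately show ?thesis using u2[OF t] u0 \<phi> by (simp add: L2_inner_diff)
qed

text \<open>Used with \<open>c = 1\<close> for the initial layer and with \<open>c = -1\<close> for
  the decay of the semigroup over the elapsed time \<open>t - s\<close>.\<close>

lemma inverse_sqrt_antiderivative:
  fixes D a c s :: real
  assumes "D > 0" "1 + (a + c * s) * D > 0"
  shows "((\<lambda>s. 2 * sqrt (1 + (a + c * s) * D) / D) has_real_derivative c / sqrt (1 + (a + c * s) * D)) (at s)"
proof -
  let ?X = "sqrt (1 + (a + c * s) * D)"
  have lin: "((\<lambda>s. 1 + (a + c * s) * D) has_real_derivative c * D) (at s)"
    by (auto intro!: derivative_eq_intros)
  have sqrt': "((\<lambda>s. sqrt (1 + (a + c * s) * D)) has_real_derivative inverse ?X / 2 * (c * D)) (at s)"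
    by (rule DERIV_chain2[where f=sqrt and g="\<lambda>s. 1 + (a + c * s) * D"])
       (rule DERIV_real_sqrt[OF assms(2)], rule lin)
  have "((\<lambda>s. 2 / D * sqrt (1 + (a + c * s) * D)) has_real_derivative 2 / D * (inverse ?X / 2 * (c * D))) (at s)"
    by (rule DERIV_cmult[OF sqrt'])
  moreover have "(\<lambda>s. 2 / D * sqrt (1 + (a + c * s) * D)) = (\<lambda>s. 2 * sqrt (1 + (a + c * s) * D) / D)"
    by simp
  moreover have "2 / D * (inverse ?X / 2 * (c * D)) = c / ?X"
    using assms(1) by (simp add: field_simps)
  ultimately show ?thesis by (simp only:)
qed

lemma has_integral_exp_plus_inverse_sqrt:
  fixes L \<kappa> \<omega> b D t :: real
  assumes "D > 0" "\<omega> > 0" "t \<ge> 0"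
  shows "((\<lambda>s. L * (2 * \<kappa> * exp (\<omega> * s) + b / sqrt (1 + s * D))) has_integral
    (L * (2 * \<kappa> * (exp (\<omega> * t) - 1) / \<omega> + b * (2 * (sqrt (1 + t * D) - 1) / D)))) {0..t}"
proof -
  have "((\<lambda>s. L * (2 * \<kappa> * exp (\<omega> * s) + b / sqrt (1 + s * D))) has_integral
    ((\<lambda>s. L * (2 * \<kappa> * exp (\<omega> * s) / \<omega> + b * (2 * sqrt (1 + s * D) / D))) t
      - (\<lambda>s. L * (2 * \<kappa> * exp (\<omega> * s) / \<omega> + b * (2 * sqrt (1 + s * D) / D))) 0)) {0..t}"
  proof (rule fundamental_theorem_of_calculus[OF assms(3)])
    fix s assume s: "s \<in> {0..t}"
    then have pos: "1 + s * D > 0" using assms by (simp add: add_pos_nonneg)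
    have d1: "((\<lambda>s. 2 * sqrt (1 + s * D) / D) has_real_derivative 1 / sqrt (1 + s * D)) (at s)"
      using inverse_sqrt_antiderivative[of D 0 1 s] assms(1) pos by simp
    have d2: "((\<lambda>s. 2 * \<kappa> * exp (\<omega> * s) / \<omega>) has_real_derivative 2 * \<kappa> * exp (\<omega> * s)) (at s)"
      using assms(2) by (auto intro!: derivative_eq_intros)
    have "((\<lambda>s. L * (2 * \<kappa> * exp (\<omega> * s) / \<omega> + b * (2 * sqrt (1 + s * D) / D))) has_real_derivative
        L * (2 * \<kappa> * exp (\<omega> * s) + b / sqrt (1 + s * D))) (at s)"
      using DERIV_cmult[OF DERIV_add[OF d2 DERIV_cmult[OF d1, of b]], of L] by simp
    then show "((\<lambda>s. L * (2 * \<kappa> * exp (\<omega> * s) / \<omega> + b * (2 * sqrt (1 + s * D) / D))) has_vector_derivative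
        L * (2 * \<kappa> * exp (\<omega> * s) + b / sqrt (1 + s * D))) (at s within {0..t})"
      by (simp add: has_real_derivative_iff_has_vector_derivative has_vector_derivative_at_within)
  qed
  then show ?thesis by (simp add: algebra_simps diff_divide_distrib)
qed

lemma has_integral_inverse_sqrt_reversed:
  fixes b D t :: real
  assumes "D > 0" "t \<ge> 0"
  shows "((\<lambda>s. b / sqrt (1 + (t - s) * D)) has_integral (b * (2 * (sqrt (1 + t * D) - 1) / D))) {0..t}"
proof -
  have "((\<lambda>s. b / sqrt (1 + (t - s) * D)) has_integral
    ((\<lambda>s. - b * (2 * sqrt (1 + (t - s) * D) / D)) t - (\<lambda>s. - b * (2 * sqrt (1 + (t - s) * D) / D)) 0)) {0..t}"
  proof (rule fundamental_theorem_of_calculus[OF assms(2)])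
    fix s assume s: "s \<in> {0..t}"
    then have pos: "1 + (t - s) * D > 0" using assms by (simp add: add_pos_nonneg)
    have "((\<lambda>s. - b * (2 * sqrt (1 + (t - s) * D) / D)) has_real_derivative b / sqrt (1 + (t - s) * D)) (at s)"
      using DERIV_cmult[OF inverse_sqrt_antiderivative[of D t "-1" s], of "- b"] assms(1) pos by simp
    then show "((\<lambda>s. - b * (2 * sqrt (1 + (t - s) * D) / D)) has_vector_derivative b / sqrt (1 + (t - s) * D)) (at s within {0..t})"
      by (simp add: has_real_derivative_iff_has_vector_derivative has_vector_derivative_at_within)
  qed
  then show ?thesis by (simp add: algebra_simps diff_divide_distrib)
qed

context neumann_semigroup
begin

text \<open>The supremum norm of the error is not known to be measurable in time, so it cannot be
  put into Gronwall's inequality. Instead an explicit bound is improved repeatedly: if the error is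
  below \<open>\<kappa> * exp (\<omega> * t)\<close> plus the layer, the integral equations return
  the same bound with \<open>\<kappa> / 2 + c * \<epsilon>\<close>. The a priori bound
  \<open>R\<close> only starts the iteration and leaves no trace in \<open>Q\<close>, so the
  estimate is uniform in \<open>D\<close> up to the explicit factor.\<close>

lemma comparison_estimate:
  fixes u v :: "real \<Rightarrow> 'a \<Rightarrow> real"
  assumes K: "K > 0" and decay: "\<And>\<tau> w B. \<tau> \<ge> 0 \<Longrightarrow> B \<ge> 0 \<Longrightarrow> w \<in> borel_measurable M \<Longrightarrow> AE x in M. \<bar>w x\<bar> \<le> B \<Longrightarrow>
      AE x in M. \<bar>S \<tau> w x - (LINT x|M. w x)\<bar> \<le> B * K / sqrt (1 + \<tau>)"
    and F: "lip2 L F" "\<And>p. \<bar>F p\<bar> \<le> B" and G: "lip2 L G" "\<And>p. \<bar>G p\<bar> \<le> B" and L: "L > 0"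
    and T: "T > 0" and D: "D > 0"
    and mild: "mild_solution \<Omega> S F G D T u\<^sub>0 v\<^sub>0 ud vd"
    and nl: "nonlocal_solution \<Omega> F G T u\<^sub>0 (LINT x|M. v\<^sub>0 x) u \<xi>"
    and u0: "u\<^sub>0 \<in> L2 \<Omega>" and v0: "v\<^sub>0 \<in> borel_measurable M" "AE x in M. \<bar>v\<^sub>0 x\<bar> \<le> B"
    and u2: "\<And>t. 0 \<le> t \<Longrightarrow> t \<le> T \<Longrightarrow> u t \<in> L2 \<Omega>"
    and R: "\<And>t. 0 \<le> t \<Longrightarrow> t \<le> T \<Longrightarrow> AE x in M. \<bar>ud t x - u t x\<bar> \<le> R"
      "\<And>t. 0 \<le> t \<Longrightarrow> t \<le> T \<Longrightarrow> AE x in M. \<bar>vd t x - \<xi> t\<bar> \<le> R"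
    and t: "0 \<le> t" "t \<le> T"
  defines "Q \<equiv> 2 * (B * K * (1 + L)) * (2 * sqrt (1 + T * D) / D) * exp (8 * L * T)"
  shows "AE x in M. \<bar>ud t x - u t x\<bar> \<le> Q" "AE x in M. \<bar>vd t x - \<xi> t\<bar> \<le> B * K / sqrt (1 + t * D) + Q"
proof -
  define \<omega> where "\<omega> = 8 * L"
  define \<epsilon> where "\<epsilon> = 2 * sqrt (1 + T * D) / D"
  define \<eta> where "\<eta> s = B * K / sqrt (1 + s * D)" for s
  \<comment> \<open>The summand 1 accounts for the decay of the semigroup inside the Duhamel
    integral, and \<open>L\<close> for the initial layer entering through the Lipschitz
    bounds.\<close>
  define c where "c = B * K * (1 + L)"
  define \<xi>\<^sub>0 where "\<xi>\<^sub>0 = (LINT x|M. v\<^sub>0 x)"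
  have \<omega>: "\<omega> > 0" using L by (simp add: \<omega>_def)
  have B0: "B \<ge> 0" using F(2)[of 0] by (auto intro: order_trans[OF abs_ge_zero])
  have BK: "B * K \<ge> 0" using B0 K by simp
  have \<epsilon>0: "\<epsilon> \<ge> 0" using D T by (simp add: \<epsilon>_def)
  have c0: "c \<ge> 0" using BK L by (simp add: c_def)
  \<comment> \<open>A statement that does not involve \<open>x\<close> and holds almost everywhere
    is true, since \<Omega> is not a null set.\<close>
  have R0: "R \<ge> 0"
  proof -
    have "AE x in M. 0 \<le> R" using R(1)[of 0] T by (auto elim!: eventually_mono intro: order_trans[OF abs_ge_zero])
    moreover have "emeasure M (space M) \<noteq> 0"
      using unit_measure domain by (auto simp: emeasure_restrict_space measure_def)
    ultimately show ?thesis using ae_filter_eq_bot_iff[of M] by (auto simp: eventually_const_iff)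
  qed
  have in2: "ud s \<in> L2 \<Omega>" "vd s \<in> L2 \<Omega>" if "0 \<le> s" "s \<le> T" for s
    using mild that unfolding mild_solution_def L2_continuous_def by auto
  have hF: "has_L2_integral \<Omega> (\<lambda>s x. F (ud s x, vd s x)) t (\<lambda>x. ud t x - u\<^sub>0 x)"
    and hG: "has_L2_integral \<Omega> (\<lambda>s. S ((t - s) * D) (\<lambda>x. G (ud s x, vd s x))) t (\<lambda>x. vd t x - S (t * D) v\<^sub>0 x)"
    if "0 \<le> t" "t \<le> T" for t
    using mild that unfolding mild_solution_def by auto
  note nlD = nonlocal_solutionD[OF nl]
  have c2: "(\<lambda>x. k) \<in> L2 \<Omega>" for k by (intro L2_const domain)
  have meas: "(\<lambda>x. H (ud s x, vd s x)) \<in> borel_measurable M" "(\<lambda>x. H (u s x, \<xi> s)) \<in> borel_measurable M"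
    if "0 \<le> s" "s \<le> T" "lip2 L H" for s H
    using in2[OF that(1,2), THEN L2_measurable] u2[OF that(1,2), THEN L2_measurable]
    by (auto intro!: lip2_measurable[OF that(3)])
  have v02: "v\<^sub>0 \<in> L2 \<Omega>" by (rule L2_bounded[OF domain(2) v0])
  \<comment> \<open>Only the diffusing component carries the layer \<open>\<eta>\<close>: at time 0
    the function \<open>v\<^sub>0\<close> differs from its mean, whereas both systems start from the
    same \<open>u\<^sub>0\<close>.\<close>
  define good where "good \<kappa> \<longleftrightarrow> \<kappa> \<ge> 0 \<and> (\<forall>s. 0 \<le> s \<and> s \<le> T \<longrightarrow>
      (AE x in M. \<bar>ud s x - u s x\<bar> \<le> \<kappa> * exp (\<omega> * s)) \<and> (AE x in M. \<bar>vd s x - \<xi> s\<bar> \<le> \<eta> s + \<kappa> * exp (\<omega> * s)))" for \<kappa>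
  have \<eta>0: "\<eta> s \<ge> 0" if "s \<ge> 0" for s using BK D that by (simp add: \<eta>_def)
  have step: "good (\<kappa> / 2 + c * \<epsilon>)" if \<kappa>: "good \<kappa>" for \<kappa>
    unfolding good_def
  proof (intro conjI allI impI)
    have \<kappa>0: "\<kappa> \<ge> 0" using \<kappa> by (simp add: good_def)
    then show "0 \<le> \<kappa> / 2 + c * \<epsilon>" using c0 \<epsilon>0 by simp
    define r where "r s = L * (2 * \<kappa> * exp (\<omega> * s) + B * K / sqrt (1 + s * D))" for s
    have diffb: "AE x in M. \<bar>H (ud s x, vd s x) - H (u s x, \<xi> s)\<bar> \<le> r s" if s: "0 \<le> s" "s \<le> T" and H: "lip2 L H" for s H
    proof -
      have "AE x in M. \<bar>ud s x - u s x\<bar> \<le> \<kappa> * exp (\<omega> * s)" "AE x in M. \<bar>vd s x - \<xi> s\<bar> \<le> \<eta> s + \<kappa> * exp (\<omega> * s)"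
        using \<kappa> s by (auto simp: good_def)
      then show ?thesis
      proof eventually_elim
        case (elim x)
        have "\<bar>H (ud s x, vd s x) - H (u s x, \<xi> s)\<bar> \<le> L * (\<bar>ud s x - u s x\<bar> + \<bar>vd s x - \<xi> s\<bar>)" by (rule lip2D[OF H])
        also have "\<dots> \<le> r s" unfolding r_def using elim L by (intro mult_left_mono) (auto simp: \<eta>_def)
        finally show ?case .
      qed
    qed
    fix s assume "0 \<le> s \<and> s \<le> T"
    then have s: "0 \<le> s" "s \<le> T" by auto
    define Ir where "Ir = L * (2 * \<kappa> * (exp (\<omega> * s) - 1) / \<omega> + B * K * (2 * (sqrt (1 + s * D) - 1) / D))"
    have rI: "(r has_integral Ir) {0..s}"
      unfolding r_def[abs_def] Ir_def by (rule has_integral_exp_plus_inverse_sqrt[OF D \<omega> s(1)])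
    have sq: "2 * (sqrt (1 + s * D) - 1) / D \<le> \<epsilon>"
    proof -
      have "sqrt (1 + s * D) \<le> sqrt (1 + T * D)" using s D by (intro real_sqrt_le_mono) (auto intro: mult_right_mono)
      then have "sqrt (1 + s * D) - 1 \<le> sqrt (1 + T * D)" by (rule order_trans[rotated]) simp
      then have "2 * (sqrt (1 + s * D) - 1) \<le> 2 * sqrt (1 + T * D)" by (rule mult_left_mono) simp
      then show ?thesis unfolding \<epsilon>_def using D by (intro divide_right_mono) simp_all
    qed
    have e1: "exp (\<omega> * s) \<ge> 1" using \<omega> s by simp
    have Ir: "Ir \<le> \<kappa> / 4 * exp (\<omega> * s) + L * (B * K) * \<epsilon>"
    proof -
      \<comment> \<open>The factor 2 counts the errors of both components; with
        \<open>\<omega> = 8 * L\<close> the integrated exponential returns a quarter of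
        \<open>\<kappa>\<close>, within the half that the iteration allows.\<close>
      have "L * (2 * \<kappa> * (exp (\<omega> * s) - 1) / \<omega>) = \<kappa> / 4 * (exp (\<omega> * s) - 1)" using L by (simp add: \<omega>_def)
      also have "\<dots> \<le> \<kappa> / 4 * exp (\<omega> * s)" using \<kappa>0 by (intro mult_left_mono) auto
      finally have 1: "L * (2 * \<kappa> * (exp (\<omega> * s) - 1) / \<omega>) \<le> \<kappa> / 4 * exp (\<omega> * s)" .
      have 2: "L * (B * K) * (2 * (sqrt (1 + s * D) - 1) / D) \<le> L * (B * K) * \<epsilon>" using sq BK L by (intro mult_left_mono) auto
      have "Ir = L * (2 * \<kappa> * (exp (\<omega> * s) - 1) / \<omega>) + L * (B * K) * (2 * (sqrt (1 + s * D) - 1) / D)"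
        unfolding Ir_def by (simp only: distrib_left mult.assoc)
      then show ?thesis using add_mono[OF 1 2] by (simp only:)
    qed
    have grow: "a \<le> a * exp (\<omega> * s)" if "a \<ge> 0" for a using e1 that by (simp add: mult_le_cancel_left1)
    have ce: "L * (B * K) * \<epsilon> + B * K * \<epsilon> = c * \<epsilon>" by (simp add: c_def algebra_simps)
    have ce0: "L * (B * K) * \<epsilon> \<ge> 0" "B * K * \<epsilon> \<ge> 0" using L BK \<epsilon>0 by auto
    have half: "\<kappa> / 4 * exp (\<omega> * s) \<le> \<kappa> / 2 * exp (\<omega> * s)" using \<kappa>0 by (intro mult_right_mono) auto
    show "AE x in M. \<bar>ud s x - u s x\<bar> \<le> (\<kappa> / 2 + c * \<epsilon>) * exp (\<omega> * s)"
    proof (rule AE_abs_le_by_duality[OF domain(2)])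
      show "(\<lambda>x. ud s x - u s x) \<in> L2 \<Omega>" by (intro L2_diff in2 u2 s)
      show "0 \<le> (\<kappa> / 2 + c * \<epsilon>) * exp (\<omega> * s)" using \<kappa>0 c0 \<epsilon>0 by simp
      fix \<phi> :: "'a \<Rightarrow> real" assume \<phi>: "\<phi> \<in> borel_measurable M" "\<And>x. \<bar>\<phi> x\<bar> \<le> 1"
      have \<phi>2: "\<phi> \<in> L2 \<Omega>" by (rule L2_bounded[OF domain(2) \<phi>(1), of 1]) (simp add: \<phi>(2))
      define I where "I = (LINT x|M. \<bar>\<phi> x\<bar>)"
      have I0: "I \<ge> 0" by (simp add: I_def)
      have h1: "((\<lambda>q. ip (\<lambda>x. F (ud q x, vd q x)) \<phi>) has_integral ip (\<lambda>x. ud s x - u\<^sub>0 x) \<phi>) {0..s}"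
        using hF[OF s] \<phi>2 unfolding has_L2_integral_def L2_inner_def
        by (auto simp: has_integral_iff set_lebesgue_integral_eq_integral(1))
      have h2: "((\<lambda>q. ip (\<lambda>x. F (u q x, \<xi> q)) \<phi>) has_integral ip (\<lambda>x. u s x - u\<^sub>0 x) \<phi>) {0..s}"
        by (rule nonlocal_solution_weak[OF domain(2) nl F u0 \<phi>2 s u2])
      have "ip (\<lambda>x. ud s x - u\<^sub>0 x) \<phi> - ip (\<lambda>x. u s x - u\<^sub>0 x) \<phi> \<le> Ir * I"
      proof (rule has_integral_le[OF has_integral_diff[OF h1 h2] has_integral_mult_left[OF rI]])
        fix q assume "q \<in> {0..s}"
        then have q: "0 \<le> q" "q \<le> T" using s by auto
        have m: "(\<lambda>x. F (ud q x, vd q x) - F (u q x, \<xi> q)) \<in> borel_measurable M"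
          using meas[OF q F(1)] by measurable
        have f2: "(\<lambda>x. F (ud q x, vd q x)) \<in> L2 \<Omega>" "(\<lambda>x. F (u q x, \<xi> q)) \<in> L2 \<Omega>"
          using meas[OF q F(1)] F(2) by (auto intro!: L2_bounded[OF domain(2), of _ B])
        show "ip (\<lambda>x. F (ud q x, vd q x)) \<phi> - ip (\<lambda>x. F (u q x, \<xi> q)) \<phi> \<le> r q * I"
          using L2_inner_bounded[OF domain(2) m diffb[OF q F(1)] \<phi>2] L2_inner_diff[OF f2 \<phi>2] by (simp add: I_def)
      qed
      also have "\<dots> \<le> ((\<kappa> / 2 + c * \<epsilon>) * exp (\<omega> * s)) * I"
      proof (rule mult_right_mono[OF _ I0])
        have "L * (B * K) * \<epsilon> \<le> c * \<epsilon> * exp (\<omega> * s)" using ce ce0 grow[of "c * \<epsilon>"] c0 \<epsilon>0 by simp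
        then show "Ir \<le> (\<kappa> / 2 + c * \<epsilon>) * exp (\<omega> * s)" using Ir half unfolding distrib_right by linarith
      qed
      finally show "ip (\<lambda>x. ud s x - u s x) \<phi> \<le> (\<kappa> / 2 + c * \<epsilon>) * exp (\<omega> * s) * (LINT x|M. \<bar>\<phi> x\<bar>)"
        using in2[OF s] u2[OF s] u0 \<phi>2 by (simp add: L2_inner_diff I_def)
    qed
    show "AE x in M. \<bar>vd s x - \<xi> s\<bar> \<le> \<eta> s + (\<kappa> / 2 + c * \<epsilon>) * exp (\<omega> * s)"
    proof (rule AE_abs_le_by_duality[OF domain(2)])
      show "(\<lambda>x. vd s x - \<xi> s) \<in> L2 \<Omega>" by (intro L2_diff in2 c2 s)
      show "0 \<le> \<eta> s + (\<kappa> / 2 + c * \<epsilon>) * exp (\<omega> * s)" using \<kappa>0 c0 \<epsilon>0 \<eta>0[OF s(1)] by simp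
      fix \<phi> :: "'a \<Rightarrow> real" assume \<phi>: "\<phi> \<in> borel_measurable M" "\<And>x. \<bar>\<phi> x\<bar> \<le> 1"
      have \<phi>2: "\<phi> \<in> L2 \<Omega>" by (rule L2_bounded[OF domain(2) \<phi>(1), of 1]) (simp add: \<phi>(2))
      define I where "I = (LINT x|M. \<bar>\<phi> x\<bar>)"
      define J where "J = (LINT x|M. \<phi> x)"
      have I0: "I \<ge> 0" by (simp add: I_def)
      have JI: "\<bar>J\<bar> \<le> I" unfolding I_def J_def by (rule integral_abs_bound)
      have ipc: "ip (\<lambda>x. k) \<phi> = k * J" for k by (simp add: L2_inner_def J_def)
      let ?g = "\<lambda>q x. G (ud q x, vd q x)"
      define m where "m q = (LINT x|M. G (u q x, \<xi> q))" for q
      have h1: "((\<lambda>q. ip (S ((s - q) * D) (?g q)) \<phi>) has_integral ip (\<lambda>x. vd s x - S (s * D) v\<^sub>0 x) \<phi>) {0..s}"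
        using hG[OF s] \<phi>2 unfolding has_L2_integral_def L2_inner_def
        by (auto simp: has_integral_iff set_lebesgue_integral_eq_integral(1))
      have h2: "((\<lambda>q. m q * J) has_integral ((\<xi> s - \<xi>\<^sub>0) * J)) {0..s}"
        unfolding m_def \<xi>\<^sub>0_def by (rule has_integral_mult_left[OF nlD(4)[OF s]])
      define Iv where "Iv = B * K * (2 * (sqrt (1 + s * D) - 1) / D) + Ir"
      have h3: "((\<lambda>q. (B * K / sqrt (1 + (s - q) * D) + r q) * I) has_integral (Iv * I)) {0..s}"
        unfolding Iv_def by (intro has_integral_mult_left has_integral_add has_integral_inverse_sqrt_reversed[OF D s(1)] rI)
      have SD: "s * D \<ge> 0" using s D by simp
      have Sv: "S (s * D) v\<^sub>0 \<in> L2 \<Omega>" by (rule S_L2[OF SD v02])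
      have "ip (\<lambda>x. vd s x - S (s * D) v\<^sub>0 x) \<phi> - (\<xi> s - \<xi>\<^sub>0) * J \<le> Iv * I"
      proof (rule has_integral_le[OF has_integral_diff[OF h1 h2] h3])
        fix q assume q': "q \<in> {0..s}"
        then have q: "0 \<le> q" "q \<le> T" using s by auto
        have tau: "(s - q) * D \<ge> 0" using q' D by simp
        have gm: "?g q \<in> borel_measurable M" "(\<lambda>x. G (u q x, \<xi> q)) \<in> borel_measurable M" using meas[OF q G(1)] by auto
        have gB: "AE x in M. \<bar>?g q x\<bar> \<le> B" by (simp add: G(2))
        have g2: "?g q \<in> L2 \<Omega>" "(\<lambda>x. G (u q x, \<xi> q)) \<in> L2 \<Omega>"
          using gm G(2) by (auto intro!: L2_bounded[OF domain(2), of _ B])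
        \<comment> \<open>The integrand is split at the spatial mean \<open>a\<close> of the
          reaction term of the diffusive system: \<open>S\<close> applied to the reaction term
          approaches \<open>a\<close> at the rate of the semigroup, and \<open>a\<close> differs
          from the nonlocal mean \<open>m q\<close> by the Lipschitz bound
          \<open>r q\<close>.\<close>
        define a where "a = (LINT x|M. ?g q x)"
        have Sg: "S ((s - q) * D) (?g q) \<in> L2 \<Omega>" by (rule S_L2[OF tau g2(1)])
        have mm: "(\<lambda>x. S ((s - q) * D) (?g q) x - a) \<in> borel_measurable M" by (intro L2_measurable L2_diff Sg c2)
        have "AE x in M. \<bar>S ((s - q) * D) (?g q) x - a\<bar> \<le> B * K / sqrt (1 + (s - q) * D)"
          unfolding a_def by (rule decay[OF tau B0 gm(1) gB])
        from L2_inner_bounded[OF domain(2) mm this \<phi>2]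
        have 1: "ip (S ((s - q) * D) (?g q)) \<phi> - a * J \<le> B * K / sqrt (1 + (s - q) * D) * I"
          using L2_inner_diff[OF Sg c2 \<phi>2, of a] by (simp add: ipc I_def)
        have "\<bar>a - m q\<bar> \<le> r q"
        proof -
          have "a - m q = ip (\<lambda>x. ?g q x - G (u q x, \<xi> q)) (\<lambda>x. 1)"
            using L2_integrable[OF domain(2)] g2 by (simp add: a_def m_def L2_inner_def)
          moreover have "(\<lambda>x. ?g q x - G (u q x, \<xi> q)) \<in> borel_measurable M" using gm by measurable
          ultimately show ?thesis
            using L2_inner_bounded[OF domain(2) _ diffb[OF q G(1)] c2[of 1]] integral_const[of 1] by simp
        qed
        then have "\<bar>(a - m q) * J\<bar> \<le> r q * I" unfolding abs_mult using JI by (intro mult_mono) (auto intro: order_trans[OF abs_ge_zero])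
        then have "(a - m q) * J \<le> r q * I" by linarith
        with 1 show "ip (S ((s - q) * D) (?g q)) \<phi> - m q * J \<le> (B * K / sqrt (1 + (s - q) * D) + r q) * I"
          unfolding distrib_right left_diff_distrib by linarith
      qed
      moreover have "ip (S (s * D) v\<^sub>0) \<phi> - \<xi>\<^sub>0 * J \<le> \<eta> s * I"
      proof -
        have mm: "(\<lambda>x. S (s * D) v\<^sub>0 x - \<xi>\<^sub>0) \<in> borel_measurable M" by (intro L2_measurable L2_diff Sv c2)
        have "AE x in M. \<bar>S (s * D) v\<^sub>0 x - \<xi>\<^sub>0\<bar> \<le> \<eta> s"
          unfolding \<xi>\<^sub>0_def \<eta>_def by (rule decay[OF SD B0 v0])
        from L2_inner_bounded[OF domain(2) mm this \<phi>2] show ?thesis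
          using L2_inner_diff[OF Sv c2 \<phi>2, of \<xi>\<^sub>0] by (simp add: ipc I_def)
      qed
      moreover have "ip (\<lambda>x. vd s x - \<xi> s) \<phi> = ip (\<lambda>x. vd s x - S (s * D) v\<^sub>0 x) \<phi> - (\<xi> s - \<xi>\<^sub>0) * J + (ip (S (s * D) v\<^sub>0) \<phi> - \<xi>\<^sub>0 * J)"
        using in2(2)[OF s] Sv c2[of "\<xi> s"] \<phi>2 by (simp add: L2_inner_diff ipc left_diff_distrib)
      ultimately have "ip (\<lambda>x. vd s x - \<xi> s) \<phi> \<le> (\<eta> s + Iv) * I" unfolding distrib_right by linarith
      also have "\<dots> \<le> (\<eta> s + (\<kappa> / 2 + c * \<epsilon>) * exp (\<omega> * s)) * I"
      proof (rule mult_right_mono[OF _ I0])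
        have "B * K * (2 * (sqrt (1 + s * D) - 1) / D) \<le> B * K * \<epsilon>" using sq BK by (intro mult_left_mono) auto
        then have "Iv \<le> \<kappa> / 2 * exp (\<omega> * s) + c * \<epsilon>" unfolding Iv_def using Ir half ce by linarith
        also have "c * \<epsilon> \<le> c * \<epsilon> * exp (\<omega> * s)" using grow[of "c * \<epsilon>"] c0 \<epsilon>0 by simp
        finally show "\<eta> s + Iv \<le> \<eta> s + (\<kappa> / 2 + c * \<epsilon>) * exp (\<omega> * s)" by (simp add: distrib_right)
      qed
      finally show "ip (\<lambda>x. vd s x - \<xi> s) \<phi> \<le> (\<eta> s + (\<kappa> / 2 + c * \<epsilon>) * exp (\<omega> * s)) * (LINT x|M. \<bar>\<phi> x\<bar>)"
        by (simp add: I_def)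
    qed
  qed
  \<comment> \<open>\<open>2 * (c * \<epsilon>)\<close> is the fixed point of the improvement
    \<open>\<kappa> / 2 + c * \<epsilon>\<close>; the distance to it is halved in every
    step.\<close>
  have iter: "good (2 * (c * \<epsilon>) + R * (1 / 2) ^ n)" for n
  proof (induction n)
    case 0
    show ?case unfolding good_def
    proof (intro conjI allI impI)
      show "0 \<le> 2 * (c * \<epsilon>) + R * (1 / 2) ^ 0" using c0 \<epsilon>0 R0 by simp
      fix s assume s: "0 \<le> s \<and> s \<le> T"
      have "R \<le> (2 * (c * \<epsilon>) + R) * 1" using c0 \<epsilon>0 by simp
      also have "\<dots> \<le> (2 * (c * \<epsilon>) + R) * exp (\<omega> * s)" using c0 \<epsilon>0 R0 \<omega> s by (intro mult_left_mono) auto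
      finally have le: "R \<le> (2 * (c * \<epsilon>) + R * (1 / 2) ^ 0) * exp (\<omega> * s)" by simp
      show "AE x in M. \<bar>ud s x - u s x\<bar> \<le> (2 * (c * \<epsilon>) + R * (1 / 2) ^ 0) * exp (\<omega> * s)"
        using R(1)[of s] s le by (auto elim!: eventually_mono)
      have le': "R \<le> \<eta> s + (2 * (c * \<epsilon>) + R * (1 / 2) ^ 0) * exp (\<omega> * s)" using le \<eta>0[of s] s by linarith
      show "AE x in M. \<bar>vd s x - \<xi> s\<bar> \<le> \<eta> s + (2 * (c * \<epsilon>) + R * (1 / 2) ^ 0) * exp (\<omega> * s)"
        using R(2)[of s] s le' by (auto elim!: eventually_mono)
    qed
  next
    case (Suc n)
    have "(2 * (c * \<epsilon>) + R * (1 / 2) ^ n) / 2 + c * \<epsilon> = 2 * (c * \<epsilon>) + R * (1 / 2) ^ Suc n" by simp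
    then show ?case using step[OF Suc.IH] by (simp only:)
  qed
  have lim: "(\<lambda>n. b + (2 * (c * \<epsilon>) + R * (1 / 2) ^ n) * exp (\<omega> * t)) \<longlonglongrightarrow> b + (2 * (c * \<epsilon>) + R * 0) * exp (\<omega> * t)" for b
    by (intro tendsto_intros LIMSEQ_realpow_zero) auto
  have Q: "(2 * (c * \<epsilon>) + R * 0) * exp (\<omega> * t) \<le> Q"
  proof -
    have "exp (\<omega> * t) \<le> exp (8 * L * T)" using t L by (simp add: \<omega>_def)
    then have "2 * (c * \<epsilon>) * exp (\<omega> * t) \<le> 2 * (c * \<epsilon>) * exp (8 * L * T)" using c0 \<epsilon>0 by (intro mult_left_mono) auto
    then show ?thesis by (simp add: Q_def c_def \<epsilon>_def mult.assoc)
  qed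
  \<comment> \<open>The countably many null sets are united before \<open>n\<close> tends to
    infinity.\<close>
  have "AE x in M. \<forall>n. \<bar>ud t x - u t x\<bar> \<le> 0 + (2 * (c * \<epsilon>) + R * (1 / 2) ^ n) * exp (\<omega> * t)"
    unfolding AE_all_countable using iter t by (auto simp: good_def)
  then show "AE x in M. \<bar>ud t x - u t x\<bar> \<le> Q"
  proof eventually_elim
    case (elim x)
    have "\<bar>ud t x - u t x\<bar> \<le> 0 + (2 * (c * \<epsilon>) + R * 0) * exp (\<omega> * t)"
      using LIMSEQ_le_const[OF lim[of 0]] elim by blast
    then show ?case using Q by linarith
  qed
  have "AE x in M. \<forall>n. \<bar>vd t x - \<xi> t\<bar> \<le> \<eta> t + (2 * (c * \<epsilon>) + R * (1 / 2) ^ n) * exp (\<omega> * t)"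
    unfolding AE_all_countable using iter t by (auto simp: good_def)
  then show "AE x in M. \<bar>vd t x - \<xi> t\<bar> \<le> B * K / sqrt (1 + t * D) + Q"
  proof eventually_elim
    case (elim x)
    have "\<bar>vd t x - \<xi> t\<bar> \<le> \<eta> t + (2 * (c * \<epsilon>) + R * 0) * exp (\<omega> * t)"
      using LIMSEQ_le_const[OF lim[of "\<eta> t"]] elim by blast
    then show ?case using Q by (simp add: \<eta>_def)
  qed
qed

end

section \<open>Existence for the nonlocal system\<close>

lemma dominated_increments_converge:
  fixes f :: "nat \<Rightarrow> real"
  assumes "\<And>n. \<bar>f (Suc n) - f n\<bar> \<le> e n" and e: "summable e"
  shows "\<bar>(f 0 + (\<Sum>k. f (Suc k) - f k)) - f n\<bar> \<le> (\<Sum>k. e (k + n))"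
proof -
  let ?g = "\<lambda>k. f (Suc k) - f k"
  have g: "summable ?g" by (rule summable_comparison_test'[OF e, of 0]) (use assms(1) in simp)
  have sum: "(\<Sum>k<n. ?g k) = f n - f 0" by (simp add: sum_lessThan_telescope)
  have "(f 0 + suminf ?g) - f n = (\<Sum>k. ?g (k + n))"
    using suminf_split_initial_segment[OF g, of n] sum by simp
  also have "\<bar>\<dots>\<bar> \<le> (\<Sum>k. e (k + n))"
    using assms(1) e by (intro norm_suminf_le[where 'a=real, unfolded real_norm_def]) (auto simp: summable_iff_shift)
  finally show ?thesis .
qed

lemma suminf_tail_tendsto_0:
  fixes e :: "nat \<Rightarrow> real"
  assumes "summable e"
  shows "(\<lambda>n. \<Sum>k. e (k + n)) \<longlonglongrightarrow> 0"
proof -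
  have "(\<lambda>n. suminf e - (\<Sum>k<n. e k)) \<longlonglongrightarrow> suminf e - suminf e"
    by (intro tendsto_intros summable_LIMSEQ assms)
  moreover have "suminf e - (\<Sum>k<n. e k) = (\<Sum>k. e (k + n))" for n
    using suminf_split_initial_segment[OF assms, of n] by simp
  ultimately show ?thesis by simp
qed

lemma integral_abs_le:
  fixes g h :: "real \<Rightarrow> real"
  assumes "g integrable_on {a..b}" "h integrable_on {a..b}" "\<And>s. s \<in> {a..b} \<Longrightarrow> \<bar>g s\<bar> \<le> h s"
  shows "\<bar>integral {a..b} g\<bar> \<le> integral {a..b} h"
  using integral_norm_bound_integral[OF assms(1,2)] assms(3) by simp

lemma Linf_norm_nonneg:
  assumes "\<Omega> \<in> lmeasurable" "measure lebesgue \<Omega> = 1" and w: "w \<in> borel_measurable (lebesgue_on \<Omega>)"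
  shows "0 \<le> Linf_norm \<Omega> w"
proof -
  have "emeasure (lebesgue_on \<Omega>) (space (lebesgue_on \<Omega>)) \<noteq> 0"
    using assms(1,2) by (auto simp: emeasure_restrict_space measure_def fmeasurableD)
  then have "esssup (lebesgue_on \<Omega>) (\<lambda>x. 0::ereal) = 0" by (rule esssup_const)
  moreover have "esssup (lebesgue_on \<Omega>) (\<lambda>x. 0::ereal) \<le> Linf_norm \<Omega> w"
    unfolding Linf_norm_def by (rule esssup_mono) auto
  ultimately show ?thesis by simp
qed

locale picard =
  fixes \<Omega> :: "'a::euclidean_space set" and F G :: "real \<times> real \<Rightarrow> real" and L B T \<xi>\<^sub>0 :: real
    and u\<^sub>0 :: "'a \<Rightarrow> real"
  assumes domain: "\<Omega> \<in> lmeasurable" and unit_measure: "measure lebesgue \<Omega> = 1"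
    and F: "lip2 L F" "\<And>p. \<bar>F p\<bar> \<le> B" and G: "lip2 L G" "\<And>p. \<bar>G p\<bar> \<le> B"
    and T: "T > 0" and u0: "u\<^sub>0 \<in> borel_measurable (lebesgue_on \<Omega>)"
begin

definition mean :: "(real \<Rightarrow> real \<Rightarrow> real) \<times> (real \<Rightarrow> real) \<Rightarrow> real \<Rightarrow> real" where
  "mean W s = (LINT x|lebesgue_on \<Omega>. G (fst W s (u\<^sub>0 x), snd W s))"

text \<open>The first unknown is a flow map: its second argument is an initial value
  \<open>a\<close>, and the point \<open>x\<close> enters only through
  \<open>a = u\<^sub>0 x\<close>. The iterates then are Lipschitz functions of real variables, so
  measurability in \<open>x\<close> follows by composition with \<open>u\<^sub>0\<close>, and the
  local equation is solved without exceptional sets.\<close>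

definition picard_map where
  "picard_map W = (\<lambda>t a. a + integral {0..t} (\<lambda>s. F (fst W s a, snd W s)), \<lambda>t. \<xi>\<^sub>0 + integral {0..t} (mean W))"

text \<open>An invariant class for the iteration. The bound \<open>B\<close> for the nonlinearities
  gives the Lipschitz constant in time, and \<open>exp (L * t)\<close> reproduces itself, being 1
  plus the integral of \<open>L * exp (L * s)\<close> over \<open>{0..t}\<close>.\<close>

definition admissible where
  "admissible W \<longleftrightarrow> (\<forall>s\<in>{0..T}. \<forall>t\<in>{0..T}. \<forall>a b. \<bar>fst W s a - fst W t a\<bar> \<le> B * \<bar>s - t\<bar> \<and>
     \<bar>snd W s - snd W t\<bar> \<le> B * \<bar>s - t\<bar> \<and> \<bar>fst W t a - fst W t b\<bar> \<le> exp (L * t) * \<bar>a - b\<bar>)"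

lemma B_nonneg: "B \<ge> 0"
  using F(2)[of 0] by (auto intro: order_trans[OF abs_ge_zero])

lemma L_nonneg: "L \<ge> 0"
  by (rule lip2_nonneg[OF F(1)])

lemma admissibleD:
  assumes "admissible W" "0 \<le> s" "s \<le> T" "0 \<le> t" "t \<le> T"
  shows "\<bar>fst W s a - fst W t a\<bar> \<le> B * \<bar>s - t\<bar>" "\<bar>snd W s - snd W t\<bar> \<le> B * \<bar>s - t\<bar>"
    "\<bar>fst W t a - fst W t b\<bar> \<le> exp (L * t) * \<bar>a - b\<bar>"
  using assms unfolding admissible_def by auto

lemma lipschitz_continuous_on:
  fixes f :: "real \<Rightarrow> real"
  assumes "\<And>s t. s \<in> A \<Longrightarrow> t \<in> A \<Longrightarrow> \<bar>f s - f t\<bar> \<le> C * \<bar>s - t\<bar>" "C \<ge> 0"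
  shows "continuous_on A f"
  using assms by (intro lipschitz_on_continuous_on[of C] lipschitz_onI) (auto simp: dist_real_def)

lemma admissible_measurable:
  assumes W: "admissible W" and t: "0 \<le> t" "t \<le> T"
  shows "(\<lambda>x. fst W t (u\<^sub>0 x)) \<in> borel_measurable (lebesgue_on \<Omega>)"
proof -
  have "continuous_on UNIV (fst W t)"
    using admissibleD(3)[OF W t t] by (intro lipschitz_continuous_on[of _ _ "exp (L * t)"]) auto
  then have "fst W t \<in> borel_measurable borel" by (rule borel_measurable_continuous_onI)
  from measurable_compose[OF u0 this] show ?thesis .
qed

lemma integrable_G:
  assumes W: "admissible W" and t: "0 \<le> t" "t \<le> T"
  shows "integrable (lebesgue_on \<Omega>) (\<lambda>x. G (fst W t (u\<^sub>0 x), snd W t))"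
  using G(2) by (intro L2_integrable[OF domain] L2_bounded[OF domain, of _ B] lip2_measurable[OF G(1)] admissible_measurable[OF W t]) auto

lemma mean_diff_le:
  assumes W: "admissible W" and s: "0 \<le> s" "s \<le> T" and V: "admissible V" and t: "0 \<le> t" "t \<le> T"
    and c: "\<And>a. \<bar>fst W s a - fst V t a\<bar> \<le> c" "\<bar>snd W s - snd V t\<bar> \<le> c"
  shows "\<bar>mean W s - mean V t\<bar> \<le> 2 * L * c"
proof -
  have "mean W s - mean V t = (LINT x|lebesgue_on \<Omega>. G (fst W s (u\<^sub>0 x), snd W s) - G (fst V t (u\<^sub>0 x), snd V t))"
    unfolding mean_def using integrable_G[OF W s] integrable_G[OF V t] by simp
  also have "\<bar>\<dots>\<bar> \<le> (LINT x|lebesgue_on \<Omega>. \<bar>G (fst W s (u\<^sub>0 x), snd W s) - G (fst V t (u\<^sub>0 x), snd V t)\<bar>)"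
    by (rule integral_abs_bound)
  also have "\<dots> \<le> (LINT x|lebesgue_on \<Omega>. 2 * L * c)"
  proof (rule integral_mono)
    show "integrable (lebesgue_on \<Omega>) (\<lambda>x. \<bar>G (fst W s (u\<^sub>0 x), snd W s) - G (fst V t (u\<^sub>0 x), snd V t)\<bar>)"
      using integrable_G[OF W s] integrable_G[OF V t] by auto
    show "integrable (lebesgue_on \<Omega>) (\<lambda>x. 2 * L * c)" by (rule L2_integrable[OF domain L2_const[OF domain]])
    fix x
    have "\<bar>G (fst W s (u\<^sub>0 x), snd W s) - G (fst V t (u\<^sub>0 x), snd V t)\<bar> \<le> L * (\<bar>fst W s (u\<^sub>0 x) - fst V t (u\<^sub>0 x)\<bar> + \<bar>snd W s - snd V t\<bar>)"
      by (rule lip2D[OF G(1)])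
    also have "\<dots> \<le> L * (c + c)" using c L_nonneg by (intro mult_left_mono add_mono) auto
    finally show "\<bar>G (fst W s (u\<^sub>0 x), snd W s) - G (fst V t (u\<^sub>0 x), snd V t)\<bar> \<le> 2 * L * c" by simp
  qed
  also have "\<dots> = 2 * L * c" using unit_measure domain by (simp add: measure_restrict_space fmeasurableD)
  finally show ?thesis .
qed

lemma mean_bounded:
  assumes W: "admissible W" and t: "0 \<le> t" "t \<le> T"
  shows "\<bar>mean W t\<bar> \<le> B"
proof -
  have "\<bar>mean W t\<bar> \<le> (LINT x|lebesgue_on \<Omega>. \<bar>G (fst W t (u\<^sub>0 x), snd W t)\<bar>)"
    unfolding mean_def by (rule integral_abs_bound)
  also have "\<dots> \<le> (LINT x|lebesgue_on \<Omega>. B)"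
    using integrable_G[OF W t] L2_integrable[OF domain L2_const[OF domain]] G(2) by (intro integral_mono) auto
  also have "\<dots> = B" using unit_measure domain by (simp add: measure_restrict_space fmeasurableD)
  finally show ?thesis .
qed

lemma admissible_continuous:
  assumes W: "admissible W"
  shows "continuous_on {0..T} (\<lambda>s. F (fst W s a, snd W s))" "continuous_on {0..T} (mean W)"
proof -
  have "continuous_on {0..T} (\<lambda>s. (fst W s a, snd W s))"
    using admissibleD(1,2)[OF W] B_nonneg by (intro continuous_on_Pair lipschitz_continuous_on[of _ _ B]) auto
  from continuous_on_compose2[OF lip2_continuous[OF F(1)] this]
  show "continuous_on {0..T} (\<lambda>s. F (fst W s a, snd W s))" by simp
  show "continuous_on {0..T} (mean W)"
  proof (rule lipschitz_continuous_on[of _ _ "2 * L * B"])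
    fix s t assume "s \<in> {0..T}" "t \<in> {0..T}"
    then show "\<bar>mean W s - mean W t\<bar> \<le> 2 * L * B * \<bar>s - t\<bar>"
      using mean_diff_le[OF W _ _ W, of s t "B * \<bar>s - t\<bar>"] admissibleD(1,2)[OF W, of s t] by (auto simp: mult.assoc)
  qed (use L_nonneg B_nonneg in auto)
qed

lemma admissible_integrable:
  assumes W: "admissible W" and ab: "0 \<le> a" "b \<le> T"
  shows "(\<lambda>s. F (fst W s c, snd W s)) integrable_on {a..b}" "mean W integrable_on {a..b}"
  using ab by (auto intro!: integrable_continuous_interval continuous_on_subset[OF admissible_continuous(1)[OF W]]
      continuous_on_subset[OF admissible_continuous(2)[OF W]])

lemma primitive_lipschitz:
  fixes g :: "real \<Rightarrow> real"
  assumes g: "g integrable_on {0..T}" "\<And>s. 0 \<le> s \<Longrightarrow> s \<le> T \<Longrightarrow> \<bar>g s\<bar> \<le> B"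
    and st: "0 \<le> s" "s \<le> T" "0 \<le> t" "t \<le> T"
  shows "\<bar>integral {0..s} g - integral {0..t} g\<bar> \<le> B * \<bar>s - t\<bar>"
proof -
  have le: "\<bar>integral {0..b} g - integral {0..a} g\<bar> \<le> B * (b - a)" if ab: "0 \<le> a" "a \<le> b" "b \<le> T" for a b
  proof -
    have i: "g integrable_on {0..b}" "g integrable_on {a..b}"
      using ab by (auto intro: integrable_on_subinterval[OF g(1)])
    have "integral {0..a} g + integral {a..b} g = integral {0..b} g"
      by (rule Henstock_Kurzweil_Integration.integral_combine[OF ab(1,2) i(1)])
    moreover have "\<bar>integral {a..b} g\<bar> \<le> integral {a..b} (\<lambda>s. B)"
      using i(2) g(2) ab by (intro integral_abs_le) auto
    ultimately show ?thesis using ab by (simp add: mult.commute)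
  qed
  show ?thesis using le[of s t] le[of t s] st by (cases "s \<le> t") (auto simp: abs_minus_commute)
qed

lemma admissible_picard_map:
  assumes W: "admissible W"
  shows "admissible (picard_map W)"
  unfolding admissible_def
proof (intro ballI allI conjI)
  fix s t a b assume "s \<in> {0..T}" "t \<in> {0..T}"
  then have st: "0 \<le> s" "s \<le> T" "0 \<le> t" "t \<le> T" by auto
  show "\<bar>fst (picard_map W) s a - fst (picard_map W) t a\<bar> \<le> B * \<bar>s - t\<bar>"
    using primitive_lipschitz[OF admissible_integrable(1)[OF W order_refl order_refl] _ st, of a] F(2) by (simp add: picard_map_def)
  show "\<bar>snd (picard_map W) s - snd (picard_map W) t\<bar> \<le> B * \<bar>s - t\<bar>"
    using primitive_lipschitz[OF admissible_integrable(2)[OF W order_refl order_refl] _ st] mean_bounded[OF W] by (simp add: picard_map_def)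
  have "\<bar>integral {0..t} (\<lambda>s. F (fst W s a, snd W s) - F (fst W s b, snd W s))\<bar> \<le> integral {0..t} (\<lambda>s. L * (exp (L * s) * \<bar>a - b\<bar>))"
  proof (rule integral_abs_le)
    show "(\<lambda>s. F (fst W s a, snd W s) - F (fst W s b, snd W s)) integrable_on {0..t}"
      using admissible_integrable(1)[OF W] st by (intro integrable_diff) auto
    show "(\<lambda>s. L * (exp (L * s) * \<bar>a - b\<bar>)) integrable_on {0..t}"
      by (intro integrable_continuous_interval continuous_intros)
    fix s assume "s \<in> {0..t}"
    then have s: "0 \<le> s" "s \<le> T" using st by auto
    have "\<bar>F (fst W s a, snd W s) - F (fst W s b, snd W s)\<bar> \<le> L * \<bar>fst W s a - fst W s b\<bar>"
      using lip2D[OF F(1), of "fst W s a" "snd W s" "fst W s b" "snd W s"] by simp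
    also have "\<dots> \<le> L * (exp (L * s) * \<bar>a - b\<bar>)" using admissibleD(3)[OF W s s] L_nonneg by (intro mult_left_mono) auto
    finally show "\<bar>F (fst W s a, snd W s) - F (fst W s b, snd W s)\<bar> \<le> L * (exp (L * s) * \<bar>a - b\<bar>)" .
  qed
  also have "integral {0..t} (\<lambda>s. L * (exp (L * s) * \<bar>a - b\<bar>)) = exp (L * t) * \<bar>a - b\<bar> - exp (L * 0) * \<bar>a - b\<bar>"
    by (intro integral_unique fundamental_theorem_of_calculus st)
       (auto intro!: derivative_eq_intros simp: has_real_derivative_iff_has_vector_derivative[symmetric])
  finally have "\<bar>integral {0..t} (\<lambda>s. F (fst W s a, snd W s)) - integral {0..t} (\<lambda>s. F (fst W s b, snd W s))\<bar> \<le> exp (L * t) * \<bar>a - b\<bar> - \<bar>a - b\<bar>"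
    using admissible_integrable(1)[OF W order_refl st(4)] by (simp add: Henstock_Kurzweil_Integration.integral_diff)
  then show "\<bar>fst (picard_map W) t a - fst (picard_map W) t b\<bar> \<le> exp (L * t) * \<bar>a - b\<bar>"
    by (simp add: picard_map_def abs_le_iff) linarith
qed

text \<open>One majorant \<open>d\<close> serves both components and all initial values, because the
  mean couples all points of \<Omega>. The factor 2 comes from the two arguments of the
  nonlinearities.\<close>

lemma picard_map_diff_le:
  assumes W: "admissible W" and V: "admissible V" and t: "0 \<le> t" "t \<le> T"
    and d: "continuous_on {0..T} d" "\<And>s a. 0 \<le> s \<Longrightarrow> s \<le> T \<Longrightarrow> \<bar>fst W s a - fst V s a\<bar> \<le> d s"
      "\<And>s. 0 \<le> s \<Longrightarrow> s \<le> T \<Longrightarrow> \<bar>snd W s - snd V s\<bar> \<le> d s"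
  shows "\<bar>fst (picard_map W) t a - fst (picard_map V) t a\<bar> \<le> integral {0..t} (\<lambda>s. 2 * L * d s)"
    and "\<bar>snd (picard_map W) t - snd (picard_map V) t\<bar> \<le> integral {0..t} (\<lambda>s. 2 * L * d s)"
proof -
  have di: "(\<lambda>s. 2 * L * d s) integrable_on {0..t}"
    using t by (intro integrable_continuous_interval continuous_intros continuous_on_subset[OF d(1)]) auto
  have "\<bar>integral {0..t} (\<lambda>s. F (fst W s a, snd W s) - F (fst V s a, snd V s))\<bar> \<le> integral {0..t} (\<lambda>s. 2 * L * d s)"
  proof (rule integral_abs_le[OF _ di])
    show "(\<lambda>s. F (fst W s a, snd W s) - F (fst V s a, snd V s)) integrable_on {0..t}"
      using admissible_integrable(1)[OF W order_refl t(2)] admissible_integrable(1)[OF V order_refl t(2)] by (intro integrable_diff)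
    fix s assume "s \<in> {0..t}"
    then have s: "0 \<le> s" "s \<le> T" using t by auto
    have "\<bar>F (fst W s a, snd W s) - F (fst V s a, snd V s)\<bar> \<le> L * (\<bar>fst W s a - fst V s a\<bar> + \<bar>snd W s - snd V s\<bar>)"
      by (rule lip2D[OF F(1)])
    also have "\<dots> \<le> L * (d s + d s)" using d(2,3)[OF s] L_nonneg by (intro mult_left_mono add_mono) auto
    finally show "\<bar>F (fst W s a, snd W s) - F (fst V s a, snd V s)\<bar> \<le> 2 * L * d s" by simp
  qed
  then show "\<bar>fst (picard_map W) t a - fst (picard_map V) t a\<bar> \<le> integral {0..t} (\<lambda>s. 2 * L * d s)"
    using admissible_integrable(1)[OF W order_refl t(2)] admissible_integrable(1)[OF V order_refl t(2)]
    by (simp add: picard_map_def Henstock_Kurzweil_Integration.integral_diff)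
  have "\<bar>integral {0..t} (\<lambda>s. mean W s - mean V s)\<bar> \<le> integral {0..t} (\<lambda>s. 2 * L * d s)"
  proof (rule integral_abs_le[OF _ di])
    show "(\<lambda>s. mean W s - mean V s) integrable_on {0..t}"
      using admissible_integrable(2)[OF W order_refl t(2)] admissible_integrable(2)[OF V order_refl t(2)] by (intro integrable_diff)
    fix s assume "s \<in> {0..t}"
    then have s: "0 \<le> s" "s \<le> T" using t by auto
    show "\<bar>mean W s - mean V s\<bar> \<le> 2 * L * d s" by (rule mean_diff_le[OF W s V s d(2)[OF s] d(3)[OF s]])
  qed
  then show "\<bar>snd (picard_map W) t - snd (picard_map V) t\<bar> \<le> integral {0..t} (\<lambda>s. 2 * L * d s)"
    using admissible_integrable(2)[OF W order_refl t(2)] admissible_integrable(2)[OF V order_refl t(2)]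
    by (simp add: picard_map_def Henstock_Kurzweil_Integration.integral_diff)
qed

definition iterate where
  "iterate n = (picard_map ^^ n) (\<lambda>t a. a, \<lambda>t. \<xi>\<^sub>0)"

lemma iterate_Suc: "iterate (Suc n) = picard_map (iterate n)"
  by (simp add: iterate_def)

lemma admissible_iterate: "admissible (iterate n)"
proof (induction n)
  case 0
  have "\<bar>a - b\<bar> \<le> exp (L * t) * \<bar>a - b\<bar>" if "t \<ge> 0" for a b t
    using mult_right_mono[of 1 "exp (L * t)" "\<bar>a - b\<bar>"] L_nonneg that by simp
  then show ?case using B_nonneg by (auto simp: iterate_def admissible_def)
next
  case (Suc n)
  then show ?case unfolding iterate_Suc by (rule admissible_picard_map)
qed

text \<open>The first Picard increment is at most \<open>B * T\<close>; each further step multiplies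
  by \<open>2 * L\<close> and integrates, which builds up an exponential series. It is summable for
  every \<open>T\<close>, so no short time intervals have to be glued.\<close>

definition bound where
  "bound n t = B * T * ((2 * L * t) ^ n / fact n)"

lemma bound_integral:
  assumes "t \<ge> 0"
  shows "integral {0..t} (\<lambda>s. 2 * L * bound n s) = bound (Suc n) t"
proof -
  have "((\<lambda>s. 2 * L * bound n s) has_integral (bound (Suc n) t - bound (Suc n) 0)) {0..t}"
  proof (rule fundamental_theorem_of_calculus[OF assms])
    fix s
    have "((\<lambda>s. B * T * ((2 * L * s) ^ Suc n / fact (Suc n))) has_real_derivative
        B * T * (real (Suc n) * (2 * L * s) ^ n * (2 * L) / fact (Suc n))) (at s)"
      by (auto intro!: derivative_eq_intros simp del: fact_Suc power_Suc)
    moreover have "B * T * (real (Suc n) * (2 * L * s) ^ n * (2 * L) / fact (Suc n)) = 2 * L * bound n s"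
      by (simp add: bound_def field_simps del: of_nat_Suc)
    ultimately have "(bound (Suc n) has_real_derivative 2 * L * bound n s) (at s)" by (simp only: bound_def[abs_def])
    then show "(bound (Suc n) has_vector_derivative 2 * L * bound n s) (at s within {0..t})"
      by (simp add: has_real_derivative_iff_has_vector_derivative has_vector_derivative_at_within)
  qed
  then have "integral {0..t} (\<lambda>s. 2 * L * bound n s) = bound (Suc n) t - bound (Suc n) 0"
    by (rule integral_unique)
  moreover have "bound (Suc n) 0 = 0" by (simp add: bound_def)
  ultimately show ?thesis by (simp only: diff_zero)
qed

lemma iterate_increment:
  assumes "0 \<le> t" "t \<le> T"
  shows "\<bar>fst (iterate (Suc n)) t a - fst (iterate n) t a\<bar> \<le> bound n t"
    and "\<bar>snd (iterate (Suc n)) t - snd (iterate n) t\<bar> \<le> bound n t"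
proof -
  have "(\<forall>a. \<bar>fst (iterate (Suc n)) t a - fst (iterate n) t a\<bar> \<le> bound n t) \<and> \<bar>snd (iterate (Suc n)) t - snd (iterate n) t\<bar> \<le> bound n t"
    using assms
  proof (induction n arbitrary: t)
    case 0
    have Bt: "B * \<bar>t - 0\<bar> \<le> B * T" using 0 B_nonneg by (intro mult_left_mono) auto
    have 1: "fst (iterate (Suc 0)) 0 a = a" "snd (iterate (Suc 0)) 0 = \<xi>\<^sub>0" for a by (auto simp: iterate_Suc picard_map_def)
    have "\<bar>fst (iterate (Suc 0)) t a - a\<bar> \<le> B * T" for a
      using admissibleD(1)[OF admissible_iterate 0 order_refl, of "Suc 0" a] T Bt unfolding 1 by simp
    moreover have "\<bar>snd (iterate (Suc 0)) t - \<xi>\<^sub>0\<bar> \<le> B * T"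
      using admissibleD(2)[OF admissible_iterate 0 order_refl, of "Suc 0"] T Bt unfolding 1 by simp
    moreover have "fst (iterate 0) t a = a" "snd (iterate 0) t = \<xi>\<^sub>0" for a by (auto simp: iterate_def)
    ultimately show ?case by (simp add: bound_def)
  next
    case (Suc n)
    have "continuous_on {0..T} (bound n)" unfolding bound_def[abs_def] by (intro continuous_intros) auto
    note le = picard_map_diff_le[OF admissible_iterate admissible_iterate Suc.prems this, of "Suc n" n]
    show ?case
      using le Suc.IH unfolding iterate_Suc[symmetric] bound_integral[OF Suc.prems(1)] by blast
  qed
  then show "\<bar>fst (iterate (Suc n)) t a - fst (iterate n) t a\<bar> \<le> bound n t"
    "\<bar>snd (iterate (Suc n)) t - snd (iterate n) t\<bar> \<le> bound n t" by auto
qed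

text \<open>The limit is written as a telescoping series, so that its distance to the iterates is a
  tail of the majorant.\<close>

definition limit where
  "limit = (\<lambda>t a. fst (iterate 0) t a + (\<Sum>k. fst (iterate (Suc k)) t a - fst (iterate k) t a),
            \<lambda>t. snd (iterate 0) t + (\<Sum>k. snd (iterate (Suc k)) t - snd (iterate k) t))"

definition remainder where
  "remainder n = (\<Sum>k. bound (k + n) T)"

lemma summable_bound: "summable (\<lambda>n. bound n T)"
  unfolding bound_def using summable_exp[of "2 * L * T"] by (intro summable_mult) (simp add: field_simps)

lemma remainder_tendsto: "remainder \<longlonglongrightarrow> 0"
  unfolding remainder_def[abs_def] by (rule suminf_tail_tendsto_0[OF summable_bound])

lemma limit_close:
  assumes t: "0 \<le> t" "t \<le> T"
  shows "\<bar>fst limit t a - fst (iterate n) t a\<bar> \<le> remainder n" "\<bar>snd limit t - snd (iterate n) t\<bar> \<le> remainder n"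
proof -
  have le: "bound k t \<le> bound k T" for k
    unfolding bound_def using t L_nonneg B_nonneg T
    by (intro mult_left_mono divide_right_mono power_mono mult_nonneg_nonneg) auto
  show "\<bar>fst limit t a - fst (iterate n) t a\<bar> \<le> remainder n"
    unfolding limit_def remainder_def fst_conv
    by (rule dominated_increments_converge[OF _ summable_bound]) (use iterate_increment(1)[OF t] le order_trans in blast)
  show "\<bar>snd limit t - snd (iterate n) t\<bar> \<le> remainder n"
    unfolding limit_def remainder_def snd_conv
    by (rule dominated_increments_converge[OF _ summable_bound]) (use iterate_increment(2)[OF t] le order_trans in blast)
qed

lemma iterate_tendsto:
  assumes t: "0 \<le> t" "t \<le> T"
  shows "(\<lambda>n. fst (iterate n) t a) \<longlonglongrightarrow> fst limit t a" "(\<lambda>n. snd (iterate n) t) \<longlonglongrightarrow> snd limit t"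
proof -
  have "(\<lambda>n. fst (iterate n) t a - fst limit t a) \<longlonglongrightarrow> 0"
    by (rule Lim_null_comparison[OF _ remainder_tendsto])
       (use limit_close(1)[OF t] in \<open>auto simp: abs_minus_commute\<close>)
  then show "(\<lambda>n. fst (iterate n) t a) \<longlonglongrightarrow> fst limit t a" by (simp add: LIM_zero_iff)
  have "(\<lambda>n. snd (iterate n) t - snd limit t) \<longlonglongrightarrow> 0"
    by (rule Lim_null_comparison[OF _ remainder_tendsto])
       (use limit_close(2)[OF t] in \<open>auto simp: abs_minus_commute\<close>)
  then show "(\<lambda>n. snd (iterate n) t) \<longlonglongrightarrow> snd limit t" by (simp add: LIM_zero_iff)
qed

lemma admissible_limit: "admissible limit"
  unfolding admissible_def
proof (intro ballI allI conjI)
  fix s t a b assume "s \<in> {0..T}" "t \<in> {0..T}"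
  then have s: "0 \<le> s" "s \<le> T" and t: "0 \<le> t" "t \<le> T" by auto
  note lim = iterate_tendsto[OF s] iterate_tendsto[OF t]
  show "\<bar>fst limit s a - fst limit t a\<bar> \<le> B * \<bar>s - t\<bar>"
    by (rule LIMSEQ_le_const2[of "\<lambda>n. \<bar>fst (iterate n) s a - fst (iterate n) t a\<bar>"])
       (use lim admissibleD(1)[OF admissible_iterate s t] in \<open>auto intro!: tendsto_intros\<close>)
  show "\<bar>snd limit s - snd limit t\<bar> \<le> B * \<bar>s - t\<bar>"
    by (rule LIMSEQ_le_const2[of "\<lambda>n. \<bar>snd (iterate n) s - snd (iterate n) t\<bar>"])
       (use lim admissibleD(2)[OF admissible_iterate s t] in \<open>auto intro!: tendsto_intros\<close>)
  show "\<bar>fst limit t a - fst limit t b\<bar> \<le> exp (L * t) * \<bar>a - b\<bar>"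
    by (rule LIMSEQ_le_const2[of "\<lambda>n. \<bar>fst (iterate n) t a - fst (iterate n) t b\<bar>"])
       (use lim admissibleD(3)[OF admissible_iterate s t] in \<open>auto intro!: tendsto_intros\<close>)
qed

text \<open>Uniform convergence on \<open>{0..T}\<close> passes through the map, with the constant
  majorant \<open>remainder n\<close>.\<close>

lemma limit_fixed:
  assumes t: "0 \<le> t" "t \<le> T"
  shows "fst (picard_map limit) t a = fst limit t a" "snd (picard_map limit) t = snd limit t"
proof -
  have le: "\<bar>fst (picard_map limit) t a - fst (iterate (Suc n)) t a\<bar> \<le> t * (2 * L * remainder n)"
    "\<bar>snd (picard_map limit) t - snd (iterate (Suc n)) t\<bar> \<le> t * (2 * L * remainder n)" for n
    using picard_map_diff_le[OF admissible_limit admissible_iterate t, of "\<lambda>s. remainder n" n] limit_close t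
    by (auto simp: iterate_Suc mult_ac)
  have r0: "(\<lambda>n. t * (2 * L * remainder n)) \<longlonglongrightarrow> 0"
    using remainder_tendsto by (auto intro!: tendsto_eq_intros)
  have "(\<lambda>n. fst (iterate (Suc n)) t a - fst (picard_map limit) t a) \<longlonglongrightarrow> 0"
    by (rule Lim_null_comparison[OF _ r0]) (use le(1) in \<open>auto simp: abs_minus_commute\<close>)
  then have "(\<lambda>n. fst (iterate (Suc n)) t a) \<longlonglongrightarrow> fst (picard_map limit) t a" by (simp add: LIM_zero_iff)
  then show "fst (picard_map limit) t a = fst limit t a"
    using LIMSEQ_unique LIMSEQ_Suc[OF iterate_tendsto(1)[OF t]] by blast
  have "(\<lambda>n. snd (iterate (Suc n)) t - snd (picard_map limit) t) \<longlonglongrightarrow> 0"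
    by (rule Lim_null_comparison[OF _ r0]) (use le(2) in \<open>auto simp: abs_minus_commute\<close>)
  then have "(\<lambda>n. snd (iterate (Suc n)) t) \<longlonglongrightarrow> snd (picard_map limit) t" by (simp add: LIM_zero_iff)
  then show "snd (picard_map limit) t = snd limit t"
    using LIMSEQ_unique LIMSEQ_Suc[OF iterate_tendsto(2)[OF t]] by blast
qed

text \<open>The fixed point is evaluated at \<open>a = u\<^sub>0 x\<close>. Its Lipschitz bound in
  time is uniform in \<open>a\<close> and yields continuity with values in the essentially bounded
  functions, while the bound on \<open>u\<^sub>0\<close> puts each slice into that space.\<close>

theorem nonlocal_solution_exists:
  assumes u0B: "AE x in lebesgue_on \<Omega>. \<bar>u\<^sub>0 x\<bar> \<le> R"
  shows "\<exists>u \<xi>. nonlocal_solution \<Omega> F G T u\<^sub>0 \<xi>\<^sub>0 u \<xi>"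
proof (intro exI)
  let ?M = "lebesgue_on \<Omega>"
  define u where "u t x = fst limit t (u\<^sub>0 x)" for t x
  have m: "u t \<in> borel_measurable ?M" if "0 \<le> t" "t \<le> T" for t
    unfolding u_def[abs_def] by (rule admissible_measurable[OF admissible_limit that])
  have lip: "\<bar>u s x - u t x\<bar> \<le> B * \<bar>s - t\<bar>" if "0 \<le> s" "s \<le> T" "0 \<le> t" "t \<le> T" for s t x
    unfolding u_def by (rule admissibleD(1)[OF admissible_limit that])
  have u_0: "u 0 x = u\<^sub>0 x" for x
    unfolding u_def using limit_fixed(1)[of 0 "u\<^sub>0 x"] T by (simp add: picard_map_def)
  show "nonlocal_solution \<Omega> F G T u\<^sub>0 \<xi>\<^sub>0 u (snd limit)"
    unfolding nonlocal_solution_def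
  proof (intro conjI)
    show "Linf_continuous \<Omega> T u"
      unfolding Linf_continuous_def
    proof (intro ballI conjI)
      fix t assume "t \<in> {0..T}"
      then have t: "0 \<le> t" "t \<le> T" by auto
      have "AE x in ?M. \<bar>u t x\<bar> \<le> R + B * t"
        using u0B
      proof eventually_elim
        case (elim x)
        then show ?case using lip[OF t, of 0 x] T t u_0[of x] by simp
      qed
      then have "Linf_norm \<Omega> (u t) \<le> ereal (R + B * t)" by (subst Linf_norm_le_iff[OF m[OF t]])
      then have "Linf_norm \<Omega> (u t) < \<infinity>" by (rule order_le_less_trans) simp
      then show "u t \<in> Linf \<Omega>" using m[OF t] by (simp add: Linf_def)
      have mem: "\<forall>\<^sub>F s in at t within {0..T}. s \<in> {0..T}" by (simp add: eventually_at_filter)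
      have lim0: "((\<lambda>s. ereal (B * \<bar>s - t\<bar>)) \<longlongrightarrow> ereal (B * \<bar>t - t\<bar>)) (at t within {0..T})"
        by (intro tendsto_intros)
      show "((\<lambda>s. Linf_norm \<Omega> (\<lambda>x. u s x - u t x)) \<longlongrightarrow> 0) (at t within {0..T})"
      proof (rule tendsto_sandwich[OF _ _ tendsto_const])
        have dm: "(\<lambda>x. u s x - u t x) \<in> borel_measurable ?M" if "s \<in> {0..T}" for s
          using m[of s] m[OF t] that by auto
        show "\<forall>\<^sub>F s in at t within {0..T}. 0 \<le> Linf_norm \<Omega> (\<lambda>x. u s x - u t x)"
          using mem by eventually_elim (rule Linf_norm_nonneg[OF domain unit_measure dm])
        show "\<forall>\<^sub>F s in at t within {0..T}. Linf_norm \<Omega> (\<lambda>x. u s x - u t x) \<le> ereal (B * \<bar>s - t\<bar>)"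
          using mem by eventually_elim (subst Linf_norm_le_iff[OF dm], assumption, use lip t in auto)
        show "((\<lambda>s. ereal (B * \<bar>s - t\<bar>)) \<longlongrightarrow> 0) (at t within {0..T})" using lim0 by (simp add: zero_ereal_def)
      qed
    qed
    show "continuous_on {0..T} (snd limit)"
      using admissibleD(2)[OF admissible_limit] B_nonneg by (intro lipschitz_continuous_on[of _ _ B]) auto
    show "AE x in ?M. \<forall>t\<in>{0..T}. ((\<lambda>s. F (u s x, snd limit s)) has_integral u t x - u\<^sub>0 x) {0..t}"
    proof (intro AE_I2 ballI)
      fix x t assume "t \<in> {0..T}"
      then have t: "0 \<le> t" "t \<le> T" by auto
      have "u t x - u\<^sub>0 x = integral {0..t} (\<lambda>s. F (u s x, snd limit s))"
        using limit_fixed(1)[OF t, of "u\<^sub>0 x"] by (simp add: u_def picard_map_def)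
      then show "((\<lambda>s. F (u s x, snd limit s)) has_integral u t x - u\<^sub>0 x) {0..t}"
        using admissible_integrable(1)[OF admissible_limit order_refl t(2), of "u\<^sub>0 x"]
        by (simp add: u_def has_integral_iff)
    qed
    show "\<forall>t\<in>{0..T}. ((\<lambda>s. LINT x|?M. G (u s x, snd limit s)) has_integral snd limit t - \<xi>\<^sub>0) {0..t}"
    proof
      fix t assume "t \<in> {0..T}"
      then have t: "0 \<le> t" "t \<le> T" by auto
      have "(mean limit has_integral snd limit t - \<xi>\<^sub>0) {0..t}"
        using limit_fixed(2)[OF t] admissible_integrable(2)[OF admissible_limit order_refl t(2)]
        by (simp add: picard_map_def has_integral_iff)
      then show "((\<lambda>s. LINT x|?M. G (u s x, snd limit s)) has_integral snd limit t - \<xi>\<^sub>0) {0..t}"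
        by (simp add: mean_def[abs_def] u_def)
    qed
  qed
qed

end

section \<open>Truncation of the nonlinearities\<close>

definition clip :: "real \<Rightarrow> real \<Rightarrow> real" where
  "clip R a = max (- R) (min R a)"

definition truncate :: "real \<Rightarrow> (real \<times> real \<Rightarrow> real) \<Rightarrow> real \<times> real \<Rightarrow> real" where
  "truncate R f p = f (clip R (fst p), clip R (snd p))"

lemma truncate_eq: "\<bar>a\<bar> \<le> R \<Longrightarrow> \<bar>b\<bar> \<le> R \<Longrightarrow> truncate R f (a, b) = f (a, b)"
  by (auto simp: truncate_def clip_def abs_le_iff max_def min_def)

lemma C1_continuous: "Ck_on 1 f UNIV \<Longrightarrow> continuous_on UNIV f"
  using Ck_on_Suc_imp[of 0 f UNIV] by simp

text \<open>A continuously differentiable function is bounded and Lipschitz on the compact convex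
  square, and clipping the coordinates is 1-Lipschitz with values in the square.\<close>

lemma truncate_lip2:
  fixes f :: "real \<times> real \<Rightarrow> real"
  assumes f: "Ck_on 1 f UNIV" and R: "R > 0"
  obtains L B where "L > 0" "lip2 L (truncate R f)" "B \<ge> 0" "\<And>p. \<bar>truncate R f p\<bar> \<le> B"
proof -
  obtain G where G: "\<And>x. (f has_derivative (\<lambda>h. G x \<bullet> h)) (at x)" "\<forall>i\<in>Basis. continuous_on UNIV (\<lambda>x. G x \<bullet> i)"
    using f by (auto simp: One_nat_def)
  have Gc: "continuous_on UNIV G" using G(2) by (subst continuous_on_componentwise) blast
  define X where "X = cbox (- R, - R) (R, R)"
  have X: "compact X" "convex X" by (auto simp: X_def)
  have inX: "(clip R a, clip R b) \<in> X" for a b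
    using R by (auto simp: X_def clip_def cbox_Pair_eq)
  have "bounded (G ` X)"
    by (intro compact_imp_bounded compact_continuous_image continuous_on_subset[OF Gc] X) auto
  then obtain C where C: "C > 0" "\<And>x. x \<in> X \<Longrightarrow> norm (G x) \<le> C" by (auto simp: bounded_pos)
  have "bounded (f ` X)"
    by (intro compact_imp_bounded compact_continuous_image continuous_on_subset[OF C1_continuous[OF f]] X) auto
  then obtain B where B: "B > 0" "\<And>x. x \<in> X \<Longrightarrow> norm (f x) \<le> B" by (auto simp: bounded_pos)
  have lipX: "norm (f x - f y) \<le> C * norm (x - y)" if "x \<in> X" "y \<in> X" for x y
  proof (rule differentiable_bound[where f'="\<lambda>x h. G x \<bullet> h", OF X(2) _ _ that])
    show "(f has_derivative (\<lambda>h. G x \<bullet> h)) (at x within X)" for x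
      by (rule has_derivative_at_withinI[OF G(1)])
    show "onorm (\<lambda>h. G x \<bullet> h) \<le> C" if "x \<in> X" for x
    proof (rule onorm_le)
      fix h show "norm (G x \<bullet> h) \<le> C * norm h"
        using Cauchy_Schwarz_ineq2[of "G x" h] C(2)[OF that] mult_right_mono[of "norm (G x)" C "norm h"] by simp
    qed
  qed
  have clip1: "\<bar>clip R a - clip R b\<bar> \<le> \<bar>a - b\<bar>" for a b by (auto simp: clip_def max_def min_def)
  show thesis
  proof (rule that[of C B])
    show "lip2 C (truncate R f)"
      unfolding lip2_def
    proof (intro allI)
      fix a b a' b'
      have "\<bar>truncate R f (a, b) - truncate R f (a', b')\<bar> \<le> C * norm ((clip R a, clip R b) - (clip R a', clip R b'))"
        using lipX[OF inX inX] by (simp add: truncate_def)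
      also have "\<dots> \<le> C * (\<bar>clip R a - clip R a'\<bar> + \<bar>clip R b - clip R b'\<bar>)"
        using C(1) norm_Pair_le[of "clip R a - clip R a'" "clip R b - clip R b'"] by (intro mult_left_mono) auto
      also have "\<dots> \<le> C * (\<bar>a - a'\<bar> + \<bar>b - b'\<bar>)" using C(1) clip1 by (intro mult_left_mono add_mono) auto
      finally show "\<bar>truncate R f (a, b) - truncate R f (a', b')\<bar> \<le> C * (\<bar>a - a'\<bar> + \<bar>b - b'\<bar>)" .
    qed
  qed (use B C inX in \<open>auto simp: truncate_def\<close>)
qed

lemma lip2_mono: "lip2 L F \<Longrightarrow> L \<le> L' \<Longrightarrow> lip2 L' F"
  unfolding lip2_def by (meson add_nonneg_nonneg abs_ge_zero mult_right_mono order_trans)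

lemma truncate_pair_lip2:
  assumes f: "Ck_on 1 f UNIV" and g: "Ck_on 1 g UNIV" and R: "R > 0"
  obtains L B where "L > 0" "B \<ge> R" "lip2 L (truncate R f)" "lip2 L (truncate R g)"
    "\<And>p. \<bar>truncate R f p\<bar> \<le> B" "\<And>p. \<bar>truncate R g p\<bar> \<le> B"
proof -
  obtain L1 B1 where 1: "L1 > 0" "lip2 L1 (truncate R f)" "B1 \<ge> 0" "\<And>p. \<bar>truncate R f p\<bar> \<le> B1"
    using truncate_lip2[OF f R] by metis
  obtain L2 B2 where 2: "L2 > 0" "lip2 L2 (truncate R g)" "B2 \<ge> 0" "\<And>p. \<bar>truncate R g p\<bar> \<le> B2"
    using truncate_lip2[OF g R] by metis
  show thesis
  proof (rule that[of "max L1 L2" "max R (max B1 B2)"])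
    show "lip2 (max L1 L2) (truncate R f)" "lip2 (max L1 L2) (truncate R g)"
      using lip2_mono[OF 1(2), of "max L1 L2"] lip2_mono[OF 2(2), of "max L1 L2"] by auto
    show "\<bar>truncate R f p\<bar> \<le> max R (max B1 B2)" "\<bar>truncate R g p\<bar> \<le> max R (max B1 B2)" for p
      using 1(4)[of p] 2(4)[of p] by linarith+
  qed (use 1 in auto)
qed

lemma continuous_pair_measurable:
  fixes g :: "real \<times> real \<Rightarrow> real"
  assumes g: "continuous_on UNIV g" and [measurable]: "a \<in> borel_measurable N" "b \<in> borel_measurable N"
  shows "(\<lambda>x. g (a x, b x)) \<in> borel_measurable N"
proof -
  have [measurable]: "g \<in> borel_measurable borel" by (rule borel_measurable_continuous_onI[OF g])
  have "(\<lambda>x. (a x, b x)) \<in> N \<rightarrow>\<^sub>M borel" unfolding borel_prod[symmetric] by measurable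
  from measurable_compose[OF this] show ?thesis by measurable
qed

text \<open>The hypothesis allows a different null set for each time. Rational times need countably
  many of them, and off the null set of the integral equation every path is an indefinite integral,
  hence continuous in time, so the bound extends to all times.\<close>

lemma nonlocal_solution_AE_bounded:
  assumes nl: "nonlocal_solution \<Omega> f g T u\<^sub>0 \<xi>\<^sub>0 u \<xi>" and T: "T > 0"
    and bd: "\<And>t. 0 \<le> t \<Longrightarrow> t \<le> T \<Longrightarrow> AE x in lebesgue_on \<Omega>. \<bar>u t x\<bar> \<le> R"
  shows "AE x in lebesgue_on \<Omega>. \<forall>t\<in>{0..T}. \<bar>u t x\<bar> \<le> R"
proof -
  note nlD = nonlocal_solutionD[OF nl]
  have "AE x in lebesgue_on \<Omega>. \<forall>q\<in>{q. 0 \<le> real_of_rat q \<and> real_of_rat q \<le> T}. \<bar>u (real_of_rat q) x\<bar> \<le> R"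
    by (subst AE_ball_countable) (use bd in auto)
  then show ?thesis using nlD(3)
  proof eventually_elim
    case (elim x)
    let ?h = "\<lambda>s. f (u s x, \<xi> s)"
    have "?h integrable_on {0..T}" using elim(2) T by (auto intro: has_integral_integrable)
    then have "continuous_on {0..T} (\<lambda>t. u\<^sub>0 x + integral {0..t} ?h)"
      by (intro continuous_intros indefinite_integral_continuous_1)
    moreover have "u\<^sub>0 x + integral {0..t} ?h = u t x" if "t \<in> {0..T}" for t
      using integral_unique[OF bspec[OF elim(2) that]] by simp
    ultimately have cont: "continuous_on {0..T} (\<lambda>t. u t x)" by (rule continuous_on_eq)
    show ?case
    proof (rule ballI, rule ccontr)
      fix t assume t: "t \<in> {0..T}" and "\<not> \<bar>u t x\<bar> \<le> R"
      then have e: "\<bar>u t x\<bar> - R > 0" by simp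
      obtain d where d: "d > 0" "\<And>s. s \<in> {0..T} \<Longrightarrow> \<bar>s - t\<bar> < d \<Longrightarrow> \<bar>u s x - u t x\<bar> < \<bar>u t x\<bar> - R"
        using cont t e unfolding continuous_on_iff dist_real_def by metis
      \<comment> \<open>Both ends are cut to \<open>{0..T}\<close>; as \<open>T > 0\<close> the
        interval stays nondegenerate even when \<open>t\<close> is an endpoint, and contains a
        rational.\<close>
      have "max 0 (t - d) < min T (t + d)" using t d(1) T by auto
      then obtain q where q: "max 0 (t - d) < real_of_rat q" "real_of_rat q < min T (t + d)"
        using of_rat_dense by blast
      have "\<bar>u (real_of_rat q) x - u t x\<bar> < \<bar>u t x\<bar> - R" using q by (intro d(2)) auto
      moreover have "\<bar>u (real_of_rat q) x\<bar> \<le> R" using elim(1) q by auto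
      ultimately show False by linarith
    qed
  qed
qed

text \<open>Serves in both directions: to remove the truncation from a constructed solution, and to
  introduce it for a given one.\<close>

lemma nonlocal_solution_transfer:
  assumes nl: "nonlocal_solution \<Omega> f g T u\<^sub>0 \<xi>\<^sub>0 u \<xi>" and T: "T > 0"
    and cont: "continuous_on UNIV g" "continuous_on UNIV g'"
    and bd: "\<And>t. 0 \<le> t \<Longrightarrow> t \<le> T \<Longrightarrow> AE x in lebesgue_on \<Omega>. \<bar>u t x\<bar> \<le> R" "\<And>t. 0 \<le> t \<Longrightarrow> t \<le> T \<Longrightarrow> \<bar>\<xi> t\<bar> \<le> R"
    and eq: "\<And>a b. \<bar>a\<bar> \<le> R \<Longrightarrow> \<bar>b\<bar> \<le> R \<Longrightarrow> f (a, b) = f' (a, b) \<and> g (a, b) = g' (a, b)"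
  shows "nonlocal_solution \<Omega> f' g' T u\<^sub>0 \<xi>\<^sub>0 u \<xi>"
  unfolding nonlocal_solution_def
proof (intro conjI)
  note nlD = nonlocal_solutionD[OF nl]
  have bdd: "AE x in lebesgue_on \<Omega>. \<forall>t\<in>{0..T}. \<bar>u t x\<bar> \<le> R"
    by (rule nonlocal_solution_AE_bounded[OF nl T]) (rule bd(1))
  show "Linf_continuous \<Omega> T u" "continuous_on {0..T} \<xi>" using nl by (auto simp: nonlocal_solution_def)
  show "AE x in lebesgue_on \<Omega>. \<forall>t\<in>{0..T}. ((\<lambda>s. f' (u s x, \<xi> s)) has_integral u t x - u\<^sub>0 x) {0..t}"
    using bdd nlD(3)
  proof eventually_elim
    case (elim x)
    show ?case
    proof
      fix t assume t: "t \<in> {0..T}"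
      then have "((\<lambda>s. f (u s x, \<xi> s)) has_integral u t x - u\<^sub>0 x) {0..t}" using elim(2) by blast
      moreover have "f (u s x, \<xi> s) = f' (u s x, \<xi> s)" if "s \<in> {0..t}" for s
        using eq elim(1) bd(2) t that by auto
      ultimately show "((\<lambda>s. f' (u s x, \<xi> s)) has_integral u t x - u\<^sub>0 x) {0..t}"
        by (rule has_integral_eq[rotated])
    qed
  qed
  show "\<forall>t\<in>{0..T}. ((\<lambda>s. LINT x|lebesgue_on \<Omega>. g' (u s x, \<xi> s)) has_integral \<xi> t - \<xi>\<^sub>0) {0..t}"
  proof
    fix t assume "t \<in> {0..T}"
    then have t: "0 \<le> t" "t \<le> T" by auto
    have "(LINT x|lebesgue_on \<Omega>. g (u s x, \<xi> s)) = (LINT x|lebesgue_on \<Omega>. g' (u s x, \<xi> s))" if "s \<in> {0..t}" for s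
    proof (rule integral_cong_AE)
      have s: "0 \<le> s" "s \<le> T" using that t by auto
      have m: "u s \<in> borel_measurable (lebesgue_on \<Omega>)" using nlD(1)[OF s] by (rule Linf_measurable)
      show "(\<lambda>x. g (u s x, \<xi> s)) \<in> borel_measurable (lebesgue_on \<Omega>)"
        by (rule continuous_pair_measurable[OF cont(1) m]) simp
      show "(\<lambda>x. g' (u s x, \<xi> s)) \<in> borel_measurable (lebesgue_on \<Omega>)"
        by (rule continuous_pair_measurable[OF cont(2) m]) simp
      show "AE x in lebesgue_on \<Omega>. g (u s x, \<xi> s) = g' (u s x, \<xi> s)"
        using bd(1)[OF s] by eventually_elim (use eq bd(2)[OF s] in blast)
    qed
    then show "((\<lambda>s. LINT x|lebesgue_on \<Omega>. g' (u s x, \<xi> s)) has_integral \<xi> t - \<xi>\<^sub>0) {0..t}"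
      using nlD(4)[OF t] by (rule has_integral_eq)
  qed
qed

section \<open>A priori bounds, and insensitivity to null sets\<close>

lemma Linf_bounded:
  assumes "w \<in> Linf \<Omega>"
  obtains c where "c > 0" "AE x in lebesgue_on \<Omega>. \<bar>w x\<bar> \<le> c"
proof -
  have m: "w \<in> borel_measurable (lebesgue_on \<Omega>)" and fin: "Linf_norm \<Omega> w < \<infinity>" using assms by (auto simp: Linf_def)
  obtain c :: real where "Linf_norm \<Omega> w < ereal c" using ereal_dense2[OF fin] by blast
  then have "Linf_norm \<Omega> w \<le> ereal (max 1 c)" by (meson ereal_less_eq(3) less_imp_le max.cobounded2 order_trans)
  then have "AE x in lebesgue_on \<Omega>. \<bar>w x\<bar> \<le> max 1 c" using Linf_norm_le_iff[OF m, of "max 1 c"] by (simp only:)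
  then show thesis by (intro that[of "max 1 c"]) auto
qed

text \<open>Continuity bounds the function near each time, and compactness of the time interval
  makes the bound uniform.\<close>

lemma Linf_continuous_bounded:
  assumes u: "Linf_continuous \<Omega> T u"
  obtains R where "R > 0" "\<And>t. 0 \<le> t \<Longrightarrow> t \<le> T \<Longrightarrow> AE x in lebesgue_on \<Omega>. \<bar>u t x\<bar> \<le> R"
proof -
  have "\<exists>d c. d > 0 \<and> c > 0 \<and> (\<forall>s\<in>{0..T}. \<bar>s - t\<bar> < d \<longrightarrow> (AE x in lebesgue_on \<Omega>. \<bar>u s x\<bar> \<le> c))" if t: "t \<in> {0..T}" for t
  proof -
    have ut: "u t \<in> Linf \<Omega>" and lim: "((\<lambda>s. Linf_norm \<Omega> (\<lambda>x. u s x - u t x)) \<longlongrightarrow> 0) (at t within {0..T})"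
      using u t by (auto simp: Linf_continuous_def)
    obtain c where c: "c > 0" "AE x in lebesgue_on \<Omega>. \<bar>u t x\<bar> \<le> c" using Linf_bounded[OF ut] by metis
    have "\<forall>\<^sub>F s in at t within {0..T}. Linf_norm \<Omega> (\<lambda>x. u s x - u t x) < 1"
      using order_tendstoD(2)[OF lim, of 1] by simp
    then obtain d where d: "d > 0" "\<And>s. s \<in> {0..T} \<Longrightarrow> s \<noteq> t \<Longrightarrow> dist s t < d \<Longrightarrow> Linf_norm \<Omega> (\<lambda>x. u s x - u t x) < 1"
      unfolding eventually_at by blast
    have "AE x in lebesgue_on \<Omega>. \<bar>u s x\<bar> \<le> c + 1" if s: "s \<in> {0..T}" "\<bar>s - t\<bar> < d" for s
    proof (cases "s = t")
      case True
      then show ?thesis using c(2) by (auto elim!: eventually_mono)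
    next
      case False
      have us: "u s \<in> Linf \<Omega>" using u s(1) by (auto simp: Linf_continuous_def)
      have m: "(\<lambda>x. u s x - u t x) \<in> borel_measurable (lebesgue_on \<Omega>)"
        using Linf_measurable[OF us] Linf_measurable[OF ut] by measurable
      have "Linf_norm \<Omega> (\<lambda>x. u s x - u t x) \<le> ereal 1" using d(2)[OF s(1) False] s(2) by (simp add: dist_real_def one_ereal_def)
      then have "AE x in lebesgue_on \<Omega>. \<bar>u s x - u t x\<bar> \<le> 1" using Linf_norm_le_iff[OF m] by simp
      with c(2) show ?thesis by eventually_elim linarith
    qed
    then show ?thesis using d(1) c(1) by (intro exI[of _ d] exI[of _ "c + 1"]) auto
  qed
  then obtain d c where dc: "\<And>t. t \<in> {0..T} \<Longrightarrow> d t > 0" "\<And>t. t \<in> {0..T} \<Longrightarrow> c t > 0"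
    "\<And>t s. t \<in> {0..T} \<Longrightarrow> s \<in> {0..T} \<Longrightarrow> \<bar>s - t\<bar> < d t \<Longrightarrow> AE x in lebesgue_on \<Omega>. \<bar>u s x\<bar> \<le> c t" by metis
  have "{0..T} \<subseteq> (\<Union>t\<in>{0..T}. ball t (d t))" using dc(1) by fastforce
  then obtain C where C: "C \<subseteq> {0..T}" "finite C" "{0..T} \<subseteq> (\<Union>t\<in>C. ball t (d t))"
    using compactE_image[of "{0..T}" "{0..T}" "\<lambda>t. ball t (d t)"] by auto
  \<comment> \<open>A sum rather than a maximum, so that an empty cover needs no separate treatment;
    adding 1 makes it positive.\<close>
  define R where "R = (\<Sum>t\<in>C. c t) + 1"
  have cR: "c t \<le> R" if "t \<in> C" for t
    using member_le_sum[OF that, of c] dc(2) C(1,2) by (force simp: R_def intro: less_imp_le)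
  show thesis
  proof (rule that[of R])
    have "(\<Sum>t\<in>C. c t) \<ge> 0" using dc(2) C(1) by (intro sum_nonneg less_imp_le) auto
    then show "R > 0" by (simp add: R_def)
    fix s assume "0 \<le> s" "s \<le> T"
    then have s: "s \<in> {0..T}" by simp
    then obtain t where t: "t \<in> C" "s \<in> ball t (d t)" using C(3) by blast
    then have "AE x in lebesgue_on \<Omega>. \<bar>u s x\<bar> \<le> c t"
      using dc(3)[of t s] C(1) s by (auto simp: dist_real_def abs_minus_commute)
    then show "AE x in lebesgue_on \<Omega>. \<bar>u s x\<bar> \<le> R" using cR[OF t(1)] by (auto elim!: eventually_mono)
  qed
qed

lemma nonlocal_solution_bounded:
  assumes nl: "nonlocal_solution \<Omega> f g T u\<^sub>0 \<xi>\<^sub>0 u \<xi>"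
  obtains R where "R > 0" "\<And>t. 0 \<le> t \<Longrightarrow> t \<le> T \<Longrightarrow> AE x in lebesgue_on \<Omega>. \<bar>u t x\<bar> \<le> R" "\<And>t. 0 \<le> t \<Longrightarrow> t \<le> T \<Longrightarrow> \<bar>\<xi> t\<bar> \<le> R"
proof -
  obtain R1 where R1: "R1 > 0" "\<And>t. 0 \<le> t \<Longrightarrow> t \<le> T \<Longrightarrow> AE x in lebesgue_on \<Omega>. \<bar>u t x\<bar> \<le> R1"
    using Linf_continuous_bounded[of \<Omega> T u] nl unfolding nonlocal_solution_def by metis
  have "bounded (\<xi> ` {0..T})"
    using nl by (intro compact_imp_bounded compact_continuous_image) (auto simp: nonlocal_solution_def)
  then obtain R2 where "\<forall>y\<in>\<xi> ` {0..T}. norm y \<le> R2" unfolding bounded_iff by blast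
  then have R2: "\<And>t. t \<in> {0..T} \<Longrightarrow> \<bar>\<xi> t\<bar> \<le> R2" by simp
  show thesis
  proof (rule that[of "max R1 R2"])
    show "AE x in lebesgue_on \<Omega>. \<bar>u t x\<bar> \<le> max R1 R2" if "0 \<le> t" "t \<le> T" for t
      using R1(2)[OF that] by eventually_elim simp
    show "\<bar>\<xi> t\<bar> \<le> max R1 R2" if "0 \<le> t" "t \<le> T" for t using R2[of t] that by auto
  qed (use R1 in auto)
qed

lemma has_L2_integral_cong:
  assumes h: "has_L2_integral \<Omega> F t h"
    and F': "\<And>s. 0 \<le> s \<Longrightarrow> s \<le> t \<Longrightarrow> F' s \<in> L2 \<Omega>" "\<And>s. 0 \<le> s \<Longrightarrow> s \<le> t \<Longrightarrow> AE x in lebesgue_on \<Omega>. F s x = F' s x"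
  shows "has_L2_integral \<Omega> F' t h"
proof -
  have eq: "(LINT x|lebesgue_on \<Omega>. F s x * \<phi> x) = (LINT x|lebesgue_on \<Omega>. F' s x * \<phi> x)" if "\<phi> \<in> L2 \<Omega>" "s \<in> {0..t}" for \<phi> s
    using L2_inner_cong_AE[of "F s" \<Omega> "F' s" \<phi>] h F'[of s] that unfolding has_L2_integral_def L2_inner_def by auto
  have "(\<lambda>s. LINT x|lebesgue_on \<Omega>. F' s x * \<phi> x) absolutely_integrable_on {0..t} \<and>
      integral {0..t} (\<lambda>s. LINT x|lebesgue_on \<Omega>. F' s x * \<phi> x) = (LINT x|lebesgue_on \<Omega>. h x * \<phi> x)" if \<phi>: "\<phi> \<in> L2 \<Omega>" for \<phi>
  proof
    have ai: "(\<lambda>s. LINT x|lebesgue_on \<Omega>. F s x * \<phi> x) absolutely_integrable_on {0..t}"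
      and i: "integral {0..t} (\<lambda>s. LINT x|lebesgue_on \<Omega>. F s x * \<phi> x) = (LINT x|lebesgue_on \<Omega>. h x * \<phi> x)"
      using h \<phi> by (auto simp: has_L2_integral_def)
    show "(\<lambda>s. LINT x|lebesgue_on \<Omega>. F' s x * \<phi> x) absolutely_integrable_on {0..t}"
      using ai by (rule absolutely_integrable_spike[OF _ negligible_empty]) (use eq[OF \<phi>] in auto)
    show "integral {0..t} (\<lambda>s. LINT x|lebesgue_on \<Omega>. F' s x * \<phi> x) = (LINT x|lebesgue_on \<Omega>. h x * \<phi> x)"
      unfolding i[symmetric] by (rule Henstock_Kurzweil_Integration.integral_cong) (use eq[OF \<phi>] in auto)
  qed
  then show ?thesis using h F'(1) unfolding has_L2_integral_def by auto
qed

context neumann_semigroup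
begin

text \<open>The semigroup axioms do not state that \<open>S t\<close> respects equality almost
  everywhere; it follows from linearity and contraction.\<close>

lemma S_cong_AE:
  assumes "t \<ge> 0" "w \<in> L2 \<Omega>" "z \<in> L2 \<Omega>" "AE x in M. w x = z x"
  shows "AE x in M. S t w x = S t z x"
proof -
  have "nrm (\<lambda>x. w x - z x) = nrm (\<lambda>x. 0)"
    using assms by (intro nrm_cong L2_diff L2_const domain) auto
  then have "nrm (\<lambda>x. S t w x - S t z x) = 0"
    using S_diff_contraction[OF assms(1-3)] L2_norm_nonneg[of \<Omega> "\<lambda>x. S t w x - S t z x"] by simp
  then show ?thesis using nrm_eq_0_AE[OF L2_diff[OF S_L2[OF assms(1,2)] S_L2[OF assms(1,3)]]] by simp
qed

text \<open>Within the uniform bound the nonlinearities agree almost everywhere at each time, and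
  the weak integrals see the slices only up to null sets. Square integrability of the original
  reaction term is inherited from the bounded one.\<close>

lemma mild_solution_transfer:
  assumes mild: "mild_solution \<Omega> S f g D T u\<^sub>0 v\<^sub>0 u v" and D: "D > 0"
    and cont: "continuous_on UNIV f" "continuous_on UNIV g" "continuous_on UNIV f'" "continuous_on UNIV g'"
    and bdd: "\<And>p. \<bar>f' p\<bar> \<le> B" "\<And>p. \<bar>g' p\<bar> \<le> B"
    and bd: "\<And>t. 0 \<le> t \<Longrightarrow> t \<le> T \<Longrightarrow> AE x in M. \<bar>u t x\<bar> \<le> R" "\<And>t. 0 \<le> t \<Longrightarrow> t \<le> T \<Longrightarrow> AE x in M. \<bar>v t x\<bar> \<le> R"
    and eq: "\<And>a b. \<bar>a\<bar> \<le> R \<Longrightarrow> \<bar>b\<bar> \<le> R \<Longrightarrow> f (a, b) = f' (a, b) \<and> g (a, b) = g' (a, b)"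
  shows "mild_solution \<Omega> S f' g' D T u\<^sub>0 v\<^sub>0 u v"
proof -
  have in_Linf: "u s \<in> Linf \<Omega>" "v s \<in> Linf \<Omega>" if "0 \<le> s" "s \<le> T" for s using mild that by (auto simp: mild_solution_def)
  have m: "(\<lambda>x. h (u s x, v s x)) \<in> borel_measurable M" if "0 \<le> s" "s \<le> T" "continuous_on UNIV h" for s and h :: "real \<times> real \<Rightarrow> real"
    by (rule continuous_pair_measurable[OF that(3) Linf_measurable[OF in_Linf(1)[OF that(1,2)]]
          Linf_measurable[OF in_Linf(2)[OF that(1,2)]]])
  have AEeq: "AE x in M. f (u s x, v s x) = f' (u s x, v s x)" "AE x in M. g (u s x, v s x) = g' (u s x, v s x)"
    if s: "0 \<le> s" "s \<le> T" for s
  proof -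
    show "AE x in M. f (u s x, v s x) = f' (u s x, v s x)"
      using bd(1)[OF s] bd(2)[OF s] by eventually_elim (use eq in blast)
    show "AE x in M. g (u s x, v s x) = g' (u s x, v s x)"
      using bd(1)[OF s] bd(2)[OF s] by eventually_elim (use eq in blast)
  qed
  have f'2: "(\<lambda>x. f' (u s x, v s x)) \<in> L2 \<Omega>" and g'2: "(\<lambda>x. g' (u s x, v s x)) \<in> L2 \<Omega>" if "0 \<le> s" "s \<le> T" for s
    using bdd by (auto intro!: L2_bounded[OF domain(2), of _ B] m that cont)
  have g2: "(\<lambda>x. g (u s x, v s x)) \<in> L2 \<Omega>" if "0 \<le> s" "s \<le> T" for s
    by (rule L2_bounded_by[OF g'2[OF that] m[OF that cont(2)]]) (use AEeq(2)[OF that] in \<open>auto elim!: eventually_mono\<close>)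
  have "has_L2_integral \<Omega> (\<lambda>s x. f' (u s x, v s x)) t (\<lambda>x. u t x - u\<^sub>0 x)" if t: "t \<in> {0..T}" for t
  proof (rule has_L2_integral_cong)
    show "has_L2_integral \<Omega> (\<lambda>s x. f (u s x, v s x)) t (\<lambda>x. u t x - u\<^sub>0 x)" using mild t by (auto simp: mild_solution_def)
  qed (use t f'2 AEeq in auto)
  moreover have "has_L2_integral \<Omega> (\<lambda>s. S ((t - s) * D) (\<lambda>x. g' (u s x, v s x))) t (\<lambda>x. v t x - S (t * D) v\<^sub>0 x)" if t: "t \<in> {0..T}" for t
  proof (rule has_L2_integral_cong)
    show "has_L2_integral \<Omega> (\<lambda>s. S ((t - s) * D) (\<lambda>x. g (u s x, v s x))) t (\<lambda>x. v t x - S (t * D) v\<^sub>0 x)"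
      using mild t by (auto simp: mild_solution_def)
    fix s assume s: "0 \<le> s" "s \<le> t"
    have r: "(t - s) * D \<ge> 0" using s D by simp
    have sT: "0 \<le> s" "s \<le> T" using s t by auto
    show "S ((t - s) * D) (\<lambda>x. g' (u s x, v s x)) \<in> L2 \<Omega>" by (rule S_L2[OF r g'2[OF sT]])
    show "AE x in M. S ((t - s) * D) (\<lambda>x. g (u s x, v s x)) x = S ((t - s) * D) (\<lambda>x. g' (u s x, v s x)) x"
      by (rule S_cong_AE[OF r g2[OF sT] g'2[OF sT] AEeq(2)[OF sT]])
  qed
  ultimately show ?thesis using mild by (auto simp: mild_solution_def)
qed

text \<open>All quantities are bounded by a multiple of \<open>1 / sqrt D\<close>; the factor \<open>t powr p\<close> with \<open>p \<ge> 1/2\<close>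
  compensates the initial layer \<open>1 / sqrt (1 + t * D)\<close>.\<close>

lemma weighted_error_tendsto_0:
  fixes u :: "real \<Rightarrow> 'a \<Rightarrow> real" and b c p T :: real
  assumes T: "T > 0" and p: "p \<ge> 1 / 2" and b: "b \<ge> 0" and c: "c \<ge> 0"
    and meas: "\<And>D t. D > 0 \<Longrightarrow> 0 \<le> t \<Longrightarrow> t \<le> T \<Longrightarrow> (\<lambda>x. uD D t x - u t x) \<in> borel_measurable M"
      "\<And>D t. D > 0 \<Longrightarrow> 0 \<le> t \<Longrightarrow> t \<le> T \<Longrightarrow> (\<lambda>x. vD D t x - \<xi> t) \<in> borel_measurable M"
    and err: "\<And>D t. D > 0 \<Longrightarrow> 0 \<le> t \<Longrightarrow> t \<le> T \<Longrightarrow> AE x in M. \<bar>uD D t x - u t x\<bar> \<le> c * (2 * sqrt (1 + T * D) / D)"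
      "\<And>D t. D > 0 \<Longrightarrow> 0 \<le> t \<Longrightarrow> t \<le> T \<Longrightarrow> AE x in M. \<bar>vD D t x - \<xi> t\<bar> \<le> b / sqrt (1 + t * D) + c * (2 * sqrt (1 + T * D) / D)"
  shows "((\<lambda>D. SUP t\<in>{0..T}. ereal (t powr p) *
    (Linf_norm \<Omega> (\<lambda>x. uD D t x - u t x) + Linf_norm \<Omega> (\<lambda>x. vD D t x - \<xi> t))) \<longlongrightarrow> 0) at_top"
proof -
  \<comment> \<open>The first summand comes from the initial layer. The second bounds the weight by
    \<open>T powr p\<close> and counts the common error in both components; its 4 is this 2 times
    the 2 of the explicit integral, with \<open>1 + T * D \<le> (1 + T) * D\<close> for
    \<open>D \<ge> 1\<close>.\<close>
  define Z where "Z = b * T powr (p - 1 / 2) + T powr p * (4 * c * sqrt (1 + T))"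
  let ?E = "\<lambda>D t. ereal (t powr p) * (Linf_norm \<Omega> (\<lambda>x. uD D t x - u t x) + Linf_norm \<Omega> (\<lambda>x. vD D t x - \<xi> t))"
  have upper: "?E D t \<le> ereal (Z / sqrt D)" if D: "D \<ge> 1" and t: "t \<in> {0..T}" for D t
  proof -
    have D0: "D > 0" using D by simp
    have tT: "0 \<le> t" "t \<le> T" using t by auto
    define q where "q = c * (2 * sqrt (1 + T * D) / D)"
    have sD: "sqrt D > 0" "sqrt D * sqrt D = D" using D0 by auto
    have q0: "q \<ge> 0" using c D0 T by (simp add: q_def)
    have q: "q \<le> 2 * c * sqrt (1 + T) / sqrt D"
    proof -
      have "sqrt (1 + T * D) \<le> sqrt ((1 + T) * D)" using D by (intro real_sqrt_le_mono) (simp add: distrib_right)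
      then have "sqrt (1 + T * D) \<le> sqrt (1 + T) * sqrt D" by (simp add: real_sqrt_mult)
      then have "2 * sqrt (1 + T * D) / D \<le> 2 * (sqrt (1 + T) * sqrt D) / (sqrt D * sqrt D)"
        unfolding sD(2) using D0 by (intro divide_right_mono mult_left_mono) auto
      also have "\<dots> = 2 * sqrt (1 + T) / sqrt D"
        using sD(1) nonzero_mult_divide_mult_cancel_right[of "sqrt D" "2 * sqrt (1 + T)" "sqrt D"]
        by (simp only: mult.assoc less_imp_neq[symmetric] not_False_eq_True simp_thms)
      finally have "q \<le> c * (2 * sqrt (1 + T) / sqrt D)" unfolding q_def using c by (intro mult_left_mono)
      then show ?thesis by (simp add: mult_ac)
    qed
    \<comment> \<open>Half a power of \<open>t\<close> is spent on
      \<open>sqrt t / sqrt (1 + t * D) \<le> 1 / sqrt D\<close>; the exponent that remains is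
      nonnegative, so the rest is at most its value at \<open>T\<close>. At \<open>t = 0\<close> the
      weight itself is 0.\<close>
    have r: "t powr p * (b / sqrt (1 + t * D)) \<le> b * T powr (p - 1 / 2) / sqrt D"
    proof (cases "t = 0")
      case False
      then have t0: "t > 0" using tT by simp
      have "t powr p = t powr (p - 1 / 2) * sqrt t" using t0 by (simp add: powr_half_sqrt[symmetric] powr_add[symmetric])
      moreover have "sqrt t / sqrt (1 + t * D) \<le> 1 / sqrt D"
      proof -
        have "sqrt (t * D) \<le> sqrt (1 + t * D)" by (intro real_sqrt_le_mono) simp
        then have "sqrt t * sqrt D \<le> 1 * sqrt (1 + t * D)" by (simp add: real_sqrt_mult)
        moreover have "sqrt (1 + t * D) > 0" using t0 D0 by (simp add: add_pos_pos)
        ultimately show ?thesis using sD(1) by (simp add: pos_divide_le_eq pos_le_divide_eq)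
      qed
      moreover have "t powr (p - 1 / 2) \<le> T powr (p - 1 / 2)" using tT p by (intro powr_mono2) auto
      ultimately have "t powr p * (b / sqrt (1 + t * D)) \<le> b * (T powr (p - 1 / 2) * (1 / sqrt D))"
      proof -
        assume a: "t powr p = t powr (p - 1 / 2) * sqrt t" "sqrt t / sqrt (1 + t * D) \<le> 1 / sqrt D" "t powr (p - 1 / 2) \<le> T powr (p - 1 / 2)"
        have "t powr p * (b / sqrt (1 + t * D)) = b * (t powr (p - 1 / 2) * (sqrt t / sqrt (1 + t * D)))" by (simp add: a(1))
        also have "\<dots> \<le> b * (T powr (p - 1 / 2) * (1 / sqrt D))" using a(2,3) b tT D0 by (intro mult_left_mono mult_mono) auto
        finally show ?thesis .
      qed
      then show ?thesis by simp
    qed (use b sD in simp)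
    have tp: "t powr p \<le> T powr p" using tT p by (intro powr_mono2) auto
    have n1: "Linf_norm \<Omega> (\<lambda>x. uD D t x - u t x) \<le> ereal q"
      using Linf_norm_le_iff[OF meas(1)[OF D0 tT]] err(1)[OF D0 tT] by (simp add: q_def)
    have n2: "Linf_norm \<Omega> (\<lambda>x. vD D t x - \<xi> t) \<le> ereal (b / sqrt (1 + t * D) + q)"
      using Linf_norm_le_iff[OF meas(2)[OF D0 tT]] err(2)[OF D0 tT] by (simp add: q_def)
    have "?E D t \<le> ereal (t powr p) * (ereal q + ereal (b / sqrt (1 + t * D) + q))"
      using n1 n2 by (intro ereal_mult_left_mono add_mono) auto
    also have "\<dots> = ereal (t powr p * (b / sqrt (1 + t * D)) + t powr p * (2 * q))" by (simp add: algebra_simps)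
    also have "\<dots> \<le> ereal (b * T powr (p - 1 / 2) / sqrt D + T powr p * (2 * (2 * c * sqrt (1 + T) / sqrt D)))"
      unfolding ereal_less_eq using r tp q q0 by (intro add_mono mult_mono mult_left_mono) auto
    also have "\<dots> = ereal (Z / sqrt D)" by (simp add: Z_def add_divide_distrib)
    finally show ?thesis .
  qed
  have lower: "0 \<le> (SUP t\<in>{0..T}. ?E D t)" if D: "D \<ge> 1" for D
  proof -
    \<comment> \<open>As \<open>0 powr p = 0\<close>, the weighted error at time 0 is 0, and it
      bounds the supremum from below.\<close>
    have "0 \<le> ?E D 0" by (simp flip: zero_ereal_def)
    also have "\<dots> \<le> (SUP t\<in>{0..T}. ?E D t)" using T by (intro SUP_upper) auto
    finally show ?thesis .
  qed
  have lim: "((\<lambda>D. ereal (Z / sqrt D)) \<longlongrightarrow> 0) at_top"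
  proof -
    have "((\<lambda>D. Z / sqrt D) \<longlongrightarrow> 0) at_top"
      by (intro tendsto_divide_0[OF tendsto_const] filterlim_at_top_imp_at_infinity sqrt_at_top)
    then show ?thesis by (simp add: zero_ereal_def)
  qed
  show ?thesis
  proof (rule tendsto_sandwich[OF _ _ tendsto_const lim])
    show "\<forall>\<^sub>F D in at_top. 0 \<le> (SUP t\<in>{0..T}. ?E D t)"
      using eventually_ge_at_top[of 1] by eventually_elim (rule lower)
    show "\<forall>\<^sub>F D in at_top. (SUP t\<in>{0..T}. ?E D t) \<le> ereal (Z / sqrt D)"
      using eventually_ge_at_top[of 1] by eventually_elim (intro SUP_least upper)
  qed
qed

end

section \<open>Convergence for large diffusion\<close>

theorem theoremA2:
  fixes f g :: "real \<times> real \<Rightarrow> real"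
    and \<Omega> :: "(real ^ 'n) set"
    and S :: "real \<Rightarrow> (real ^ 'n \<Rightarrow> real) \<Rightarrow> (real ^ 'n \<Rightarrow> real)"
    and u\<^sub>0 v\<^sub>0 :: "real ^ 'n \<Rightarrow> real"
    and uD vD :: "real \<Rightarrow> real \<Rightarrow> real ^ 'n \<Rightarrow> real"
    and T :: real
  assumes "Ck_on 1 f UNIV" and "Ck_on 1 g UNIV"
    and "smooth_bounded_domain \<Omega>" and "measure lebesgue \<Omega> = 1"
    and "neumann_heat_semigroup \<Omega> S"
    and "u\<^sub>0 \<in> Linf \<Omega>" and "v\<^sub>0 \<in> Linf \<Omega>" and "T > 0"
    and "\<And>D. D > 0 \<Longrightarrow> mild_solution \<Omega> S f g D T u\<^sub>0 v\<^sub>0 (uD D) (vD D)"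
    and "(SUP D\<in>{0<..}. (SUP t\<in>{0..T}. Linf_norm \<Omega> (uD D t)) +
                         (SUP t\<in>{0..T}. Linf_norm \<Omega> (vD D t))) < \<infinity>"
  shows "(\<exists>u \<xi>. nonlocal_solution \<Omega> f g T u\<^sub>0 (LINT x|lebesgue_on \<Omega>. v\<^sub>0 x) u \<xi>) \<and>
    (\<forall>u \<xi>. nonlocal_solution \<Omega> f g T u\<^sub>0 (LINT x|lebesgue_on \<Omega>. v\<^sub>0 x) u \<xi> \<longrightarrow>
      ((\<lambda>D. SUP t\<in>{0..T}. ereal (t powr (real CARD('n) / 2)) *
         (Linf_norm \<Omega> (\<lambda>x. uD D t x - u t x) + Linf_norm \<Omega> (\<lambda>x. vD D t x - \<xi> t)))
       \<longlongrightarrow> 0) at_top)"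
proof -
  note f = assms(1) and g = assms(2) and T = assms(8) and mild = assms(9)
  interpret neumann_semigroup \<Omega> S by unfold_locales (rule assms)+
  let ?\<xi>\<^sub>0 = "LINT x|lebesgue_on \<Omega>. v\<^sub>0 x"
  have in_Linf: "uD D t \<in> Linf \<Omega>" "vD D t \<in> Linf \<Omega>" if "D > 0" "0 \<le> t" "t \<le> T" for D t
    using mild[OF that(1)] that by (auto simp: mild_solution_def)
  note in_meas = in_Linf[THEN Linf_measurable]
  obtain R where R: "R > 0" "\<And>D t. D > 0 \<Longrightarrow> 0 \<le> t \<Longrightarrow> t \<le> T \<Longrightarrow> AE x in M. \<bar>uD D t x\<bar> \<le> R"
    "\<And>D t. D > 0 \<Longrightarrow> 0 \<le> t \<Longrightarrow> t \<le> T \<Longrightarrow> AE x in M. \<bar>vD D t x\<bar> \<le> R"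
  proof -
    let ?A = "\<lambda>D. SUP t\<in>{0..T}. Linf_norm \<Omega> (uD D t)" and ?B = "\<lambda>D. SUP t\<in>{0..T}. Linf_norm \<Omega> (vD D t)"
    obtain r where r: "(SUP D\<in>{0<..}. ?A D + ?B D) < ereal r" using ereal_dense2[OF assms(10)] by blast
    have le: "?A D + ?B D \<le> ereal (max 1 r)" if "D > 0" for D
    proof -
      have "?A D + ?B D \<le> (SUP D\<in>{0<..}. ?A D + ?B D)" using that by (intro SUP_upper) auto
      also have "\<dots> \<le> ereal r" using r by simp
      also have "\<dots> \<le> ereal (max 1 r)" by simp
      finally show ?thesis .
    qed
    \<comment> \<open>The hypothesis bounds a sum of suprema; nonnegativity of the norms is needed
      to bound each summand by the sum.\<close>
    have u_le: "Linf_norm \<Omega> (uD D t) \<le> ?A D" and v_le: "Linf_norm \<Omega> (vD D t) \<le> ?B D"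
      and u_nn: "0 \<le> Linf_norm \<Omega> (uD D t)" and v_nn: "0 \<le> Linf_norm \<Omega> (vD D t)"
      if "D > 0" "0 \<le> t" "t \<le> T" for D t
      using that Linf_norm_nonneg[OF domain(2) unit_measure] in_meas[OF that] by (auto intro!: SUP_upper)
    show thesis
    proof (rule that[of "max 1 r"])
      fix D t assume *: "D > (0::real)" "0 \<le> t" "t \<le> T"
      have "Linf_norm \<Omega> (uD D t) + 0 \<le> ?A D + ?B D"
        using u_le[OF *] order_trans[OF v_nn[OF *] v_le[OF *]] by (rule add_mono)
      then have "Linf_norm \<Omega> (uD D t) \<le> ereal (max 1 r)" using le[OF *(1)] by (simp only: add_0_right)
      then show "AE x in M. \<bar>uD D t x\<bar> \<le> max 1 r" by (simp only: Linf_norm_le_iff[OF in_meas(1)[OF *]])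
      have "0 + Linf_norm \<Omega> (vD D t) \<le> ?A D + ?B D"
        using order_trans[OF u_nn[OF *] u_le[OF *]] v_le[OF *] by (rule add_mono)
      then have "Linf_norm \<Omega> (vD D t) \<le> ereal (max 1 r)" using le[OF *(1)] by (simp only: add_0_left)
      then show "AE x in M. \<bar>vD D t x\<bar> \<le> max 1 r" by (simp only: Linf_norm_le_iff[OF in_meas(2)[OF *]])
    qed simp
  qed
  obtain Ru where Ru: "Ru > 0" "AE x in M. \<bar>u\<^sub>0 x\<bar> \<le> Ru" using Linf_bounded[OF assms(6)] by metis
  obtain Rv where Rv: "Rv > 0" "AE x in M. \<bar>v\<^sub>0 x\<bar> \<le> Rv" using Linf_bounded[OF assms(7)] by metis
  have u0: "u\<^sub>0 \<in> borel_measurable M" and v0: "v\<^sub>0 \<in> borel_measurable M"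
    using assms(6,7) by (auto intro: Linf_measurable)
  have u02: "u\<^sub>0 \<in> L2 \<Omega>" by (rule L2_bounded[OF domain(2) u0 Ru(2)])
  obtain K where K: "K > 0" "\<And>\<tau> w B. \<tau> \<ge> 0 \<Longrightarrow> B \<ge> 0 \<Longrightarrow> w \<in> borel_measurable M \<Longrightarrow> AE x in M. \<bar>w x\<bar> \<le> B \<Longrightarrow>
      AE x in M. \<bar>S \<tau> w x - (LINT x|M. w x)\<bar> \<le> B * K / sqrt (1 + \<tau>)"
    using heat_semigroup_decay by metis
  \<comment> \<open>Shared by both halves of the theorem. The condition \<open>r \<ge> R\<close>
    makes the truncation invisible to \<open>(uD, vD)\<close>, and \<open>r \<ge> Rv\<close> lets
    the common bound \<open>B\<close> control \<open>v\<^sub>0\<close> as well. The solution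
    \<open>u\<close>, \<open>\<xi>\<close> is one of the truncated system and need not be bounded by
    \<open>r\<close>.\<close>
  have estimate: "\<exists>b c. b \<ge> 0 \<and> c \<ge> 0 \<and> (\<forall>D t. D > 0 \<and> 0 \<le> t \<and> t \<le> T \<longrightarrow>
      (AE x in M. \<bar>uD D t x - u t x\<bar> \<le> c * (2 * sqrt (1 + T * D) / D)) \<and>
      (AE x in M. \<bar>vD D t x - \<xi> t\<bar> \<le> b / sqrt (1 + t * D) + c * (2 * sqrt (1 + T * D) / D)))"
    if r: "r \<ge> R" "r \<ge> Rv" and nl: "nonlocal_solution \<Omega> (truncate r f) (truncate r g) T u\<^sub>0 ?\<xi>\<^sub>0 u \<xi>" for r u \<xi>
  proof -
    have r0: "r > 0" using r(1) R(1) by linarith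
    obtain L B where LB: "L > 0" "B \<ge> r" "lip2 L (truncate r f)" "lip2 L (truncate r g)"
      "\<And>p. \<bar>truncate r f p\<bar> \<le> B" "\<And>p. \<bar>truncate r g p\<bar> \<le> B"
      using truncate_pair_lip2[OF f g r0] by metis
    obtain R' where R': "R' > 0" "\<And>t. 0 \<le> t \<Longrightarrow> t \<le> T \<Longrightarrow> AE x in M. \<bar>u t x\<bar> \<le> R'" "\<And>t. 0 \<le> t \<Longrightarrow> t \<le> T \<Longrightarrow> \<bar>\<xi> t\<bar> \<le> R'"
      using nonlocal_solution_bounded[OF nl] by metis
    have mild': "mild_solution \<Omega> S (truncate r f) (truncate r g) D T u\<^sub>0 v\<^sub>0 (uD D) (vD D)" if D: "D > 0" for D
      by (rule mild_solution_transfer[OF mild[OF D] D C1_continuous[OF f] C1_continuous[OF g] lip2_continuous[OF LB(3)]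
            lip2_continuous[OF LB(4)] LB(5,6) R(2)[OF D] R(3)[OF D]])
         (use r(1) in \<open>auto simp: truncate_eq\<close>)
    have u2: "u t \<in> L2 \<Omega>" if "0 \<le> t" "t \<le> T" for t
      using nonlocal_solutionD(1)[OF nl that] by (intro L2_bounded[OF domain(2) _ R'(2)[OF that]] Linf_measurable)
    have v0B: "AE x in M. \<bar>v\<^sub>0 x\<bar> \<le> B" using Rv(2) by eventually_elim (use r(2) LB(2) in linarith)
    \<comment> \<open>The crude bound that starts the iteration of
      \<open>comparison_estimate\<close>; it does not enter the constants.\<close>
    have dist: "AE x in M. \<bar>uD D t x - u t x\<bar> \<le> R + R'" "AE x in M. \<bar>vD D t x - \<xi> t\<bar> \<le> R + R'"
      if "D > 0" "0 \<le> t" "t \<le> T" for D t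
    proof -
      show "AE x in M. \<bar>uD D t x - u t x\<bar> \<le> R + R'"
        using R(2)[OF that] R'(2)[OF that(2,3)] by eventually_elim linarith
      show "AE x in M. \<bar>vD D t x - \<xi> t\<bar> \<le> R + R'"
        using R(3)[OF that] by eventually_elim (use R'(3)[OF that(2,3)] in linarith)
    qed
    define c where "c = 2 * (B * K * (1 + L)) * exp (8 * L * T)"
    have B0: "B \<ge> 0" using LB(2) r0 by linarith
    have c0: "c \<ge> 0" using B0 K(1) LB(1) by (simp add: c_def)
    have "(AE x in M. \<bar>uD D t x - u t x\<bar> \<le> c * (2 * sqrt (1 + T * D) / D)) \<and>
        (AE x in M. \<bar>vD D t x - \<xi> t\<bar> \<le> B * K / sqrt (1 + t * D) + c * (2 * sqrt (1 + T * D) / D))"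
      if D: "D > 0" and t: "0 \<le> t" "t \<le> T" for D t
    proof -
      have Q: "2 * (B * K * (1 + L)) * (2 * sqrt (1 + T * D) / D) * exp (8 * L * T) = c * (2 * sqrt (1 + T * D) / D)"
        by (simp only: c_def mult_ac)
      note est = comparison_estimate[OF K LB(3,5,4,6,1) T D mild'[OF D] nl u02 v0 v0B u2 dist[OF D] t, unfolded Q]
      show ?thesis by (rule conjI[OF est])
    qed
    then show ?thesis using c0 B0 K(1) by (intro exI[of _ "B * K"] exI[of _ c]) auto
  qed
  have "\<exists>u \<xi>. nonlocal_solution \<Omega> f g T u\<^sub>0 ?\<xi>\<^sub>0 u \<xi>"
  proof -
    \<comment> \<open>The solution of the truncated system is a limit of functions bounded by
      \<open>R\<close>, so it is bounded by this \<open>r\<close> and solves the original system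
      too. Global existence on \<open>{0..T}\<close> is thereby drawn from the assumed uniform
      bound.\<close>
    define r where "r = max R Rv"
    have r: "r \<ge> R" "r \<ge> Rv" "r > 0" using R(1) by (auto simp: r_def)
    obtain L B where LB: "L > 0" "B \<ge> r" "lip2 L (truncate r f)" "lip2 L (truncate r g)"
      "\<And>p. \<bar>truncate r f p\<bar> \<le> B" "\<And>p. \<bar>truncate r g p\<bar> \<le> B"
      using truncate_pair_lip2[OF f g r(3)] by metis
    interpret P: picard \<Omega> "truncate r f" "truncate r g" L B T ?\<xi>\<^sub>0 u\<^sub>0
      by unfold_locales (use domain unit_measure LB T u0 in auto)
    obtain u \<xi> where nl: "nonlocal_solution \<Omega> (truncate r f) (truncate r g) T u\<^sub>0 ?\<xi>\<^sub>0 u \<xi>"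
      using P.nonlocal_solution_exists[OF Ru(2)] by blast
    obtain b c where bc: "b \<ge> 0" "c \<ge> 0"
      "\<And>D t. D > 0 \<Longrightarrow> 0 \<le> t \<Longrightarrow> t \<le> T \<Longrightarrow> AE x in M. \<bar>uD D t x - u t x\<bar> \<le> c * (2 * sqrt (1 + T * D) / D)"
      "\<And>D t. D > 0 \<Longrightarrow> 0 \<le> t \<Longrightarrow> t \<le> T \<Longrightarrow> AE x in M. \<bar>vD D t x - \<xi> t\<bar> \<le> b / sqrt (1 + t * D) + c * (2 * sqrt (1 + T * D) / D)"
      using estimate[OF r(1,2) nl] by blast
    have Suc_pos: "0 < real (Suc n)" for n by simp
    \<comment> \<open>The limit is taken along \<open>D = real (Suc n)\<close>: a sequence keeps the
      number of null sets countable, and the successor keeps \<open>D\<close> positive.\<close>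
    have Suc_lim: "filterlim (\<lambda>n. real (Suc n)) at_top sequentially"
      by (rule filterlim_compose[OF filterlim_real_sequentially filterlim_Suc])
    have lim1: "(\<lambda>n. c * (2 * sqrt (1 + T * real (Suc n)) / real (Suc n))) \<longlonglongrightarrow> 0"
    proof -
      have "((\<lambda>D. c * (2 * sqrt (1 + T * D) / D)) \<longlongrightarrow> 0) at_top" using T by real_asymp
      from filterlim_compose[OF this Suc_lim] show ?thesis .
    qed
    have lim2: "(\<lambda>n. b / sqrt (1 + t * real (Suc n))) \<longlonglongrightarrow> 0" if "t > 0" for t
    proof -
      have "((\<lambda>D. b / sqrt (1 + t * D)) \<longlongrightarrow> 0) at_top" using that by real_asymp
      from filterlim_compose[OF this Suc_lim] show ?thesis .
    qed
    have u_le: "AE x in M. \<bar>u t x\<bar> \<le> r" if t: "0 \<le> t" "t \<le> T" for t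
    proof -
      have "AE x in M. \<forall>n. \<bar>u t x\<bar> \<le> r + c * (2 * sqrt (1 + T * real (Suc n)) / real (Suc n))"
        unfolding AE_all_countable
      proof
        fix n
        show "AE x in M. \<bar>u t x\<bar> \<le> r + c * (2 * sqrt (1 + T * real (Suc n)) / real (Suc n))"
          using R(2)[OF Suc_pos[of n] t] bc(3)[OF Suc_pos[of n] t]
          by eventually_elim (use r(1) in linarith)
      qed
      then show ?thesis
      proof eventually_elim
        case (elim x)
        have "(\<lambda>n. r + c * (2 * sqrt (1 + T * real (Suc n)) / real (Suc n))) \<longlonglongrightarrow> r + 0" by (intro tendsto_intros lim1)
        from LIMSEQ_le_const[OF this] show ?case using elim by auto
      qed
    qed
    \<comment> \<open>Time 0 is separate because the layer \<open>b / sqrt (1 + t * D)\<close> does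
      not decay there. Instead \<open>\<xi> 0\<close> is the mean of \<open>v\<^sub>0\<close>,
      bounded by \<open>Rv\<close> since \<Omega> has measure 1.\<close>
    have \<xi>_le: "\<bar>\<xi> t\<bar> \<le> r" if t: "0 \<le> t" "t \<le> T" for t
    proof (cases "t = 0")
      case True
      have "((\<lambda>s. LINT x|M. truncate r g (u s x, \<xi> s)) has_integral (\<xi> 0 - ?\<xi>\<^sub>0)) {0..0}"
        using nonlocal_solutionD(4)[OF nl, of 0] T by simp
      from integral_unique[OF this] have "\<xi> 0 = ?\<xi>\<^sub>0" by simp
      moreover have "\<bar>?\<xi>\<^sub>0\<bar> \<le> Rv"
        using L2_inner_bounded[OF domain(2) v0 Rv(2) L2_const[OF domain(2), of 1]] integral_const[of 1]
        by (simp add: L2_inner_def)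
      ultimately show ?thesis using True r(2) by simp
    next
      case False
      then have t0: "t > 0" using t by simp
      have le: "\<bar>\<xi> t\<bar> \<le> r + (b / sqrt (1 + t * real (Suc n)) + c * (2 * sqrt (1 + T * real (Suc n)) / real (Suc n)))" for n
      proof -
        have "AE x in M. \<bar>\<xi> t\<bar> \<le> r + (b / sqrt (1 + t * real (Suc n)) + c * (2 * sqrt (1 + T * real (Suc n)) / real (Suc n)))"
          using R(3)[OF Suc_pos[of n] t] bc(4)[OF Suc_pos[of n] t]
          by eventually_elim (use r(1) in linarith)
        moreover have "emeasure M (space M) \<noteq> 0"
          using unit_measure domain by (auto simp: emeasure_restrict_space measure_def)
        ultimately show ?thesis using ae_filter_eq_bot_iff[of M] by (auto simp: eventually_const_iff)
      qed
      have "(\<lambda>n. r + (b / sqrt (1 + t * real (Suc n)) + c * (2 * sqrt (1 + T * real (Suc n)) / real (Suc n)))) \<longlonglongrightarrow> r + (0 + 0)"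
        by (intro tendsto_intros lim1 lim2[OF t0])
      from LIMSEQ_le_const[OF this] show ?thesis using le by auto
    qed
    have "nonlocal_solution \<Omega> f g T u\<^sub>0 ?\<xi>\<^sub>0 u \<xi>"
      by (rule nonlocal_solution_transfer[OF nl T lip2_continuous[OF LB(4)] C1_continuous[OF g] u_le \<xi>_le])
         (auto simp: truncate_eq)
    then show ?thesis by blast
  qed
  moreover have "((\<lambda>D. SUP t\<in>{0..T}. ereal (t powr (real CARD('n) / 2)) *
         (Linf_norm \<Omega> (\<lambda>x. uD D t x - u t x) + Linf_norm \<Omega> (\<lambda>x. vD D t x - \<xi> t))) \<longlongrightarrow> 0) at_top"
    if nl: "nonlocal_solution \<Omega> f g T u\<^sub>0 ?\<xi>\<^sub>0 u \<xi>" for u \<xi>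
  proof -
    obtain R' where R': "R' > 0" "\<And>t. 0 \<le> t \<Longrightarrow> t \<le> T \<Longrightarrow> AE x in M. \<bar>u t x\<bar> \<le> R'" "\<And>t. 0 \<le> t \<Longrightarrow> t \<le> T \<Longrightarrow> \<bar>\<xi> t\<bar> \<le> R'"
      using nonlocal_solution_bounded[OF nl] by metis
    \<comment> \<open>Here the solution is given, so the truncation level must also exceed its own
      bound \<open>R'\<close>; then it solves the truncated system and the estimate applies.\<close>
    define r where "r = max R' (max R Rv)"
    have r: "r \<ge> R" "r \<ge> Rv" "r \<ge> R'" "r > 0" using R(1) by (auto simp: r_def)
    obtain L B where LB: "L > 0" "B \<ge> r" "lip2 L (truncate r f)" "lip2 L (truncate r g)"
      "\<And>p. \<bar>truncate r f p\<bar> \<le> B" "\<And>p. \<bar>truncate r g p\<bar> \<le> B"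
      using truncate_pair_lip2[OF f g r(4)] by metis
    have nl': "nonlocal_solution \<Omega> (truncate r f) (truncate r g) T u\<^sub>0 ?\<xi>\<^sub>0 u \<xi>"
      by (rule nonlocal_solution_transfer[OF nl T C1_continuous[OF g] lip2_continuous[OF LB(4)] R'(2,3)])
         (use r(3) in \<open>auto simp: truncate_eq\<close>)
    obtain b c where bc: "b \<ge> 0" "c \<ge> 0"
      "\<And>D t. D > 0 \<Longrightarrow> 0 \<le> t \<Longrightarrow> t \<le> T \<Longrightarrow> AE x in M. \<bar>uD D t x - u t x\<bar> \<le> c * (2 * sqrt (1 + T * D) / D)"
      "\<And>D t. D > 0 \<Longrightarrow> 0 \<le> t \<Longrightarrow> t \<le> T \<Longrightarrow> AE x in M. \<bar>vD D t x - \<xi> t\<bar> \<le> b / sqrt (1 + t * D) + c * (2 * sqrt (1 + T * D) / D)"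
      using estimate[OF r(1,2) nl'] by blast
    have "real CARD('n) \<ge> 1" by (simp add: Suc_leI)
    then have p: "real CARD('n) / 2 \<ge> 1 / 2" by simp
    show ?thesis
    proof (rule weighted_error_tendsto_0[OF T p bc(1,2)])
      fix D t :: real assume *: "D > 0" "0 \<le> t" "t \<le> T"
      have [measurable]: "uD D t \<in> borel_measurable M" "vD D t \<in> borel_measurable M" "u t \<in> borel_measurable M"
        using in_meas[OF *] nonlocal_solutionD(1)[OF nl *(2,3)] by (auto intro: Linf_measurable)
      show "(\<lambda>x. uD D t x - u t x) \<in> borel_measurable M" "(\<lambda>x. vD D t x - \<xi> t) \<in> borel_measurable M" by measurable
    qed (use bc(3,4) in auto)
  qed
  ultimately show ?thesis by blast
qed

end
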